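(* Let $\tau=(T_j)_{1\le j\le n}$ be an $n$-tuple of bounded Hermitian operators on $\mathcal H$. Then the finite rank operators $\mathcal R$ are dense in $\mathcal K(\tau;\mathcal C_\infty^-)$, so that $K_0(\mathcal K(\tau;\mathcal C_\infty^-))\simeq\mathbb Z$ and $K_1(\mathcal K(\tau;\mathcal C_\infty^-))=0$. Moreover, $p(\mathcal E(\tau;\mathcal C_\infty^-))$ is a $C^*$-subalgebra of the Calkin algebra $\mathcal B/\mathcal K$ which is isomorphic as a Banach $*$-algebra to $\mathcal E/\mathcal K(\tau;\mathcal C_\infty^-)$.
   Context: $\mathcal H$ is a separable infinite-dimensional complex Hilbert space, $\mathcal B=\mathcal B(\mathcal H)$, $\mathcal K$ is the ideal of compact operators, and $p:\mathcal B\to\mathcal B/\mathcal K$ is the quotient map onto the Calkin algebra. $\mathcal R$ is the set of finite rank operators on $\mathcal H$. $(\mathcal C_\infty^-,|\cdot|_\infty^-)$ is the Macaev ideal: compact operators $X$ with $|X|_\infty^-=\sum_{j\ge1}s_j(X)j^{-1}<\infty$, where $s_1(X)\ge s_2(X)\ge\dots$ are the eigenvalues of $(X^*X)^{1/2}$ in decreasing order, repeated according to multiplicity. $\mathcal E(\tau;\mathcal C_\infty^-)=\{X\in\mathcal B(\mathcal H):[X,T_j]\in\mathcal C_\infty^-,\ 1\le j\le n\}$ with the norm $|||X|||=\|X\|+\max_{1\le j\le n}|[T_j,X]|_\infty^-$; $\mathcal K(\tau;\mathcal C_\infty^-)=\mathcal E(\tau;\mathcal C_\infty^-)\cap\mathcal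 K$ with the same norm (density is with respect to this norm); $\mathcal E/\mathcal K(\tau;\mathcal C_\infty^-)=\mathcal E(\tau;\mathcal C_\infty^-)/\mathcal K(\tau;\mathcal C_\infty^-)$ with the quotient norm. An isomorphism of Banach $*$-algebras is a $*$-isomorphism which is a homeomorphism (not necessarily isometric). *)

theory Defs
  imports "HOL-Analysis.Analysis" "HOL-Algebra.QuotRing" "HOL-Algebra.Elementary_Groups"
begin

section \<open>Complex Hilbert spaces and bounded operators\<close>

text \<open>
  The inner product is linear in its first argument. The real structure inherited from
  \<^class>\<open>banach\<close> is the restriction of the complex one, so that bounded complex-linear operators are
  those elements of the library type of bounded (real-)linear maps that commute with complex scalars;
  the operator norm is the norm of that type.
\<close>

class complex_hilbert = banach +
  fixes scaleC :: "complex \<Rightarrow> 'a \<Rightarrow> 'a" (infixr "*\<^sub>C" 75)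
    and cinner :: "'a \<Rightarrow> 'a \<Rightarrow> complex"
  assumes scaleC_add_right: "a *\<^sub>C (x + y) = a *\<^sub>C x + a *\<^sub>C y"
    and scaleC_add_left: "(a + b) *\<^sub>C x = a *\<^sub>C x + b *\<^sub>C x"
    and scaleC_scaleC: "a *\<^sub>C (b *\<^sub>C x) = (a * b) *\<^sub>C x"
    and scaleR_scaleC: "r *\<^sub>R x = complex_of_real r *\<^sub>C x"
    and cinner_commute: "cinner x y = cnj (cinner y x)"
    and cinner_add_left: "cinner (x + y) z = cinner x z + cinner y z"
    and cinner_scaleC_left: "cinner (a *\<^sub>C x) y = a * cinner x y"
    and cinner_self: "cinner x x = complex_of_real ((norm x)\<^sup>2)"

global_interpretation complex_vs: vector_space "scaleC :: complex \<Rightarrow> 'a \<Rightarrow> 'a::complex_hilbert"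
  defines cspan = complex_vs.span
    and cdim = complex_vs.dim
proof
  show "1 *\<^sub>C x = x" for x :: 'a
    using scaleR_scaleC [of 1 x] by simp
qed (simp_all add: scaleC_add_right scaleC_add_left scaleC_scaleC)

definition bounded_ops :: "('h::complex_hilbert \<Rightarrow>\<^sub>L 'h) set" where
  "bounded_ops = {X. \<forall>c x. blinfun_apply X (c *\<^sub>C x) = c *\<^sub>C blinfun_apply X x}"

definition adj_op :: "('h::complex_hilbert \<Rightarrow>\<^sub>L 'h) \<Rightarrow> ('h \<Rightarrow>\<^sub>L 'h)" where
  "adj_op X = (THE Y. Y \<in> bounded_ops \<and>
     (\<forall>x y. cinner (blinfun_apply X x) y = cinner x (blinfun_apply Y y)))"

definition hermitian_op :: "('h::complex_hilbert \<Rightarrow>\<^sub>L 'h) \<Rightarrow> bool" where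
  "hermitian_op X \<longleftrightarrow> X \<in> bounded_ops \<and> adj_op X = X"

definition positive_op :: "('h::complex_hilbert \<Rightarrow>\<^sub>L 'h) \<Rightarrow> bool" where
  "positive_op X \<longleftrightarrow> X \<in> bounded_ops \<and> (\<forall>x. cinner (blinfun_apply X x) x \<in> \<real>\<^sub>\<ge>\<^sub>0)"

definition compact_ops :: "('h::complex_hilbert \<Rightarrow>\<^sub>L 'h) set" where
  "compact_ops = {X \<in> bounded_ops. compact (closure (blinfun_apply X ` cball 0 1))}"

definition finite_rank_ops :: "('h::complex_hilbert \<Rightarrow>\<^sub>L 'h) set" where
  "finite_rank_ops = {X \<in> bounded_ops. \<exists>S. finite S \<and> range (blinfun_apply X) \<subseteq> cspan S}"

text \<open>The modulus \<open>(X\<^sup>* X)\<^bsup>1/2\<^esup>\<close>: the unique positive square root of \<open>X\<^sup>* X\<close>.\<close>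

definition abs_op :: "('h::complex_hilbert \<Rightarrow>\<^sub>L 'h) \<Rightarrow> ('h \<Rightarrow>\<^sub>L 'h)" where
  "abs_op X = (THE P. positive_op P \<and> P o\<^sub>L P = adj_op X o\<^sub>L X)"

definition eigen_mult :: "('h::complex_hilbert \<Rightarrow>\<^sub>L 'h) \<Rightarrow> real \<Rightarrow> nat" where
  "eigen_mult P r = cdim {x. blinfun_apply P x = r *\<^sub>R x}"

text \<open>
  Singular numbers of a compact operator, numbered from 0: \<open>sing_num X j\<close> is the number usually written
  \<open>s\<^sub>j\<^sub>+\<^sub>1(X)\<close>. As usual, only the positive eigenvalues of the modulus are enumerated (each as often as
  its multiplicity), and the list is continued by zeros if there are only finitely many of them.
\<close>

definition sing_num :: "('h::complex_hilbert \<Rightarrow>\<^sub>L 'h) \<Rightarrow> nat \<Rightarrow> real" where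
  "sing_num X = (THE s. decseq s \<and> (\<forall>j. 0 \<le> s j) \<and>
     (\<forall>r>0. finite {j. s j = r} \<and> card {j. s j = r} = eigen_mult (abs_op X) r))"

definition macaev_ideal :: "('h::complex_hilbert \<Rightarrow>\<^sub>L 'h) set" where
  "macaev_ideal = {X \<in> compact_ops. summable (\<lambda>j. sing_num X j / real (Suc j))}"

definition macaev_norm :: "('h::complex_hilbert \<Rightarrow>\<^sub>L 'h) \<Rightarrow> real" where
  "macaev_norm X = (\<Sum>j. sing_num X j / real (Suc j))"

definition commutator_op ::
  "('h::complex_hilbert \<Rightarrow>\<^sub>L 'h) \<Rightarrow> ('h \<Rightarrow>\<^sub>L 'h) \<Rightarrow> ('h \<Rightarrow>\<^sub>L 'h)" where
  "commutator_op X Y = (X o\<^sub>L Y) - (Y o\<^sub>L X)"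


section \<open>Normed complex *-algebras\<close>

text \<open>
  The ring record of HOL-Algebra extended by complex scalars, norm and involution. For a non-unital
  algebra the field \<^const>\<open>one\<close> carries no information (it need not lie in the carrier), and no
  definition below that applies to non-unital algebras refers to it.
\<close>

record 'a star_alg = "'a ring" +
  cscale :: "complex \<Rightarrow> 'a \<Rightarrow> 'a"
  anorm :: "'a \<Rightarrow> real"
  star :: "'a \<Rightarrow> 'a"

text \<open>The distance is set to 0 off the carrier because \<^locale>\<open>Metric_space\<close> asks for nonnegativity and
  symmetry of the distance on the whole type; the topology depends only on its values on the carrier.\<close>

definition alg_dist :: "('a, 'm) star_alg_scheme \<Rightarrow> 'a \<Rightarrow> 'a \<Rightarrow> real" where
  "alg_dist A x y = (if x \<in> carrier A \<and> y \<in> carrier A then anorm A (x \<ominus>\<^bsub>A\<^esub> y) else 0)"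

definition alg_topology :: "('a, 'm) star_alg_scheme \<Rightarrow> 'a topology" where
  "alg_topology A = Metric_space.mtopology (carrier A) (alg_dist A)"

definition quot_alg :: "('a, 'm) star_alg_scheme \<Rightarrow> 'a set \<Rightarrow> 'a set star_alg" where
  "quot_alg A I =
     ring.extend (A Quot I)
       (star_alg.fields
         (\<lambda>c P. \<Union>x\<in>P. I +>\<^bsub>A\<^esub> cscale A c x)
         (\<lambda>P. Inf (anorm A ` P))
         (\<lambda>P. \<Union>x\<in>P. I +>\<^bsub>A\<^esub> star A x))"

text \<open>For a C*-algebra \<open>A\<close>, its C*-subalgebras are its norm-closed *-subalgebras.\<close>

definition cstar_subalgebra :: "'a set \<Rightarrow> ('a, 'm) star_alg_scheme \<Rightarrow> bool" where
  "cstar_subalgebra S A \<longleftrightarrow>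
     S \<subseteq> carrier A \<and> \<zero>\<^bsub>A\<^esub> \<in> S \<and>
     (\<forall>x\<in>S. \<forall>y\<in>S. x \<oplus>\<^bsub>A\<^esub> y \<in> S \<and> x \<otimes>\<^bsub>A\<^esub> y \<in> S) \<and>
     (\<forall>c. \<forall>x\<in>S. cscale A c x \<in> S) \<and>
     (\<forall>x\<in>S. star A x \<in> S) \<and>
     closedin (alg_topology A) S"

definition banach_star_iso ::
  "('a, 'm) star_alg_scheme \<Rightarrow> ('b, 'k) star_alg_scheme \<Rightarrow> ('a \<Rightarrow> 'b) \<Rightarrow> bool" where
  "banach_star_iso A B \<phi> \<longleftrightarrow>
     bij_betw \<phi> (carrier A) (carrier B) \<and>
     (\<forall>x\<in>carrier A. \<forall>y\<in>carrier A.
        \<phi> (x \<oplus>\<^bsub>A\<^esub> y) = \<phi> x \<oplus>\<^bsub>B\<^esub> \<phi> y \<and> \<phi> (x \<otimes>\<^bsub>A\<^esub> y) = \<phi> x \<otimes>\<^bsub>B\<^esub> \<phi> y) \<and>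
     (\<forall>c. \<forall>x\<in>carrier A. \<phi> (cscale A c x) = cscale B c (\<phi> x)) \<and>
     (\<forall>x\<in>carrier A. \<phi> (star A x) = star B (\<phi> x)) \<and>
     homeomorphic_map (alg_topology A) (alg_topology B) \<phi>"

definition unitization :: "('a, 'm) star_alg_scheme \<Rightarrow> (complex \<times> 'a) star_alg" where
  "unitization A =
    \<lparr>carrier = UNIV \<times> carrier A,
     mult = (\<lambda>(a, x) (b, y). (a * b, cscale A a y \<oplus>\<^bsub>A\<^esub> cscale A b x \<oplus>\<^bsub>A\<^esub> x \<otimes>\<^bsub>A\<^esub> y)),
     one = (1, \<zero>\<^bsub>A\<^esub>),
     zero = (0, \<zero>\<^bsub>A\<^esub>),
     add = (\<lambda>(a, x) (b, y). (a + b, x \<oplus>\<^bsub>A\<^esub> y)),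
     cscale = (\<lambda>c (a, x). (c * a, cscale A c x)),
     anorm = (\<lambda>(a, x). cmod a + anorm A x),
     star = (\<lambda>(a, x). (cnj a, star A x))\<rparr>"

definition complex_alg :: "complex star_alg" where
  "complex_alg =
    \<lparr>carrier = UNIV, mult = (*), one = 1, zero = 0, add = (+),
     cscale = (*), anorm = cmod, star = cnj\<rparr>"


section \<open>K-theory\<close>

text \<open>
  Infinite matrices: in every use below each row of \<open>x\<close> has only finitely many nonzero entries, so the
  sum defining the product is finite.
\<close>

definition inf_mat_mult ::
  "('a, 'm) ring_scheme \<Rightarrow> (nat \<Rightarrow> nat \<Rightarrow> 'a) \<Rightarrow> (nat \<Rightarrow> nat \<Rightarrow> 'a) \<Rightarrow> nat \<Rightarrow> nat \<Rightarrow> 'a" where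
  "inf_mat_mult R x y = (\<lambda>i j. \<Oplus>\<^bsub>R\<^esub>k\<in>{k. x i k \<noteq> \<zero>\<^bsub>R\<^esub>}. x i k \<otimes>\<^bsub>R\<^esub> y k j)"

definition inf_mat_one :: "('a, 'm) ring_scheme \<Rightarrow> nat \<Rightarrow> nat \<Rightarrow> 'a" where
  "inf_mat_one R = (\<lambda>i j. if i = j then \<one>\<^bsub>R\<^esub> else \<zero>\<^bsub>R\<^esub>)"

subsection \<open>\<open>K\<^sub>0\<close>\<close>

text \<open>\<open>M\<^sub>\<infinity>(R)\<close>, the union of the \<open>M\<^sub>n(R)\<close> under the embeddings \<open>x \<mapsto> diag(x, 0)\<close>.\<close>

definition M_inf :: "('a, 'm) ring_scheme \<Rightarrow> (nat \<Rightarrow> nat \<Rightarrow> 'a) set" where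
  "M_inf R = {x. (\<forall>i j. x i j \<in> carrier R) \<and> (\<exists>n. \<forall>i j. n \<le> i \<or> n \<le> j \<longrightarrow> x i j = \<zero>\<^bsub>R\<^esub>)}"

definition idempotents :: "('a, 'm) ring_scheme \<Rightarrow> (nat \<Rightarrow> nat \<Rightarrow> 'a) set" where
  "idempotents R = {e \<in> M_inf R. inf_mat_mult R e e = e}"

definition idem_equiv :: "('a, 'm) ring_scheme \<Rightarrow> ((nat \<Rightarrow> nat \<Rightarrow> 'a) \<times> (nat \<Rightarrow> nat \<Rightarrow> 'a)) set" where
  "idem_equiv R = {(e, f). e \<in> idempotents R \<and> f \<in> idempotents R \<and>
     (\<exists>x\<in>M_inf R. \<exists>y\<in>M_inf R. inf_mat_mult R x y = e \<and> inf_mat_mult R y x = f)}"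

definition mat_size :: "('a, 'm) ring_scheme \<Rightarrow> (nat \<Rightarrow> nat \<Rightarrow> 'a) \<Rightarrow> nat" where
  "mat_size R x = (LEAST n. \<forall>i j. n \<le> i \<or> n \<le> j \<longrightarrow> x i j = \<zero>\<^bsub>R\<^esub>)"

text \<open>\<open>diag(x, y)\<close>, where \<open>x\<close> is regarded as a square matrix of the smallest possible size.\<close>

definition diag_sum ::
  "('a, 'm) ring_scheme \<Rightarrow> (nat \<Rightarrow> nat \<Rightarrow> 'a) \<Rightarrow> (nat \<Rightarrow> nat \<Rightarrow> 'a) \<Rightarrow> nat \<Rightarrow> nat \<Rightarrow> 'a" where
  "diag_sum R x y = (let n = mat_size R x in
     (\<lambda>i j. if i < n \<and> j < n then x i j
            else if n \<le> i \<and> n \<le> j then y (i - n) (j - n)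
            else \<zero>\<^bsub>R\<^esub>))"

text \<open>The monoid \<open>V(R)\<close> of equivalence classes of idempotents in \<open>M\<^sub>\<infinity>(R)\<close>, written multiplicatively.\<close>

definition V_monoid :: "('a, 'm) ring_scheme \<Rightarrow> (nat \<Rightarrow> nat \<Rightarrow> 'a) set monoid" where
  "V_monoid R =
    \<lparr>carrier = idempotents R // idem_equiv R,
     mult = (\<lambda>E F. \<Union>e\<in>E. \<Union>f\<in>F. idem_equiv R `` {diag_sum R e f}),
     one = idem_equiv R `` {\<lambda>i j. \<zero>\<^bsub>R\<^esub>}\<rparr>"

definition V_map ::
  "('b, 'k) ring_scheme \<Rightarrow> ('a \<Rightarrow> 'b) \<Rightarrow> (nat \<Rightarrow> nat \<Rightarrow> 'a) set \<Rightarrow> (nat \<Rightarrow> nat \<Rightarrow> 'b) set" where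
  "V_map S h E = (\<Union>e\<in>E. idem_equiv S `` {\<lambda>i j. h (e i j)})"

text \<open>The Grothendieck group of a commutative monoid; the pair \<open>(a, b)\<close> stands for \<open>a - b\<close>.\<close>

definition groth_rel :: "('a, 'm) monoid_scheme \<Rightarrow> (('a \<times> 'a) \<times> ('a \<times> 'a)) set" where
  "groth_rel M = {((a, b), (c, d)).
     a \<in> carrier M \<and> b \<in> carrier M \<and> c \<in> carrier M \<and> d \<in> carrier M \<and>
     (\<exists>g\<in>carrier M. a \<otimes>\<^bsub>M\<^esub> d \<otimes>\<^bsub>M\<^esub> g = c \<otimes>\<^bsub>M\<^esub> b \<otimes>\<^bsub>M\<^esub> g)}"

definition groth_group :: "('a, 'm) monoid_scheme \<Rightarrow> ('a \<times> 'a) set monoid" where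
  "groth_group M =
    \<lparr>carrier = (carrier M \<times> carrier M) // groth_rel M,
     mult = (\<lambda>P Q. \<Union>(a, b)\<in>P. \<Union>(c, d)\<in>Q. groth_rel M `` {(a \<otimes>\<^bsub>M\<^esub> c, b \<otimes>\<^bsub>M\<^esub> d)}),
     one = groth_rel M `` {(\<one>\<^bsub>M\<^esub>, \<one>\<^bsub>M\<^esub>)}\<rparr>"

definition groth_map :: "('b, 'k) monoid_scheme \<Rightarrow> ('a \<Rightarrow> 'b) \<Rightarrow> ('a \<times> 'a) set \<Rightarrow> ('b \<times> 'b) set" where
  "groth_map N h P = (\<Union>(a, b)\<in>P. groth_rel N `` {(h a, h b)})"

text \<open>\<open>K\<^sub>0\<close> of a (possibly non-unital) algebra \<open>A\<close> with unitization \<open>A\<^sup>+\<close> is the kernel of the map from the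
  Grothendieck group of \<open>V(A\<^sup>+)\<close> to that of \<open>V(\<complex>)\<close> induced by the character \<open>A\<^sup>+ \<rightarrow> \<complex>\<close>.\<close>

definition K0_unital :: "('a, 'm) ring_scheme \<Rightarrow> ((nat \<Rightarrow> nat \<Rightarrow> 'a) set \<times> (nat \<Rightarrow> nat \<Rightarrow> 'a) set) set monoid"
  where "K0_unital R = groth_group (V_monoid R)"

definition K0 :: "('a, 'm) star_alg_scheme \<Rightarrow>
    ((nat \<Rightarrow> nat \<Rightarrow> complex \<times> 'a) set \<times> (nat \<Rightarrow> nat \<Rightarrow> complex \<times> 'a) set) set monoid" where
  "K0 A = (K0_unital (unitization A))
     \<lparr>carrier := kernel (K0_unital (unitization A)) (K0_unital complex_alg)
        (groth_map (V_monoid complex_alg) (V_map complex_alg fst))\<rparr>"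

subsection \<open>\<open>K\<^sub>1\<close>\<close>

text \<open>Here \<open>GL\<^sub>n(R)\<close> is embedded in the infinite matrices by \<open>g \<mapsto> diag(g, 1)\<close>.\<close>

definition stable_mats :: "('a, 'm) ring_scheme \<Rightarrow> nat \<Rightarrow> (nat \<Rightarrow> nat \<Rightarrow> 'a) set" where
  "stable_mats R n = {g. (\<forall>i j. g i j \<in> carrier R) \<and>
     (\<forall>i j. n \<le> i \<or> n \<le> j \<longrightarrow> g i j = inf_mat_one R i j)}"

definition GL_n :: "('a, 'm) ring_scheme \<Rightarrow> nat \<Rightarrow> (nat \<Rightarrow> nat \<Rightarrow> 'a) set" where
  "GL_n R n = {g \<in> stable_mats R n. \<exists>h\<in>stable_mats R n.
     inf_mat_mult R g h = inf_mat_one R \<and> inf_mat_mult R h g = inf_mat_one R}"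

definition GL_topology :: "('a, 'm) star_alg_scheme \<Rightarrow> nat \<Rightarrow> (nat \<Rightarrow> nat \<Rightarrow> 'a) topology" where
  "GL_topology R n = Metric_space.mtopology (GL_n R n)
     (\<lambda>g h. \<Sum>i<n. \<Sum>j<n. alg_dist R (g i j) (h i j))"

definition GL_inf :: "('a, 'm) ring_scheme \<Rightarrow> (nat \<Rightarrow> nat \<Rightarrow> 'a) monoid" where
  "GL_inf R = \<lparr>carrier = (\<Union>n. GL_n R n), mult = inf_mat_mult R, one = inf_mat_one R\<rparr>"

text \<open>The identity component of \<open>GL\<^sub>\<infinity>(R)\<close>: the union of those of the \<open>GL\<^sub>n(R)\<close>.\<close>

definition GL_inf_0 :: "('a, 'm) star_alg_scheme \<Rightarrow> (nat \<Rightarrow> nat \<Rightarrow> 'a) set" where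
  "GL_inf_0 R = (\<Union>n. {g. path_component_of (GL_topology R n) (inf_mat_one R) g})"

text \<open>\<open>K\<^sub>1(A) = K\<^sub>1(A\<^sup>+)\<close>, since \<open>K\<^sub>1(\<complex>) = 0\<close>.\<close>

definition K1_unital :: "('a, 'm) star_alg_scheme \<Rightarrow> (nat \<Rightarrow> nat \<Rightarrow> 'a) set monoid" where
  "K1_unital R = GL_inf R Mod GL_inf_0 R"

definition K1 :: "('a, 'm) star_alg_scheme \<Rightarrow> (nat \<Rightarrow> nat \<Rightarrow> complex \<times> 'a) set monoid" where
  "K1 A = K1_unital (unitization A)"


section \<open>The operator algebras\<close>

definition B_alg :: "('h::complex_hilbert \<Rightarrow>\<^sub>L 'h) star_alg" where
  "B_alg =
    \<lparr>carrier = bounded_ops, mult = (o\<^sub>L), one = id_blinfun, zero = 0, add = (+),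
     cscale = (\<lambda>c X. Blinfun (\<lambda>x. c *\<^sub>C blinfun_apply X x)), anorm = norm, star = adj_op\<rparr>"

definition calkin_alg :: "('h::complex_hilbert \<Rightarrow>\<^sub>L 'h) set star_alg" where
  "calkin_alg = quot_alg B_alg compact_ops"

definition calkin_proj :: "('h::complex_hilbert \<Rightarrow>\<^sub>L 'h) \<Rightarrow> ('h \<Rightarrow>\<^sub>L 'h) set" where
  "calkin_proj X = compact_ops +>\<^bsub>B_alg\<^esub> X"

text \<open>The \<open>n\<close>-tuple \<open>\<tau>\<close> is given by the values \<open>T 1, \<dots>, T n\<close> of \<open>T\<close>, where \<open>n \<ge> 1\<close>.\<close>

definition E_alg :: "nat \<Rightarrow> (nat \<Rightarrow> 'h::complex_hilbert \<Rightarrow>\<^sub>L 'h) \<Rightarrow> ('h \<Rightarrow>\<^sub>L 'h) star_alg" where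
  "E_alg n T = B_alg
    \<lparr>carrier := {X \<in> bounded_ops. \<forall>j\<in>{1..n}. commutator_op X (T j) \<in> macaev_ideal},
     anorm := (\<lambda>X. norm X + Max ((\<lambda>j. macaev_norm (commutator_op (T j) X)) ` {1..n}))\<rparr>"

definition K_alg :: "nat \<Rightarrow> (nat \<Rightarrow> 'h::complex_hilbert \<Rightarrow>\<^sub>L 'h) \<Rightarrow> ('h \<Rightarrow>\<^sub>L 'h) star_alg" where
  "K_alg n T = (E_alg n T)\<lparr>carrier := carrier (E_alg n T) \<inter> compact_ops\<rparr>"

definition EK_alg :: "nat \<Rightarrow> (nat \<Rightarrow> 'h::complex_hilbert \<Rightarrow>\<^sub>L 'h) \<Rightarrow> ('h \<Rightarrow>\<^sub>L 'h) set star_alg" where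
  "EK_alg n T = quot_alg (E_alg n T) (carrier (K_alg n T))"

end

theory Submission
  imports Defs "Jordan_Normal_Form.Char_Poly"
begin

text \<open>
  Everything rests on Voiculescu's observation that a tuple of operators almost commutes, in the Macaev norm
  and with a bound \<open>C\<close> independent of \<open>S\<close>, with finite rank positive contractions which are the identity on
  a prescribed finite set \<open>S\<close> of vectors. The defect \<open>1 - A\<close> of such a contraction \<open>A\<close> makes \<open>(1 - A) X\<close> small
  for compact \<open>X\<close> while controlling its commutators. Hence the finite rank operators are dense
  in \<open>\<K>(\<tau>)\<close>, and the norm of \<open>\<E>/\<K>(\<tau>)\<close> is equivalent to that of the Calkin algebra, so that \<open>p(\<E>(\<tau>))\<close> is
  complete.

  For the K-groups, matrices over the unitization of \<open>\<K>(\<tau>)\<close> are treated as operator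
  matrices that differ from complex matrices by compact operators. Such a perturbation is a small one, removable
  by a Neumann series, followed by a finite rank one, and a finite rank matrix \<open>F\<close> factors as
  \<open>b a\<close> through a complex matrix \<open>a b = c\<close>. So an idempotent equals, up to finite
  rank idempotents, a complex one, which leaves the rank of the finite rank part as the only invariant in
  \<open>K\<^sub>0\<close>; and \<open>1 + z F\<close> is invertible unless \<open>- 1/z\<close> is one
  of finitely many eigenvalues of \<open>c\<close>, which connects every invertible matrix to
  \<open>1\<close>.
\<close>


section \<open>Complex Hilbert spaces\<close>

text \<open>The Macaev norm weighs the j-th singular number by 1/j, so an operator of norm c living
  on an N-dimensional space costs about c log N. Words of length m in the tuple span spaces of
  dimension exponential in m, so log N is of order m, which is balanced by the factor 1/m gained
  from averaging m projections: hence a commutator constant that ignores the size of S. A second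
  obstacle is that \<open>E\<close> carries a finer norm than the operator norm, while compactness
  gives smallness only in the latter. Two devices bridge the gap: one operator A that fixes finitely
  many ranges controls a remainder in both norms at once, and inverses found in operator norm return
  to the algebra through the commutator formula for inverses. Since singular numbers, moduli and
  adjoints are definite descriptions, they are traded early for quantified inequalities over
  orthonormal systems. In K-theory the delicate point is uniqueness of the rank: the idempotents to
  be compared contain a scalar block and may have infinite rank, so a trace does not see them. It is
  replaced by an index argument, namely that a left inverse of a compact perturbation of 1 is also a
  right inverse.\<close>

lemma cinner_add_right: "cinner x (y + z) = cinner x y + cinner x (z :: 'h::complex_hilbert)"
  by (metis cinner_commute cinner_add_left complex_cnj_add)

lemma cinner_scaleC_right: "cinner x (a *\<^sub>C y) = cnj a * cinner x (y :: 'h::complex_hilbert)"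
  by (metis cinner_commute cinner_scaleC_left complex_cnj_mult)

lemma scaleC_diff_right: "a *\<^sub>C (x - y) = a *\<^sub>C x - a *\<^sub>C (y :: 'h::complex_hilbert)"
  by (rule complex_vs.scale_right_diff_distrib)

lemma scaleC_diff_left: "(a - b) *\<^sub>C x = a *\<^sub>C x - b *\<^sub>C (x :: 'h::complex_hilbert)"
  by (rule complex_vs.scale_left_diff_distrib)

lemma scaleC_sum_right: "a *\<^sub>C (\<Sum>i\<in>A. f i) = (\<Sum>i\<in>A. a *\<^sub>C (f i :: 'h::complex_hilbert))"
  by (rule complex_vs.scale_sum_right)

lemma cinner_zero_left [simp]: "cinner 0 (y :: 'h::complex_hilbert) = 0"
  using cinner_scaleC_left [of 0 y y] by simp

lemma cinner_zero_right [simp]: "cinner (y :: 'h::complex_hilbert) 0 = 0"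
  using cinner_scaleC_right [of y 0 y] by simp

lemma cinner_minus_left: "cinner (- x) y = - cinner x (y :: 'h::complex_hilbert)"
  using cinner_scaleC_left [of "-1" x y] by simp

lemma cinner_minus_right: "cinner x (- y) = - cinner x (y :: 'h::complex_hilbert)"
  using cinner_scaleC_right [of x "-1" y] by simp

lemma cinner_diff_left: "cinner (x - z) y = cinner x y - cinner z (y :: 'h::complex_hilbert)"
  using cinner_add_left [of x "-z" y] by (simp add: cinner_minus_left)

lemma cinner_diff_right: "cinner x (y - z) = cinner x y - cinner x (z :: 'h::complex_hilbert)"
  using cinner_add_right [of x y "-z"] by (simp add: cinner_minus_right)

lemma cinner_scaleR_left: "cinner (r *\<^sub>R x) y = complex_of_real r * cinner x (y :: 'h::complex_hilbert)"
  by (simp add: scaleR_scaleC cinner_scaleC_left)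

lemma cinner_scaleR_right: "cinner x (r *\<^sub>R y) = complex_of_real r * cinner x (y :: 'h::complex_hilbert)"
  by (simp add: scaleR_scaleC cinner_scaleC_right)

lemma cinner_sum_left: "cinner (\<Sum>i\<in>A. f i) y = (\<Sum>i\<in>A. cinner (f i) (y :: 'h::complex_hilbert))"
  by (induction A rule: infinite_finite_induct) (auto simp: cinner_add_left)

lemma cinner_sum_right: "cinner y (\<Sum>i\<in>A. f i) = (\<Sum>i\<in>A. cinner (y :: 'h::complex_hilbert) (f i))"
  by (induction A rule: infinite_finite_induct) (auto simp: cinner_add_right)

lemmas cinner_algebra = cinner_add_left cinner_add_right cinner_diff_left cinner_diff_right
  cinner_minus_left cinner_minus_right cinner_scaleC_left cinner_scaleC_right
  cinner_scaleR_left cinner_scaleR_right cinner_sum_left cinner_sum_right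

lemma norm_sq_cinner: "(norm (x :: 'h::complex_hilbert))\<^sup>2 = Re (cinner x x)"
  by (simp add: cinner_self)

lemma cinner_self_eq_0 [simp]: "cinner x x = 0 \<longleftrightarrow> x = (0 :: 'h::complex_hilbert)"
  by (simp add: cinner_self)

lemma Re_cinner_commute: "Re (cinner x y) = Re (cinner y (x :: 'h::complex_hilbert))"
  by (metis cinner_commute complex_cnj(1) complex.sel(1) cnj.simps(1))

lemma norm_add_sq:
  "(norm (x + y :: 'h::complex_hilbert))\<^sup>2 = (norm x)\<^sup>2 + (norm y)\<^sup>2 + 2 * Re (cinner x y)"
  using Re_cinner_commute [of x y] by (simp add: norm_sq_cinner cinner_algebra)

lemma norm_diff_sq:
  "(norm (x - y :: 'h::complex_hilbert))\<^sup>2 = (norm x)\<^sup>2 + (norm y)\<^sup>2 - 2 * Re (cinner x y)"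
  using norm_add_sq [of x "-y"] by (simp add: cinner_minus_right)

lemma norm_scaleC [simp]: "norm (a *\<^sub>C (x :: 'h::complex_hilbert)) = cmod a * norm x"
proof -
  have "cinner (a *\<^sub>C x) (a *\<^sub>C x) = (a * cnj a) * cinner x x"
    by (simp add: cinner_algebra mult_ac)
  also have "\<dots> = complex_of_real ((cmod a)\<^sup>2) * complex_of_real ((norm x)\<^sup>2)"
    by (simp only: complex_norm_square cinner_self)
  finally have "complex_of_real ((norm (a *\<^sub>C x))\<^sup>2) = complex_of_real ((cmod a * norm x)\<^sup>2)"
    by (simp add: cinner_self power_mult_distrib)
  then have "(norm (a *\<^sub>C x))\<^sup>2 = (cmod a * norm x)\<^sup>2" by (simp only: of_real_eq_iff)
  then show ?thesis by (rule power2_eq_imp_eq) auto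
qed

text \<open>Nonnegativity of the squared distance from x to its projection
  \<open>a *\<^sub>C y\<close> on the line of y.\<close>

lemma cinner_bound: "cmod (cinner x (y :: 'h::complex_hilbert)) \<le> norm x * norm y"
proof (cases "y = 0")
  case False
  define a where "a = cinner x y / complex_of_real ((norm y)\<^sup>2)"
  have y: "norm y > 0" using False by simp
  have "0 \<le> (norm (x - a *\<^sub>C y))\<^sup>2" by simp
  also have "\<dots> = (norm x)\<^sup>2 + (cmod a * norm y)\<^sup>2 - 2 * Re (cnj a * cinner x y)"
    by (simp add: norm_diff_sq cinner_scaleC_right)
  also have "cnj a * cinner x y = cinner x y * cnj (cinner x y) / complex_of_real ((norm y)\<^sup>2)"
    unfolding a_def by simp
  also have "\<dots> = complex_of_real ((cmod (cinner x y))\<^sup>2 / (norm y)\<^sup>2)"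
    by (simp only: complex_norm_square of_real_divide)
  also have "cmod a = cmod (cinner x y) / (norm y)\<^sup>2"
    unfolding a_def by (simp add: norm_divide norm_power)
  finally have "0 \<le> (norm x)\<^sup>2 - (cmod (cinner x y))\<^sup>2 / (norm y)\<^sup>2"
    using y by (simp add: power2_eq_square field_simps)
  then have "(cmod (cinner x y))\<^sup>2 \<le> (norm x * norm y)\<^sup>2"
    using y by (simp add: field_simps)
  then show ?thesis by (rule power2_le_imp_le) simp
qed simp

lemma bounded_bilinear_cinner: "bounded_bilinear (cinner :: 'h::complex_hilbert \<Rightarrow> 'h \<Rightarrow> complex)"
  by unfold_locales
    (auto simp: cinner_algebra scaleR_conv_of_real intro!: exI [of _ 1] cinner_bound)

lemma bounded_linear_scaleC: "bounded_linear (\<lambda>x :: 'h::complex_hilbert. c *\<^sub>C x)"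
  by (rule bounded_linear_intro [where K = "cmod c"])
     (auto simp: scaleC_add_right scaleR_scaleC scaleC_scaleC mult.commute)

lemma cinner_ext_right: "(\<And>y. cinner y x = cinner y z) \<Longrightarrow> x = (z :: 'h::complex_hilbert)"
  by (metis cinner_diff_right cinner_self_eq_0 right_minus_eq)

text \<open>Up to a constant, \<open>J x\<close> is the squared distance from x to the vector
  sought, which is therefore found as a minimizer of \<open>J\<close>. The parallelogram law makes a
  minimizing sequence Cauchy, and the first variation at the limit identifies real parts.\<close>

theorem riesz_representation:
  fixes f :: "'h::complex_hilbert \<Rightarrow> complex"
  assumes add: "\<And>x y. f (x + y) = f x + f y" and scale: "\<And>a x. f (a *\<^sub>C x) = a * f x"
    and bound: "\<And>x. cmod (f x) \<le> K * norm x"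
  shows "\<exists>y. \<forall>x. f x = cinner x y"
proof -
  define J where "J = (\<lambda>x. (norm x)\<^sup>2 - 2 * Re (f x))"
  have J_bound: "J x \<ge> - K\<^sup>2" for x
  proof -
    have "Re (f x) \<le> K * norm x"
      using complex_Re_le_cmod [of "f x"] bound [of x] by linarith
    moreover have "0 \<le> (norm x - K)\<^sup>2" by simp
    ultimately show ?thesis unfolding J_def by (simp add: power2_diff mult.commute)
  qed
  define m where "m = Inf (range J)"
  have bdd: "bdd_below (range J)" using J_bound by (auto intro!: bdd_belowI)
  have m: "m \<le> J x" for x unfolding m_def by (intro cInf_lower bdd) auto
  have "\<exists>x. J x < m + inverse (real (Suc n))" for n
  proof -
    have "Inf (range J) < m + inverse (real (Suc n))" by (simp add: m_def)
    then show ?thesis using bdd by (subst (asm) cInf_less_iff) auto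
  qed
  then obtain X where X: "\<And>n. J (X n) < m + inverse (real (Suc n))" by metis
  have fR: "f (r *\<^sub>R x) = complex_of_real r * f x" for r x
    by (simp add: scaleR_scaleC scale)
  have par: "(norm (x - y))\<^sup>2 \<le> 2 * (J x - m) + 2 * (J y - m)" for x y
  proof -
    have "J ((1/2) *\<^sub>R (x + y)) = (norm (x + y))\<^sup>2 / 4 - Re (f x) - Re (f y)"
    proof -
      have "norm ((1/2) *\<^sub>R (x + y)) = norm (x + y) / 2" by simp
      then show ?thesis unfolding J_def fR add by (simp add: power_divide add_divide_distrib)
    qed
    moreover have "(norm (x + y))\<^sup>2 + (norm (x - y))\<^sup>2 = 2 * (norm x)\<^sup>2 + 2 * (norm y)\<^sup>2"
      by (simp add: norm_add_sq norm_diff_sq)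
    moreover have "J ((1/2) *\<^sub>R (x + y)) \<ge> m" by (rule m)
    ultimately show ?thesis unfolding J_def by simp
  qed
  have "Cauchy X"
  proof (rule metric_CauchyI)
    fix e :: real assume e: "e > 0"
    then obtain N where N: "inverse (real (Suc N)) < e\<^sup>2 / 4"
      using reals_Archimedean [of "e\<^sup>2/4"] by auto
    show "\<exists>M. \<forall>i\<ge>M. \<forall>j\<ge>M. dist (X i) (X j) < e"
    proof (intro exI allI impI)
      fix i j assume ij: "i \<ge> N" "j \<ge> N"
      have "inverse (real (Suc i)) \<le> inverse (real (Suc N))" "inverse (real (Suc j)) \<le> inverse (real (Suc N))"
        using ij by (auto intro!: le_imp_inverse_le)
      then have "inverse (real (Suc i)) < e\<^sup>2 / 4" "inverse (real (Suc j)) < e\<^sup>2 / 4"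
        using N by (blast intro: order_le_less_trans)+
      then have "J (X i) < m + e\<^sup>2 / 4" "J (X j) < m + e\<^sup>2 / 4"
        using X by (meson add_strict_left_mono order_less_trans)+
      then have "(norm (X i - X j))\<^sup>2 < e\<^sup>2"
        using par [of "X i" "X j"] by auto
      then show "dist (X i) (X j) < e"
        using e by (simp add: dist_norm power2_less_imp_less)
    qed
  qed
  then obtain y where y: "X \<longlonglongrightarrow> y"
    using Cauchy_convergent_iff convergent_def by blast
  have lf: "bounded_linear f"
    by (rule bounded_linear_intro [where K = K])
      (auto simp: add fR scaleR_conv_of_real mult.commute intro: order_trans [OF bound])
  have "(\<lambda>n. J (X n)) \<longlonglongrightarrow> J y"
    unfolding J_def by (intro tendsto_intros y bounded_linear.tendsto [OF lf])
  moreover have "(\<lambda>n. m + inverse (real (Suc n))) \<longlonglongrightarrow> m + 0"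
    by (intro tendsto_intros LIMSEQ_inverse_real_of_nat)
  ultimately have "J y \<le> m + 0"
    using X by (intro LIMSEQ_le) (auto intro: less_imp_le)
  then have Jy: "J y \<le> J x" for x using m [of x] by simp
  have Re_eq: "Re (f x) = Re (cinner x y)" for x
  proof (rule ccontr)
    assume ne: "Re (f x) \<noteq> Re (cinner x y)"
    define d where "d = Re (cinner y x) - Re (f x)"
    have d: "d \<noteq> 0" using ne Re_cinner_commute [of x y] by (simp add: d_def)
    have q: "0 \<le> 2 * t * d + t\<^sup>2 * (norm x)\<^sup>2" for t
      using Jy [of "y + t *\<^sub>R x"] unfolding J_def d_def
      by (simp add: norm_add_sq add fR cinner_scaleR_right power_mult_distrib algebra_simps)
    \<comment> \<open>A step against the sign of \<open>d\<close>, short enough for the linear term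
      to win; the summand 1 in the denominator covers \<open>x = 0\<close>.\<close>
    define t where "t = - d / (1 + (norm x)\<^sup>2)"
    have pos: "1 + (norm x)\<^sup>2 > 0" by (simp add: add_pos_nonneg)
    have td: "t * (1 + (norm x)\<^sup>2) = - d" using pos by (simp add: t_def)
    have "2 * t * d + t\<^sup>2 * (norm x)\<^sup>2 = 2 * t * d + t * (t * (1 + (norm x)\<^sup>2)) - t\<^sup>2"
      by (simp add: power2_eq_square algebra_simps)
    also have "\<dots> = t * d - t\<^sup>2" by (simp add: td)
    also have "t * d = - d\<^sup>2 / (1 + (norm x)\<^sup>2)" by (simp add: t_def power2_eq_square)
    finally have "2 * t * d + t\<^sup>2 * (norm x)\<^sup>2 < 0"
      using d pos by (smt (verit) divide_neg_pos power2_less_0 zero_less_power2)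
    with q [of t] show False by simp
  qed
  have "f x = cinner x y" for x
  proof (rule complex_eqI)
    show "Re (f x) = Re (cinner x y)" by (rule Re_eq)
    \<comment> \<open>The imaginary part of \<open>f x\<close> is minus the real part of
      \<open>f\<close> at i times x.\<close>
    show "Im (f x) = Im (cinner x y)"
      using Re_eq [of "\<i> *\<^sub>C x"] by (simp add: scale cinner_scaleC_left)
  qed
  then show ?thesis by blast
qed

section \<open>Bounded operators and adjoints\<close>

lemma bounded_opsD: "X \<in> bounded_ops \<Longrightarrow> blinfun_apply X (c *\<^sub>C x) = c *\<^sub>C blinfun_apply X x"
  by (simp add: bounded_ops_def)

lemma bounded_ops_0 [simp]: "0 \<in> bounded_ops"
  and bounded_ops_id [simp]: "id_blinfun \<in> bounded_ops"
  and bounded_ops_add: "X \<in> bounded_ops \<Longrightarrow> Y \<in> bounded_ops \<Longrightarrow> X + Y \<in> bounded_ops"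
  and bounded_ops_diff: "X \<in> bounded_ops \<Longrightarrow> Y \<in> bounded_ops \<Longrightarrow> X - Y \<in> bounded_ops"
  and bounded_ops_minus: "X \<in> bounded_ops \<Longrightarrow> - X \<in> bounded_ops"
  and bounded_ops_scaleR: "X \<in> bounded_ops \<Longrightarrow> r *\<^sub>R X \<in> bounded_ops"
  and bounded_ops_compose: "X \<in> bounded_ops \<Longrightarrow> Y \<in> bounded_ops \<Longrightarrow> X o\<^sub>L Y \<in> bounded_ops"
  by (auto simp: bounded_ops_def blinfun.bilinear_simps scaleC_add_right scaleC_diff_right
      scaleR_scaleC scaleC_scaleC mult.commute)

lemma bounded_ops_sum: "(\<And>i. i \<in> A \<Longrightarrow> X i \<in> bounded_ops) \<Longrightarrow> (\<Sum>i\<in>A. X i) \<in> bounded_ops"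
  by (induction A rule: infinite_finite_induct) (auto intro: bounded_ops_add)

lemma closed_bounded_ops: "closed (bounded_ops :: ('h::complex_hilbert \<Rightarrow>\<^sub>L 'h) set)"
proof -
  have eq: "(bounded_ops :: ('h \<Rightarrow>\<^sub>L 'h) set)
      = (\<Inter>c. \<Inter>x. {X. blinfun_apply X (c *\<^sub>C x) = c *\<^sub>C blinfun_apply X x})"
    by (auto simp: bounded_ops_def)
  have "continuous_on UNIV (\<lambda>X :: 'h \<Rightarrow>\<^sub>L 'h. c *\<^sub>C blinfun_apply X x)" for c x
    by (intro bounded_linear.continuous_on [OF bounded_linear_scaleC] continuous_intros)
  then show ?thesis unfolding eq
    by (intro closed_INT ballI closed_Collect_eq continuous_intros)
qed

text \<open>This is the field \<open>cscale\<close> of \<open>B_alg\<close>, named so that it can be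
  used apart from the record.\<close>

definition scaleO :: "complex \<Rightarrow> ('h::complex_hilbert \<Rightarrow>\<^sub>L 'h) \<Rightarrow> ('h \<Rightarrow>\<^sub>L 'h)" where
  "scaleO c X = Blinfun (\<lambda>x. c *\<^sub>C blinfun_apply X x)"

lemma scaleO_apply [simp]: "blinfun_apply (scaleO c X) x = c *\<^sub>C blinfun_apply X x"
  unfolding scaleO_def
  by (subst bounded_linear_Blinfun_apply)
    (auto intro!: bounded_linear_compose [OF bounded_linear_scaleC] blinfun.bounded_linear_right)

lemma bounded_ops_scaleO: "X \<in> bounded_ops \<Longrightarrow> scaleO c X \<in> bounded_ops"
  by (auto simp: bounded_ops_def scaleC_scaleC mult.commute)

lemma norm_scaleO: "norm (scaleO c X) = cmod c * norm X"
proof -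
  have le: "norm (scaleO c X) \<le> cmod c * norm X" for c and X :: "'h::complex_hilbert \<Rightarrow>\<^sub>L 'h"
    by (rule norm_blinfun_bound) (auto simp: mult.assoc intro!: mult_left_mono norm_blinfun)
  show ?thesis
  proof (cases "c = 0")
    case True then show ?thesis using le [of c X] by simp
  next
    case False
    then have "scaleO (inverse c) (scaleO c X) = X"
      by (intro blinfun_eqI) (simp add: scaleC_scaleC)
    then have "norm X \<le> inverse (cmod c) * norm (scaleO c X)" using le by (metis norm_inverse)
    then have "cmod c * norm X \<le> norm (scaleO c X)"
      using False by (simp add: field_simps)
    then show ?thesis using le [of c X] by simp
  qed
qed

lemma
  fixes X Y :: "'h::complex_hilbert \<Rightarrow>\<^sub>L 'h"
  shows scaleO_add_right: "scaleO c (X + Y) = scaleO c X + scaleO c Y"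
    and scaleO_diff_right: "scaleO c (X - Y) = scaleO c X - scaleO c Y"
    and scaleO_minus_right: "scaleO c (- X) = - scaleO c X"
    and scaleO_add_left: "scaleO (c + d) X = scaleO c X + scaleO d X"
    and scaleO_diff_left: "scaleO (c - d) X = scaleO c X - scaleO d X"
    and scaleO_scaleO: "scaleO c (scaleO d X) = scaleO (c * d) X"
    and scaleO_zero_left: "scaleO 0 X = 0"
    and scaleO_zero_right: "scaleO c (0 :: 'h \<Rightarrow>\<^sub>L 'h) = 0"
    and scaleO_one: "scaleO 1 X = X"
    and scaleO_of_real: "scaleO (of_real r) X = r *\<^sub>R X"
    and scaleO_compose_left: "scaleO c X o\<^sub>L Y = scaleO c (X o\<^sub>L Y)"
  by (auto intro!: blinfun_eqI simp: blinfun.bilinear_simps scaleC_add_right scaleC_diff_right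
      scaleC_add_left scaleC_diff_left scaleC_scaleC scaleR_scaleC)

lemma scaleO_compose_right: "X \<in> bounded_ops \<Longrightarrow> X o\<^sub>L scaleO c Y = scaleO c (X o\<^sub>L Y)"
  by (auto intro!: blinfun_eqI simp: bounded_opsD)

text \<open>\<open>adj_op\<close> is a definite description, so this must precede any statement
  about it. The value of the adjoint at y is the Riesz vector of the functional that sends x to
  \<open>cinner (X x) y\<close>.\<close>

lemma adjoint_exists:
  fixes X :: "'h::complex_hilbert \<Rightarrow>\<^sub>L 'h"
  assumes X: "X \<in> bounded_ops"
  shows "\<exists>!Y. Y \<in> bounded_ops \<and> (\<forall>x y. cinner (X x) y = cinner x (blinfun_apply Y y))"
proof -
  have "\<exists>z. \<forall>x. cinner (X x) y = cinner x z" for y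
    by (rule riesz_representation [where K = "norm X * norm y"])
      (auto simp: blinfun.bilinear_simps cinner_algebra bounded_opsD [OF X] mult_ac
        intro!: order_trans [OF cinner_bound] order_trans [OF mult_right_mono [OF norm_blinfun]])
  then obtain g where g: "\<And>x y. cinner (X x) y = cinner x (g y)" by metis
  have ng: "norm (g y) \<le> norm X * norm y" for y
  proof (cases "g y = 0")
    case False
    have "(norm (g y))\<^sup>2 = Re (cinner (X (g y)) y)" by (simp add: g norm_sq_cinner)
    also have "\<dots> \<le> norm (X (g y)) * norm y"
      using cinner_bound [of "X (g y)" y] complex_Re_le_cmod order_trans by blast
    also have "\<dots> \<le> norm X * norm (g y) * norm y" by (intro mult_right_mono norm_blinfun) auto
    finally show ?thesis using False by (simp add: power2_eq_square mult_ac)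
  qed simp
  have sc: "g (c *\<^sub>C y) = c *\<^sub>C g y" for c y
    by (rule cinner_ext_right) (simp add: cinner_algebra flip: g)
  have "bounded_linear g"
  proof (rule bounded_linear_intro [where K = "norm X"])
    show "g (x + y) = g x + g y" for x y
      by (rule cinner_ext_right) (simp add: cinner_algebra flip: g)
  next
    show "norm (g x) \<le> norm x * norm X" for x using ng [of x] by (simp add: mult.commute)
  qed (simp add: scaleR_scaleC sc)
  then have "blinfun_apply (Blinfun g) = g" by (rule bounded_linear_Blinfun_apply)
  then have ex: "Blinfun g \<in> bounded_ops \<and> (\<forall>x y. cinner (X x) y = cinner x (blinfun_apply (Blinfun g) y))"
    by (simp add: bounded_ops_def sc g)
  show ?thesis
  proof (rule ex1I)
    show "Blinfun g \<in> bounded_ops \<and> (\<forall>x y. cinner (X x) y = cinner x (blinfun_apply (Blinfun g) y))"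
      by (rule ex)
    fix Y assume Y: "Y \<in> bounded_ops \<and> (\<forall>x y. cinner (X x) y = cinner x (blinfun_apply Y y))"
    show "Y = Blinfun g"
      by (rule blinfun_eqI, rule cinner_ext_right) (use Y ex in metis)
  qed
qed

lemma adj_op_in [simp]: "X \<in> bounded_ops \<Longrightarrow> adj_op X \<in> bounded_ops"
  and cinner_adj: "X \<in> bounded_ops \<Longrightarrow> cinner (blinfun_apply X x) y = cinner x (blinfun_apply (adj_op X) y)"
  using theI' [OF adjoint_exists, of X] unfolding adj_op_def by blast+

lemma cinner_adj': "X \<in> bounded_ops \<Longrightarrow> cinner (blinfun_apply (adj_op X) x) y = cinner x (blinfun_apply X y)"
  by (metis cinner_adj cinner_commute)

lemma adj_op_unique:
  assumes "X \<in> bounded_ops" "\<And>x y. cinner (blinfun_apply X x) y = cinner x (blinfun_apply Y y)"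
  shows "adj_op X = Y"
  by (rule blinfun_eqI, rule cinner_ext_right) (metis assms cinner_adj)

lemma adj_op_adj_op [simp]: "X \<in> bounded_ops \<Longrightarrow> adj_op (adj_op X) = X"
  by (rule adj_op_unique) (auto simp: cinner_adj')

lemma adj_op_add: "X \<in> bounded_ops \<Longrightarrow> Y \<in> bounded_ops \<Longrightarrow> adj_op (X + Y) = adj_op X + adj_op Y"
  by (rule adj_op_unique) (auto simp: blinfun.bilinear_simps cinner_algebra cinner_adj bounded_ops_add)

lemma adj_op_diff: "X \<in> bounded_ops \<Longrightarrow> Y \<in> bounded_ops \<Longrightarrow> adj_op (X - Y) = adj_op X - adj_op Y"
  by (rule adj_op_unique) (auto simp: blinfun.bilinear_simps cinner_algebra cinner_adj bounded_ops_diff)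

lemma adj_op_0 [simp]: "adj_op 0 = 0"
  by (rule adj_op_unique) auto

lemma adj_op_sum: "(\<And>i. i \<in> A \<Longrightarrow> X i \<in> bounded_ops) \<Longrightarrow> adj_op (\<Sum>i\<in>A. X i) = (\<Sum>i\<in>A. adj_op (X i))"
  by (induction A rule: infinite_finite_induct) (auto simp: adj_op_add bounded_ops_sum)

lemma adj_op_compose: "X \<in> bounded_ops \<Longrightarrow> Y \<in> bounded_ops \<Longrightarrow> adj_op (X o\<^sub>L Y) = adj_op Y o\<^sub>L adj_op X"
  by (rule adj_op_unique) (auto simp: cinner_adj bounded_ops_compose)

lemma norm_le_cinner:
  assumes "\<And>y. cmod (cinner x y) \<le> K * norm y" "K \<ge> 0"
  shows "norm (x :: 'h::complex_hilbert) \<le> K"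
proof (cases "x = 0")
  case False
  have "(norm x)\<^sup>2 \<le> K * norm x"
    using assms(1) [of x] by (simp add: cinner_self norm_power)
  then show ?thesis using False by (simp add: power2_eq_square)
qed (use assms in simp)

lemma norm_adj_op [simp]:
  fixes X :: "'h::complex_hilbert \<Rightarrow>\<^sub>L 'h"
  assumes X: "X \<in> bounded_ops" shows "norm (adj_op X) = norm X"
proof -
  have le: "norm (adj_op X) \<le> norm X" if X: "X \<in> bounded_ops" for X :: "'h \<Rightarrow>\<^sub>L 'h"
  proof (rule norm_blinfun_bound)
    fix x
    show "norm (adj_op X x) \<le> norm X * norm x"
    proof (rule norm_le_cinner)
      fix y
      have "cmod (cinner (adj_op X x) y) \<le> norm x * norm (X y)"
        unfolding cinner_adj' [OF X] by (rule cinner_bound)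
      also have "\<dots> \<le> norm x * (norm X * norm y)" by (intro mult_left_mono norm_blinfun) auto
      finally show "cmod (cinner (adj_op X x) y) \<le> norm X * norm x * norm y" by (simp add: mult_ac)
    qed auto
  qed auto
  show ?thesis using le [OF X] le [OF adj_op_in [OF X]] X by simp
qed

section \<open>Orthonormal systems\<close>

text \<open>Only the first k values count, so subsystems are initial segments and one infinite
  sequence can serve all k.\<close>

definition orthn :: "nat \<Rightarrow> (nat \<Rightarrow> 'h::complex_hilbert) \<Rightarrow> bool" where
  "orthn k u \<longleftrightarrow> (\<forall>i<k. \<forall>j<k. cinner (u i) (u j) = (if i = j then 1 else 0))"

lemma orthnD: "orthn k u \<Longrightarrow> i < k \<Longrightarrow> j < k \<Longrightarrow> cinner (u i) (u j) = (if i = j then 1 else 0)"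
  by (simp add: orthn_def)

lemma orthn_norm: "orthn k u \<Longrightarrow> i < k \<Longrightarrow> norm (u i) = 1"
  using orthnD [of k u i i] norm_sq_cinner [of "u i"] by (simp add: power2_eq_1_iff)
    (metis norm_ge_zero neg_0_le_iff_le not_one_le_zero)

lemma orthn_mono: "orthn k u \<Longrightarrow> m \<le> k \<Longrightarrow> orthn m u"
  by (simp add: orthn_def)

lemma orthn_0 [simp]: "orthn 0 u" by (simp add: orthn_def)

text \<open>The orthogonal projection of x onto the span of the first k vectors, as a plain
  function; \<open>oproj\<close> is the corresponding operator.\<close>

definition ocomp :: "nat \<Rightarrow> (nat \<Rightarrow> 'h::complex_hilbert) \<Rightarrow> 'h \<Rightarrow> 'h" where
  "ocomp k u x = (\<Sum>i<k. cinner x (u i) *\<^sub>C u i)"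

lemma cinner_ocomp: "orthn k u \<Longrightarrow> j < k \<Longrightarrow> cinner (ocomp k u x) (u j) = cinner x (u j)"
  by (simp add: ocomp_def cinner_algebra orthnD if_distrib [of "(*) _"] cong: if_cong)

lemma norm_orthn_sum:
  assumes "orthn k u"
  shows "(norm (\<Sum>i<k. a i *\<^sub>C u i))\<^sup>2 = (\<Sum>i<k. (cmod (a i))\<^sup>2)"
proof -
  have "cinner (\<Sum>i<k. a i *\<^sub>C u i) (\<Sum>i<k. a i *\<^sub>C u i) = (\<Sum>i<k. a i * cnj (a i))"
    using assms by (simp add: cinner_sum_left cinner_sum_right cinner_scaleC_left cinner_scaleC_right
        orthnD if_distrib [of "(*) _"] mult.commute cong: if_cong)
  then have "complex_of_real ((norm (\<Sum>i<k. a i *\<^sub>C u i))\<^sup>2) = complex_of_real (\<Sum>i<k. (cmod (a i))\<^sup>2)"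
    by (simp only: cinner_self [symmetric] of_real_sum complex_norm_square)
  then show ?thesis by (simp only: of_real_eq_iff)
qed

lemma norm_ocomp: "orthn k u \<Longrightarrow> (norm (ocomp k u x))\<^sup>2 = (\<Sum>i<k. (cmod (cinner x (u i)))\<^sup>2)"
  unfolding ocomp_def by (rule norm_orthn_sum)

lemma cinner_ocomp_rest: "orthn k u \<Longrightarrow> j < k \<Longrightarrow> cinner (x - ocomp k u x) (u j) = 0"
  by (simp add: cinner_diff_left cinner_ocomp)

lemma ocomp_orthogonal:
  assumes "orthn k u" shows "cinner (x - ocomp k u x) (ocomp k u y) = 0"
  unfolding ocomp_def [of k u y] cinner_sum_right cinner_scaleC_right
  using cinner_ocomp_rest [OF assms] by simp

lemma pythagoras_ocomp:
  "orthn k u \<Longrightarrow> (norm x)\<^sup>2 = (norm (ocomp k u x))\<^sup>2 + (norm (x - ocomp k u x))\<^sup>2"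
  using norm_add_sq [of "x - ocomp k u x" "ocomp k u x"] ocomp_orthogonal [of k u x x] by simp

lemma bessel: "orthn k u \<Longrightarrow> (\<Sum>i<k. (cmod (cinner x (u i)))\<^sup>2) \<le> (norm x)\<^sup>2"
  using pythagoras_ocomp [of k u x] norm_ocomp [of k u x] by simp

lemma bessel': "orthn k u \<Longrightarrow> (\<Sum>i<k. (cmod (cinner (u i) x))\<^sup>2) \<le> (norm x)\<^sup>2"
proof -
  assume u: "orthn k u"
  have "cmod (cinner (u i) x) = cmod (cinner x (u i))" for i
    by (metis cinner_commute complex_mod_cnj)
  then show ?thesis using bessel [OF u, of x] by simp
qed

lemma ocomp_span:
  assumes u: "orthn k u" and x: "x \<in> cspan (u ` {..<k})"
  shows "ocomp k u x = x"
  using x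
proof (induction rule: complex_vs.span_induct_alt)
  case base then show ?case by (simp add: ocomp_def)
next
  case (step c v y)
  then obtain i where i: "i < k" "v = u i" by auto
  have "ocomp k u (u i) = u i"
    using i(1) by (simp add: ocomp_def orthnD [OF u] if_distrib [of "\<lambda>c. c *\<^sub>C _"] cong: if_cong)
  moreover have "ocomp k u (c *\<^sub>C v + y) = c *\<^sub>C ocomp k u v + ocomp k u y"
    by (simp add: ocomp_def cinner_algebra scaleC_add_left sum.distrib scaleC_sum_right scaleC_scaleC)
  ultimately show ?case using step i by simp
qed

lemma ocomp_in_span: "ocomp k u x \<in> cspan (u ` {..<k})"
  unfolding ocomp_def by (intro complex_vs.span_sum complex_vs.span_scale complex_vs.span_base) auto

lemma gram_schmidt_extend:
  assumes u: "orthn k u"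
  obtains u' k' where "orthn k' u'" "k \<le> k'" "k' \<le> Suc k" "\<And>i. i < k \<Longrightarrow> u' i = u i"
    "x \<in> cspan (u' ` {..<k'})" "u' ` {..<k'} \<subseteq> cspan (insert x (u ` {..<k}))"
    "x \<notin> cspan (u ` {..<k}) \<longleftrightarrow> k' = Suc k"
proof (cases "x - ocomp k u x = 0")
  case True
  then have "x \<in> cspan (u ` {..<k})" using ocomp_in_span [of k u x] by simp
  then show ?thesis using u
    by (intro that [of k u]) (auto intro: complex_vs.span_base)
next
  case False
  define w where "w = x - ocomp k u x"
  define e where "e = inverse (norm w) *\<^sub>R w"
  define u' where "u' = u(k := e)"
  have nw: "norm w \<noteq> 0" using False by (simp add: w_def)
  have e1: "cinner e e = 1" using nw by (simp add: e_def cinner_algebra cinner_self power2_eq_square)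
  have e2: "cinner e (u j) = 0" if "j < k" for j
    using cinner_ocomp_rest [OF u that, of x] by (simp add: e_def cinner_algebra w_def)
  have e3: "cinner (u j) e = 0" if "j < k" for j
    using e2 [OF that] by (subst cinner_commute) simp
  have o: "orthn (Suc k) u'"
    unfolding orthn_def u'_def using u e1 e2 e3 by (auto simp: less_Suc_eq orthnD)
  have im: "u' ` {..<Suc k} = insert e (u ` {..<k})"
    by (auto simp: u'_def less_Suc_eq image_iff)
  have "x = norm w *\<^sub>R e + ocomp k u x" using nw by (simp add: e_def w_def)
  moreover have "norm w *\<^sub>R e + ocomp k u x \<in> cspan (insert e (u ` {..<k}))"
    unfolding scaleR_scaleC
    by (intro complex_vs.span_add complex_vs.span_scale complex_vs.span_base
        subsetD [OF complex_vs.span_mono ocomp_in_span]) auto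
  ultimately have x: "x \<in> cspan (u' ` {..<Suc k})" unfolding im by metis
  have "e \<in> cspan (insert x (u ` {..<k}))"
    unfolding e_def w_def scaleR_scaleC
    by (intro complex_vs.span_scale complex_vs.span_diff complex_vs.span_base
        subsetD [OF complex_vs.span_mono ocomp_in_span]) auto
  then have sub: "u' ` {..<Suc k} \<subseteq> cspan (insert x (u ` {..<k}))"
    unfolding im by (auto intro: complex_vs.span_base)
  have "x \<notin> cspan (u ` {..<k})" using False ocomp_span [OF u] by auto
  then show ?thesis
    using o x sub by (intro that [of "Suc k" u'] iffI) (simp_all add: u'_def)
qed

text \<open>The bound \<open>k \<le> card S\<close> is what later limits the rank of the projections
  onto spaces of word vectors.\<close>

lemma gram_schmidt:
  fixes S :: "'h::complex_hilbert set"
  assumes "finite S"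
  obtains k u where "orthn k u" "k \<le> card S" "cspan (u ` {..<k}) = cspan S"
proof -
  have "\<exists>k u. orthn k u \<and> k \<le> card S \<and> cspan (u ` {..<k}) = cspan S"
    using assms
  proof (induction S)
    case empty
    show ?case by (rule exI [of _ 0]) auto
  next
    case (insert x S)
    then obtain k u where u: "orthn k u" "k \<le> card S" "cspan (u ` {..<k}) = cspan S" by blast
    obtain u' k' where u': "orthn k' u'" "k \<le> k'" "k' \<le> Suc k" "\<And>i. i < k \<Longrightarrow> u' i = u i"
      "x \<in> cspan (u' ` {..<k'})" "u' ` {..<k'} \<subseteq> cspan (insert x (u ` {..<k}))"
      by (rule gram_schmidt_extend [OF u(1), of x]) blast
    have uu: "u ` {..<k} \<subseteq> u' ` {..<k'}"
    proof
      fix y assume "y \<in> u ` {..<k}"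
      then obtain i where "i < k" "y = u' i" using u'(4) by auto
      then show "y \<in> u' ` {..<k'}" using u'(2) by auto
    qed
    have "u ` {..<k} \<subseteq> cspan (insert x S)"
      using u(3) complex_vs.span_superset [of "u ` {..<k}"] complex_vs.span_mono [of S "insert x S"]
      by (metis order_trans subset_insertI)
    then have "cspan (insert x (u ` {..<k})) \<subseteq> cspan (insert x S)"
      by (intro complex_vs.span_minimal) (auto intro: complex_vs.span_base)
    then have 1: "cspan (u' ` {..<k'}) \<subseteq> cspan (insert x S)"
      using u'(6) by (intro complex_vs.span_minimal) auto
    have "S \<subseteq> cspan (u' ` {..<k'})"
      using u(3) complex_vs.span_superset [of S] complex_vs.span_mono [OF uu] by (metis order_trans)
    then have 2: "cspan (insert x S) \<subseteq> cspan (u' ` {..<k'})"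
      using u'(5) by (intro complex_vs.span_minimal) auto
    have "k' \<le> card (insert x S)" using u'(3) u(2) insert(1,2) by simp
    then show ?case using u'(1) 1 2 by blast
  qed
  then show ?thesis using that by blast
qed

section \<open>Finite rank operators and finite-dimensional projections\<close>

definition rank1 :: "'h::complex_hilbert \<Rightarrow> 'h \<Rightarrow> ('h \<Rightarrow>\<^sub>L 'h)" where
  "rank1 x y = Blinfun (\<lambda>z. cinner z y *\<^sub>C x)"

lemma rank1_apply [simp]: "blinfun_apply (rank1 x y) z = cinner z y *\<^sub>C x"
proof -
  have "bounded_linear (\<lambda>z. cinner z y *\<^sub>C x)"
  proof (rule bounded_linear_intro [where K = "norm y * norm x"])
    show "norm (cinner z y *\<^sub>C x) \<le> norm z * (norm y * norm x)" for z
      using mult_right_mono [OF cinner_bound [of z y], of "norm x"] by (simp add: mult.assoc)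
    show "cinner (r *\<^sub>R z) y *\<^sub>C x = r *\<^sub>R (cinner z y *\<^sub>C x)" for r z
      by (simp add: cinner_scaleR_left) (simp add: scaleR_scaleC scaleC_scaleC)
  qed (simp add: cinner_add_left scaleC_add_left)
  then show ?thesis unfolding rank1_def by (simp add: bounded_linear_Blinfun_apply)
qed

lemma rank1_in [simp]: "rank1 x y \<in> bounded_ops"
  by (simp add: bounded_ops_def cinner_algebra scaleC_scaleC)

lemma adj_rank1: "adj_op (rank1 x y) = rank1 y x"
proof (rule adj_op_unique)
  fix z w
  show "cinner (blinfun_apply (rank1 x y) z) w = cinner z (blinfun_apply (rank1 y x) w)"
    by (simp add: cinner_algebra cinner_commute [of x w])
qed simp

definition oproj :: "nat \<Rightarrow> (nat \<Rightarrow> 'h::complex_hilbert) \<Rightarrow> ('h \<Rightarrow>\<^sub>L 'h)" where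
  "oproj k u = (\<Sum>i<k. rank1 (u i) (u i))"

lemma oproj_apply [simp]: "blinfun_apply (oproj k u) x = ocomp k u x"
  by (simp add: oproj_def ocomp_def blinfun.sum_left)

lemma oproj_in [simp]: "oproj k u \<in> bounded_ops"
  by (simp add: oproj_def bounded_ops_sum)

lemma adj_oproj [simp]: "adj_op (oproj k u) = oproj k u"
  by (simp add: oproj_def adj_op_sum adj_rank1)

lemma norm_ocomp_le:
  assumes "orthn k u" shows "norm (ocomp k u x) \<le> norm x"
  using pythagoras_ocomp [OF assms, of x] zero_le_power2 [of "norm (x - ocomp k u x)"]
  by (intro power2_le_imp_le [OF _ norm_ge_zero]) linarith

lemma norm_rest_le:
  assumes "orthn k u" shows "norm (x - ocomp k u x) \<le> norm x"
  using pythagoras_ocomp [OF assms, of x] zero_le_power2 [of "norm (ocomp k u x)"]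
  by (intro power2_le_imp_le [OF _ norm_ge_zero]) linarith

lemma norm_oproj_le: "orthn k u \<Longrightarrow> norm (oproj k u) \<le> 1"
  by (intro norm_blinfun_bound) (auto simp: norm_ocomp_le)

lemma finite_rank_I: "X \<in> bounded_ops \<Longrightarrow> finite S \<Longrightarrow> (\<And>x. blinfun_apply X x \<in> cspan S) \<Longrightarrow> X \<in> finite_rank_ops"
  by (auto simp: finite_rank_ops_def)

lemma finite_rank_oproj [simp]: "oproj k u \<in> finite_rank_ops"
  by (rule finite_rank_I [of _ "u ` {..<k}"]) (auto simp: ocomp_in_span)

lemma finite_rank_bounded [simp]: "X \<in> finite_rank_ops \<Longrightarrow> X \<in> bounded_ops"
  by (simp add: finite_rank_ops_def)

text \<open>One orthonormal basis of the span of all the ranges serves finitely many operators at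
  once.\<close>

lemma finite_rank_obtain:
  assumes "finite F" "F \<subseteq> finite_rank_ops"
  obtains k u where "orthn k u" "\<And>X x. X \<in> F \<Longrightarrow> ocomp k u (blinfun_apply X x) = blinfun_apply X x"
proof -
  have "\<exists>S. finite S \<and> range (blinfun_apply X) \<subseteq> cspan S" if "X \<in> F" for X
    using subsetD [OF assms(2) that] unfolding finite_rank_ops_def by blast
  then obtain S where S: "\<And>X. X \<in> F \<Longrightarrow> finite (S X) \<and> range (blinfun_apply X) \<subseteq> cspan (S X)" by metis
  have fin: "finite (\<Union>(S ` F))" using S assms by auto
  obtain k u where ku: "orthn k u" "cspan (u ` {..<k}) = cspan (\<Union>(S ` F))"
    using gram_schmidt [OF fin] by metis
  have *: "blinfun_apply X x \<in> cspan (u ` {..<k})" if "X \<in> F" for X x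
  proof -
    have "blinfun_apply X x \<in> cspan (S X)" using S [OF that] by auto
    moreover have "cspan (S X) \<subseteq> cspan (\<Union>(S ` F))"
      using that by (intro complex_vs.span_mono) auto
    ultimately show ?thesis using ku(2) by auto
  qed
  show ?thesis
    by (rule that [OF ku(1)]) (rule ocomp_span [OF ku(1) *])
qed

lemma finite_rank_iff_oproj:
  "X \<in> finite_rank_ops \<longleftrightarrow> X \<in> bounded_ops \<and> (\<exists>k u. orthn k u \<and> oproj k u o\<^sub>L X = X)"
proof
  assume X: "X \<in> finite_rank_ops"
  then have X': "{X} \<subseteq> finite_rank_ops" by simp
  obtain k u where "orthn k u" "\<And>x. ocomp k u (blinfun_apply X x) = blinfun_apply X x"
    by (rule finite_rank_obtain [OF _ X']) auto
  then show "X \<in> bounded_ops \<and> (\<exists>k u. orthn k u \<and> oproj k u o\<^sub>L X = X)"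
    using X by (auto intro!: exI blinfun_eqI)
next
  assume R: "X \<in> bounded_ops \<and> (\<exists>k u. orthn k u \<and> oproj k u o\<^sub>L X = X)"
  then obtain k u where "oproj k u o\<^sub>L X = X" by blast
  then have "blinfun_apply X x \<in> cspan (u ` {..<k})" for x
    by (metis blinfun_apply_blinfun_compose ocomp_in_span oproj_apply)
  then show "X \<in> finite_rank_ops" using R by (auto intro: finite_rank_I)
qed

lemma finite_rank_D: "X \<in> finite_rank_ops \<Longrightarrow> \<exists>S. finite S \<and> (\<forall>x. blinfun_apply X x \<in> cspan S)"
  unfolding finite_rank_ops_def by blast

lemma finite_rank_compose_left:
  assumes X: "X \<in> finite_rank_ops" and Y: "Y \<in> bounded_ops"
  shows "X o\<^sub>L Y \<in> finite_rank_ops"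
proof -
  obtain S where S: "finite S" "\<And>x. blinfun_apply X x \<in> cspan S"
    using finite_rank_D [OF X] by blast
  show ?thesis
    by (rule finite_rank_I [OF _ S(1)]) (simp_all add: S(2) X Y bounded_ops_compose)
qed

lemma finite_rank_compose_right:
  assumes X: "X \<in> finite_rank_ops" and Y: "Y \<in> bounded_ops"
  shows "Y o\<^sub>L X \<in> finite_rank_ops"
proof -
  obtain S where S: "finite S" "\<And>x. blinfun_apply X x \<in> cspan S"
    using finite_rank_D [OF X] by blast
  have *: "blinfun_apply Y x \<in> cspan (blinfun_apply Y ` S)" if "x \<in> cspan S" for x
    using that
  proof (induction rule: complex_vs.span_induct_alt)
    case base then show ?case by (simp add: blinfun.zero_right complex_vs.span_zero)
  next
    case (step c x y)
    then show ?case
      by (auto simp: blinfun.add_right bounded_opsD [OF Y]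
          intro!: complex_vs.span_add complex_vs.span_scale intro: complex_vs.span_base)
  qed
  show ?thesis
    by (rule finite_rank_I [of _ "blinfun_apply Y ` S"]) (simp_all add: S * X Y bounded_ops_compose)
qed

text \<open>If the projection P fixes the range of X, then taking adjoints in \<open>P X = X\<close>
  makes the adjoint factor through P.\<close>

lemma finite_rank_adj:
  assumes X: "X \<in> finite_rank_ops" shows "adj_op X \<in> finite_rank_ops"
proof -
  obtain k u where "orthn k u" "oproj k u o\<^sub>L X = X" and X': "X \<in> bounded_ops"
    using X finite_rank_iff_oproj by blast
  then have "adj_op X = adj_op X o\<^sub>L oproj k u"
    using adj_op_compose [of "oproj k u" X] by simp
  moreover have "adj_op X o\<^sub>L oproj k u \<in> finite_rank_ops"
    by (rule finite_rank_compose_right) (simp_all add: X')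
  ultimately show ?thesis by simp
qed

lemma finite_rank_add:
  assumes "X \<in> finite_rank_ops" "Y \<in> finite_rank_ops" shows "X + Y \<in> finite_rank_ops"
proof -
  obtain S S' where S: "finite S" "\<And>x. blinfun_apply X x \<in> cspan S"
    and S': "finite S'" "\<And>x. blinfun_apply Y x \<in> cspan S'"
    using finite_rank_D assms by meson
  have "cspan S \<subseteq> cspan (S \<union> S')" "cspan S' \<subseteq> cspan (S \<union> S')"
    by (auto intro!: complex_vs.span_mono)
  then have *: "blinfun_apply (X + Y) x \<in> cspan (S \<union> S')" for x
    unfolding blinfun.add_left using S(2) S'(2) by (intro complex_vs.span_add) blast+
  show ?thesis
    by (rule finite_rank_I [of _ "S \<union> S'"]) (simp_all add: * S S' assms bounded_ops_add)
qed

lemma finite_rank_0 [simp]: "0 \<in> finite_rank_ops"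
  by (rule finite_rank_I [of _ "{}"]) auto

lemma id_compose [simp]: "id_blinfun o\<^sub>L X = X" "X o\<^sub>L id_blinfun = X"
  by (auto intro: blinfun_eqI)

lemma compose_assoc: "(X o\<^sub>L Y) o\<^sub>L Z = X o\<^sub>L (Y o\<^sub>L Z)"
  by (rule blinfun_eqI) simp

lemmas compose_add_left = bounded_bilinear.add_left [OF bounded_bilinear_blinfun_compose]
  and compose_add_right = bounded_bilinear.add_right [OF bounded_bilinear_blinfun_compose]
  and compose_diff_left = bounded_bilinear.diff_left [OF bounded_bilinear_blinfun_compose]
  and compose_diff_right = bounded_bilinear.diff_right [OF bounded_bilinear_blinfun_compose]
  and compose_minus_left = bounded_bilinear.minus_left [OF bounded_bilinear_blinfun_compose]
  and compose_minus_right = bounded_bilinear.minus_right [OF bounded_bilinear_blinfun_compose]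
  and compose_zero_left = bounded_bilinear.zero_left [OF bounded_bilinear_blinfun_compose]
  and compose_zero_right = bounded_bilinear.zero_right [OF bounded_bilinear_blinfun_compose]
  and compose_sum_left = bounded_bilinear.sum_left [OF bounded_bilinear_blinfun_compose]
  and compose_sum_right = bounded_bilinear.sum_right [OF bounded_bilinear_blinfun_compose]

lemmas compose_algebra = compose_add_left compose_add_right compose_diff_left compose_diff_right
  compose_minus_left compose_minus_right

lemma finite_rank_scaleO: "X \<in> finite_rank_ops \<Longrightarrow> scaleO c X \<in> finite_rank_ops"
  using finite_rank_compose_right [of X "scaleO c id_blinfun"]
  by (simp add: scaleO_compose_left bounded_ops_scaleO)

lemma finite_rank_minus: "X \<in> finite_rank_ops \<Longrightarrow> - X \<in> finite_rank_ops"
  using finite_rank_scaleO [of X "-1"] scaleO_of_real [of "-1" X] by simp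

lemma finite_rank_diff: "X \<in> finite_rank_ops \<Longrightarrow> Y \<in> finite_rank_ops \<Longrightarrow> X - Y \<in> finite_rank_ops"
  using finite_rank_add [of X "-Y"] finite_rank_minus [of Y] by simp

lemma finite_rank_rank1 [simp]: "rank1 x y \<in> finite_rank_ops"
  by (rule finite_rank_I [of _ "{x}"]) (auto intro: complex_vs.span_scale complex_vs.span_base)

lemma finite_rank_sum: "(\<And>i. i \<in> A \<Longrightarrow> X i \<in> finite_rank_ops) \<Longrightarrow> (\<Sum>i\<in>A. X i) \<in> finite_rank_ops"
  by (induction A rule: infinite_finite_induct) (auto intro: finite_rank_add)

section \<open>Compact operators\<close>

lemma norm_blinfun_le_unit:
  assumes "\<And>x. norm x \<le> 1 \<Longrightarrow> norm (blinfun_apply X x) \<le> b"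
  shows "norm X \<le> b"
proof (rule norm_blinfun_bound)
  show "0 \<le> b" using assms [of 0] by (simp add: blinfun.zero_right)
  fix x
  show "norm (blinfun_apply X x) \<le> b * norm x"
  proof (cases "x = 0")
    case False
    have "norm (blinfun_apply X (inverse (norm x) *\<^sub>R x)) \<le> b"
      using False by (intro assms) simp
    then show ?thesis using False by (simp add: blinfun.scaleR_right field_simps)
  qed (simp add: blinfun.zero_right)
qed

lemma norm_compose_le: "norm X \<le> a \<Longrightarrow> norm Y \<le> b \<Longrightarrow> norm (X o\<^sub>L Y) \<le> a * b"
  by (meson mult_mono norm_blinfun_compose norm_ge_zero order_trans)

text \<open>Local compactness of finite-dimensional subspaces in the form needed below; the
  induction adds one compact disc of coefficients at a time.\<close>

lemma compact_coefficient_box: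
  fixes k :: nat
  shows "compact {(\<Sum>i<k. a i *\<^sub>C (u i :: 'h::complex_hilbert)) | a. \<forall>i<k. cmod (a i) \<le> M}"
proof (induction k)
  case 0 then show ?case by simp
next
  case (Suc k)
  let ?K = "\<lambda>k::nat. {(\<Sum>i<k. a i *\<^sub>C u i) | a. \<forall>i<k. cmod (a i) \<le> M}"
  have eq: "?K (Suc k) = (\<lambda>(y, c). y + c *\<^sub>C u k) ` (?K k \<times> cball 0 M)"
  proof (rule subset_antisym; rule subsetI)
    fix x assume "x \<in> ?K (Suc k)"
    then obtain a where a: "x = (\<Sum>i<Suc k. a i *\<^sub>C u i)" "\<forall>i<Suc k. cmod (a i) \<le> M" by blast
    have "(\<Sum>i<k. a i *\<^sub>C u i) \<in> ?K k" using a(2) by auto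
    moreover have "a k \<in> cball 0 M" using a(2) by simp
    ultimately show "x \<in> (\<lambda>(y, c). y + c *\<^sub>C u k) ` (?K k \<times> cball 0 M)"
      unfolding a(1) by (intro image_eqI [where x = "(\<Sum>i<k. a i *\<^sub>C u i, a k)"]) auto
  next
    fix x assume "x \<in> (\<lambda>(y, c). y + c *\<^sub>C u k) ` (?K k \<times> cball 0 M)"
    then obtain a c where "x = (\<Sum>i<k. a i *\<^sub>C u i) + c *\<^sub>C u k" "\<forall>i<k. cmod (a i) \<le> M" "cmod c \<le> M"
      by auto
    then show "x \<in> ?K (Suc k)"
      by (intro CollectI exI [of _ "a(k := c)"]) (auto simp: less_Suc_eq)
  qed
  have bl: "bounded_linear (\<lambda>c. c *\<^sub>C u k)"
  proof (rule bounded_linear_intro [where K = "norm (u k)"])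
    show "(r *\<^sub>R c) *\<^sub>C u k = r *\<^sub>R c *\<^sub>C u k" for r c
      by (simp add: scaleR_scaleC scaleC_scaleC scaleR_conv_of_real)
  qed (simp_all add: scaleC_add_left)
  have "continuous_on (?K k \<times> cball 0 M) (\<lambda>(y, c). y + c *\<^sub>C u k)"
    unfolding case_prod_beta
    by (intro continuous_intros bounded_linear.continuous_on [OF bl])
  then show ?case
    unfolding eq using Suc by (intro compact_continuous_image compact_Times compact_cball)
qed

lemma finite_rank_image_subset_compact:
  assumes "F \<in> finite_rank_ops"
  shows "\<exists>K. compact K \<and> blinfun_apply F ` cball 0 1 \<subseteq> K"
proof -
  obtain k u where u: "orthn k u" "oproj k u o\<^sub>L F = F"
    using assms finite_rank_iff_oproj by blast
  let ?K = "{(\<Sum>i<k. a i *\<^sub>C u i) | a. \<forall>i<k. cmod (a i) \<le> norm F}"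
  have "blinfun_apply F x \<in> ?K" if "norm x \<le> 1" for x
  proof -
    have "blinfun_apply F x = ocomp k u (blinfun_apply F x)"
      by (metis u(2) blinfun_apply_blinfun_compose oproj_apply)
    moreover have "cmod (cinner (blinfun_apply F x) (u i)) \<le> norm F" if "i < k" for i
    proof -
      have "cmod (cinner (blinfun_apply F x) (u i)) \<le> norm (blinfun_apply F x)"
        using cinner_bound [of "blinfun_apply F x" "u i"] orthn_norm [OF u(1) that] by simp
      also have "\<dots> \<le> norm F * norm x" by (rule norm_blinfun)
      also have "\<dots> \<le> norm F" using \<open>norm x \<le> 1\<close> by (simp add: mult_left_le)
      finally show ?thesis .
    qed
    ultimately show ?thesis unfolding ocomp_def
      by (intro CollectI exI [of _ "\<lambda>i. cinner (blinfun_apply F x) (u i)"]) simp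
  qed
  then show ?thesis using compact_coefficient_box [where k = k and u = u and M = "norm F"] by (intro exI [of _ ?K]) auto
qed

text \<open>Take a finite net of radius e for the image of the unit ball. The projection onto its
  span moves an image point by no more than its distance to the net.\<close>

lemma compact_op_approx:
  assumes X: "X \<in> compact_ops" and e: "e > 0"
  shows "\<exists>F\<in>finite_rank_ops. norm (X - F) \<le> e"
proof -
  have "\<exists>N. finite N \<and> closure (blinfun_apply X ` cball 0 1) \<subseteq> (\<Union>y\<in>N. ball y e)"
    using X e compact_eq_totally_bounded [of "closure (blinfun_apply X ` cball 0 1)"]
    unfolding compact_ops_def by blast
  then obtain N where N: "finite N" "closure (blinfun_apply X ` cball 0 1) \<subseteq> (\<Union>y\<in>N. ball y e)" by blast
  obtain k u where u: "orthn k u" "cspan (u ` {..<k}) = cspan N"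
    using gram_schmidt [OF N(1)] by metis
  have Xb: "X \<in> bounded_ops" using X by (simp add: compact_ops_def)
  have "norm (X - (oproj k u o\<^sub>L X)) \<le> e"
  proof (rule norm_blinfun_le_unit)
    fix x :: 'a assume "norm x \<le> 1"
    then have "blinfun_apply X x \<in> blinfun_apply X ` cball 0 1" by simp
    then have "blinfun_apply X x \<in> (\<Union>y\<in>N. ball y e)"
      using N(2) closure_subset [of "blinfun_apply X ` cball 0 1"] by blast
    then obtain y where y: "y \<in> N" "dist y (blinfun_apply X x) < e" by auto
    have "y \<in> cspan (u ` {..<k})" using y(1) u(2) complex_vs.span_base by auto
    then have "ocomp k u y = y" by (rule ocomp_span [OF u(1)])
    then have "blinfun_apply (X - (oproj k u o\<^sub>L X)) x
        = (blinfun_apply X x - y) - ocomp k u (blinfun_apply X x - y)"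
      by (simp add: blinfun.bilinear_simps flip: oproj_apply)
    also have "norm \<dots> \<le> norm (blinfun_apply X x - y)" by (rule norm_rest_le [OF u(1)])
    also have "\<dots> \<le> e" using y(2) by (simp add: dist_norm norm_minus_commute)
    finally show "norm (blinfun_apply (X - (oproj k u o\<^sub>L X)) x) \<le> e" .
  qed
  moreover have "oproj k u o\<^sub>L X \<in> finite_rank_ops" by (rule finite_rank_compose_left) (simp_all add: Xb)
  ultimately show ?thesis by blast
qed

text \<open>A finite net for the image under a close finite rank operator is a net for the image
  under X; closed balls of radius e/2 carry the covering over to the closure.\<close>

lemma compact_op_if_approx:
  assumes X: "X \<in> bounded_ops" and approx: "\<And>e. e > 0 \<Longrightarrow> \<exists>F\<in>finite_rank_ops. norm (X - F) \<le> e"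
  shows "X \<in> compact_ops"
proof -
  let ?S = "blinfun_apply X ` cball 0 1"
  have "\<exists>N. finite N \<and> closure ?S \<subseteq> (\<Union>y\<in>N. ball y e)" if e: "e > 0" for e
  proof -
    obtain F where F: "F \<in> finite_rank_ops" "norm (X - F) \<le> e / 4" using approx [of "e/4"] e by auto
    obtain K where K: "compact K" "blinfun_apply F ` cball 0 1 \<subseteq> K"
      using finite_rank_image_subset_compact [OF F(1)] by blast
    obtain N where N: "finite N" "K \<subseteq> (\<Union>y\<in>N. ball y (e/4))"
      using K(1) e compact_eq_totally_bounded [of K] by (metis zero_less_divide_iff zero_less_numeral)
    have "?S \<subseteq> (\<Union>y\<in>N. cball y (e/2))"
    proof
      fix z assume "z \<in> ?S"
      then obtain x where x: "norm x \<le> 1" "z = blinfun_apply X x" by auto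
      then have "blinfun_apply F x \<in> blinfun_apply F ` cball 0 1" by simp
      then have "blinfun_apply F x \<in> (\<Union>y\<in>N. ball y (e/4))" using K(2) N(2) by blast
      then obtain y where y: "y \<in> N" "dist y (blinfun_apply F x) < e/4" by auto
      have "norm (blinfun_apply (X - F) x) \<le> norm (X - F) * norm x" by (rule norm_blinfun)
      also have "\<dots> \<le> e/4 * 1" using F(2) x(1) e by (intro mult_mono) auto
      finally have "dist (blinfun_apply F x) z \<le> e/4"
        by (simp add: x(2) dist_norm blinfun.diff_left norm_minus_commute)
      then have "dist y z \<le> e/2" using y(2) dist_triangle [of y z "blinfun_apply F x"] by simp
      then show "z \<in> (\<Union>y\<in>N. cball y (e/2))" using y(1) by auto
    qed
    then have "closure ?S \<subseteq> (\<Union>y\<in>N. cball y (e/2))"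
      using N(1) by (intro closure_minimal closed_UN) auto
    also have "\<dots> \<subseteq> (\<Union>y\<in>N. ball y e)" using e by (intro UN_mono) auto
    finally show ?thesis using N(1) by blast
  qed
  then have "compact (closure ?S)"
    unfolding compact_eq_totally_bounded by (auto simp: complete_eq_closed)
  then show ?thesis using X by (simp add: compact_ops_def)
qed

text \<open>From here on compactness means approximability by finite rank operators; in this form
  the ideal properties are inherited from \<open>finite_rank_ops\<close>.\<close>

lemma compact_ops_iff:
  "X \<in> compact_ops \<longleftrightarrow> X \<in> bounded_ops \<and> (\<forall>e>0. \<exists>F\<in>finite_rank_ops. norm (X - F) \<le> e)"
  using compact_op_approx compact_op_if_approx by (auto simp: compact_ops_def)

lemma compact_ops_bounded [simp]: "X \<in> compact_ops \<Longrightarrow> X \<in> bounded_ops"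
  by (simp add: compact_ops_iff)

lemma finite_rank_compact [simp]: "X \<in> finite_rank_ops \<Longrightarrow> X \<in> compact_ops"
  unfolding compact_ops_iff by (auto intro!: bexI [of _ X])

lemma compact_ops_0 [simp]: "0 \<in> compact_ops" by simp

lemma compact_op_limit:
  assumes X: "X \<in> bounded_ops" and approx: "\<And>e. e > 0 \<Longrightarrow> \<exists>F\<in>compact_ops. norm (X - F) \<le> e"
  shows "X \<in> compact_ops"
proof (rule compact_op_if_approx [OF X])
  fix e :: real assume e: "e > 0"
  obtain F where F: "F \<in> compact_ops" "norm (X - F) \<le> e/2" using approx [of "e/2"] e by auto
  obtain G where G: "G \<in> finite_rank_ops" "norm (F - G) \<le> e/2"
    using compact_op_approx [OF F(1), of "e/2"] e by auto
  have "norm (X - G) \<le> e"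
    using norm_triangle_ineq [of "X - F" "F - G"] F G by simp
  then show "\<exists>F\<in>finite_rank_ops. norm (X - F) \<le> e" using G by blast
qed

lemma compact_ops_add:
  assumes "X \<in> compact_ops" "Y \<in> compact_ops" shows "X + Y \<in> compact_ops"
proof (rule compact_op_if_approx)
  show "X + Y \<in> bounded_ops" using assms by (simp add: bounded_ops_add)
  fix e :: real assume e: "e > 0"
  obtain F where F: "F \<in> finite_rank_ops" "norm (X - F) \<le> e/2" using compact_op_approx [OF assms(1), of "e/2"] e by auto
  obtain G where G: "G \<in> finite_rank_ops" "norm (Y - G) \<le> e/2" using compact_op_approx [OF assms(2), of "e/2"] e by auto
  have "norm (X + Y - (F + G)) \<le> e"
    using norm_triangle_ineq [of "X - F" "Y - G"] F G by (simp add: algebra_simps)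
  then show "\<exists>F\<in>finite_rank_ops. norm (X + Y - F) \<le> e" using finite_rank_add F G by blast
qed

lemma compact_ops_compose_left:
  assumes X: "X \<in> compact_ops" and Y: "Y \<in> bounded_ops" shows "X o\<^sub>L Y \<in> compact_ops"
proof (rule compact_op_if_approx)
  show "X o\<^sub>L Y \<in> bounded_ops" using assms by (simp add: bounded_ops_compose)
  fix e :: real assume e: "e > 0"
  have p: "e / (norm Y + 1) > 0" using e by (simp add: add_nonneg_pos)
  obtain F where F: "F \<in> finite_rank_ops" "norm (X - F) \<le> e / (norm Y + 1)"
    using compact_op_approx [OF X p] by auto
  have "norm ((X - F) o\<^sub>L Y) \<le> e / (norm Y + 1) * (norm Y + 1)"
    by (intro norm_compose_le F) simp
  also have "\<dots> = e" by (smt (verit) nonzero_eq_divide_eq norm_ge_zero)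
  finally have "norm ((X o\<^sub>L Y) - (F o\<^sub>L Y)) \<le> e" by (simp add: compose_diff_left)
  then show "\<exists>F\<in>finite_rank_ops. norm ((X o\<^sub>L Y) - F) \<le> e"
    using finite_rank_compose_left [OF F(1) Y] by blast
qed

lemma compact_ops_adj:
  assumes X: "X \<in> compact_ops" shows "adj_op X \<in> compact_ops"
proof (rule compact_op_if_approx)
  show "adj_op X \<in> bounded_ops" using assms by simp
  fix e :: real assume e: "e > 0"
  obtain F where F: "F \<in> finite_rank_ops" "norm (X - F) \<le> e"
    using compact_op_approx [OF X e] by auto
  have "norm (adj_op X - adj_op F) \<le> e"
    using F X by (simp add: bounded_ops_diff flip: adj_op_diff)
  then show "\<exists>F\<in>finite_rank_ops. norm (adj_op X - F) \<le> e"
    using finite_rank_adj [OF F(1)] by blast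
qed

lemma compact_ops_compose_right:
  assumes X: "X \<in> compact_ops" and Y: "Y \<in> bounded_ops" shows "Y o\<^sub>L X \<in> compact_ops"
proof -
  have "adj_op (adj_op X o\<^sub>L adj_op Y) \<in> compact_ops"
    by (intro compact_ops_adj compact_ops_compose_left) (simp_all add: X Y)
  then show ?thesis using X Y by (simp add: adj_op_compose)
qed

lemma compact_ops_scaleO: "X \<in> compact_ops \<Longrightarrow> scaleO c X \<in> compact_ops"
  using compact_ops_compose_right [of X "scaleO c id_blinfun"]
  by (simp add: scaleO_compose_left bounded_ops_scaleO)

lemma compact_ops_minus: "X \<in> compact_ops \<Longrightarrow> - X \<in> compact_ops"
  using compact_ops_scaleO [of X "-1"] scaleO_of_real [of "-1" X] by simp

lemma compact_ops_diff: "X \<in> compact_ops \<Longrightarrow> Y \<in> compact_ops \<Longrightarrow> X - Y \<in> compact_ops"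
  using compact_ops_add [of X "-Y"] compact_ops_minus [of Y] by simp

lemma compact_ops_sum: "(\<And>i. i \<in> A \<Longrightarrow> X i \<in> compact_ops) \<Longrightarrow> (\<Sum>i\<in>A. X i) \<in> compact_ops"
  by (induction A rule: infinite_finite_induct) (auto intro: compact_ops_add)


section \<open>The Schmidt decomposition\<close>

text \<open>Singular value data of X as one infinite orthonormal sequence, continued by kernel
  vectors once \<open>s\<close> has reached 0. The last clause replaces completeness of
  \<open>e\<close>: together with the convergence of \<open>s\<close> to 0 it forces X to vanish on
  the orthogonal complement of all \<open>e i\<close>.\<close>

definition schmidt :: "('h::complex_hilbert \<Rightarrow>\<^sub>L 'h) \<Rightarrow> (nat \<Rightarrow> 'h) \<Rightarrow> (nat \<Rightarrow> real) \<Rightarrow> bool" where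
  "schmidt X e s \<longleftrightarrow> (\<forall>k. orthn k e) \<and> (\<forall>i. s i = norm (blinfun_apply X (e i))) \<and>
     (\<forall>i. blinfun_apply (adj_op X) (blinfun_apply X (e i)) = (s i)\<^sup>2 *\<^sub>R e i) \<and> decseq s \<and> s \<longlonglongrightarrow> 0 \<and>
     (\<forall>m y. (\<forall>i<m. cinner y (e i) = 0) \<longrightarrow> norm (blinfun_apply X y) \<le> s m * norm y)"

locale infinite_dim =
  fixes H :: "'h::complex_hilbert itself"
  assumes infinite_dim: "\<nexists>S :: 'h set. finite S \<and> cspan S = UNIV"
begin

lemma orthogonal_unit_vector:
  assumes "orthn m e"
  shows "\<exists>v::'h. norm v = 1 \<and> (\<forall>i<m. cinner v (e i) = 0)"
proof -
  have "cspan (e ` {..<m}) \<noteq> UNIV" using infinite_dim by blast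
  then obtain x where x: "x \<notin> cspan (e ` {..<m})" by blast
  define w where "w = x - ocomp m e x"
  have "w \<noteq> 0" using x ocomp_in_span [of m e x] by (auto simp: w_def)
  then show ?thesis
    using cinner_ocomp_rest [OF assms, of _ x]
    by (intro exI [of _ "inverse (norm w) *\<^sub>R w"]) (auto simp: cinner_scaleR_left w_def)
qed

text \<open>The vector v maximizes \<open>norm (X y)\<close> over unit vectors orthogonal to the
  \<open>e i\<close>. Their complement is invariant under \<open>?P\<close>, the adjoint of X times
  X, because the \<open>e i\<close> are eigenvectors; compactness makes a maximizing sequence
  converge, and its limit is again an eigenvector.\<close>

lemma next_singular_vector:
  fixes X :: "'h \<Rightarrow>\<^sub>L 'h"
  assumes X: "X \<in> compact_ops" and e: "orthn m e"
    and eig: "\<And>i. i < m \<Longrightarrow> \<exists>c::real. blinfun_apply (adj_op X) (blinfun_apply X (e i)) = c *\<^sub>R e i"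
  shows "\<exists>v. norm v = 1 \<and> (\<forall>i<m. cinner v (e i) = 0) \<and>
    blinfun_apply (adj_op X) (blinfun_apply X v) = (norm (blinfun_apply X v))\<^sup>2 *\<^sub>R v \<and>
    (\<forall>y. (\<forall>i<m. cinner y (e i) = 0) \<longrightarrow> norm (blinfun_apply X y) \<le> norm (blinfun_apply X v) * norm y)"
proof -
  have Xb: "X \<in> bounded_ops" using X by simp
  define V where "V = {y. \<forall>i<m. cinner y (e i) = 0}"
  define N where "N = {norm (blinfun_apply X y) | y. y \<in> V \<and> norm y = 1}"
  define s where "s = Sup N"
  have Nne: "N \<noteq> {}" using orthogonal_unit_vector [OF e] by (auto simp: N_def V_def)
  have Nbdd: "bdd_above N"
  proof (rule bdd_aboveI)
    fix t assume "t \<in> N" then show "t \<le> norm X"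
      using norm_blinfun [of X] by (auto simp: N_def) (metis mult.right_neutral)
  qed
  have s_unit: "norm (blinfun_apply X y) \<le> s" if "y \<in> V" "norm y = 1" for y
    unfolding s_def by (rule cSup_upper [OF _ Nbdd]) (use that in \<open>auto simp: N_def\<close>)
  have s0: "s \<ge> 0"
  proof -
    obtain y where "y \<in> V" "norm y = 1" using Nne by (auto simp: N_def)
    then show ?thesis using s_unit [of y] norm_ge_zero order_trans by blast
  qed
  have s_le: "norm (blinfun_apply X y) \<le> s * norm y" if "y \<in> V" for y
  proof (cases "y = 0")
    case False
    have "inverse (norm y) *\<^sub>R y \<in> V" using that by (simp add: V_def cinner_scaleR_left)
    then have "norm (blinfun_apply X (inverse (norm y) *\<^sub>R y)) \<le> s" using False by (intro s_unit) auto
    then show ?thesis using False by (simp add: blinfun.scaleR_right field_simps)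
  qed (simp add: blinfun.zero_right)
  let ?P = "\<lambda>y. blinfun_apply (adj_op X) (blinfun_apply X y)"
  have PP: "cinner (?P y) z = cinner y (?P z)" for y z
    by (simp add: cinner_adj' [OF Xb] cinner_adj [OF Xb])
  have PV: "?P y \<in> V" if "y \<in> V" for y
    unfolding V_def
  proof (intro CollectI allI impI)
    fix i assume i: "i < m"
    then obtain c :: real where "?P (e i) = c *\<^sub>R e i" using eig by blast
    then show "cinner (?P y) (e i) = 0"
      unfolding PP using that i by (simp add: V_def cinner_scaleR_right)
  qed
  have P_le: "norm (?P y) \<le> s\<^sup>2 * norm y" if "y \<in> V" for y
  proof (cases "?P y = 0")
    case False
    have "(norm (?P y))\<^sup>2 = Re (cinner (blinfun_apply X y) (blinfun_apply X (?P y)))"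
      by (simp add: norm_sq_cinner cinner_adj' [OF Xb])
    also have "\<dots> \<le> norm (blinfun_apply X y) * norm (blinfun_apply X (?P y))"
      using cinner_bound complex_Re_le_cmod order_trans by blast
    also have "\<dots> \<le> (s * norm y) * (s * norm (?P y))"
      using s0 by (intro mult_mono s_le PV that) auto
    finally show ?thesis using False by (simp add: power2_eq_square mult_ac)
  qed (use s0 in simp)
  show ?thesis
  proof (cases "s = 0")
    case True
    obtain v where v: "norm v = 1" "v \<in> V" using Nne by (auto simp: N_def)
    have "blinfun_apply X v = 0" using s_le [OF v(2)] True by simp
    then show ?thesis
      using v s_le True by (intro exI [of _ v]) (auto simp: V_def blinfun.zero_right)
  next
    case False
    then have s: "s > 0" using s0 by simp
    have "\<exists>y\<in>V. norm y = 1 \<and> norm (blinfun_apply X y) > s - inverse (real (Suc n))" for n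
    proof -
      have "s - inverse (real (Suc n)) < Sup N" by (simp add: s_def)
      then show ?thesis using less_cSup_iff [OF Nne Nbdd] by (auto simp: N_def)
    qed
    then obtain Y where Y: "\<And>n. Y n \<in> V" "\<And>n. norm (Y n) = 1"
      "\<And>n. norm (blinfun_apply X (Y n)) > s - inverse (real (Suc n))" by metis
    have Ylim: "(\<lambda>n. norm (blinfun_apply X (Y n))) \<longlonglongrightarrow> s"
    proof (rule tendsto_sandwich)
      show "(\<lambda>n. s - inverse (real (Suc n))) \<longlonglongrightarrow> s"
        using LIMSEQ_inverse_real_of_nat_add_minus [of s] by simp
      show "\<forall>\<^sub>F n in sequentially. s - inverse (real (Suc n)) \<le> norm (blinfun_apply X (Y n))"
        using Y(3) by (intro always_eventually allI less_imp_le)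
      show "\<forall>\<^sub>F n in sequentially. norm (blinfun_apply X (Y n)) \<le> s"
        by (intro always_eventually allI s_unit Y)
    qed simp
    have cl: "seq_compact (closure (blinfun_apply X ` cball 0 1))"
      using X unfolding compact_ops_def compact_eq_seq_compact_metric by blast
    have mem: "blinfun_apply X (Y n) \<in> closure (blinfun_apply X ` cball 0 1)" for n
      using Y(2) [of n] closure_subset [of "blinfun_apply X ` cball 0 1"] by auto
    obtain z r where r: "strict_mono r" "((\<lambda>n. blinfun_apply X (Y n)) \<circ> r) \<longlonglongrightarrow> z"
      by (rule seq_compactE [OF cl, of "\<lambda>n. blinfun_apply X (Y n)"]) (use mem in blast)+
    then have r: "strict_mono r" "(\<lambda>n. blinfun_apply X (Y (r n))) \<longlonglongrightarrow> z"
      by (simp_all add: comp_def)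
    have PYlim: "(\<lambda>n. ?P (Y (r n))) \<longlonglongrightarrow> blinfun_apply (adj_op X) z"
      using r(2) by (rule blinfun.tendsto [OF tendsto_const])
    \<comment> \<open>Near-maximizers are near-eigenvectors: the cross term of the expanded square
      is a multiple of the squared norm of \<open>X (Y n)\<close>, which is close to the square of
      \<open>s\<close>.\<close>
    have bound: "(norm (?P (Y n) - s\<^sup>2 *\<^sub>R Y n))\<^sup>2 \<le> 2 * s\<^sup>2 * (s\<^sup>2 - (norm (blinfun_apply X (Y n)))\<^sup>2)" for n
    proof -
      have "norm (?P (Y n)) \<le> s\<^sup>2" using P_le [OF Y(1) [of n]] Y(2) by simp
      then have "(norm (?P (Y n)))\<^sup>2 \<le> (s\<^sup>2)\<^sup>2" by (rule power_mono) simp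
      moreover have "Re (cinner (?P (Y n)) (s\<^sup>2 *\<^sub>R Y n)) = s\<^sup>2 * (norm (blinfun_apply X (Y n)))\<^sup>2"
        by (simp add: cinner_scaleR_right cinner_adj' [OF Xb] norm_sq_cinner)
      moreover have "(norm (s\<^sup>2 *\<^sub>R Y n))\<^sup>2 = (s\<^sup>2)\<^sup>2" using Y(2) by simp
      moreover have "2 * s\<^sup>2 * (s\<^sup>2 - (norm (blinfun_apply X (Y n)))\<^sup>2)
          = (s\<^sup>2)\<^sup>2 + (s\<^sup>2)\<^sup>2 - 2 * (s\<^sup>2 * (norm (blinfun_apply X (Y n)))\<^sup>2)"
        by (simp add: power2_eq_square algebra_simps)
      ultimately show ?thesis unfolding norm_diff_sq by linarith
    qed
    have "(\<lambda>n. 2 * s\<^sup>2 * (s\<^sup>2 - (norm (blinfun_apply X (Y n)))\<^sup>2)) \<longlonglongrightarrow> 2 * s\<^sup>2 * (s\<^sup>2 - s\<^sup>2)"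
      by (intro tendsto_intros Ylim)
    then have lim0: "(\<lambda>n. 2 * s\<^sup>2 * (s\<^sup>2 - (norm (blinfun_apply X (Y n)))\<^sup>2)) \<longlonglongrightarrow> 0" by simp
    have "(\<lambda>n. (norm (?P (Y n) - s\<^sup>2 *\<^sub>R Y n))\<^sup>2) \<longlonglongrightarrow> 0"
    proof (rule tendsto_sandwich [OF _ _ tendsto_const lim0])
      show "\<forall>\<^sub>F n in sequentially. (norm (?P (Y n) - s\<^sup>2 *\<^sub>R Y n))\<^sup>2
          \<le> 2 * s\<^sup>2 * (s\<^sup>2 - (norm (blinfun_apply X (Y n)))\<^sup>2)"
        by (intro always_eventually allI bound)
    qed simp
    then have "(\<lambda>n. sqrt ((norm (?P (Y n) - s\<^sup>2 *\<^sub>R Y n))\<^sup>2)) \<longlonglongrightarrow> sqrt 0" by (rule tendsto_real_sqrt)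
    then have "(\<lambda>n. ?P (Y n) - s\<^sup>2 *\<^sub>R Y n) \<longlonglongrightarrow> 0" by (simp add: tendsto_norm_zero_iff)
    then have d0: "(\<lambda>n. ?P (Y (r n)) - s\<^sup>2 *\<^sub>R Y (r n)) \<longlonglongrightarrow> 0"
      using LIMSEQ_subseq_LIMSEQ [OF _ r(1)] unfolding comp_def by blast
    \<comment> \<open>Compactness only makes the images under X converge along \<open>r\<close>. As
      \<open>?P (Y n)\<close> approaches \<open>s\<^sup>2 *\<^sub>R Y n\<close> and
      \<open>s > 0\<close>, dividing by the square of \<open>s\<close> recovers a limit of the
      vectors themselves.\<close>
    define v where "v = inverse (s\<^sup>2) *\<^sub>R blinfun_apply (adj_op X) z"
    have "(\<lambda>n. inverse (s\<^sup>2) *\<^sub>R (?P (Y (r n)) - (?P (Y (r n)) - s\<^sup>2 *\<^sub>R Y (r n))))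
        \<longlonglongrightarrow> inverse (s\<^sup>2) *\<^sub>R (blinfun_apply (adj_op X) z - 0)"
      by (intro tendsto_intros PYlim d0)
    then have Yv: "(\<lambda>n. Y (r n)) \<longlonglongrightarrow> v" using s by (simp add: v_def)
    have nv: "norm v = 1"
      using tendsto_norm [OF Yv] Y(2) by (simp add: LIMSEQ_const_iff)
    have vV: "v \<in> V"
      unfolding V_def
    proof (intro CollectI allI impI)
      fix i assume i: "i < m"
      have "(\<lambda>n. cinner (Y (r n)) (e i)) \<longlonglongrightarrow> cinner v (e i)"
        by (intro bounded_bilinear.tendsto [OF bounded_bilinear_cinner] Yv tendsto_const)
      then show "cinner v (e i) = 0" using Y(1) i by (simp add: V_def LIMSEQ_const_iff)
    qed
    have "(\<lambda>n. ?P (Y (r n)) - s\<^sup>2 *\<^sub>R Y (r n)) \<longlonglongrightarrow> ?P v - s\<^sup>2 *\<^sub>R v"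
      by (intro tendsto_intros Yv)
    from LIMSEQ_unique [OF this d0] have Pv: "?P v = s\<^sup>2 *\<^sub>R v" by simp
    have "(norm (blinfun_apply X v))\<^sup>2 = Re (cinner (?P v) v)"
      by (simp add: cinner_adj' [OF Xb] norm_sq_cinner)
    also have "\<dots> = s\<^sup>2" using nv by (simp add: Pv cinner_scaleR_left cinner_self)
    finally have "norm (blinfun_apply X v) = s" using s0 by (simp add: power2_eq_iff_nonneg)
    then show ?thesis
      using nv vV Pv s_le by (intro exI [of _ v]) (auto simp: V_def)
  qed
qed

end

context infinite_dim
begin

text \<open>By Bessel each coefficient \<open>cinner (e i) w\<close> tends to 0, and a finite rank
  operator depends on finitely many such coefficients.\<close>

lemma finite_rank_orthonormal_tendsto:
  fixes F :: "'h \<Rightarrow>\<^sub>L 'h"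
  assumes F: "F \<in> finite_rank_ops" and e: "\<And>k. orthn k e"
  shows "(\<lambda>i. blinfun_apply F (e i)) \<longlonglongrightarrow> 0"
proof -
  obtain k u where u: "orthn k u" "oproj k u o\<^sub>L F = F"
    using F finite_rank_iff_oproj by blast
  have Fb: "F \<in> bounded_ops" using F by simp
  have lim: "(\<lambda>i. cinner (e i) w) \<longlonglongrightarrow> 0" for w
  proof -
    have "summable (\<lambda>i. (cmod (cinner (e i) w))\<^sup>2)"
    proof (rule bounded_imp_summable [where B = "(norm w)\<^sup>2"])
      show "(\<Sum>i\<le>n. (cmod (cinner (e i) w))\<^sup>2) \<le> (norm w)\<^sup>2" for n
        using bessel' [OF e [of "Suc n"], of w] by (simp only: lessThan_Suc_atMost)
    qed simp
    then have "(\<lambda>i. (cmod (cinner (e i) w))\<^sup>2) \<longlonglongrightarrow> 0" by (rule summable_LIMSEQ_zero)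
    then have "(\<lambda>i. sqrt ((cmod (cinner (e i) w))\<^sup>2)) \<longlonglongrightarrow> sqrt 0" by (rule tendsto_real_sqrt)
    then show ?thesis by (simp add: tendsto_norm_zero_iff)
  qed
  have eq: "blinfun_apply F (e i) = (\<Sum>j<k. cinner (e i) (blinfun_apply (adj_op F) (u j)) *\<^sub>C u j)" for i
  proof -
    have "blinfun_apply F (e i) = ocomp k u (blinfun_apply F (e i))"
      by (metis u(2) blinfun_apply_blinfun_compose oproj_apply)
    then show ?thesis by (simp add: ocomp_def cinner_adj [OF Fb])
  qed
  have "(\<lambda>i. \<Sum>j<k. cinner (e i) (blinfun_apply (adj_op F) (u j)) *\<^sub>C u j) \<longlonglongrightarrow> (\<Sum>j<k. 0)"
  proof (intro tendsto_sum)
    fix j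
    have "(\<lambda>i. cmod (cinner (e i) (blinfun_apply (adj_op F) (u j))) * norm (u j)) \<longlonglongrightarrow> 0 * norm (u j)"
      by (intro tendsto_mult tendsto_const tendsto_norm_zero lim)
    then have "(\<lambda>i. norm (cinner (e i) (blinfun_apply (adj_op F) (u j)) *\<^sub>C u j)) \<longlonglongrightarrow> 0"
      by (simp only: norm_scaleC mult_zero_left)
    then show "(\<lambda>i. cinner (e i) (blinfun_apply (adj_op F) (u j)) *\<^sub>C u j) \<longlonglongrightarrow> 0"
      by (rule tendsto_norm_zero_cancel)
  qed
  then show ?thesis unfolding eq by simp
qed

theorem schmidt_exists:
  fixes X :: "'h \<Rightarrow>\<^sub>L 'h"
  assumes X: "X \<in> compact_ops"
  shows "\<exists>e s. schmidt X e s"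
proof -
  let ?P = "\<lambda>y. blinfun_apply (adj_op X) (blinfun_apply X y)"
  define good where "good = (\<lambda>(u :: nat \<Rightarrow> 'h) i. ?P (u i) = (norm (blinfun_apply X (u i)))\<^sup>2 *\<^sub>R u i \<and>
    (\<forall>y. (\<forall>j<i. cinner y (u j) = 0) \<longrightarrow> norm (blinfun_apply X y) \<le> norm (blinfun_apply X (u i)) * norm y))"
  \<comment> \<open>Stage n settles the first n vectors and later stages keep them, so the diagonal
    of the stages is one infinite sequence.\<close>
  have "\<exists>f. \<forall>n. (orthn n (f n) \<and> (\<forall>i<n. good (f n) i)) \<and> (\<forall>i<n. f (Suc n) i = f n i)"
  proof (rule dependent_nat_choice)
    show "\<exists>u :: nat \<Rightarrow> 'h. orthn 0 u \<and> (\<forall>i<0. good u i)" by simp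
    fix u :: "nat \<Rightarrow> 'h" and n assume u: "orthn n u \<and> (\<forall>i<n. good u i)"
    then have un: "orthn n u" and gu: "\<And>i. i < n \<Longrightarrow> good u i" by auto
    have "\<exists>c::real. ?P (u i) = c *\<^sub>R u i" if "i < n" for i
      using gu [OF that] unfolding good_def by blast
    note next_singular_vector [OF X un this]
    then obtain v where v: "norm v = 1" "\<And>i. i < n \<Longrightarrow> cinner v (u i) = 0"
      "?P v = (norm (blinfun_apply X v))\<^sup>2 *\<^sub>R v"
      "\<And>y. (\<forall>i<n. cinner y (u i) = 0) \<Longrightarrow> norm (blinfun_apply X y) \<le> norm (blinfun_apply X v) * norm y"
      by blast
    have v': "cinner (u i) v = 0" if "i < n" for i using v(2) [OF that] by (subst cinner_commute) simp
    have "orthn (Suc n) (u(n := v))"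
      unfolding orthn_def using un v(1,2) v' cinner_self [of v] by (auto simp: less_Suc_eq orthnD)
    moreover have "good (u(n := v)) i" if "i < Suc n" for i
    proof (cases "i = n")
      case True
      then show ?thesis using v(3,4) by (simp add: good_def)
    next
      case False
      then show ?thesis using gu [of i] that by (auto simp: good_def)
    qed
    ultimately show "\<exists>u'. (orthn (Suc n) u' \<and> (\<forall>i<Suc n. good u' i)) \<and> (\<forall>i<n. u' i = u i)"
      by (intro exI [of _ "u(n := v)"]) simp
  qed
  then obtain f where F: "\<forall>n. (orthn n (f n) \<and> (\<forall>i<n. good (f n) i)) \<and> (\<forall>i<n. f (Suc n) i = f n i)"
    by (elim exE) (rule that)
  have f: "orthn n (f n)" "i < n \<Longrightarrow> good (f n) i" "i < n \<Longrightarrow> f (Suc n) i = f n i" for n i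
    using F by blast+
  define e where "e = (\<lambda>n. f (Suc n) n)"
  have fe: "f n i = e i" if "i < n" for n i
    using that
  proof (induction n)
    case (Suc n) then show ?case by (cases "i = n") (auto simp: e_def f(3))
  qed simp
  have o: "orthn k e" for k using f(1) [of k] fe by (auto simp: orthn_def)
  have g: "good e i" for i
    using f(2) [of i "Suc i"] fe [of _ "Suc i"] by (simp add: good_def)
  define s where "s = (\<lambda>i. norm (blinfun_apply X (e i)))"
  have dec: "decseq s"
  proof (rule decseq_SucI)
    fix i
    have "\<forall>j<i. cinner (e (Suc i)) (e j) = 0" using orthnD [OF o [of "Suc (Suc i)"]] by auto
    then have "s (Suc i) \<le> s i * norm (e (Suc i))" using g [of i] by (auto simp: s_def good_def)
    then show "s (Suc i) \<le> s i" using orthn_norm [OF o [of "Suc (Suc i)"], of "Suc i"] by simp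
  qed
  have lim: "s \<longlonglongrightarrow> 0"
  proof (rule LIMSEQ_I)
    fix d :: real assume d: "d > 0"
    obtain F where F: "F \<in> finite_rank_ops" "norm (X - F) \<le> d/2"
      using compact_op_approx [OF X, of "d/2"] d by auto
    obtain M where M: "\<And>i. i \<ge> M \<Longrightarrow> norm (blinfun_apply F (e i)) < d/2"
      using LIMSEQ_D [OF finite_rank_orthonormal_tendsto [OF F(1) o], of "d/2"] d by auto
    have "norm (s i - 0) < d" if "i \<ge> M" for i
    proof -
      have "norm (blinfun_apply (X - F) (e i)) \<le> norm (X - F) * norm (e i)" by (rule norm_blinfun)
      also have "norm (e i) = 1" using orthn_norm [OF o [of "Suc i"]] by simp
      finally have "norm (blinfun_apply X (e i) - blinfun_apply F (e i)) \<le> d/2"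
        using F(2) by (simp add: blinfun.diff_left)
      then show ?thesis
        using norm_triangle_ineq [of "blinfun_apply X (e i) - blinfun_apply F (e i)" "blinfun_apply F (e i)"] M [OF that]
        by (simp add: s_def)
    qed
    then show "\<exists>no. \<forall>n\<ge>no. norm (s n - 0) < d" by blast
  qed
  show ?thesis
    unfolding schmidt_def using o g [unfolded good_def] dec lim by (intro exI [of _ e] exI [of _ s]) (simp add: s_def)
qed

end

lemma schmidtD:
  assumes "schmidt X e s"
  shows "orthn k e" "s i = norm (blinfun_apply X (e i))" "s i \<ge> 0"
    "blinfun_apply (adj_op X) (blinfun_apply X (e i)) = (s i)\<^sup>2 *\<^sub>R e i" "decseq s" "s \<longlonglongrightarrow> 0"
    "(\<And>i. i < m \<Longrightarrow> cinner y (e i) = 0) \<Longrightarrow> norm (blinfun_apply X y) \<le> s m * norm y"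
    "cinner (e i) (e j) = (if i = j then 1 else 0)"
  using assms orthnD [of "Suc (max i j)" e i j] unfolding schmidt_def by (simp_all only: less_Suc_eq_le) auto

lemma schmidt_antimono: "schmidt X e s \<Longrightarrow> i \<le> j \<Longrightarrow> s j \<le> s i"
  using schmidtD(5) [of X e s] by (auto simp: decseq_def)

lemma schmidt_tail:
  assumes "schmidt X e s"
  shows "norm (blinfun_apply X (x - ocomp m e x)) \<le> s m * norm x"
proof -
  have "norm (blinfun_apply X (x - ocomp m e x)) \<le> s m * norm (x - ocomp m e x)"
    using cinner_ocomp_rest [OF schmidtD(1) [OF assms]] by (intro schmidtD(7) [OF assms]) blast
  also have "\<dots> \<le> s m * norm x"
    using schmidtD(1,3) [OF assms] by (intro mult_left_mono norm_rest_le) auto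
  finally show ?thesis .
qed

lemma schmidt_expansion:
  assumes "schmidt X e s"
  shows "(\<lambda>m. blinfun_apply X (ocomp m e x)) \<longlonglongrightarrow> blinfun_apply X x"
proof -
  have lim: "(\<lambda>m. s m * norm x) \<longlonglongrightarrow> 0"
    using tendsto_mult_left_zero [OF schmidtD(6) [OF assms]] .
  have "(\<lambda>m. blinfun_apply X (x - ocomp m e x)) \<longlonglongrightarrow> 0"
    by (rule Lim_null_comparison [OF _ lim]) (intro always_eventually allI schmidt_tail [OF assms])
  then have "(\<lambda>m. blinfun_apply X x - blinfun_apply X (x - ocomp m e x)) \<longlonglongrightarrow> blinfun_apply X x - 0"
    by (intro tendsto_intros)
  then show ?thesis by (simp add: blinfun.diff_right)
qed


subsection \<open>The modulus\<close>

text \<open>Polarization of the real-valued quadratic form, evaluated at x + y and x + i y.\<close>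

lemma positive_op_hermitian:
  assumes B: "positive_op B"
  shows "cinner (blinfun_apply B x) y = cinner x (blinfun_apply B y)"
proof -
  have Bb: "B \<in> bounded_ops" using B by (simp add: positive_op_def)
  have im: "Im (cinner (blinfun_apply B z) z) = 0" for z
    using B by (auto simp: positive_op_def complex_nonneg_Reals_iff)
  have 1: "Im (cinner (blinfun_apply B x) y) + Im (cinner (blinfun_apply B y) x) = 0"
    using im [of "x + y"] im [of x] im [of y] by (simp add: blinfun.add_right cinner_algebra)
  have 2: "Re (cinner (blinfun_apply B x) y) = Re (cinner (blinfun_apply B y) x)"
    using im [of "x + \<i> *\<^sub>C y"] im [of x] im [of y]
    by (simp add: blinfun.add_right cinner_algebra bounded_opsD [OF Bb])
  have "cinner (blinfun_apply B x) y = cnj (cinner (blinfun_apply B y) x)"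
    using 1 2 by (intro complex_eqI) auto
  then show ?thesis by (metis cinner_commute)
qed

text \<open>Factor the equation as (B + s)(B - s) v = 0. For s > 0 a nonzero vector (B - s) v would
  belong to the eigenvalue - s, which positivity excludes.\<close>

lemma positive_op_eigen_sqrt:
  assumes B: "positive_op B" and s: "s \<ge> 0" and eig: "blinfun_apply B (blinfun_apply B v) = s\<^sup>2 *\<^sub>R v"
  shows "blinfun_apply B v = s *\<^sub>R v"
proof (cases "s = 0")
  case True
  have "complex_of_real ((norm (blinfun_apply B v))\<^sup>2) = cinner (blinfun_apply B (blinfun_apply B v)) v"
    by (simp only: cinner_self [symmetric] positive_op_hermitian [OF B])
  then show ?thesis using True eig by simp
next
  case False
  define y where "y = blinfun_apply B v - s *\<^sub>R v"
  have "blinfun_apply B y = - s *\<^sub>R y"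
    by (simp add: y_def blinfun.diff_right blinfun.scaleR_right eig power2_eq_square algebra_simps)
  then have "cinner (blinfun_apply B y) y = complex_of_real (- s * (norm y)\<^sup>2)"
    by (simp add: cinner_minus_left cinner_scaleR_left cinner_self)
  moreover have "cinner (blinfun_apply B y) y \<in> \<real>\<^sub>\<ge>\<^sub>0" using B by (simp add: positive_op_def)
  ultimately have "- s * (norm y)\<^sup>2 \<ge> 0" by (simp only: nonneg_Reals_of_real_iff)
  then have "y = 0" using s False by (simp add: mult_le_0_iff)
  then show ?thesis by (simp add: y_def)
qed

text \<open>The partial sums \<open>Q m\<close> of the diagonal operator with entries
  \<open>s i\<close> are Cauchy in operator norm, because the part beyond m has norm at most
  \<open>s m\<close>.\<close>

lemma schmidt_modulus_exists:
  fixes X :: "'h::complex_hilbert \<Rightarrow>\<^sub>L 'h"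
  assumes X: "X \<in> bounded_ops" and sch: "schmidt X e s"
  shows "\<exists>P. positive_op P \<and> P o\<^sub>L P = adj_op X o\<^sub>L X \<and> (\<forall>x. (\<lambda>m. \<Sum>i<m. (s i * cinner x (e i)) *\<^sub>C e i) \<longlonglongrightarrow> blinfun_apply P x)"
proof -
  define Q where "Q = (\<lambda>m. \<Sum>i<m. s i *\<^sub>R rank1 (e i) (e i))"
  have Q_apply: "blinfun_apply (Q m) x = (\<Sum>i<m. (s i * cinner x (e i)) *\<^sub>C e i)" for m x
    by (simp add: Q_def blinfun.sum_left blinfun.scaleR_left scaleR_scaleC scaleC_scaleC)
  have Qb: "Q m \<in> bounded_ops" for m
    unfolding Q_def by (intro bounded_ops_sum bounded_ops_scaleR rank1_in)
  have Qdiff: "norm (Q n - Q m) \<le> s m" if "m \<le> n" for m n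
  proof (rule norm_blinfun_bound [OF schmidtD(3) [OF sch]])
    fix x
    define a where "a = (\<lambda>i. if m \<le> i then s i * cinner x (e i) else 0)"
    have "blinfun_apply (Q n - Q m) x = (\<Sum>i<n. a i *\<^sub>C e i)"
    proof -
      have "(\<Sum>i<m. (s i * cinner x (e i)) *\<^sub>C e i) + (\<Sum>i<n. a i *\<^sub>C e i) = (\<Sum>i<n. (s i * cinner x (e i)) *\<^sub>C e i)"
      proof -
        have "(\<Sum>i<m. (s i * cinner x (e i)) *\<^sub>C e i) = (\<Sum>i<n. if i < m then (s i * cinner x (e i)) *\<^sub>C e i else 0)"
          using that by (intro sum.mono_neutral_cong_left) auto
        then show ?thesis by (simp add: a_def flip: sum.distrib) (intro sum.cong, auto)
      qed
      then show ?thesis by (simp add: blinfun.diff_left Q_apply algebra_simps)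
    qed
    then have "(norm (blinfun_apply (Q n - Q m) x))\<^sup>2 = (\<Sum>i<n. (cmod (a i))\<^sup>2)"
      using norm_orthn_sum [OF schmidtD(1) [OF sch]] by simp
    also have "\<dots> \<le> (\<Sum>i<n. (s m)\<^sup>2 * (cmod (cinner x (e i)))\<^sup>2)"
    proof (rule sum_mono)
      fix i
      show "(cmod (a i))\<^sup>2 \<le> (s m)\<^sup>2 * (cmod (cinner x (e i)))\<^sup>2"
        using schmidt_antimono [OF sch, of m i] schmidtD(3) [OF sch, of i]
        by (auto simp: a_def norm_mult power_mult_distrib intro!: mult_right_mono power_mono)
    qed
    also have "\<dots> = (s m)\<^sup>2 * (\<Sum>i<n. (cmod (cinner x (e i)))\<^sup>2)" by (simp add: sum_distrib_left)
    also have "\<dots> \<le> (s m)\<^sup>2 * (norm x)\<^sup>2" by (intro mult_left_mono bessel schmidtD(1) [OF sch]) auto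
    finally have "(norm (blinfun_apply (Q n - Q m) x))\<^sup>2 \<le> (s m * norm x)\<^sup>2" by (simp add: power_mult_distrib)
    then show "norm (blinfun_apply (Q n - Q m) x) \<le> s m * norm x"
      by (rule power2_le_imp_le) (simp add: schmidtD(3) [OF sch])
  qed
  have "Cauchy Q"
  proof (rule metric_CauchyI)
    fix d :: real assume d: "d > 0"
    obtain M where N: "\<And>n. n \<ge> M \<Longrightarrow> norm (s n - 0) < d/2"
      using LIMSEQ_D [OF schmidtD(6) [OF sch], of "d/2"] d by auto
    have M: "s M < d/2" using N [of M] by simp
    have "dist (Q i) (Q j) < d" if "i \<ge> M" "j \<ge> M" for i j
    proof -
      have "dist (Q i) (Q j) \<le> dist (Q i) (Q M) + dist (Q j) (Q M)" by (rule dist_triangle2)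
      also have "\<dots> \<le> s M + s M" unfolding dist_norm by (intro add_mono Qdiff that)
      finally show ?thesis using M by simp
    qed
    then show "\<exists>M. \<forall>i\<ge>M. \<forall>j\<ge>M. dist (Q i) (Q j) < d" by blast
  qed
  then obtain P where P: "Q \<longlonglongrightarrow> P" using Cauchy_convergent_iff convergent_def by blast
  have Pb: "P \<in> bounded_ops"
    using closed_sequentially [OF closed_bounded_ops _ P] Qb by blast
  have Pap: "(\<lambda>m. blinfun_apply (Q m) x) \<longlonglongrightarrow> blinfun_apply P x" for x
    by (intro blinfun.tendsto P tendsto_const)
  have pos: "cinner (blinfun_apply P x) x \<in> \<real>\<^sub>\<ge>\<^sub>0" for x
  proof (rule closed_sequentially [OF closed_nonneg_Reals_complex])
    show "(\<lambda>m. cinner (blinfun_apply (Q m) x) x) \<longlonglongrightarrow> cinner (blinfun_apply P x) x"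
      by (intro bounded_bilinear.tendsto [OF bounded_bilinear_cinner] Pap tendsto_const)
    have "cinner (blinfun_apply (Q m) x) x = complex_of_real (\<Sum>i<m. s i * (cmod (cinner x (e i)))\<^sup>2)" for m
      unfolding Q_apply cinner_sum_left cinner_scaleC_left of_real_sum of_real_mult
      by (intro sum.cong refl) (metis cinner_commute complex_norm_square mult.assoc)
    moreover have "(\<Sum>i<m. s i * (cmod (cinner x (e i)))\<^sup>2) \<ge> 0" for m
      by (intro sum_nonneg mult_nonneg_nonneg schmidtD(3) [OF sch]) simp
    ultimately show "cinner (blinfun_apply (Q m) x) x \<in> \<real>\<^sub>\<ge>\<^sub>0" for m
      by (simp only: nonneg_Reals_of_real_iff)
  qed
  have Pe: "blinfun_apply P (e j) = s j *\<^sub>R e j" for j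
  proof -
    have "blinfun_apply (Q m) (e j) = s j *\<^sub>R e j" if "m > j" for m
      unfolding Q_apply schmidtD(8) [OF sch]
      using that by (simp add: if_distrib [of "\<lambda>c. c *\<^sub>C _"] scaleR_scaleC if_distrib [of "(*) _"] cong: if_cong)
    then have "\<forall>\<^sub>F m in sequentially. blinfun_apply (Q m) (e j) = s j *\<^sub>R e j"
      by (intro eventually_sequentiallyI [of "Suc j"]) auto
    then have "(\<lambda>m. blinfun_apply (Q m) (e j)) \<longlonglongrightarrow> s j *\<^sub>R e j" by (rule tendsto_eventually)
    then show ?thesis using LIMSEQ_unique Pap by blast
  qed
  have "P o\<^sub>L P = adj_op X o\<^sub>L X"
  proof (rule blinfun_eqI)
    fix x
    have "blinfun_apply P (blinfun_apply (Q m) x) = blinfun_apply (adj_op X) (blinfun_apply X (ocomp m e x))" for m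
      unfolding Q_apply ocomp_def blinfun.sum_right bounded_opsD [OF Pb] bounded_opsD [OF X] bounded_opsD [OF adj_op_in [OF X]]
        Pe schmidtD(4) [OF sch]
      by (intro sum.cong refl) (simp add: scaleR_scaleC scaleC_scaleC power2_eq_square mult_ac)
    moreover have "(\<lambda>m. blinfun_apply P (blinfun_apply (Q m) x)) \<longlonglongrightarrow> blinfun_apply P (blinfun_apply P x)"
      by (intro blinfun.tendsto Pap tendsto_const)
    moreover have "(\<lambda>m. blinfun_apply (adj_op X) (blinfun_apply X (ocomp m e x)))
        \<longlonglongrightarrow> blinfun_apply (adj_op X) (blinfun_apply X x)"
      by (intro blinfun.tendsto tendsto_const schmidt_expansion [OF sch])
    ultimately show "blinfun_apply (P o\<^sub>L P) x = blinfun_apply (adj_op X o\<^sub>L X) x"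
      using LIMSEQ_unique by (metis (no_types, lifting) blinfun_apply_blinfun_compose ext)
  qed
  moreover have "positive_op P" unfolding positive_op_def using Pb pos by blast
  moreover have "(\<lambda>m. \<Sum>i<m. (s i * cinner x (e i)) *\<^sub>C e i) \<longlonglongrightarrow> blinfun_apply P x" for x
    using Pap [of x] by (simp only: Q_apply)
  ultimately show ?thesis by blast
qed

lemma norm_modulus:
  assumes B: "positive_op B" and BB: "B o\<^sub>L B = adj_op X o\<^sub>L X" and X: "X \<in> bounded_ops"
  shows "norm (blinfun_apply B x) = norm (blinfun_apply X x)"
proof -
  have eq: "blinfun_apply B (blinfun_apply B x) = blinfun_apply (adj_op X) (blinfun_apply X x)"
    by (metis BB blinfun_apply_blinfun_compose)
  have "cinner (blinfun_apply B x) (blinfun_apply B x) = cinner (blinfun_apply X x) (blinfun_apply X x)"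
    by (simp add: positive_op_hermitian [OF B] eq cinner_adj [OF X])
  then have "(norm (blinfun_apply B x))\<^sup>2 = (norm (blinfun_apply X x))\<^sup>2"
    by (simp only: norm_sq_cinner)
  then show ?thesis by simp
qed

text \<open>Any positive square root B of the adjoint of X times X has this expansion: it acts on
  \<open>e i\<close> as \<open>s i\<close>, and \<open>norm (B x) = norm (X x)\<close> controls the
  tail. Uniqueness of the root follows, as the definite description \<open>abs_op\<close>
  requires.\<close>

lemma modulus_expansion:
  assumes B: "positive_op B" and BB: "B o\<^sub>L B = adj_op X o\<^sub>L X" and X: "X \<in> bounded_ops"
    and sch: "schmidt X e s"
  shows "(\<lambda>m. \<Sum>i<m. (s i * cinner x (e i)) *\<^sub>C e i) \<longlonglongrightarrow> blinfun_apply B x"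
proof -
  have Bb: "B \<in> bounded_ops" using B by (simp add: positive_op_def)
  have BBap: "blinfun_apply B (blinfun_apply B v) = blinfun_apply (adj_op X) (blinfun_apply X v)" for v
    by (metis BB blinfun_apply_blinfun_compose)
  have Be: "blinfun_apply B (e i) = s i *\<^sub>R e i" for i
    by (rule positive_op_eigen_sqrt [OF B schmidtD(3) [OF sch]]) (simp only: BBap schmidtD(4) [OF sch])
  have lim: "(\<lambda>m. s m * norm x) \<longlonglongrightarrow> 0"
    using tendsto_mult_left_zero [OF schmidtD(6) [OF sch]] .
  have "(\<lambda>m. blinfun_apply B (x - ocomp m e x)) \<longlonglongrightarrow> 0"
  proof (rule Lim_null_comparison [OF _ lim], intro always_eventually allI)
    show "norm (blinfun_apply B (x - ocomp m e x)) \<le> s m * norm x" for m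
      unfolding norm_modulus [OF B BB X] by (rule schmidt_tail [OF sch])
  qed
  then have "(\<lambda>m. blinfun_apply B x - blinfun_apply B (x - ocomp m e x)) \<longlonglongrightarrow> blinfun_apply B x - 0"
    by (intro tendsto_intros)
  moreover have "blinfun_apply B x - blinfun_apply B (x - ocomp m e x) = (\<Sum>i<m. (s i * cinner x (e i)) *\<^sub>C e i)" for m
    by (simp add: blinfun.diff_right ocomp_def blinfun.sum_right bounded_opsD [OF Bb] Be
        scaleR_scaleC scaleC_scaleC mult.commute)
  ultimately show ?thesis by simp
qed

lemma abs_op_expansion:
  assumes X: "X \<in> bounded_ops" and sch: "schmidt X e s"
  shows "positive_op (abs_op X)" "abs_op X o\<^sub>L abs_op X = adj_op X o\<^sub>L X"
    "(\<lambda>m. \<Sum>i<m. (s i * cinner x (e i)) *\<^sub>C e i) \<longlonglongrightarrow> blinfun_apply (abs_op X) x"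
proof -
  obtain P where P: "positive_op P" "P o\<^sub>L P = adj_op X o\<^sub>L X"
    using schmidt_modulus_exists [OF X sch] by blast
  have "\<exists>!P. positive_op P \<and> P o\<^sub>L P = adj_op X o\<^sub>L X"
  proof (rule ex1I [of _ P])
    fix B assume B: "positive_op B \<and> B o\<^sub>L B = adj_op X o\<^sub>L X"
    show "B = P"
    proof (rule blinfun_eqI)
      fix x
      show "blinfun_apply B x = blinfun_apply P x"
        using modulus_expansion [OF P X sch, of x] modulus_expansion [OF conjunct1 [OF B] conjunct2 [OF B] X sch, of x]
        by (rule LIMSEQ_unique [symmetric])
    qed
  qed (use P in simp)
  from theI' [OF this] show *: "positive_op (abs_op X)" "abs_op X o\<^sub>L abs_op X = adj_op X o\<^sub>L X"
    unfolding abs_op_def by auto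
  show "(\<lambda>m. \<Sum>i<m. (s i * cinner x (e i)) *\<^sub>C e i) \<longlonglongrightarrow> blinfun_apply (abs_op X) x"
    by (rule modulus_expansion [OF * X sch])
qed

section \<open>Singular numbers from eigenvalue multiplicities\<close>

lemma finite_level_set:
  assumes "s \<longlonglongrightarrow> (0::real)" "r > 0" shows "finite {i. s i \<ge> r}"
proof -
  obtain M where M: "\<And>i. i \<ge> M \<Longrightarrow> norm (s i - 0) < r" using LIMSEQ_D [OF assms] by blast
  have "{i. s i \<ge> r} \<subseteq> {..<M}"
  proof
    fix i assume "i \<in> {i. s i \<ge> r}"
    then show "i \<in> {..<M}" using M [of i] by (cases "i < M") auto
  qed
  then show ?thesis by (rule finite_subset) simp
qed

lemma dim_span_orthonormal:
  fixes e :: "nat \<Rightarrow> 'h::complex_hilbert"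
  assumes o: "\<And>i j. cinner (e i) (e j) = (if i = j then 1 else 0)" and I: "finite I"
  shows "cdim (cspan (e ` I)) = card I"
proof -
  have inj: "inj_on e I"
  proof (rule inj_onI)
    fix i j assume "e i = e j"
    then have "cinner (e i) (e j) = 1" using o [of i i] by simp
    then show "i = j" using o [of i j] by (auto split: if_splits)
  qed
  have "complex_vs.independent (e ` I)"
  proof (rule complex_vs.independent_if_scalars_zero)
    show "finite (e ` I)" using I by simp
    fix f x assume z: "(\<Sum>x\<in>e ` I. f x *\<^sub>C x) = 0" and "x \<in> e ` I"
    then obtain j where j: "j \<in> I" "x = e j" by auto
    have "0 = cinner (\<Sum>i\<in>I. f (e i) *\<^sub>C e i) (e j)" using z by (simp add: sum.reindex [OF inj])
    also have "\<dots> = f (e j)" using j I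
      by (simp add: cinner_sum_left cinner_scaleC_left o if_distrib [of "(*) _"] cong: if_cong)
    finally show "f x = 0" using j by simp
  qed
  then have "cdim (cspan (e ` I)) = card (e ` I)"
    by (simp add: complex_vs.dim_span complex_vs.dim_eq_card_independent)
  then show ?thesis using card_image [OF inj] by simp
qed

text \<open>An eigenvector of the modulus for r > 0 is orthogonal to every \<open>e i\<close> with a
  different \<open>s i\<close>, so its expansion collapses to the finitely many \<open>e i\<close>
  with \<open>s i = r\<close>.\<close>

lemma eigen_mult_abs_op:
  assumes X: "X \<in> bounded_ops" and sch: "schmidt X e s" and r: "r > 0"
  shows "finite {i. s i = r}" "eigen_mult (abs_op X) r = card {i. s i = r}"
proof -
  show fin: "finite {i. s i = r}"
    by (rule finite_subset [OF _ finite_level_set [OF schmidtD(6) [OF sch] r]]) auto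
  let ?P = "abs_op X"
  note P = abs_op_expansion [OF X sch]
  have Pb: "?P \<in> bounded_ops" using P(1) by (simp add: positive_op_def)
  have Pe: "blinfun_apply ?P (e i) = s i *\<^sub>R e i" for i
  proof (rule positive_op_eigen_sqrt [OF P(1) schmidtD(3) [OF sch]])
    show "blinfun_apply ?P (blinfun_apply ?P (e i)) = (s i)\<^sup>2 *\<^sub>R e i"
      using arg_cong [OF P(2), of "\<lambda>Z. blinfun_apply Z (e i)"] schmidtD(4) [OF sch] by simp
  qed
  have "{x. blinfun_apply ?P x = r *\<^sub>R x} = cspan (e ` {i. s i = r})"
  proof (rule subset_antisym; rule subsetI)
    fix x assume "x \<in> cspan (e ` {i. s i = r})"
    then have "blinfun_apply ?P x = r *\<^sub>R x"
    proof (induction rule: complex_vs.span_induct_alt)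
      case base then show ?case by (simp add: blinfun.zero_right)
    next
      case (step c v y)
      then obtain i where "s i = r" "v = e i" by auto
      then show ?case using step Pe [of i]
        by (simp add: blinfun.add_right bounded_opsD [OF Pb] scaleR_scaleC scaleC_scaleC scaleC_add_right mult.commute)
    qed
    then show "x \<in> {x. blinfun_apply ?P x = r *\<^sub>R x}" by simp
  next
    fix x assume "x \<in> {x. blinfun_apply ?P x = r *\<^sub>R x}"
    then have x: "blinfun_apply ?P x = r *\<^sub>R x" by simp
    have z: "cinner x (e i) = 0" if "s i \<noteq> r" for i
    proof -
      have "r * cinner x (e i) = cinner (blinfun_apply ?P x) (e i)" by (simp add: x cinner_scaleR_left)
      also have "\<dots> = s i * cinner x (e i)"
        by (simp add: positive_op_hermitian [OF P(1)] Pe cinner_scaleR_right)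
      finally show ?thesis using that by simp
    qed
    obtain M where M: "{i. s i = r} \<subseteq> {..<M}" using fin finite_nat_bounded by blast
    have eq: "(\<Sum>i<m. (s i * cinner x (e i)) *\<^sub>C e i) = (\<Sum>i\<in>{i. s i = r}. (r * cinner x (e i)) *\<^sub>C e i)" if "m \<ge> M" for m
    proof (rule sum.mono_neutral_cong_right)
      show "{i. s i = r} \<subseteq> {..<m}" using M that by auto
      show "\<forall>i\<in>{..<m} - {i. s i = r}. (s i * cinner x (e i)) *\<^sub>C e i = 0" using z by auto
    qed auto
    have "(\<lambda>m. \<Sum>i<m. (s i * cinner x (e i)) *\<^sub>C e i) \<longlonglongrightarrow> (\<Sum>i\<in>{i. s i = r}. (r * cinner x (e i)) *\<^sub>C e i)"
      by (rule tendsto_eventually) (rule eventually_sequentiallyI [of M], rule eq)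
    then have "r *\<^sub>R x = (\<Sum>i\<in>{i. s i = r}. (r * cinner x (e i)) *\<^sub>C e i)"
      using LIMSEQ_unique [OF P(3) [of x]] x by metis
    also have "\<dots> \<in> cspan (e ` {i. s i = r})"
      by (intro complex_vs.span_sum complex_vs.span_scale complex_vs.span_base) auto
    finally have "complex_of_real (inverse r) *\<^sub>C (r *\<^sub>R x) \<in> cspan (e ` {i. s i = r})"
      by (rule complex_vs.span_scale)
    moreover have "complex_of_real (inverse r) *\<^sub>C (r *\<^sub>R x) = x"
      using r by (simp only: scaleR_scaleC scaleC_scaleC flip: of_real_mult) simp
    ultimately show "x \<in> cspan (e ` {i. s i = r})" by simp
  qed
  then show "eigen_mult ?P r = card {i. s i = r}"
    unfolding eigen_mult_def using dim_span_orthonormal [OF schmidtD(8) [OF sch] fin] by simp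
qed

text \<open>Above each level r > 0 both sequences take the same values equally often, so
  \<open>{j. s j \<ge> r}\<close> and \<open>{j. t j \<ge> r}\<close> have equal cardinality; being
  initial segments of the naturals, they coincide.\<close>

lemma decreasing_rearrangement_unique:
  fixes s t :: "nat \<Rightarrow> real"
  assumes s: "decseq s" "\<And>j. s j \<ge> 0" "s \<longlonglongrightarrow> 0" and t: "decseq t" "\<And>j. t j \<ge> 0"
    and eq: "\<And>r. r > 0 \<Longrightarrow> finite {j. s j = r} \<and> finite {j. t j = r} \<and> card {j. s j = r} = card {j. t j = r}"
  shows "s = t"
proof -
  have level: "finite {j. t j \<ge> r} \<and> card {j. t j \<ge> r} = card {j. s j \<ge> r}" if r: "r > 0" for r
  proof -
    define V where "V = s ` {j. s j \<ge> r}"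
    have finS: "finite {j. s j \<ge> r}" using finite_level_set [OF s(3) r] .
    have finV: "finite V" using finS by (simp add: V_def)
    have Vr: "v \<ge> r" if "v \<in> V" for v using that by (auto simp: V_def)
    have S: "{j. s j \<ge> r} = (\<Union>v\<in>V. {j. s j = v})" by (auto simp: V_def)
    have T: "{j. t j \<ge> r} = (\<Union>v\<in>V. {j. t j = v})"
    proof (rule subset_antisym; rule subsetI)
      fix j assume j: "j \<in> {j. t j \<ge> r}"
      then have pos: "t j > 0" using r by simp
      have "{i. t i = t j} \<noteq> {}" by auto
      then have "card {i. s i = t j} \<noteq> 0" using eq [OF pos] by (metis card_eq_0_iff)
      then obtain i where "s i = t j" by (metis (mono_tags, lifting) Collect_empty_eq card.empty)
      then have "t j \<in> V" using j by (auto simp: V_def intro!: image_eqI [of _ _ i])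
      then show "j \<in> (\<Union>v\<in>V. {j. t j = v})" by auto
    qed (use Vr in auto)
    have "card {j. t j \<ge> r} = (\<Sum>v\<in>V. card {j. t j = v})"
      unfolding T using finV Vr eq r by (intro card_UN_disjoint) force+
    also have "\<dots> = (\<Sum>v\<in>V. card {j. s j = v})"
      using Vr eq r by (intro sum.cong refl) force
    also have "\<dots> = card {j. s j \<ge> r}"
      unfolding S using finV Vr eq r by (intro card_UN_disjoint [symmetric]) force+
    finally have c: "card {j. t j \<ge> r} = card {j. s j \<ge> r}" .
    have "finite {j. t j \<ge> r}"
      unfolding T using finV Vr eq r by (intro finite_UN_I) force+
    with c show ?thesis by blast
  qed
  have seg: "A = {..<card A}" if "finite A" "\<And>i j. j \<in> A \<Longrightarrow> i \<le> j \<Longrightarrow> i \<in> A" for A :: "nat set"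
  proof -
    have "\<exists>n. A = {..<n}"
    proof (cases "A = {}")
      case False
      then have mx: "Max A \<in> A" using that(1) by (rule_tac Max_in)
      have "A = {..<Suc (Max A)}"
      proof (rule subset_antisym; rule subsetI)
        show "x \<in> {..<Suc (Max A)}" if "x \<in> A" for x
          using Max_ge [OF \<open>finite A\<close> that] by simp
        show "x \<in> A" if "x \<in> {..<Suc (Max A)}" for x
          using \<open>\<And>i j. j \<in> A \<Longrightarrow> i \<le> j \<Longrightarrow> i \<in> A\<close> [OF mx, of x] that by simp
      qed
      then show ?thesis by blast
    qed auto
    then show ?thesis by auto
  qed
  have same: "s j \<ge> r \<longleftrightarrow> t j \<ge> r" if r: "r > 0" for j r
  proof -
    have "{j. s j \<ge> r} = {..<card {j. s j \<ge> r}}"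
      using s(1) by (intro seg finite_level_set [OF s(3) r]) (auto simp: decseq_def intro: order_trans)
    moreover have "{j. t j \<ge> r} = {..<card {j. t j \<ge> r}}"
      using t(1) level [OF r] by (intro seg) (auto simp: decseq_def intro: order_trans)
    ultimately have "{j. s j \<ge> r} = {j. t j \<ge> r}" using level [OF r] by simp
    then show ?thesis by auto
  qed
  show ?thesis
  proof
    fix j
    have "s j \<le> t j" using same [of "s j" j] t(2) [of j] by (cases "s j > 0") auto
    moreover have "t j \<le> s j" using same [of "t j" j] s(2) [of j] by (cases "t j > 0") auto
    ultimately show "s j = t j" by simp
  qed
qed

text \<open>Replaces the definite description \<open>sing_num\<close> by the numbers of an arbitrary
  Schmidt decomposition, which is all that is used of singular numbers afterwards.\<close>

lemma sing_num_schmidt: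
  assumes X: "X \<in> bounded_ops" and sch: "schmidt X e s"
  shows "sing_num X = s"
  unfolding sing_num_def
proof (rule the_equality)
  show "decseq s \<and> (\<forall>j. 0 \<le> s j) \<and> (\<forall>r>0. finite {j. s j = r} \<and> card {j. s j = r} = eigen_mult (abs_op X) r)"
    using schmidtD(3,5) [OF sch] eigen_mult_abs_op [OF X sch] by simp
  fix t assume t: "decseq t \<and> (\<forall>j. 0 \<le> t j) \<and> (\<forall>r>0. finite {j. t j = r} \<and> card {j. t j = r} = eigen_mult (abs_op X) r)"
  have "s = t"
    using t eigen_mult_abs_op [OF X sch]
    by (intro decreasing_rearrangement_unique schmidtD [OF sch]) simp_all
  then show "t = s" by simp
qed

section \<open>The Macaev norm\<close>

text \<open>By Ky Fan's inequality this says that the Macaev norm of a compact operator is at most \<open>C\<close>.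
  In this form subadditivity and lower semicontinuity of the norm are evident.\<close>

definition mac_bdd :: "('h::complex_hilbert \<Rightarrow>\<^sub>L 'h) \<Rightarrow> real \<Rightarrow> bool" where
  "mac_bdd X C \<longleftrightarrow> (\<forall>k u v. orthn k u \<longrightarrow> orthn k v \<longrightarrow>
     (\<Sum>j<k. cmod (cinner (blinfun_apply X (u j)) (v j)) / real (Suc j)) \<le> C)"

lemma mac_bddD: "mac_bdd X C \<Longrightarrow> orthn k u \<Longrightarrow> orthn k v \<Longrightarrow>
    (\<Sum>j<k. cmod (cinner (blinfun_apply X (u j)) (v j)) / real (Suc j)) \<le> C"
  by (simp add: mac_bdd_def)

lemma mac_bdd_nonneg: "mac_bdd X C \<Longrightarrow> C \<ge> 0"
  using mac_bddD [of X C 0] by simp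

lemma mac_bdd_mono: "mac_bdd X C \<Longrightarrow> C \<le> D \<Longrightarrow> mac_bdd X D"
  unfolding mac_bdd_def using order_trans by blast

lemma mac_bdd_0: "C \<ge> 0 \<Longrightarrow> mac_bdd 0 C"
  by (simp add: mac_bdd_def)

lemma mac_bdd_add:
  assumes "mac_bdd X C" "mac_bdd Y D" shows "mac_bdd (X + Y) (C + D)"
  unfolding mac_bdd_def
proof (intro allI impI)
  fix k and u v :: "nat \<Rightarrow> 'a" assume uv: "orthn k u" "orthn k v"
  have "(\<Sum>j<k. cmod (cinner (blinfun_apply (X + Y) (u j)) (v j)) / real (Suc j))
     \<le> (\<Sum>j<k. cmod (cinner (blinfun_apply X (u j)) (v j)) / real (Suc j) + cmod (cinner (blinfun_apply Y (u j)) (v j)) / real (Suc j))"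
    by (intro sum_mono) (simp add: blinfun.add_left cinner_add_left divide_right_mono norm_triangle_ineq flip: add_divide_distrib)
  also have "\<dots> \<le> C + D"
    unfolding sum.distrib by (intro add_mono mac_bddD assms uv)
  finally show "(\<Sum>j<k. cmod (cinner (blinfun_apply (X + Y) (u j)) (v j)) / real (Suc j)) \<le> C + D" .
qed

lemma mac_bdd_scaleO:
  assumes "mac_bdd X C" shows "mac_bdd (scaleO c X) (cmod c * C)"
  unfolding mac_bdd_def
proof (intro allI impI)
  fix k and u v :: "nat \<Rightarrow> 'a" assume uv: "orthn k u" "orthn k v"
  have "(\<Sum>j<k. cmod (cinner (blinfun_apply (scaleO c X) (u j)) (v j)) / real (Suc j))
      = cmod c * (\<Sum>j<k. cmod (cinner (blinfun_apply X (u j)) (v j)) / real (Suc j))"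
    by (simp add: cinner_scaleC_left norm_mult sum_distrib_left)
  also have "\<dots> \<le> cmod c * C" by (intro mult_left_mono mac_bddD assms uv) simp
  finally show "(\<Sum>j<k. cmod (cinner (blinfun_apply (scaleO c X) (u j)) (v j)) / real (Suc j)) \<le> cmod c * C" .
qed

lemma mac_bdd_minus: "mac_bdd X C \<Longrightarrow> mac_bdd (- X) C"
  by (simp add: mac_bdd_def blinfun.minus_left cinner_minus_left)

lemma mac_bdd_diff: "mac_bdd X C \<Longrightarrow> mac_bdd Y D \<Longrightarrow> mac_bdd (X - Y) (C + D)"
  using mac_bdd_add [of X C "-Y" D] mac_bdd_minus [of Y D] by simp

lemma mac_bdd_adj:
  assumes "mac_bdd X C" "X \<in> bounded_ops" shows "mac_bdd (adj_op X) C"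
  unfolding mac_bdd_def
proof (intro allI impI)
  fix k and u v :: "nat \<Rightarrow> 'a" assume uv: "orthn k u" "orthn k v"
  have "cmod (cinner (blinfun_apply (adj_op X) (u j)) (v j)) = cmod (cinner (blinfun_apply X (v j)) (u j))" for j
    by (metis assms(2) cinner_adj' cinner_commute complex_mod_cnj)
  then show "(\<Sum>j<k. cmod (cinner (blinfun_apply (adj_op X) (u j)) (v j)) / real (Suc j)) \<le> C"
    using mac_bddD [OF assms(1) uv(2,1)] by simp
qed

text \<open>Each finite sum in \<open>mac_bdd\<close> is continuous in the operator, so a common
  bound survives limits in operator norm.\<close>

lemma mac_bdd_limit:
  assumes X: "X \<longlonglongrightarrow> Y" and bd: "\<And>n. n \<ge> N \<Longrightarrow> mac_bdd (X n) C"
  shows "mac_bdd Y C"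
  unfolding mac_bdd_def
proof (intro allI impI)
  fix k and u v :: "nat \<Rightarrow> 'a" assume uv: "orthn k u" "orthn k v"
  have "(\<lambda>n. \<Sum>j<k. cmod (cinner (blinfun_apply (X n) (u j)) (v j)) / real (Suc j)) \<longlonglongrightarrow>
      (\<Sum>j<k. cmod (cinner (blinfun_apply Y (u j)) (v j)) / real (Suc j))"
    by (intro tendsto_sum tendsto_divide tendsto_norm tendsto_const
        bounded_bilinear.tendsto [OF bounded_bilinear_cinner] blinfun.tendsto X) simp
  then show "(\<Sum>j<k. cmod (cinner (blinfun_apply Y (u j)) (v j)) / real (Suc j)) \<le> C"
    by (rule LIMSEQ_le_const2) (use mac_bddD [OF bd _ _ ] uv in blast)
qed

text \<open>A decreasing sequence is weighted most profitably by putting the full weight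
  \<open>K\<close> on its first \<open>p\<close> terms. Subtracting the threshold \<open>t p\<close>
  makes the terms before p nonnegative and the later ones nonpositive, so that they can be compared
  one by one.\<close>

lemma sum_rearrangement_bound:
  fixes t w :: "nat \<Rightarrow> real"
  assumes t: "decseq t" "\<And>m. t m \<ge> 0" and w: "\<And>m. m < M \<Longrightarrow> 0 \<le> w m" "\<And>m. m < M \<Longrightarrow> w m \<le> K"
    and sw: "(\<Sum>m<M. w m) \<le> real p * K" and K: "K \<ge> 0"
  shows "(\<Sum>m<M. t m * w m) \<le> K * (\<Sum>m<p. t m)"
proof -
  have "(\<Sum>m<M. (t m - t p) * w m) \<le> (\<Sum>m<M. if m < p then (t m - t p) * K else 0)"
  proof (rule sum_mono)
    fix m assume m: "m \<in> {..<M}"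
    show "(t m - t p) * w m \<le> (if m < p then (t m - t p) * K else 0)"
    proof (cases "m < p")
      case True
      then show ?thesis using m w t(1) by (auto simp: decseq_def intro!: mult_left_mono)
    next
      case False
      then have "t m \<le> t p" using t(1) by (simp add: decseq_def)
      then show ?thesis using False m w by (auto intro!: mult_nonpos_nonneg)
    qed
  qed
  also have "\<dots> = (\<Sum>m\<in>{..<M} \<inter> {..<p}. (t m - t p) * K)"
    by (simp add: sum.inter_restrict)
  also have "\<dots> \<le> (\<Sum>m<p. (t m - t p) * K)"
    using t(1) K by (intro sum_mono2) (auto simp: decseq_def)
  also have "\<dots> = K * (\<Sum>m<p. t m) - t p * (real p * K)"
    by (simp add: sum_subtractf sum_distrib_left sum_distrib_right algebra_simps flip: sum_distrib_right)
  finally have "(\<Sum>m<M. t m * w m) - t p * (\<Sum>m<M. w m) \<le> K * (\<Sum>m<p. t m) - t p * (real p * K)"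
    by (simp add: left_diff_distrib sum_subtractf sum_distrib_left)
  moreover have "t p * (\<Sum>m<M. w m) \<le> t p * (real p * K)"
    using sw t(2) by (intro mult_left_mono) auto
  ultimately show ?thesis by linarith
qed

text \<open>Abel summation. The induction carries the partial sum of the differences with the weight
  \<open>c p\<close>, which may be lowered to \<open>c (Suc p)\<close> because that partial sum is
  nonnegative.\<close>

lemma sum_weak_majorization:
  fixes c A t :: "nat \<Rightarrow> real"
  assumes c: "decseq c" "\<And>j. c j \<ge> 0" and le: "\<And>p. p \<le> k \<Longrightarrow> (\<Sum>j<p. A j) \<le> (\<Sum>j<p. t j)"
  shows "(\<Sum>j<k. c j * A j) \<le> (\<Sum>j<k. c j * t j)"
proof -
  have "(\<Sum>j<p. c j * (t j - A j)) \<ge> c p * (\<Sum>j<p. t j - A j)" if "p \<le> k" for p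
    using that
  proof (induction p)
    case (Suc p)
    have "c (Suc p) * (\<Sum>j<Suc p. t j - A j) \<le> c p * (\<Sum>j<Suc p. t j - A j)"
      using le [OF Suc.prems] c(1) by (intro mult_right_mono) (auto simp: decseq_Suc_iff sum_subtractf)
    also have "\<dots> = c p * (\<Sum>j<p. t j - A j) + c p * (t p - A p)" by (simp add: algebra_simps)
    also have "\<dots> \<le> (\<Sum>j<Suc p. c j * (t j - A j))" using Suc by simp
    finally show ?case .
  qed simp
  from this [of k] have "0 \<le> (\<Sum>j<k. c j * (t j - A j))"
    using mult_nonneg_nonneg [OF c(2) [of k], of "\<Sum>j<k. t j - A j"] le [of k] by (simp add: sum_subtractf)
  then show ?thesis by (simp add: right_diff_distrib sum_subtractf)
qed

lemma cauchy_schwarz_sum: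
  fixes a b :: "nat \<Rightarrow> real"
  assumes "(\<Sum>i<n. (a i)\<^sup>2) \<le> A\<^sup>2" "(\<Sum>i<n. (b i)\<^sup>2) \<le> B\<^sup>2" "A \<ge> 0" "B \<ge> 0"
  shows "(\<Sum>i<n. a i * b i) \<le> A * B"
proof -
  have "(\<Sum>i<n. a i * b i)\<^sup>2 \<le> (\<Sum>i<n. (a i)\<^sup>2) * (\<Sum>i<n. (b i)\<^sup>2)" by (rule Cauchy_Schwarz_ineq_sum)
  also have "\<dots> \<le> A\<^sup>2 * B\<^sup>2" using assms by (intro mult_mono) (auto intro: sum_nonneg)
  finally have "(\<Sum>i<n. a i * b i)\<^sup>2 \<le> (A * B)\<^sup>2" by (simp add: power_mult_distrib)
  then show ?thesis by (rule power2_le_imp_le) (simp add: assms)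
qed

text \<open>The moduli of the coefficients form a matrix \<open>a\<close> whose row and column sums
  are at most \<open>norm A * norm B\<close>, by Cauchy-Schwarz and Bessel; such a matrix can only
  spread out the decreasing numbers \<open>t\<close>. A and B are carried along so that the ideal
  inequality comes from the same argument. The vectors \<open>e\<close> and \<open>f\<close> enter
  through Bessel bounds, which also admit an \<open>f\<close> that vanishes where the singular
  numbers do.\<close>

theorem ky_fan:
  fixes X :: "'h::complex_hilbert \<Rightarrow>\<^sub>L 'h"
  assumes exp: "\<And>x. (\<lambda>M. \<Sum>m<M. (t m * cinner x (e m)) *\<^sub>C f m) \<longlonglongrightarrow> blinfun_apply X x"
    and t: "decseq t" "\<And>m. t m \<ge> 0"
    and be: "\<And>x M. (\<Sum>m<M. (cmod (cinner x (e m)))\<^sup>2) \<le> (norm x)\<^sup>2"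
    and bf: "\<And>x M. (\<Sum>m<M. (cmod (cinner (f m) x))\<^sup>2) \<le> (norm x)\<^sup>2"
    and ne: "\<And>m. norm (e m) \<le> 1" and nf: "\<And>m. norm (f m) \<le> 1"
    and A: "A \<in> bounded_ops" and B: "B \<in> bounded_ops"
    and u: "orthn k u" and v: "orthn k v"
  shows "(\<Sum>j<k. cmod (cinner (blinfun_apply X (blinfun_apply B (u j))) (blinfun_apply A (v j))) / real (Suc j))
    \<le> norm A * norm B * (\<Sum>j<k. t j / real (Suc j))"
proof -
  define K where "K = norm B * norm A"
  define a where "a = (\<lambda>j m. cmod (cinner (blinfun_apply B (u j)) (e m)) * cmod (cinner (f m) (blinfun_apply A (v j))))"
  have K0: "K \<ge> 0" by (simp add: K_def)
  have a0: "a j m \<ge> 0" for j m by (simp add: a_def)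
  have row: "(\<Sum>m<M. a j m) \<le> K" if "j < k" for j M
  proof -
    have "norm (blinfun_apply B (u j)) \<le> norm B" "norm (blinfun_apply A (v j)) \<le> norm A"
      using norm_blinfun [of B "u j"] norm_blinfun [of A "v j"] orthn_norm [OF u that] orthn_norm [OF v that] by simp_all
    then have "(norm (blinfun_apply B (u j)))\<^sup>2 \<le> (norm B)\<^sup>2" "(norm (blinfun_apply A (v j)))\<^sup>2 \<le> (norm A)\<^sup>2"
      by (simp_all add: power_mono)
    then show ?thesis unfolding a_def K_def
      by (intro cauchy_schwarz_sum order_trans [OF be] order_trans [OF bf]) simp_all
  qed
  have col: "(\<Sum>j<p. a j m) \<le> K" if "p \<le> k" for p m
  proof -
    have "norm (blinfun_apply (adj_op B) (e m)) \<le> norm B * 1"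
      using norm_blinfun [of "adj_op B" "e m"] ne [of m] B
      by (metis mult_left_mono norm_adj_op norm_ge_zero order_trans)
    then have 1: "(norm (blinfun_apply (adj_op B) (e m)))\<^sup>2 \<le> (norm B)\<^sup>2" by (simp add: power_mono)
    have "norm (blinfun_apply (adj_op A) (f m)) \<le> norm A * 1"
      using norm_blinfun [of "adj_op A" "f m"] nf [of m] A
      by (metis mult_left_mono norm_adj_op norm_ge_zero order_trans)
    then have 2: "(norm (blinfun_apply (adj_op A) (f m)))\<^sup>2 \<le> (norm A)\<^sup>2" by (simp add: power_mono)
    show ?thesis unfolding a_def K_def cinner_adj [OF B] cinner_adj' [OF A, symmetric]
      by (intro cauchy_schwarz_sum order_trans [OF bessel' 1] order_trans [OF bessel 2]
          orthn_mono [OF u that] orthn_mono [OF v that]) simp_all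
  qed
  have fin: "(\<Sum>j<k. (\<Sum>m<M. t m * a j m) / real (Suc j)) \<le> K * (\<Sum>j<k. t j / real (Suc j))" for M
  proof -
    \<comment> \<open>Weak majorization reduces the weights 1/(j+1) to plain partial sums over j <
      p. There the column sums cap the weight of each \<open>t m\<close> and the row sums cap the
      total weight.\<close>
    have "(\<Sum>j<k. inverse (real (Suc j)) * (\<Sum>m<M. t m * a j m)) \<le> (\<Sum>j<k. inverse (real (Suc j)) * (K * t j))"
    proof (rule sum_weak_majorization)
      show "decseq (\<lambda>j. inverse (real (Suc j)))" by (intro decseq_SucI le_imp_inverse_le) auto
      fix p assume p: "p \<le> k"
      have "(\<Sum>j<p. \<Sum>m<M. t m * a j m) = (\<Sum>m<M. t m * (\<Sum>j<p. a j m))"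
        by (subst sum.swap) (simp add: sum_distrib_left)
      also have "\<dots> \<le> K * (\<Sum>m<p. t m)"
      proof (rule sum_rearrangement_bound [OF t])
        have "(\<Sum>m<M. \<Sum>j<p. a j m) = (\<Sum>j<p. \<Sum>m<M. a j m)" by (rule sum.swap)
        also have "\<dots> \<le> (\<Sum>j<p. K)" using p by (intro sum_mono row) auto
        finally show "(\<Sum>m<M. \<Sum>j<p. a j m) \<le> real p * K" by simp
      qed (use col [OF p] a0 K0 in \<open>auto intro: sum_nonneg\<close>)
      finally show "(\<Sum>j<p. \<Sum>m<M. t m * a j m) \<le> (\<Sum>j<p. K * t j)" by (simp add: sum_distrib_left)
    qed simp
    then show ?thesis by (simp add: divide_inverse sum_distrib_left mult_ac)
  qed
  have lim: "(\<lambda>M. cinner (\<Sum>m<M. (t m * cinner (blinfun_apply B (u j)) (e m)) *\<^sub>C f m) (blinfun_apply A (v j)))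
      \<longlonglongrightarrow> cinner (blinfun_apply X (blinfun_apply B (u j))) (blinfun_apply A (v j))" for j
    by (intro bounded_bilinear.tendsto [OF bounded_bilinear_cinner] exp tendsto_const)
  have le: "cmod (cinner (\<Sum>m<M. (t m * cinner (blinfun_apply B (u j)) (e m)) *\<^sub>C f m) (blinfun_apply A (v j)))
      \<le> (\<Sum>m<M. t m * a j m)" for j M
    unfolding cinner_sum_left cinner_scaleC_left
    by (rule order_trans [OF norm_sum], rule sum_mono) (simp add: norm_mult a_def t(2))
  have "(\<lambda>M. \<Sum>j<k. cmod (cinner (\<Sum>m<M. (t m * cinner (blinfun_apply B (u j)) (e m)) *\<^sub>C f m) (blinfun_apply A (v j))) / real (Suc j))
    \<longlonglongrightarrow> (\<Sum>j<k. cmod (cinner (blinfun_apply X (blinfun_apply B (u j))) (blinfun_apply A (v j))) / real (Suc j))"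
    by (intro tendsto_sum tendsto_divide tendsto_norm lim tendsto_const) simp
  then have "(\<Sum>j<k. cmod (cinner (blinfun_apply X (blinfun_apply B (u j))) (blinfun_apply A (v j))) / real (Suc j))
      \<le> K * (\<Sum>j<k. t j / real (Suc j))"
  proof (rule LIMSEQ_le_const2, intro exI allI impI)
    fix M
    have "(\<Sum>j<k. cmod (cinner (\<Sum>m<M. (t m * cinner (blinfun_apply B (u j)) (e m)) *\<^sub>C f m) (blinfun_apply A (v j))) / real (Suc j))
      \<le> (\<Sum>j<k. (\<Sum>m<M. t m * a j m) / real (Suc j))"
      by (intro sum_mono divide_right_mono le) simp
    also note fin [of M]
    finally show "(\<Sum>j<k. cmod (cinner (\<Sum>m<M. (t m * cinner (blinfun_apply B (u j)) (e m)) *\<^sub>C f m) (blinfun_apply A (v j))) / real (Suc j))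
      \<le> K * (\<Sum>j<k. t j / real (Suc j))" .
  qed
  then show ?thesis by (simp add: K_def mult.commute)
qed

text \<open>The zero vector where the singular number vanishes.\<close>

definition svec :: "('h::complex_hilbert \<Rightarrow>\<^sub>L 'h) \<Rightarrow> (nat \<Rightarrow> 'h) \<Rightarrow> (nat \<Rightarrow> real) \<Rightarrow> nat \<Rightarrow> 'h" where
  "svec X e s m = inverse (s m) *\<^sub>R blinfun_apply X (e m)"

context
  fixes X :: "'h::complex_hilbert \<Rightarrow>\<^sub>L 'h" and e s
  assumes X: "X \<in> bounded_ops" and sch: "schmidt X e s"
begin

lemma svec_apply: "blinfun_apply X (e m) = s m *\<^sub>R svec X e s m"
  using schmidtD(2) [OF sch, of m] by (cases "s m = 0") (auto simp: svec_def)

lemma svec_cinner: "cinner (svec X e s i) (svec X e s j) = (if i = j \<and> s i \<noteq> 0 then 1 else 0)"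
proof -
  have "cinner (blinfun_apply X (e i)) (blinfun_apply X (e j)) = (s j)\<^sup>2 * cinner (e i) (e j)"
    by (simp add: cinner_adj [OF X] schmidtD(4) [OF sch] cinner_scaleR_right)
  then have "cinner (svec X e s i) (svec X e s j)
      = complex_of_real (inverse (s i) * inverse (s j) * (s j)\<^sup>2) * (if i = j then 1 else 0)"
    by (simp add: svec_def cinner_scaleR_left cinner_scaleR_right schmidtD(8) [OF sch] mult_ac)
  also have "\<dots> = (if i = j \<and> s i \<noteq> 0 then 1 else 0)"
  proof (cases "i = j \<and> s i \<noteq> 0")
    case True
    then have ij: "i = j" and nz: "s j \<noteq> 0" by blast+
    have one: "inverse (s i) * inverse (s j) * (s j)\<^sup>2 = 1"
      unfolding ij using nz by (simp add: power2_eq_square field_simps)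
    show ?thesis unfolding one using ij nz by simp
  qed auto
  finally show ?thesis .
qed

lemma svec_norm: "norm (svec X e s m) \<le> 1"
  using svec_cinner [of m m] norm_sq_cinner [of "svec X e s m"] by (auto simp: power2_eq_1_iff split: if_splits)

lemma svec_orthn: assumes "s p > 0" shows "orthn (Suc p) (svec X e s)"
proof -
  have "s i \<noteq> 0" if "i < Suc p" for i
    using schmidt_antimono [OF sch, of i p] that assms by simp
  then show ?thesis by (auto simp: orthn_def svec_cinner)
qed

lemma svec_bessel: "(\<Sum>m<M. (cmod (cinner (svec X e s m) x))\<^sup>2) \<le> (norm x)\<^sup>2"
proof (induction M)
  case (Suc M)
  show ?case
  proof (cases "s M = 0")
    case True
    then show ?thesis using Suc by (simp add: svec_def)
  next
    case False
    then show ?thesis using bessel' [OF svec_orthn [of M], of x] schmidtD(3) [OF sch, of M] by simp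
  qed
qed simp

lemma svec_expansion: "(\<lambda>M. \<Sum>m<M. (s m * cinner x (e m)) *\<^sub>C svec X e s m) \<longlonglongrightarrow> blinfun_apply X x"
proof -
  have "blinfun_apply X (ocomp M e x) = (\<Sum>m<M. (s m * cinner x (e m)) *\<^sub>C svec X e s m)" for M
    by (simp add: ocomp_def blinfun.sum_right bounded_opsD [OF X] svec_apply scaleR_scaleC scaleC_scaleC mult.commute)
  then show ?thesis using schmidt_expansion [OF sch, of x] by simp
qed

lemma ky_fan_schmidt:
  assumes "A \<in> bounded_ops" "B \<in> bounded_ops" "orthn k u" "orthn k v"
  shows "(\<Sum>j<k. cmod (cinner (blinfun_apply X (blinfun_apply B (u j))) (blinfun_apply A (v j))) / real (Suc j))
    \<le> norm A * norm B * (\<Sum>j<k. s j / real (Suc j))"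
proof (rule ky_fan [OF svec_expansion])
  show "norm (e m) \<le> 1" for m using orthn_norm [OF schmidtD(1) [OF sch, of "Suc m"], of m] by simp
  show "(\<Sum>m<M. (cmod (cinner x (e m)))\<^sup>2) \<le> (norm x)\<^sup>2" for x M
    by (rule bessel [OF schmidtD(1) [OF sch]])
qed (rule assms schmidtD(3,5) [OF sch] svec_bessel svec_norm)+

text \<open>Test with the singular vectors themselves. Where \<open>s k\<close> vanishes the vector
  \<open>svec\<close> is 0 and orthonormality breaks down, but such a term adds nothing, so the
  induction passes over it.\<close>

lemma mac_bdd_lower:
  assumes "mac_bdd X C"
  shows "(\<Sum>j<k. s j / real (Suc j)) \<le> C"
proof (induction k)
  case 0 then show ?case using mac_bdd_nonneg [OF assms] by simp
next
  case (Suc k)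
  show ?case
  proof (cases "s k = 0")
    case True then show ?thesis using Suc by simp
  next
    case False
    then have pos: "s k > 0" using schmidtD(3) [OF sch, of k] by simp
    have nz: "s j \<noteq> 0" if "j < Suc k" for j using schmidt_antimono [OF sch, of j k] that pos by simp
    have "cmod (cinner (blinfun_apply X (e j)) (svec X e s j)) = s j" if "j < Suc k" for j
      using nz [OF that] schmidtD(3) [OF sch, of j] by (simp add: svec_apply cinner_scaleR_left svec_cinner)
    then have "(\<Sum>j<Suc k. s j / real (Suc j))
        = (\<Sum>j<Suc k. cmod (cinner (blinfun_apply X (e j)) (svec X e s j)) / real (Suc j))"
      by (intro sum.cong) auto
    also have "\<dots> \<le> C" by (rule mac_bddD [OF assms schmidtD(1) [OF sch] svec_orthn [OF pos]])
    finally show ?thesis .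
  qed
qed

end

context infinite_dim
begin

text \<open>The bridge between the series defining the Macaev norm and the test over orthonormal
  systems: Ky Fan's inequality in one direction, singular vectors in the other.\<close>

lemma macaev_iff:
  fixes X :: "'h \<Rightarrow>\<^sub>L 'h"
  assumes X: "X \<in> compact_ops"
  shows "X \<in> macaev_ideal \<and> macaev_norm X \<le> C \<longleftrightarrow> mac_bdd X C"
proof -
  obtain e s where sch: "schmidt X e s" using schmidt_exists [OF X] by blast
  have Xb: "X \<in> bounded_ops" using X by simp
  have sn: "sing_num X = s" by (rule sing_num_schmidt [OF Xb sch])
  have s0: "s j / real (Suc j) \<ge> 0" for j using schmidtD(3) [OF sch] by simp
  show ?thesis
  proof
    assume R: "X \<in> macaev_ideal \<and> macaev_norm X \<le> C"
    then have sm: "summable (\<lambda>j. s j / real (Suc j))" unfolding macaev_ideal_def mem_Collect_eq sn by blast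
    show "mac_bdd X C"
      unfolding mac_bdd_def
    proof (intro allI impI)
      fix k and u v :: "nat \<Rightarrow> 'h" assume uv: "orthn k u" "orthn k v"
      have "(\<Sum>j<k. cmod (cinner (blinfun_apply X (u j)) (v j)) / real (Suc j))
        \<le> norm (id_blinfun :: 'h \<Rightarrow>\<^sub>L 'h) * norm (id_blinfun :: 'h \<Rightarrow>\<^sub>L 'h) * (\<Sum>j<k. s j / real (Suc j))"
        using ky_fan_schmidt [OF Xb sch bounded_ops_id bounded_ops_id uv] by simp
      also have "\<dots> \<le> 1 * 1 * (\<Sum>j<k. s j / real (Suc j))"
        by (intro mult_right_mono mult_mono norm_blinfun_id_le sum_nonneg s0) auto
      also have "\<dots> \<le> (\<Sum>j. s j / real (Suc j))"
        using sum_le_suminf [OF sm, of "{..<k}"] s0 by simp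
      also have "\<dots> \<le> C" using R unfolding macaev_norm_def sn by blast
      finally show "(\<Sum>j<k. cmod (cinner (blinfun_apply X (u j)) (v j)) / real (Suc j)) \<le> C" .
    qed
  next
    assume b: "mac_bdd X C"
    have le: "(\<Sum>j<k. s j / real (Suc j)) \<le> C" for k by (rule mac_bdd_lower [OF Xb sch b])
    have sm: "summable (\<lambda>j. s j / real (Suc j))"
    proof (rule bounded_imp_summable [OF s0])
      show "(\<Sum>j\<le>n. s j / real (Suc j)) \<le> C" for n using le [of "Suc n"] by (simp only: lessThan_Suc_atMost)
    qed
    then show "X \<in> macaev_ideal \<and> macaev_norm X \<le> C"
      using X suminf_le_const [OF sm] le unfolding macaev_ideal_def macaev_norm_def mem_Collect_eq sn by blast
  qed
qed

lemma macaev_ideal_iff: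
  fixes X :: "'h \<Rightarrow>\<^sub>L 'h"
  shows "X \<in> macaev_ideal \<longleftrightarrow> X \<in> compact_ops \<and> (\<exists>C. mac_bdd X C)"
proof (cases "X \<in> compact_ops")
  case True
  then show ?thesis using macaev_iff [OF True] by blast
next
  case False
  then show ?thesis unfolding macaev_ideal_def by blast
qed

lemma macaev_idealI:
  fixes X :: "'h \<Rightarrow>\<^sub>L 'h"
  shows "X \<in> compact_ops \<Longrightarrow> mac_bdd X C \<Longrightarrow> X \<in> macaev_ideal"
  using macaev_ideal_iff by blast

lemma macaev_compact:
  fixes X :: "'h \<Rightarrow>\<^sub>L 'h"
  shows "X \<in> macaev_ideal \<Longrightarrow> X \<in> compact_ops"
  using macaev_ideal_iff by blast

lemma macaev_norm_bdd:
  fixes X :: "'h \<Rightarrow>\<^sub>L 'h"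
  shows "X \<in> macaev_ideal \<Longrightarrow> mac_bdd X (macaev_norm X)"
  using macaev_iff macaev_compact by blast

lemma macaev_norm_le:
  fixes X :: "'h \<Rightarrow>\<^sub>L 'h"
  shows "X \<in> macaev_ideal \<Longrightarrow> mac_bdd X C \<Longrightarrow> macaev_norm X \<le> C"
  using macaev_iff macaev_compact by blast

section \<open>Ideal inequalities and finite rank approximation in the Macaev norm\<close>

lemma mac_bdd_compose:
  fixes X :: "'h \<Rightarrow>\<^sub>L 'h"
  assumes X: "X \<in> compact_ops" and b: "mac_bdd X C" and A: "A \<in> bounded_ops" and B: "B \<in> bounded_ops"
  shows "mac_bdd (A o\<^sub>L X o\<^sub>L B) (norm A * norm B * C)"
  unfolding mac_bdd_def
proof (intro allI impI)
  fix k and u v :: "nat \<Rightarrow> 'h" assume uv: "orthn k u" "orthn k v"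
  obtain e s where sch: "schmidt X e s" using schmidt_exists [OF X] by blast
  have Xb: "X \<in> bounded_ops" using X by simp
  have "(\<Sum>j<k. cmod (cinner (blinfun_apply (A o\<^sub>L X o\<^sub>L B) (u j)) (v j)) / real (Suc j))
     = (\<Sum>j<k. cmod (cinner (blinfun_apply X (blinfun_apply B (u j))) (blinfun_apply (adj_op A) (v j))) / real (Suc j))"
    by (simp add: cinner_adj [OF A])
  also have "\<dots> \<le> norm (adj_op A) * norm B * (\<Sum>j<k. s j / real (Suc j))"
    by (rule ky_fan_schmidt [OF Xb sch adj_op_in [OF A] B uv])
  also have "\<dots> \<le> norm A * norm B * C"
    unfolding norm_adj_op [OF A] by (intro mult_left_mono mac_bdd_lower [OF Xb sch b]) simp
  finally show "(\<Sum>j<k. cmod (cinner (blinfun_apply (A o\<^sub>L X o\<^sub>L B) (u j)) (v j)) / real (Suc j)) \<le> norm A * norm B * C" .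
qed

lemma mac_bdd_compose_left:
  fixes X :: "'h \<Rightarrow>\<^sub>L 'h"
  assumes X: "X \<in> compact_ops" and b: "mac_bdd X C" and A: "A \<in> bounded_ops" and n: "norm A \<le> a"
  shows "mac_bdd (A o\<^sub>L X) (a * C)"
proof -
  have C: "C \<ge> 0" by (rule mac_bdd_nonneg [OF b])
  have "norm A * norm (id_blinfun :: 'h \<Rightarrow>\<^sub>L 'h) * C \<le> a * 1 * C"
    by (intro mult_right_mono mult_mono norm_blinfun_id_le n C) (use n norm_ge_zero order_trans in blast, simp)
  then show ?thesis using mac_bdd_compose [OF X b A bounded_ops_id] mac_bdd_mono by auto
qed

lemma mac_bdd_compose_right:
  fixes X :: "'h \<Rightarrow>\<^sub>L 'h"
  assumes X: "X \<in> compact_ops" and b: "mac_bdd X C" and A: "A \<in> bounded_ops" and n: "norm A \<le> a"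
  shows "mac_bdd (X o\<^sub>L A) (a * C)"
proof -
  have C: "C \<ge> 0" by (rule mac_bdd_nonneg [OF b])
  have "norm (id_blinfun :: 'h \<Rightarrow>\<^sub>L 'h) * norm A * C \<le> 1 * a * C"
    by (intro mult_right_mono mult_mono norm_blinfun_id_le n C) auto
  then show ?thesis using mac_bdd_compose [OF X b bounded_ops_id A] mac_bdd_mono by auto
qed

text \<open>Cutting off the first M singular vectors leaves an operator with the singular numbers
  \<open>s (M + j)\<close>. Its Macaev norm is small because few early weights meet the small number
  \<open>s M\<close>, while the later ones fall under the tail of a convergent series.\<close>

lemma macaev_finite_rank_approx:
  fixes X :: "'h \<Rightarrow>\<^sub>L 'h"
  assumes X: "X \<in> macaev_ideal" and d: "d > 0"
  shows "\<exists>F\<in>finite_rank_ops. mac_bdd (X - F) d"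
proof -
  have Xc: "X \<in> compact_ops" using macaev_compact [OF X] .
  then have Xb: "X \<in> bounded_ops" by simp
  obtain e s where sch: "schmidt X e s" using schmidt_exists [OF Xc] by blast
  have s0: "s j \<ge> 0" for j using schmidtD(3) [OF sch] .
  have sm: "summable (\<lambda>j. s j / real (Suc j))"
    using X unfolding macaev_ideal_def mem_Collect_eq sing_num_schmidt [OF Xb sch] by blast
  obtain J where J': "\<And>n m. n \<ge> J \<Longrightarrow> norm (\<Sum>j=n..m. s j / real (Suc j)) < d/2"
    using summable_partial_sum_bound [OF sm half_gt_zero [OF d]] by blast
  have J: "norm (\<Sum>j=J..<m. s j / real (Suc j)) < d/2" for m
  proof (cases m)
    case (Suc l)
    then show ?thesis using J' [of J l] by (simp only: atLeastLessThanSuc_atLeastAtMost order_refl)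
  qed (use d in simp)
  have pos: "d / (2 * (real J + 1)) > 0" using d by simp
  \<comment> \<open>The first \<open>J\<close> terms of the shifted sum cost at most
    \<open>J * s M\<close>, which this choice keeps below d/2; beyond \<open>J\<close> the shifted
    terms are dominated by the original tail.\<close>
  obtain M where M: "norm (s M - 0) < d / (2 * (real J + 1))"
    using LIMSEQ_D [OF schmidtD(6) [OF sch] pos] by (meson order_refl)
  have tail: "(\<Sum>j<k. s (M + j) / real (Suc j)) \<le> d" for k
  proof -
    have "(\<Sum>j<k. s (M + j) / real (Suc j)) \<le> (\<Sum>j<k. (if j < J then s M else 0) + (if J \<le> j then s j / real (Suc j) else 0))"
    proof (rule sum_mono)
      fix j
      have "s (M + j) / real (Suc j) \<le> s (M + j)" using s0 [of "M + j"] by (simp add: divide_le_eq mult_left_le_one_le algebra_simps)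
      then show "s (M + j) / real (Suc j) \<le> (if j < J then s M else 0) + (if J \<le> j then s j / real (Suc j) else 0)"
        using schmidt_antimono [OF sch, of M "M + j"] schmidt_antimono [OF sch, of j "M + j"]
        by (auto simp: divide_right_mono)
    qed
    also have "\<dots> = (\<Sum>j\<in>{..<k} \<inter> {..<J}. s M) + (\<Sum>j\<in>{J..<k}. s j / real (Suc j))"
    proof -
      have "(\<Sum>j<k. if j < J then s M else 0) = (\<Sum>j\<in>{..<k} \<inter> {..<J}. s M)"
        by (simp only: sum.inter_restrict finite_lessThan lessThan_iff)
      moreover have "(\<Sum>j<k. if J \<le> j then s j / real (Suc j) else 0) = (\<Sum>j\<in>{J..<k}. s j / real (Suc j))"
        by (rule sum.mono_neutral_cong_right) auto
      ultimately show ?thesis by (simp only: sum.distrib)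
    qed
    also have "(\<Sum>j\<in>{..<k} \<inter> {..<J}. s M) \<le> (real J + 1) * s M"
    proof -
      have "card ({..<k} \<inter> {..<J}) \<le> card {..<J}" by (intro card_mono) auto
      then have "real (card ({..<k} \<inter> {..<J})) \<le> real J + 1" by simp
      then show ?thesis using s0 by (simp add: mult_right_mono)
    qed
    also have "(real J + 1) * s M \<le> d/2"
      using M s0 [of M] by (simp add: field_simps add_pos_nonneg)
    also have "(\<Sum>j\<in>{J..<k}. s j / real (Suc j)) \<le> d/2" using J [of k] by simp
    finally show ?thesis by simp
  qed
  define F where "F = X o\<^sub>L oproj M e"
  have F: "F \<in> finite_rank_ops" unfolding F_def by (rule finite_rank_compose_right) (simp_all add: Xb)
  let ?f = "\<lambda>m. svec X e s (M + m)"
  have exp: "(\<lambda>k. \<Sum>m<k. (s (M + m) * cinner x (e (M + m))) *\<^sub>C ?f m) \<longlonglongrightarrow> blinfun_apply (X - F) x" for x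
  proof -
    let ?g = "\<lambda>m. (s m * cinner x (e m)) *\<^sub>C svec X e s m"
    have "(\<lambda>k. \<Sum>m<k + M. ?g m) \<longlonglongrightarrow> blinfun_apply X x"
      using LIMSEQ_ignore_initial_segment [OF svec_expansion [OF Xb sch, of x], of M] .
    moreover have "(\<Sum>m<k + M. ?g m) = (\<Sum>m<M. ?g m) + (\<Sum>m<k. ?g (M + m))" for k
      by (induction k) (simp_all add: add.commute add.left_commute)
    moreover have "(\<Sum>m<M. ?g m) = blinfun_apply F x"
      by (simp add: F_def ocomp_def blinfun.sum_right bounded_opsD [OF Xb] svec_apply [OF Xb sch] scaleR_scaleC scaleC_scaleC mult.commute)
    ultimately have "(\<lambda>k. blinfun_apply F x + (\<Sum>m<k. ?g (M + m))) \<longlonglongrightarrow> blinfun_apply X x" by simp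
    then have "(\<lambda>k. blinfun_apply F x + (\<Sum>m<k. ?g (M + m)) - blinfun_apply F x) \<longlonglongrightarrow> blinfun_apply X x - blinfun_apply F x"
      by (intro tendsto_diff tendsto_const)
    then show ?thesis by (simp add: blinfun.diff_left)
  qed
  have shift: "(\<Sum>m<k. g (M + m)) \<le> B" if "(\<Sum>m<M + k. g m) \<le> B" "\<And>m. g m \<ge> 0" for g :: "nat \<Rightarrow> real" and k B
  proof -
    have "(\<Sum>m<k. g (M + m)) = (\<Sum>m\<in>{M..<M + k}. g m)"
      using sum.shift_bounds_nat_ivl [of g 0 M k] by (simp add: atLeast0LessThan add.commute)
    also have "\<dots> \<le> (\<Sum>m<M + k. g m)" using that(2) by (intro sum_mono2) auto
    finally show ?thesis using that(1) by simp
  qed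
  have "mac_bdd (X - F) d"
    unfolding mac_bdd_def
  proof (intro allI impI)
    fix k and u v :: "nat \<Rightarrow> 'h" assume uv: "orthn k u" "orthn k v"
    have "(\<Sum>j<k. cmod (cinner (blinfun_apply (X - F) (blinfun_apply id_blinfun (u j))) (blinfun_apply id_blinfun (v j))) / real (Suc j))
      \<le> norm (id_blinfun :: 'h \<Rightarrow>\<^sub>L 'h) * norm (id_blinfun :: 'h \<Rightarrow>\<^sub>L 'h) * (\<Sum>j<k. s (M + j) / real (Suc j))"
    proof (rule ky_fan [OF exp])
      show "decseq (\<lambda>m. s (M + m))" using schmidt_antimono [OF sch] by (simp add: decseq_def)
      show "(\<Sum>m<k. (cmod (cinner x (e (M + m))))\<^sup>2) \<le> (norm x)\<^sup>2" for x k
        by (rule shift [OF bessel [OF schmidtD(1) [OF sch]]]) simp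
      show "(\<Sum>m<k. (cmod (cinner (?f m) x))\<^sup>2) \<le> (norm x)\<^sup>2" for x k
        by (rule shift [OF svec_bessel [OF Xb sch]]) simp
      show "norm (e (M + m)) \<le> 1" for m
        using orthn_norm [OF schmidtD(1) [OF sch, of "Suc (M + m)"], of "M + m"] by simp
    qed (rule s0 svec_norm [OF Xb sch] bounded_ops_id uv)+
    also have "\<dots> \<le> 1 * 1 * d"
      by (intro mult_mono norm_blinfun_id_le tail) (use s0 in \<open>auto intro: sum_nonneg\<close>)
    finally show "(\<Sum>j<k. cmod (cinner (blinfun_apply (X - F) (u j)) (v j)) / real (Suc j)) \<le> d" by simp
  qed
  then show ?thesis using F by blast
qed

end

text \<open>Here the logarithm enters. With P the projection onto the N-dimensional space, the j-th
  coefficient is at most \<open>norm X\<close> times the norms of P applied to the j-th test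
  vectors. These products of norms are at most 1 and by Bessel sum to at most N, so the weights
  1/(j+1) contribute no more than the N-th harmonic number.\<close>

lemma mac_bdd_corner:
  fixes X :: "'h::complex_hilbert \<Rightarrow>\<^sub>L 'h"
  assumes w: "orthn N w" and X: "X = oproj N w o\<^sub>L X o\<^sub>L oproj N w"
  shows "mac_bdd X (norm X * (\<Sum>j<N. inverse (real (Suc j))))"
  unfolding mac_bdd_def
proof (intro allI impI)
  fix k and u v :: "nat \<Rightarrow> 'h" assume uv: "orthn k u" "orthn k v"
  have sq: "(\<Sum>j<k. (norm (ocomp N w (u j)))\<^sup>2) \<le> (sqrt (real N))\<^sup>2" if u: "orthn k u" for u :: "nat \<Rightarrow> 'h"
  proof -
    have "(\<Sum>j<k. (norm (ocomp N w (u j)))\<^sup>2) = (\<Sum>i<N. \<Sum>j<k. (cmod (cinner (u j) (w i)))\<^sup>2)"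
      unfolding norm_ocomp [OF w] by (rule sum.swap)
    also have "\<dots> \<le> (\<Sum>i<N. 1)"
    proof (rule sum_mono)
      fix i assume "i \<in> {..<N}"
      then show "(\<Sum>j<k. (cmod (cinner (u j) (w i)))\<^sup>2) \<le> 1"
        using bessel' [OF u, of "w i"] orthn_norm [OF w, of i] by simp
    qed
    finally show ?thesis by simp
  qed
  have le1: "norm (ocomp N w (u j)) \<le> 1" if "orthn k u" "j < k" for u :: "nat \<Rightarrow> 'h" and j
    using norm_ocomp_le [OF w, of "u j"] orthn_norm [OF that] by simp
  have cw: "cinner (ocomp N w x) y = cinner x (ocomp N w y)" for x y
    using cinner_adj [OF oproj_in, of N w x y] by simp
  have "cmod (cinner (blinfun_apply X (u j)) (v j)) \<le> norm X * (norm (ocomp N w (u j)) * norm (ocomp N w (v j)))" for j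
  proof -
    have "blinfun_apply X (u j) = ocomp N w (blinfun_apply X (ocomp N w (u j)))"
      using arg_cong [OF X, of "\<lambda>Z. blinfun_apply Z (u j)"] by simp
    then have "cmod (cinner (blinfun_apply X (u j)) (v j)) = cmod (cinner (blinfun_apply X (ocomp N w (u j))) (ocomp N w (v j)))"
      by (simp add: cw)
    also have "\<dots> \<le> norm (blinfun_apply X (ocomp N w (u j))) * norm (ocomp N w (v j))" by (rule cinner_bound)
    also have "\<dots> \<le> norm X * norm (ocomp N w (u j)) * norm (ocomp N w (v j))"
      by (intro mult_right_mono norm_blinfun) simp
    finally show ?thesis by (simp add: mult.assoc)
  qed
  then have "(\<Sum>j<k. cmod (cinner (blinfun_apply X (u j)) (v j)) / real (Suc j))
      \<le> (\<Sum>j<k. norm X * (norm (ocomp N w (u j)) * norm (ocomp N w (v j))) / real (Suc j))"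
    by (intro sum_mono divide_right_mono) auto
  also have "\<dots> = norm X * (\<Sum>j<k. inverse (real (Suc j)) * (norm (ocomp N w (u j)) * norm (ocomp N w (v j))))"
    by (simp add: sum_distrib_left divide_inverse mult_ac)
  also have "(\<Sum>j<k. inverse (real (Suc j)) * (norm (ocomp N w (u j)) * norm (ocomp N w (v j)))) \<le> 1 * (\<Sum>j<N. inverse (real (Suc j)))"
  proof (rule sum_rearrangement_bound)
    show "decseq (\<lambda>j. inverse (real (Suc j)))" by (intro decseq_SucI le_imp_inverse_le) auto
    have "(\<Sum>j<k. norm (ocomp N w (u j)) * norm (ocomp N w (v j))) \<le> sqrt (real N) * sqrt (real N)"
      by (intro cauchy_schwarz_sum sq uv) auto
    then show "(\<Sum>j<k. norm (ocomp N w (u j)) * norm (ocomp N w (v j))) \<le> real N * 1" by simp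
    show "norm (ocomp N w (u j)) * norm (ocomp N w (v j)) \<le> 1" if "j < k" for j
      using mult_mono [OF le1 [OF uv(1) that] le1 [OF uv(2) that]] by simp
  qed auto
  finally show "(\<Sum>j<k. cmod (cinner (blinfun_apply X (u j)) (v j)) / real (Suc j))
      \<le> norm X * (\<Sum>j<N. inverse (real (Suc j)))" by (simp add: mult_left_mono)
qed

text \<open>Adding the adjoints to the family turns a projection that fixes all ranges into one that
  is absorbed from both sides.\<close>

lemma finite_rank_corner:
  assumes "finite F" "F \<subseteq> finite_rank_ops"
  obtains k u where "orthn k u"
    "\<And>X. X \<in> F \<Longrightarrow> oproj k u o\<^sub>L X = X" "\<And>X. X \<in> F \<Longrightarrow> X o\<^sub>L oproj k u = X"
proof -
  have sub: "F \<union> adj_op ` F \<subseteq> finite_rank_ops" using assms(2) finite_rank_adj by auto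
  have fin: "finite (F \<union> adj_op ` F)" using assms(1) by simp
  obtain k u where u: "orthn k u"
    and u_fix: "\<And>X x. X \<in> F \<union> adj_op ` F \<Longrightarrow> ocomp k u (blinfun_apply X x) = blinfun_apply X x"
    by (rule finite_rank_obtain [OF fin sub]) blast
  have 1: "oproj k u o\<^sub>L X = X" if "X \<in> F \<union> adj_op ` F" for X
    by (rule blinfun_eqI) (simp add: u_fix [OF that])
  have 2: "X o\<^sub>L oproj k u = X" if "X \<in> F" for X
  proof -
    have Xb: "X \<in> bounded_ops" using that assms(2) by auto
    have "adj_op (oproj k u o\<^sub>L adj_op X) = adj_op (adj_op X)" using 1 [of "adj_op X"] that by simp
    then show ?thesis using Xb by (simp add: adj_op_compose)
  qed
  show ?thesis by (rule that [OF u]) (use 1 2 in blast)+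
qed

lemma finite_rank_mac_bdd:
  assumes "X \<in> finite_rank_ops" shows "\<exists>C. mac_bdd X C"
proof -
  have "{X} \<subseteq> finite_rank_ops" using assms by simp
  note finite_rank_corner [OF _ this]
  then obtain k u where u: "orthn k u" "oproj k u o\<^sub>L X = X" "X o\<^sub>L oproj k u = X"
    by (metis finite.emptyI finite.insertI singletonI)
  then have "X = oproj k u o\<^sub>L X o\<^sub>L oproj k u" by simp
  then show ?thesis using mac_bdd_corner [OF u(1)] by blast
qed

lemma (in infinite_dim) finite_rank_macaev:
  fixes X :: "'h \<Rightarrow>\<^sub>L 'h"
  shows "X \<in> finite_rank_ops \<Longrightarrow> X \<in> macaev_ideal"
  using finite_rank_mac_bdd macaev_idealI finite_rank_compact by blast

section \<open>Finite rank operators almost commuting with a tuple\<close>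

lemma harmonic_le_ln: "N > 0 \<Longrightarrow> (\<Sum>j<N. inverse (real (Suc j))) \<le> 1 + ln (real N)"
proof (induction N)
  case (Suc N)
  show ?case
  proof (cases "N = 0")
    case False
    have "ln (real N / real (Suc N)) \<le> real N / real (Suc N) - 1"
      using False by (intro ln_le_minus_one) simp
    also have "\<dots> = - inverse (real (Suc N))" by (simp add: field_simps)
    finally have "inverse (real (Suc N)) \<le> ln (real (Suc N)) - ln (real N)"
      using False by (simp add: ln_div)
    then show ?thesis using Suc False by simp
  qed simp
qed simp

text \<open>The images of S under words of length at most k in the tuple. Keeping the shorter words
  makes the spans increase with k, at the price of a factor n + 1 in the count per step.\<close>

fun word_vectors :: "nat \<Rightarrow> (nat \<Rightarrow> 'h::complex_hilbert \<Rightarrow>\<^sub>L 'h) \<Rightarrow> 'h set \<Rightarrow> nat \<Rightarrow> 'h set" where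
  "word_vectors n T S 0 = S"
| "word_vectors n T S (Suc k) = word_vectors n T S k \<union> (\<Union>j\<in>{1..n}. blinfun_apply (T j) ` word_vectors n T S k)"

lemma finite_word_vectors: "finite S \<Longrightarrow> finite (word_vectors n T S k)"
  by (induction k) auto

lemma card_word_vectors:
  assumes "finite S" shows "card (word_vectors n T S k) \<le> card S * (n + 1) ^ k"
proof (induction k)
  case (Suc k)
  let ?W = "word_vectors n T S k"
  have "card (word_vectors n T S (Suc k)) \<le> card ?W + card (\<Union>j\<in>{1..n}. blinfun_apply (T j) ` ?W)"
    by (simp add: card_Un_le)
  also have "card (\<Union>j\<in>{1..n}. blinfun_apply (T j) ` ?W) \<le> (\<Sum>j\<in>{1..n}. card (blinfun_apply (T j) ` ?W))"
    by (rule card_UN_le) simp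
  also have "\<dots> \<le> (\<Sum>j\<in>{1..n}. card ?W)"
    by (intro sum_mono card_image_le finite_word_vectors assms)
  finally have "card (word_vectors n T S (Suc k)) \<le> card ?W * (n + 1)" by (simp add: mult.commute)
  also have "\<dots> \<le> (card S * (n + 1) ^ k) * (n + 1)" using Suc by (intro mult_right_mono) auto
  finally show ?case by (simp add: mult_ac)
qed simp

lemma span_image_subset:
  assumes X: "X \<in> bounded_ops" and sub: "blinfun_apply X ` S \<subseteq> cspan S'" and x: "x \<in> cspan S"
  shows "blinfun_apply X x \<in> cspan S'"
  using x
proof (induction rule: complex_vs.span_induct_alt)
  case base then show ?case by (simp add: blinfun.zero_right complex_vs.span_zero)
next
  case (step c x y)
  have "blinfun_apply X x \<in> cspan S'" using sub step(1) by blast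
  then show ?case
    unfolding blinfun.add_right bounded_opsD [OF X] using step by (intro complex_vs.span_add complex_vs.span_scale)
qed

text \<open>\<open>R k\<close> are the increments of an increasing chain of projections \<open>P\<close>; an operator which moves each step of
  the chain by at most one is block tridiagonal, and its lower diagonal has norm at most that of the operator.\<close>

lemma norm_lower_diagonal:
  fixes P :: "nat \<Rightarrow> 'h::complex_hilbert \<Rightarrow>\<^sub>L 'h"
  assumes P: "\<And>k. P k \<in> bounded_ops" "\<And>k. adj_op (P k) = P k"
    and chain: "\<And>k l. k \<le> l \<Longrightarrow> P l o\<^sub>L P k = P k" "\<And>k l. k \<le> l \<Longrightarrow> P k o\<^sub>L P l = P k"
    and P1: "\<And>k. norm (P k) \<le> 1"
    and T: "\<And>k. P (Suc k) o\<^sub>L T o\<^sub>L P k = T o\<^sub>L P k"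
  shows "norm (\<Sum>k<m. (P (Suc k) - P k) o\<^sub>L T o\<^sub>L P k) \<le> norm T"
proof -
  have Px: "norm (blinfun_apply (P k) x) \<le> norm x" for k x
    using norm_blinfun [of "P k" x] mult_right_mono [OF P1 [of k], of "norm x"] by simp
  define R where "R = (\<lambda>k. if k = 0 then P 0 else P k - P (k - 1))"
  have P2: "blinfun_apply (P l) (blinfun_apply (P k) x) = blinfun_apply (P (min k l)) x" for k l x
    using chain [of k l] chain [of l k] by (metis blinfun_apply_blinfun_compose min.absorb1 min.absorb2 nat_le_linear)
  have Pc: "cinner (blinfun_apply (P k) x) y = cinner x (blinfun_apply (P k) y)" for k x y
    using cinner_adj [OF P(1) [of k], of x y] P(2) by simp
  \<comment> \<open>T carries the range of \<open>P l\<close> into that of \<open>P (Suc l)\<close>,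
    so \<open>P (Suc k) - P k\<close> annihilates everything coming from below the last increment of
    \<open>P k\<close>.\<close>
  have R_term: "(P (Suc k) - P k) o\<^sub>L T o\<^sub>L P k = R (Suc k) o\<^sub>L T o\<^sub>L R k" for k
  proof (cases k)
    case (Suc l)
    have "(P (Suc k) - P k) o\<^sub>L T o\<^sub>L P l = (P (Suc k) - P k) o\<^sub>L (P k o\<^sub>L T o\<^sub>L P l)"
      using T [of l] Suc by (simp add: compose_assoc)
    also have "\<dots> = ((P (Suc k) - P k) o\<^sub>L P k) o\<^sub>L (T o\<^sub>L P l)" by (simp add: compose_assoc)
    also have "\<dots> = 0" using chain [of k "Suc k"] chain [of k k] by (simp add: compose_diff_left)
    finally show ?thesis using Suc by (simp add: R_def compose_diff_right)
  qed (simp add: R_def)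
  \<comment> \<open>The increments have mutually orthogonal ranges; squared norms therefore add up
    on the domain side here and on the range side in \<open>sumR\<close>.\<close>
  have pyth: "(\<Sum>i<Suc k. (norm (blinfun_apply (R i) x))\<^sup>2) = (norm (blinfun_apply (P k) x))\<^sup>2" for k x
  proof (induction k)
    case (Suc k)
    have "cinner (blinfun_apply (P k) x) (blinfun_apply (R (Suc k)) x) = 0"
      by (simp add: R_def Pc blinfun.diff_left blinfun.diff_right cinner_diff_right P2)
    moreover have "blinfun_apply (P (Suc k)) x = blinfun_apply (P k) x + blinfun_apply (R (Suc k)) x"
      by (simp add: R_def blinfun.diff_left)
    ultimately have "(norm (blinfun_apply (P (Suc k)) x))\<^sup>2 = (norm (blinfun_apply (P k) x))\<^sup>2 + (norm (blinfun_apply (R (Suc k)) x))\<^sup>2"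
      by (simp only: norm_add_sq) simp
    then show ?case using Suc by simp
  qed (simp add: R_def)
  have sumR: "(norm (\<Sum>k<m. blinfun_apply (R (Suc k)) (y k)))\<^sup>2 = (\<Sum>k<m. (norm (blinfun_apply (R (Suc k)) (y k)))\<^sup>2)" for y m
  proof (induction m)
    case (Suc m)
    have "cinner (blinfun_apply (R (Suc k)) (y k)) (blinfun_apply (R (Suc m)) (y m)) = 0" if "k < m" for k
      using that by (simp add: R_def Pc blinfun.diff_left blinfun.diff_right cinner_diff_left cinner_diff_right P2)
    then have "cinner (\<Sum>k<m. blinfun_apply (R (Suc k)) (y k)) (blinfun_apply (R (Suc m)) (y m)) = 0"
      by (simp add: cinner_sum_left)
    then show ?case using Suc by (simp add: norm_add_sq)
  qed simp
  have R1: "norm (blinfun_apply (R k) x) \<le> norm x" for k x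
  proof (rule power2_le_imp_le)
    have "(norm (blinfun_apply (R k) x))\<^sup>2 \<le> (\<Sum>i<Suc k. (norm (blinfun_apply (R i) x))\<^sup>2)"
      by (rule member_le_sum) auto
    also have "\<dots> \<le> (norm x)\<^sup>2" unfolding pyth
      by (intro power_mono Px) simp
    finally show "(norm (blinfun_apply (R k) x))\<^sup>2 \<le> (norm x)\<^sup>2" .
  qed simp
  show ?thesis
  proof (rule norm_blinfun_bound)
    fix x
    let ?D = "\<Sum>k<m. (P (Suc k) - P k) o\<^sub>L T o\<^sub>L P k"
    have "blinfun_apply ?D x = (\<Sum>k<m. blinfun_apply (R (Suc k)) (blinfun_apply T (blinfun_apply (R k) x)))"
      unfolding R_term by (simp add: blinfun.sum_left)
    then have "(norm (blinfun_apply ?D x))\<^sup>2 = (\<Sum>k<m. (norm (blinfun_apply (R (Suc k)) (blinfun_apply T (blinfun_apply (R k) x))))\<^sup>2)"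
      using sumR by simp
    also have "\<dots> \<le> (\<Sum>k<m. (norm T)\<^sup>2 * (norm (blinfun_apply (R k) x))\<^sup>2)"
    proof (rule sum_mono)
      fix k
      have "norm (blinfun_apply (R (Suc k)) (blinfun_apply T (blinfun_apply (R k) x))) \<le> norm T * norm (blinfun_apply (R k) x)"
        by (rule order_trans [OF R1 norm_blinfun])
      then have "(norm (blinfun_apply (R (Suc k)) (blinfun_apply T (blinfun_apply (R k) x))))\<^sup>2 \<le> (norm T * norm (blinfun_apply (R k) x))\<^sup>2"
        by (rule power_mono) simp
      then show "(norm (blinfun_apply (R (Suc k)) (blinfun_apply T (blinfun_apply (R k) x))))\<^sup>2 \<le> (norm T)\<^sup>2 * (norm (blinfun_apply (R k) x))\<^sup>2"
        by (simp only: power_mult_distrib)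
    qed
    also have "\<dots> = (norm T)\<^sup>2 * (\<Sum>k<m. (norm (blinfun_apply (R k) x))\<^sup>2)" by (simp only: sum_distrib_left)
    also have "\<dots> \<le> (norm T)\<^sup>2 * (norm x)\<^sup>2"
    proof (rule mult_left_mono)
      have "(\<Sum>k<m. (norm (blinfun_apply (R k) x))\<^sup>2) \<le> (\<Sum>k<Suc m. (norm (blinfun_apply (R k) x))\<^sup>2)" by simp
      also have "\<dots> \<le> (norm x)\<^sup>2" unfolding pyth
        by (intro power_mono Px) simp
      finally show "(\<Sum>k<m. (norm (blinfun_apply (R k) x))\<^sup>2) \<le> (norm x)\<^sup>2" .
    qed simp
    finally have "(norm (blinfun_apply ?D x))\<^sup>2 \<le> (norm T * norm x)\<^sup>2" by (simp only: power_mult_distrib)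
    then show "norm (blinfun_apply ?D x) \<le> norm T * norm x" by (rule power2_le_imp_le) simp
  qed simp
qed

lemma word_vectors_mono: "k \<le> l \<Longrightarrow> word_vectors n T S k \<subseteq> word_vectors n T S l"
  by (rule lift_Suc_mono_le) auto

text \<open>The constant in the commutator bound does not depend on \<open>S\<close>: averaging the projections onto the first \<open>m\<close>
  spaces of word vectors makes the commutators of norm \<open>O(1/m)\<close>, while their rank, and hence the exponential of
  the relevant harmonic sum, grows only exponentially in \<open>m\<close>.\<close>

theorem almost_commuting_finite_rank:
  fixes T :: "nat \<Rightarrow> 'h::complex_hilbert \<Rightarrow>\<^sub>L 'h"
  assumes herm: "\<And>j. j \<in> {1..n} \<Longrightarrow> hermitian_op (T j)"
    and M: "\<And>j. j \<in> {1..n} \<Longrightarrow> norm (T j) \<le> M" and M0: "M \<ge> 0" and S: "finite S"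
  shows "\<exists>A\<in>finite_rank_ops. norm A \<le> 1 \<and> (\<forall>x\<in>cspan S. blinfun_apply A x = x) \<and>
    (\<forall>j\<in>{1..n}. mac_bdd (commutator_op A (T j)) (2 * M * (1 + ln (real n + 1))))"
proof -
  let ?W = "word_vectors n T S"
  have "\<forall>k. \<exists>d u. orthn d u \<and> d \<le> card (?W k) \<and> cspan (u ` {..<d}) = cspan (?W k)"
    using gram_schmidt [OF finite_word_vectors [OF S]] by metis
  then obtain D U where DU: "\<And>k. orthn (D k) (U k)" "\<And>k. D k \<le> card (?W k)"
    "\<And>k. cspan (U k ` {..<D k}) = cspan (?W k)" by metis
  define P where "P = (\<lambda>k. oproj (D k) (U k))"
  have Pb: "P k \<in> bounded_ops" and Padj: "adj_op (P k) = P k" and P1: "norm (P k) \<le> 1"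
    and Pf: "P k \<in> finite_rank_ops" for k
    by (simp_all add: P_def norm_oproj_le DU(1))
  have Pin: "blinfun_apply (P k) x \<in> cspan (?W k)" for k x
    using ocomp_in_span [of "D k" "U k" x] DU(3) [of k] by (simp add: P_def)
  have Pfix: "blinfun_apply (P k) x = x" if "x \<in> cspan (?W k)" for k x
    using ocomp_span [OF DU(1) [of k], of x] that DU(3) [of k] by (simp add: P_def)
  have chain1: "P l o\<^sub>L P k = P k" if "k \<le> l" for k l
    using Pin [of k] complex_vs.span_mono [OF word_vectors_mono [OF that, of n T S]]
    by (intro blinfun_eqI) (auto intro!: Pfix)
  have chain2: "P k o\<^sub>L P l = P k" if "k \<le> l" for k l
    using arg_cong [OF chain1 [OF that], of adj_op] by (simp add: adj_op_compose Pb Padj)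
  \<comment> \<open>The number m of averaged projections is taken to dominate the logarithm of the
    size of S, and this removes S from the final bound.\<close>
  obtain m where m0: "m > 0" and m: "1 + ln (real (card S) + 1) \<le> real m"
    using real_arch_simple [of "1 + ln (real (card S) + 1)"]
    by (metis One_nat_def Suc_le_lessD le_add2 le_add_same_cancel1 of_nat_0_le_iff of_nat_Suc order_trans plus_1_eq_Suc zero_le zero_less_Suc add_increasing zero_le_one linorder_not_le nat_less_le gr0I ln_ge_zero not_one_le_zero of_nat_0 le_add_same_cancel2)
  define A where "A = inverse (real m) *\<^sub>R (\<Sum>k<m. P k)"
  have A_fr: "A \<in> finite_rank_ops"
    unfolding A_def using finite_rank_scaleO [OF finite_rank_sum, of "{..<m}" P "of_real (inverse (real m))"] Pf
    by (simp only: scaleO_of_real)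
  have "norm A \<le> inverse (real m) * (\<Sum>k<m. norm (P k))"
    unfolding A_def using norm_sum [of P "{..<m}"] by (simp add: mult_left_mono)
  also have "\<dots> \<le> inverse (real m) * (\<Sum>k<m. 1)"
    by (intro mult_left_mono sum_mono P1) auto
  also have "\<dots> = 1" using m0 by simp
  finally have A1: "norm A \<le> 1" .
  have A_fix: "blinfun_apply A x = x" if "x \<in> cspan S" for x
  proof -
    have "blinfun_apply (P k) x = x" for k
      using that complex_vs.span_mono [OF word_vectors_mono [of 0 k n T S]] by (intro Pfix) auto
    then have "blinfun_apply A x = inverse (real m) *\<^sub>R (\<Sum>k<m. x)"
      by (simp add: A_def blinfun.scaleR_left blinfun.sum_left)
    also have "(\<Sum>k<m. x) = real m *\<^sub>R x" by (simp add: sum_constant_scaleR)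
    finally show ?thesis using m0 by simp
  qed
  have bound: "mac_bdd (commutator_op A (T j)) (2 * M * (1 + ln (real n + 1)))" if j: "j \<in> {1..n}" for j
  proof -
    have Tb: "T j \<in> bounded_ops" and Tadj: "adj_op (T j) = T j"
      using herm [OF j] by (simp_all add: hermitian_op_def)
    have Tstep: "P (Suc k) o\<^sub>L T j o\<^sub>L P k = T j o\<^sub>L P k" for k
    proof (rule blinfun_eqI)
      fix x
      have "blinfun_apply (T j) ` ?W k \<subseteq> cspan (?W (Suc k))"
        using j by (auto intro!: complex_vs.span_base)
      then have "blinfun_apply (T j) (blinfun_apply (P k) x) \<in> cspan (?W (Suc k))"
        by (rule span_image_subset [OF Tb _ Pin])
      then show "blinfun_apply (P (Suc k) o\<^sub>L T j o\<^sub>L P k) x = blinfun_apply (T j o\<^sub>L P k) x"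
        by (simp add: Pfix)
    qed
    define L where "L = (\<Sum>k<m. (P (Suc k) - P k) o\<^sub>L T j o\<^sub>L P k)"
    have Lb: "L \<in> bounded_ops"
      unfolding L_def by (intro bounded_ops_sum bounded_ops_compose bounded_ops_diff Pb Tb)
    have nL: "norm L \<le> norm (T j)"
      unfolding L_def by (rule norm_lower_diagonal [where P = P and T = "T j"])
        (fact Pb Padj chain1 chain2 P1 Tstep)+
    have Tstep': "P k o\<^sub>L T j o\<^sub>L P (Suc k) = P k o\<^sub>L T j" for k
      using arg_cong [OF Tstep [of k], of adj_op]
      by (simp add: adj_op_compose Pb Padj Tb Tadj bounded_ops_compose compose_assoc)
    have adjL: "adj_op L = (\<Sum>k<m. P k o\<^sub>L T j o\<^sub>L (P (Suc k) - P k))"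
      unfolding L_def
      by (simp add: adj_op_sum adj_op_compose adj_op_diff Pb Padj Tb Tadj bounded_ops_compose bounded_ops_diff compose_assoc)
    \<comment> \<open>Each commutator involves only the step from \<open>P k\<close> to
      \<open>P (Suc k)\<close> and its adjoint. The sum over k is thus \<open>adj_op L - L\<close>,
      whose norm does not grow with m, and the average gains the factor 1/m.\<close>
    have "(P k o\<^sub>L T j) - (T j o\<^sub>L P k)
        = (P k o\<^sub>L T j o\<^sub>L (P (Suc k) - P k)) - ((P (Suc k) - P k) o\<^sub>L T j o\<^sub>L P k)" for k
      using Tstep [of k] Tstep' [of k] by (simp add: compose_algebra)
    then have "(\<Sum>k<m. (P k o\<^sub>L T j) - (T j o\<^sub>L P k)) = adj_op L - L"
      unfolding adjL unfolding L_def by (simp only: sum_subtractf)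
    moreover have "commutator_op A (T j) = inverse (real m) *\<^sub>R (\<Sum>k<m. (P k o\<^sub>L T j) - (T j o\<^sub>L P k))"
      unfolding commutator_op_def A_def
      by (intro blinfun_eqI) (simp add: blinfun.bilinear_simps blinfun.sum_left blinfun.sum_right sum_subtractf scaleR_diff_right scaleR_sum_right)
    ultimately have comm: "commutator_op A (T j) = inverse (real m) *\<^sub>R (adj_op L - L)" by simp
    have Pm: "P m o\<^sub>L (P (Suc k) - P k) = P (Suc k) - P k" if "k < m" for k
      using that by (simp add: compose_diff_right chain1)
    have LP: "L o\<^sub>L P m = L" "P m o\<^sub>L L = L"
      unfolding L_def compose_sum_left compose_sum_right
      by (intro sum.cong refl; simp add: compose_assoc chain2)
        (intro sum.cong refl; simp add: Pm flip: compose_assoc)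
    have LP': "P m o\<^sub>L adj_op L = adj_op L" "adj_op L o\<^sub>L P m = adj_op L"
      using arg_cong [OF LP(1), of adj_op] arg_cong [OF LP(2), of adj_op]
      by (simp_all add: adj_op_compose Pb Padj Lb)
    have "commutator_op A (T j) = P m o\<^sub>L commutator_op A (T j) o\<^sub>L P m"
    proof -
      have "P m o\<^sub>L (adj_op L - L) o\<^sub>L P m = adj_op L - L"
        by (simp add: compose_algebra LP LP')
      moreover have "P m o\<^sub>L (inverse (real m) *\<^sub>R (adj_op L - L)) o\<^sub>L P m
          = inverse (real m) *\<^sub>R (P m o\<^sub>L (adj_op L - L) o\<^sub>L P m)"
        by (intro blinfun_eqI) (simp add: blinfun.bilinear_simps)
      ultimately show ?thesis unfolding comm by simp
    qed
    then have b: "mac_bdd (commutator_op A (T j)) (norm (commutator_op A (T j)) * (\<Sum>i<D m. inverse (real (Suc i))))"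
      unfolding P_def by (rule mac_bdd_corner [OF DU(1)])
    have nc: "norm (commutator_op A (T j)) \<le> inverse (real m) * (2 * M)"
    proof -
      have "norm (adj_op L - L) \<le> norm (adj_op L) + norm L" by (rule norm_triangle_ineq4)
      also have "\<dots> \<le> 2 * M" using nL M [OF j] Lb by simp
      finally show ?thesis unfolding comm by (simp add: mult_left_mono)
    qed
    \<comment> \<open>A bound for the rank of the top projection, exponential in m; 1 is added to
      \<open>card S\<close> so that N is positive and has a logarithm.\<close>
    define N where "N = (card S + 1) * (n + 1) ^ m"
    have "D m \<le> N"
      using DU(2) [of m] card_word_vectors [OF S, of n T m] by (simp add: N_def)
    then have "(\<Sum>i<D m. inverse (real (Suc i))) \<le> (\<Sum>i<N. inverse (real (Suc i)))"
      by (intro sum_mono2) auto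
    also have "\<dots> \<le> 1 + ln (real N)" by (rule harmonic_le_ln) (simp add: N_def)
    also have "ln (real N) = ln (real (card S) + 1) + real m * ln (real n + 1)"
    proof -
      have "real N = (real (card S) + 1) * (real n + 1) ^ m" by (simp add: N_def add.commute distrib_right)
      moreover have "ln ((real (card S) + 1) * (real n + 1) ^ m) = ln (real (card S) + 1) + ln ((real n + 1) ^ m)"
        by (subst ln_mult) auto
      moreover have "ln ((real n + 1) ^ m) = real m * ln (real n + 1)" by (simp add: ln_realpow)
      ultimately show ?thesis by simp
    qed
    also have "1 + (ln (real (card S) + 1) + real m * ln (real n + 1)) \<le> real m * (1 + ln (real n + 1))"
      using m by (simp add: algebra_simps)
    finally have h: "(\<Sum>i<D m. inverse (real (Suc i))) \<le> real m * (1 + ln (real n + 1))" .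
    have "norm (commutator_op A (T j)) * (\<Sum>i<D m. inverse (real (Suc i)))
        \<le> inverse (real m) * (2 * M) * (real m * (1 + ln (real n + 1)))"
      by (intro mult_mono nc h sum_nonneg) (use M0 in auto)
    also have "\<dots> = 2 * M * (1 + ln (real n + 1))" using m0 by simp
    finally show ?thesis by (rule mac_bdd_mono [OF b])
  qed
  show ?thesis using A_fr A1 A_fix bound by blast
qed

section \<open>Commutators and the norm of the algebra of the tuple\<close>

lemma commutator_compose_left:
  "commutator_op (A o\<^sub>L X) T = (A o\<^sub>L commutator_op X T) + (commutator_op A T o\<^sub>L X)"
  by (simp add: commutator_op_def compose_algebra compose_assoc)

lemma commutator_diff_left: "commutator_op (X - Y) T = commutator_op X T - commutator_op Y T"
  by (simp add: commutator_op_def compose_algebra)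

lemma commutator_add_left: "commutator_op (X + Y) T = commutator_op X T + commutator_op Y T"
  by (simp add: commutator_op_def compose_algebra)

lemma commutator_minus_left: "commutator_op (- X) T = - commutator_op X T"
  by (simp add: commutator_op_def compose_algebra)

lemma commutator_swap: "commutator_op X T = - commutator_op T X"
  by (simp add: commutator_op_def)

lemma commutator_bounded: "X \<in> bounded_ops \<Longrightarrow> T \<in> bounded_ops \<Longrightarrow> commutator_op X T \<in> bounded_ops"
  by (simp add: commutator_op_def bounded_ops_diff bounded_ops_compose)

lemma commutator_compact: "X \<in> compact_ops \<Longrightarrow> T \<in> bounded_ops \<Longrightarrow> commutator_op X T \<in> compact_ops"
  by (simp add: commutator_op_def compact_ops_diff compact_ops_compose_left compact_ops_compose_right)

lemma commutator_finite_rank: "X \<in> finite_rank_ops \<Longrightarrow> T \<in> bounded_ops \<Longrightarrow> commutator_op X T \<in> finite_rank_ops"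
  by (simp add: commutator_op_def finite_rank_diff finite_rank_compose_left finite_rank_compose_right)

locale hermitian_tuple = infinite_dim H for H :: "'h::complex_hilbert itself" +
  fixes T :: "nat \<Rightarrow> 'h \<Rightarrow>\<^sub>L 'h" and n :: nat
  assumes n1: "n \<ge> 1" and herm_interval: "\<And>j. j \<in> {1..n} \<Longrightarrow> hermitian_op (T j)"
begin

definition J :: "nat set" where "J = {1..n}"

lemma herm: "j \<in> J \<Longrightarrow> hermitian_op (T j)" using herm_interval by (simp add: J_def)

lemma finite_J [simp]: "finite J" and J_ne [simp]: "J \<noteq> {}"
  using n1 by (auto simp: J_def)

lemma T_bounded: "j \<in> J \<Longrightarrow> T j \<in> bounded_ops" and T_adj: "j \<in> J \<Longrightarrow> adj_op (T j) = T j"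
  using herm by (simp_all add: hermitian_op_def)

definition E :: "('h \<Rightarrow>\<^sub>L 'h) set" where
  "E = {X \<in> bounded_ops. \<forall>j\<in>J. commutator_op X (T j) \<in> macaev_ideal}"

text \<open>The commutator part of the norm as an upper bound, the form in which it passes to sums,
  products and limits.\<close>

definition ecomm :: "('h \<Rightarrow>\<^sub>L 'h) \<Rightarrow> real \<Rightarrow> bool" where
  "ecomm X C \<longleftrightarrow> (\<forall>j\<in>J. mac_bdd (commutator_op X (T j)) C)"

definition T_bound :: real where "T_bound = Max ((\<lambda>j. norm (T j)) ` J)"

text \<open>The commutator constant of \<open>almost_commuting_finite_rank\<close>, determined by
  the tuple alone; it becomes the distortion between the two quotient norms.\<close>

definition C0 :: real where "C0 = 2 * T_bound * (1 + ln (real n + 1))"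

lemma T_bound: "j \<in> J \<Longrightarrow> norm (T j) \<le> T_bound"
  unfolding T_bound_def by (rule Max_ge) auto

lemma T_bound_nonneg: "T_bound \<ge> 0"
  using T_bound J_ne norm_ge_zero order_trans by blast

lemma C0_nonneg: "C0 \<ge> 0"
  unfolding C0_def using T_bound_nonneg by (intro mult_nonneg_nonneg) auto

lemma E_bounded: "X \<in> E \<Longrightarrow> X \<in> bounded_ops" by (simp add: E_def)

lemma E_comm: "X \<in> E \<Longrightarrow> j \<in> J \<Longrightarrow> commutator_op X (T j) \<in> macaev_ideal" by (simp add: E_def)

lemma E_I:
  assumes "X \<in> bounded_ops" "\<And>j. j \<in> J \<Longrightarrow> commutator_op X (T j) \<in> compact_ops" "ecomm X C"
  shows "X \<in> E"
  using assms macaev_idealI unfolding E_def ecomm_def by blast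

lemma finite_rank_E: "X \<in> finite_rank_ops \<Longrightarrow> X \<in> E"
  unfolding E_def by (simp add: finite_rank_macaev commutator_finite_rank T_bounded)

lemma ecomm_mono: "ecomm X C \<Longrightarrow> C \<le> D \<Longrightarrow> ecomm X D"
  unfolding ecomm_def using mac_bdd_mono by blast

lemma ecomm_nonneg: "ecomm X C \<Longrightarrow> C \<ge> 0"
  unfolding ecomm_def using mac_bdd_nonneg J_ne by blast

lemma ecomm_add: "ecomm X C \<Longrightarrow> ecomm Y D \<Longrightarrow> ecomm (X + Y) (C + D)"
  unfolding ecomm_def commutator_add_left using mac_bdd_add by blast

lemma ecomm_minus: "ecomm X C \<Longrightarrow> ecomm (- X) C"
  unfolding ecomm_def commutator_minus_left using mac_bdd_minus by blast

lemma commutator_scaleO: "j \<in> J \<Longrightarrow> commutator_op (scaleO c X) (T j) = scaleO c (commutator_op X (T j))"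
  by (simp add: commutator_op_def scaleO_diff_right scaleO_compose_left scaleO_compose_right T_bounded)

lemma ecomm_scaleO: "ecomm X C \<Longrightarrow> ecomm (scaleO c X) (cmod c * C)"
  unfolding ecomm_def by (simp add: commutator_scaleO mac_bdd_scaleO)

lemma commutator_adj: "X \<in> bounded_ops \<Longrightarrow> j \<in> J \<Longrightarrow> commutator_op (adj_op X) (T j) = - adj_op (commutator_op X (T j))"
  by (simp add: commutator_op_def adj_op_diff adj_op_compose bounded_ops_compose T_bounded T_adj)

lemma ecomm_adj: "X \<in> bounded_ops \<Longrightarrow> ecomm X C \<Longrightarrow> ecomm (adj_op X) C"
  unfolding ecomm_def by (simp add: commutator_adj mac_bdd_minus mac_bdd_adj commutator_bounded T_bounded)

lemma E_comm_compact: "X \<in> E \<Longrightarrow> j \<in> J \<Longrightarrow> commutator_op X (T j) \<in> compact_ops"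
  using E_comm macaev_compact by blast

text \<open>Membership in \<open>E\<close> is stated with the commutator of X and
  \<open>T j\<close>, the norm with the one of \<open>T j\<close> and X; Macaev bounds are blind to
  the sign.\<close>

lemma E_ecomm: "X \<in> E \<Longrightarrow> ecomm X (Max ((\<lambda>j. macaev_norm (commutator_op (T j) X)) ` J))"
  unfolding ecomm_def
proof
  fix j assume X: "X \<in> E" and j: "j \<in> J"
  have "commutator_op (T j) X = - commutator_op X (T j)" by (rule commutator_swap)
  have m: "mac_bdd (commutator_op X (T j)) (macaev_norm (commutator_op X (T j)))"
    by (rule macaev_norm_bdd [OF E_comm [OF X j]])
  have ci: "commutator_op (T j) X \<in> macaev_ideal"
    unfolding commutator_swap [of "T j" X]
    by (rule macaev_idealI [OF compact_ops_minus [OF E_comm_compact [OF X j]] mac_bdd_minus [OF m]])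
  have "mac_bdd (commutator_op X (T j)) (macaev_norm (commutator_op (T j) X))"
    using mac_bdd_minus [OF macaev_norm_bdd [OF ci]] unfolding commutator_swap [of X] .
  moreover have "macaev_norm (commutator_op (T j) X) \<le> Max ((\<lambda>j. macaev_norm (commutator_op (T j) X)) ` J)"
    using j by (intro Max_ge) auto
  ultimately show "mac_bdd (commutator_op X (T j)) (Max ((\<lambda>j. macaev_norm (commutator_op (T j) X)) ` J))"
    by (rule mac_bdd_mono)
qed

definition Enorm :: "('h \<Rightarrow>\<^sub>L 'h) \<Rightarrow> real" where
  "Enorm X = norm X + Max ((\<lambda>j. macaev_norm (commutator_op (T j) X)) ` J)"

lemma Enorm_le:
  assumes X: "X \<in> E" and C: "ecomm X C"
  shows "Enorm X \<le> norm X + C"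
proof -
  have "macaev_norm (commutator_op (T j) X) \<le> C" if j: "j \<in> J" for j
  proof -
    have b: "mac_bdd (commutator_op (T j) X) C"
      using C j mac_bdd_minus unfolding ecomm_def commutator_swap [of "T j" X] by blast
    have "commutator_op (T j) X \<in> compact_ops"
      unfolding commutator_swap [of "T j" X] by (rule compact_ops_minus [OF E_comm_compact [OF X j]])
    then show ?thesis using macaev_norm_le [OF macaev_idealI [OF _ b] b] by blast
  qed
  then have "Max ((\<lambda>j. macaev_norm (commutator_op (T j) X)) ` J) \<le> C"
    by (intro Max.boundedI) auto
  then show ?thesis by (simp add: Enorm_def)
qed

lemma ecomm_Enorm: "X \<in> E \<Longrightarrow> ecomm X (Enorm X - norm X)"
  using E_ecomm by (simp add: Enorm_def)

lemma norm_le_Enorm: "X \<in> E \<Longrightarrow> norm X \<le> Enorm X"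
  using ecomm_nonneg [OF ecomm_Enorm] by fastforce

lemma E_add: "X \<in> E \<Longrightarrow> Y \<in> E \<Longrightarrow> X + Y \<in> E"
  by (rule E_I [OF _ _ ecomm_add [OF E_ecomm E_ecomm]])
    (auto simp: commutator_add_left intro: bounded_ops_add compact_ops_add E_bounded E_comm_compact)

lemma E_scaleO: "X \<in> E \<Longrightarrow> scaleO c X \<in> E"
  by (rule E_I [OF _ _ ecomm_scaleO [OF E_ecomm]])
    (auto simp: commutator_scaleO intro: bounded_ops_scaleO compact_ops_scaleO E_bounded E_comm_compact)

lemma E_minus: "X \<in> E \<Longrightarrow> - X \<in> E"
  using E_scaleO [of X "-1"] scaleO_of_real [of "-1" X] by simp

lemma E_diff: "X \<in> E \<Longrightarrow> Y \<in> E \<Longrightarrow> X - Y \<in> E"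
  using E_add [of X "-Y"] E_minus [of Y] by simp

lemma E_adj: "X \<in> E \<Longrightarrow> adj_op X \<in> E"
  by (rule E_I [OF _ _ ecomm_adj [OF _ E_ecomm]])
    (auto simp: commutator_adj E_bounded intro!: compact_ops_minus compact_ops_adj E_comm_compact)

lemma ecomm_compose:
  assumes X: "X \<in> E" "ecomm X C" and Y: "Y \<in> E" "ecomm Y D"
  shows "ecomm (X o\<^sub>L Y) (norm X * D + norm Y * C)"
  unfolding ecomm_def
proof
  fix j assume j: "j \<in> J"
  show "mac_bdd (commutator_op (X o\<^sub>L Y) (T j)) (norm X * D + norm Y * C)"
    unfolding commutator_compose_left
    using X Y j E_bounded E_comm_compact
    by (intro mac_bdd_add mac_bdd_compose_left mac_bdd_compose_right) (auto simp: ecomm_def)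
qed

lemma E_compose: "X \<in> E \<Longrightarrow> Y \<in> E \<Longrightarrow> X o\<^sub>L Y \<in> E"
  by (rule E_I [OF _ _ ecomm_compose [OF _ E_ecomm _ E_ecomm]])
    (simp_all add: commutator_compose_left compact_ops_add compact_ops_compose_right [OF E_comm_compact]
      compact_ops_compose_left [OF E_comm_compact] bounded_ops_compose E_bounded)

lemma E_id: "id_blinfun \<in> E"
  by (rule E_I [where C = 0]) (auto simp: commutator_op_def ecomm_def mac_bdd_0)

lemma E_0 [simp]: "0 \<in> E"
  by (simp add: finite_rank_E)

lemma Enorm_add: "X \<in> E \<Longrightarrow> Y \<in> E \<Longrightarrow> Enorm (X + Y) \<le> Enorm X + Enorm Y"
  using Enorm_le [OF E_add ecomm_add [OF ecomm_Enorm ecomm_Enorm], of X Y] norm_triangle_ineq [of X Y] by simp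

lemma Enorm_minus: "X \<in> E \<Longrightarrow> Enorm (- X) = Enorm X"
  using Enorm_le [OF E_minus ecomm_minus [OF ecomm_Enorm], of X]
    Enorm_le [OF E_minus ecomm_minus [OF ecomm_Enorm], of "- X"] E_minus [of X] by simp

lemma Enorm_scaleO_le: "X \<in> E \<Longrightarrow> Enorm (scaleO c X) \<le> cmod c * Enorm X"
  using Enorm_le [OF E_scaleO ecomm_scaleO [OF ecomm_Enorm], of X c] by (simp add: norm_scaleO algebra_simps)

text \<open>The source of both density and closedness. Take an almost commuting A that fixes the
  range of a finite rank F close to X - Y. Then \<open>X - A X = (1 - A) (X - F)\<close> has norm
  about \<open>2 * norm Y\<close>. Its commutator is
  \<open>(1 - A) ([X, T] - G) - [A, T] (X - F)\<close>, where the first term is small because A also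
  fixes the range of the finite rank approximation G, and the second costs about
  \<open>C0 * norm Y\<close>.\<close>

lemma E_approx_modulo_compact:
  assumes X: "X \<in> E" and Y: "Y \<in> bounded_ops" and XY: "X - Y \<in> compact_ops" and d: "d > 0"
  shows "\<exists>G\<in>finite_rank_ops. norm (X - G) \<le> 2 * norm Y + d \<and> ecomm (X - G) (C0 * norm Y + d)"
proof -
  \<comment> \<open>Scaled so that \<open>2 * d' + C0 * d'\<close>, the error in the commutator
    estimate, is exactly d.\<close>
  define d' where "d' = d / (C0 + 2)"
  have d': "d' > 0" "2 * d' \<le> d" "C0 * d' + 2 * d' = d"
  proof -
    have p: "C0 + 2 > 0" using C0_nonneg by simp
    show "d' > 0" using d p by (simp add: d'_def)
    have e: "(C0 + 2) * d' = d" using p by (simp add: d'_def)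
    then show "C0 * d' + 2 * d' = d" by (simp add: algebra_simps)
    then show "2 * d' \<le> d" using C0_nonneg \<open>d' > 0\<close> by (smt (verit) mult_nonneg_nonneg)
  qed
  obtain F where F: "F \<in> finite_rank_ops" "norm (X - Y - F) \<le> d'"
    using compact_op_approx [OF XY d'(1)] by blast
  have "\<forall>j\<in>J. \<exists>G\<in>finite_rank_ops. mac_bdd (commutator_op X (T j) - G) d'"
    using macaev_finite_rank_approx [OF E_comm [OF X] d'(1)] by blast
  then obtain G where G: "\<And>j. j \<in> J \<Longrightarrow> G j \<in> finite_rank_ops"
    "\<And>j. j \<in> J \<Longrightarrow> mac_bdd (commutator_op X (T j) - G j) d'" by metis
  \<comment> \<open>Besides F and the \<open>G j\<close>, the operators
    \<open>T j o\<^sub>L F\<close> are to be fixed by A from the left: this makes the commutator of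
    A and \<open>T j\<close> vanish on the range of F.\<close>
  have fin: "finite ({F} \<union> G ` J \<union> (\<lambda>j. T j o\<^sub>L F) ` J)" by simp
  have sub: "{F} \<union> G ` J \<union> (\<lambda>j. T j o\<^sub>L F) ` J \<subseteq> finite_rank_ops"
    using F(1) G(1) finite_rank_compose_right [OF F(1) T_bounded] by blast
  obtain k u where u: "orthn k u"
    "\<And>Z x. Z \<in> {F} \<union> G ` J \<union> (\<lambda>j. T j o\<^sub>L F) ` J \<Longrightarrow> ocomp k u (blinfun_apply Z x) = blinfun_apply Z x"
    by (rule finite_rank_obtain [OF fin sub]) blast
  have fu: "finite (u ` {..<k})" by simp
  obtain A where A: "A \<in> finite_rank_ops" "norm A \<le> 1" "\<And>x. x \<in> cspan (u ` {..<k}) \<Longrightarrow> blinfun_apply A x = x"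
    "\<And>j. j \<in> J \<Longrightarrow> mac_bdd (commutator_op A (T j)) C0"
    using almost_commuting_finite_rank [where n = n and T = T and M = T_bound, OF herm_interval _ T_bound_nonneg fu]
      T_bound unfolding C0_def J_def by blast
  have Ab: "A \<in> bounded_ops" and Xb: "X \<in> bounded_ops" and Fb: "F \<in> bounded_ops" using A E_bounded [OF X] F by simp_all
  have Afix: "A o\<^sub>L Z = Z" if "Z \<in> {F} \<union> G ` J \<union> (\<lambda>j. T j o\<^sub>L F) ` J" for Z
  proof (rule blinfun_eqI)
    fix x
    have "blinfun_apply Z x \<in> cspan (u ` {..<k})" using ocomp_in_span [of k u "blinfun_apply Z x"] u(2) [OF that] by simp
    then show "blinfun_apply (A o\<^sub>L Z) x = blinfun_apply Z x" using A(3) by simp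
  qed
  have A2: "norm (id_blinfun - A) \<le> 2"
    using norm_triangle_ineq4 [of id_blinfun A] A(2) norm_blinfun_id_le [where ?'a = 'h] by linarith
  have nXF: "norm (X - F) \<le> norm Y + d'"
    using norm_triangle_ineq [of Y "X - Y - F"] F(2) by simp
  have XAX: "X - (A o\<^sub>L X) = (id_blinfun - A) o\<^sub>L (X - F)"
    using Afix [of F] by (simp add: compose_algebra)
  have 1: "norm (X - (A o\<^sub>L X)) \<le> 2 * norm Y + d"
  proof -
    have "norm (X - (A o\<^sub>L X)) \<le> 2 * (norm Y + d')"
      unfolding XAX by (rule norm_compose_le [OF A2 nXF])
    then show ?thesis using d' by simp
  qed
  have 2: "ecomm (X - (A o\<^sub>L X)) (C0 * norm Y + d)"
    unfolding ecomm_def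
  proof
    fix j assume j: "j \<in> J"
    have "commutator_op A (T j) o\<^sub>L F = 0"
    proof -
      have "A o\<^sub>L (T j o\<^sub>L F) = T j o\<^sub>L F" "A o\<^sub>L F = F" using Afix j by auto
      then show ?thesis by (simp add: commutator_op_def compose_algebra compose_assoc)
    qed
    moreover have "A o\<^sub>L G j = G j" using Afix j by auto
    ultimately have eq: "commutator_op (X - (A o\<^sub>L X)) (T j)
        = ((id_blinfun - A) o\<^sub>L (commutator_op X (T j) - G j)) - (commutator_op A (T j) o\<^sub>L (X - F))"
      by (simp add: commutator_diff_left commutator_compose_left compose_algebra)
    have "mac_bdd (commutator_op (X - (A o\<^sub>L X)) (T j)) (2 * d' + (norm Y + d') * C0)"
      unfolding eq
    proof (rule mac_bdd_diff)
      show "mac_bdd ((id_blinfun - A) o\<^sub>L (commutator_op X (T j) - G j)) (2 * d')"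
        using G(1) [OF j] E_comm_compact [OF X j] A2 Ab
        by (intro mac_bdd_compose_left G j) (auto intro!: compact_ops_diff bounded_ops_diff)
      show "mac_bdd (commutator_op A (T j) o\<^sub>L (X - F)) ((norm Y + d') * C0)"
        using nXF A(1) Xb Fb T_bounded [OF j]
        by (intro mac_bdd_compose_right A j) (auto intro!: bounded_ops_diff commutator_compact)
    qed
    then show "mac_bdd (commutator_op (X - (A o\<^sub>L X)) (T j)) (C0 * norm Y + d)"
      by (rule mac_bdd_mono) (use d' in \<open>simp add: algebra_simps\<close>)
  qed
  have "A o\<^sub>L X \<in> finite_rank_ops" by (rule finite_rank_compose_left [OF A(1) Xb])
  then show ?thesis using 1 2 by blast
qed

text \<open>Commutation with \<open>T j\<close> is continuous in operator norm, so compactness and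
  Macaev bounds of the partial sums pass to the limit. The one summable sequence \<open>c\<close>
  controls both parts of the norm.\<close>

lemma E_series:
  assumes D: "\<And>k. D k \<in> E" "\<And>k. norm (D k) \<le> c k" "\<And>k. ecomm (D k) (c k)" and c: "summable c"
  shows "summable D" "(\<Sum>k. D k) \<in> E"
proof -
  show sD: "summable D" by (rule summable_comparison_test' [OF c, of 0]) (simp add: D(2))
  have lim: "(\<lambda>m. \<Sum>k<m. D k) \<longlonglongrightarrow> (\<Sum>k. D k)" by (rule summable_LIMSEQ [OF sD])
  have c0: "c k \<ge> 0" for k using norm_ge_zero D(2) order_trans by blast
  have part: "(\<Sum>k<m. D k) \<in> E" "ecomm (\<Sum>k<m. D k) (\<Sum>k<m. c k)" for m
  proof (induction m)
    case 0
    show "(\<Sum>k<0. D k) \<in> E" by simp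
    show "ecomm (\<Sum>k<0. D k) (\<Sum>k<0. c k)" by (simp add: ecomm_def commutator_op_def mac_bdd_0)
  next
    case (Suc m)
    show "(\<Sum>k<Suc m. D k) \<in> E" using Suc(1) D(1) by (simp add: E_add)
    show "ecomm (\<Sum>k<Suc m. D k) (\<Sum>k<Suc m. c k)" using ecomm_add [OF Suc(2) D(3)] by simp
  qed
  have cl: "(\<lambda>m. commutator_op (\<Sum>k<m. D k) (T j)) \<longlonglongrightarrow> commutator_op (\<Sum>k. D k) (T j)" for j
    unfolding commutator_op_def
    by (intro tendsto_diff bounded_bilinear.tendsto [OF bounded_bilinear_blinfun_compose] lim tendsto_const)
  show "(\<Sum>k. D k) \<in> E"
  proof (rule E_I)
    show b: "(\<Sum>k. D k) \<in> bounded_ops"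
      using closed_sequentially [OF closed_bounded_ops _ lim] E_bounded part(1) by blast
    show "ecomm (\<Sum>k. D k) (suminf c)"
      unfolding ecomm_def
    proof
      fix j assume j: "j \<in> J"
      have "mac_bdd (commutator_op (\<Sum>k<m. D k) (T j)) (suminf c)" for m
        using part(2) [of m] j sum_le_suminf [OF c, of "{..<m}"] c0 mac_bdd_mono
        unfolding ecomm_def by (metis finite_lessThan)
      then show "mac_bdd (commutator_op (\<Sum>k. D k) (T j)) (suminf c)"
        by (intro mac_bdd_limit [OF cl, of 0])
    qed
    fix j assume j: "j \<in> J"
    show "commutator_op (\<Sum>k. D k) (T j) \<in> compact_ops"
    proof (rule compact_op_limit)
      show "commutator_op (\<Sum>k. D k) (T j) \<in> bounded_ops" by (rule commutator_bounded [OF b T_bounded [OF j]])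
      fix d :: real assume "d > 0"
      then obtain m where "norm (commutator_op (\<Sum>k<m. D k) (T j) - commutator_op (\<Sum>k. D k) (T j)) < d"
        using LIMSEQ_D [OF cl] by blast
      then show "\<exists>F\<in>compact_ops. norm (commutator_op (\<Sum>k. D k) (T j) - F) \<le> d"
        using E_comm_compact [OF part(1) j] by (metis less_imp_le norm_minus_commute)
    qed
  qed
qed

end

section \<open>Quotient norms\<close>

lemma lipschitz_continuous_map:
  assumes M1: "Metric_space M1 d1" and M2: "Metric_space M2 d2"
    and f: "f ` M1 \<subseteq> M2" and lip: "\<And>x y. x \<in> M1 \<Longrightarrow> y \<in> M1 \<Longrightarrow> d2 (f x) (f y) \<le> L * d1 x y"
  shows "continuous_map (Metric_space.mtopology M1 d1) (Metric_space.mtopology M2 d2) f"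
proof -
  interpret M1: Metric_space M1 d1 by (rule M1)
  interpret M2: Metric_space M2 d2 by (rule M2)
  show ?thesis
    unfolding continuous_map_def
  proof (intro conjI allI impI)
    show "f \<in> topspace M1.mtopology \<rightarrow> topspace M2.mtopology" using f by auto
    fix U assume U: "openin M2.mtopology U"
    show "openin M1.mtopology {x \<in> topspace M1.mtopology. f x \<in> U}"
      unfolding M1.openin_mtopology
    proof (intro conjI allI impI)
      fix x assume "x \<in> {x \<in> topspace M1.mtopology. f x \<in> U}"
      then have x: "x \<in> M1" "f x \<in> U" by auto
      obtain r where r: "r > 0" "M2.mball (f x) r \<subseteq> U" using U x unfolding M2.openin_mtopology by blast
      have p: "r / (\<bar>L\<bar> + 1) > 0" using r(1) by simp
      have "M1.mball x (r / (\<bar>L\<bar> + 1)) \<subseteq> {x \<in> topspace M1.mtopology. f x \<in> U}"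
      proof
        fix y assume "y \<in> M1.mball x (r / (\<bar>L\<bar> + 1))"
        then have y: "y \<in> M1" "d1 x y < r / (\<bar>L\<bar> + 1)" by auto
        have "d2 (f x) (f y) \<le> L * d1 x y" by (rule lip [OF x(1) y(1)])
        also have "\<dots> \<le> (\<bar>L\<bar> + 1) * d1 x y" by (intro mult_right_mono) auto
        also have "\<dots> < r" using y(2) by (simp add: pos_less_divide_eq mult.commute)
        finally have "f y \<in> M2.mball (f x) r" using x(1) y(1) f by auto
        then show "y \<in> {x \<in> topspace M1.mtopology. f x \<in> U}" using r y by auto
      qed
      then show "\<exists>r>0. M1.mball x r \<subseteq> {x \<in> topspace M1.mtopology. f x \<in> U}" using p by blast
    qed auto
  qed
qed

text \<open>Serves two quotients: bounded by compact operators with the operator norm, and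
  \<open>E\<close> by \<open>KE\<close> with \<open>Enorm\<close>. Both live in a type that is an
  abelian group, so cosets are ordinary translates and the difference of two elements needs no
  inverse from the ring record.\<close>

locale quotient_norm =
  fixes C I :: "'a::ab_group_add set" and N :: "'a \<Rightarrow> real"
  assumes C_add: "\<And>x y. x \<in> C \<Longrightarrow> y \<in> C \<Longrightarrow> x + y \<in> C" and C_minus: "\<And>x. x \<in> C \<Longrightarrow> - x \<in> C"
    and I_sub: "I \<subseteq> C" and I_0: "0 \<in> I"
    and I_add: "\<And>x y. x \<in> I \<Longrightarrow> y \<in> I \<Longrightarrow> x + y \<in> I" and I_minus: "\<And>x. x \<in> I \<Longrightarrow> - x \<in> I"
    and N_0: "N 0 = 0" and N_nonneg: "\<And>x. x \<in> C \<Longrightarrow> N x \<ge> 0" and N_minus: "\<And>x. x \<in> C \<Longrightarrow> N (- x) = N x"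
    and N_add: "\<And>x y. x \<in> C \<Longrightarrow> y \<in> C \<Longrightarrow> N (x + y) \<le> N x + N y"
begin

definition cos :: "'a \<Rightarrow> 'a set" where "cos x = (\<lambda>i. i + x) ` I"

definition qn :: "'a \<Rightarrow> real" where "qn x = Inf (N ` cos x)"

lemma I_diff: "x \<in> I \<Longrightarrow> y \<in> I \<Longrightarrow> x - y \<in> I"
  using I_add [of x "- y"] I_minus [of y] by simp

lemma mem_cos_iff: "y \<in> cos x \<longleftrightarrow> y - x \<in> I"
  by (auto simp: cos_def image_iff intro!: bexI [of _ "y - x"])

lemma cos_eq_iff: "cos x = cos y \<longleftrightarrow> x - y \<in> I"
proof
  assume "cos x = cos y"
  moreover have "x \<in> cos x" by (simp add: mem_cos_iff I_0)
  ultimately show "x - y \<in> I" by (simp add: mem_cos_iff)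
next
  assume xy: "x - y \<in> I"
  have "z - x \<in> I \<longleftrightarrow> z - y \<in> I" for z
    using I_add [of "z - x" "x - y"] I_diff [of "z - y" "x - y"] xy by auto
  then show "cos x = cos y" by (auto simp: mem_cos_iff)
qed

lemma cos_0: "cos 0 = I" by (simp add: cos_def)

lemma cos_plus: "(\<Union>h\<in>cos x. \<Union>k\<in>cos y. {h + k}) = cos (x + y)"
proof (rule subset_antisym; rule subsetI)
  fix z assume "z \<in> (\<Union>h\<in>cos x. \<Union>k\<in>cos y. {h + k})"
  then obtain h k where hk: "h - x \<in> I" "k - y \<in> I" "z = h + k" by (auto simp: mem_cos_iff)
  have "z - (x + y) = (h - x) + (k - y)" using hk by simp
  then show "z \<in> cos (x + y)" unfolding mem_cos_iff by (simp only: I_add [OF hk(1,2)])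
next
  fix z assume "z \<in> cos (x + y)"
  then have "z - y \<in> cos x" "y \<in> cos y" "z = (z - y) + y"
    using I_0 by (auto simp: mem_cos_iff diff_diff_eq add.commute)
  then show "z \<in> (\<Union>h\<in>cos x. \<Union>k\<in>cos y. {h + k})" by blast
qed

lemma bdd: "x \<in> C \<Longrightarrow> bdd_below (N ` cos x)"
  using N_nonneg C_add I_sub by (intro bdd_belowI [of _ 0]) (auto simp: cos_def)

lemma cos_ne: "cos x \<noteq> {}" using I_0 by (auto simp: cos_def)

lemma qn_le: "x \<in> C \<Longrightarrow> i \<in> I \<Longrightarrow> qn x \<le> N (i + x)"
  unfolding qn_def by (rule cInf_lower [OF _ bdd]) (auto simp: cos_def)

lemma qn_approx:
  assumes "x \<in> C" "e > 0" shows "\<exists>i\<in>I. N (i + x) < qn x + e"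
proof -
  have "Inf (N ` cos x) < qn x + e" using assms by (simp add: qn_def)
  then show ?thesis using cInf_less_iff [OF _ bdd [OF assms(1)]] cos_ne by (auto simp: cos_def)
qed

lemma qn_nonneg: "x \<in> C \<Longrightarrow> qn x \<ge> 0"
  unfolding qn_def using cos_ne N_nonneg C_add I_sub by (intro cInf_greatest) (auto simp: cos_def)

lemma qn_greatest: "(\<And>i. i \<in> I \<Longrightarrow> b \<le> N (i + x)) \<Longrightarrow> b \<le> qn x"
  unfolding qn_def using cos_ne by (intro cInf_greatest) (auto simp: cos_def)

lemma qn_minus_le: "x \<in> C \<Longrightarrow> qn (- x) \<le> qn x"
proof (rule qn_greatest)
  fix i assume x: "x \<in> C" and i: "i \<in> I"
  have "qn (- x) \<le> N (- i + - x)" by (rule qn_le [OF C_minus [OF x] I_minus [OF i]])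
  also have "\<dots> = N (i + x)" using N_minus [of "i + x"] C_add [of i x] x i I_sub by auto
  finally show "qn (- x) \<le> N (i + x)" .
qed

lemma qn_minus: "x \<in> C \<Longrightarrow> qn (- x) = qn x"
  using qn_minus_le [of x] qn_minus_le [of "- x"] C_minus [of x] by simp

lemma qn_add:
  assumes x: "x \<in> C" and y: "y \<in> C" shows "qn (x + y) \<le> qn x + qn y"
proof (rule field_le_epsilon)
  fix e :: real assume e: "e > 0"
  obtain i where i: "i \<in> I" "N (i + x) < qn x + e/2" using qn_approx [OF x, of "e/2"] e by auto
  obtain j where j: "j \<in> I" "N (j + y) < qn y + e/2" using qn_approx [OF y, of "e/2"] e by auto
  have "qn (x + y) \<le> N ((i + j) + (x + y))" by (rule qn_le [OF C_add [OF x y] I_add [OF i(1) j(1)]])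
  also have "(i + j) + (x + y) = (i + x) + (j + y)" by (simp add: algebra_simps)
  also have "N \<dots> \<le> N (i + x) + N (j + y)" using x y i j I_sub by (intro N_add C_add) auto
  finally show "qn (x + y) \<le> qn x + qn y + e" using i j by simp
qed

lemma qn_cong: "x - y \<in> I \<Longrightarrow> qn x = qn y"
  unfolding qn_def using cos_eq_iff [of x y] by simp

text \<open>The set \<open>D\<close> of representatives may be smaller than \<open>C\<close>: the
  image of \<open>E\<close> in the Calkin algebra consists of cosets modulo all compact operators,
  but of elements of \<open>E\<close>.\<close>

lemma quotient_dist:
  assumes D: "D \<subseteq> C" "\<And>x. x \<in> D \<Longrightarrow> - x \<in> D" "\<And>x y. x \<in> D \<Longrightarrow> y \<in> D \<Longrightarrow> x + y \<in> D"
    and Q: "carrier Q = cos ` D" "\<And>x y. x \<in> D \<Longrightarrow> y \<in> D \<Longrightarrow> cos x \<oplus>\<^bsub>Q\<^esub> cos y = cos (x + y)" "\<zero>\<^bsub>Q\<^esub> = cos 0"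
      "\<And>x. anorm Q (cos x) = qn x"
    and x: "x \<in> D" and y: "y \<in> D"
  shows "alg_dist Q (cos x) (cos y) = qn (x - y)"
proof -
  have "\<ominus>\<^bsub>Q\<^esub> cos y = cos (- y)"
    unfolding a_inv_def m_inv_def
  proof (rule the_equality)
    show "cos (- y) \<in> carrier (add_monoid Q) \<and> cos y \<otimes>\<^bsub>add_monoid Q\<^esub> cos (- y) = \<one>\<^bsub>add_monoid Q\<^esub>
        \<and> cos (- y) \<otimes>\<^bsub>add_monoid Q\<^esub> cos y = \<one>\<^bsub>add_monoid Q\<^esub>"
      using y D(2) by (simp add: Q)
    fix P assume P: "P \<in> carrier (add_monoid Q) \<and> cos y \<otimes>\<^bsub>add_monoid Q\<^esub> P = \<one>\<^bsub>add_monoid Q\<^esub>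
        \<and> P \<otimes>\<^bsub>add_monoid Q\<^esub> cos y = \<one>\<^bsub>add_monoid Q\<^esub>"
    then obtain z where z: "z \<in> D" "P = cos z" by (auto simp: Q)
    then have "cos (y + z) = cos 0" using P y by (simp add: Q)
    then have "z - (- y) \<in> I" by (simp add: cos_eq_iff add.commute)
    then show "P = cos (- y)" using z by (simp add: cos_eq_iff)
  qed
  then have "cos x \<ominus>\<^bsub>Q\<^esub> cos y = cos (x - y)"
    using x y D(2) by (simp add: a_minus_def Q)
  then show ?thesis using x y by (simp add: alg_dist_def Q)
qed

text \<open>The assumption \<open>definite\<close> is closedness of the ideal relative to
  \<open>D\<close>; the remaining metric laws come from the seminorm \<open>qn\<close>.\<close>

lemma quotient_metric:
  assumes D: "D \<subseteq> C" "\<And>x. x \<in> D \<Longrightarrow> - x \<in> D" "\<And>x y. x \<in> D \<Longrightarrow> y \<in> D \<Longrightarrow> x + y \<in> D"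
    and Q: "carrier Q = cos ` D" "\<And>x y. x \<in> D \<Longrightarrow> y \<in> D \<Longrightarrow> cos x \<oplus>\<^bsub>Q\<^esub> cos y = cos (x + y)" "\<zero>\<^bsub>Q\<^esub> = cos 0"
      "\<And>x. anorm Q (cos x) = qn x"
    and definite: "\<And>x. x \<in> D \<Longrightarrow> qn x = 0 \<Longrightarrow> x \<in> I"
  shows "Metric_space (carrier Q) (alg_dist Q)"
proof -
  have dist: "alg_dist Q (cos x) (cos y) = qn (x - y)" if "x \<in> D" "y \<in> D" for x y
    by (rule quotient_dist [where D = D]) (use D Q that in auto)
  have Dd: "x - y \<in> D" if "x \<in> D" "y \<in> D" for x y
    using D(3) [OF that(1) D(2) [OF that(2)]] by simp
  show ?thesis
  proof
    fix P R
    consider "P \<in> carrier Q \<and> R \<in> carrier Q" | "\<not> (P \<in> carrier Q \<and> R \<in> carrier Q)" by blast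
    then show "0 \<le> alg_dist Q P R"
    proof cases
      case 1
      then obtain x y where xy: "x \<in> D" "y \<in> D" "P = cos x" "R = cos y" by (auto simp: Q)
      then show ?thesis using dist qn_nonneg [OF subsetD [OF D(1) Dd [OF xy(1,2)]]] by simp
    qed (auto simp: alg_dist_def)
    consider "P \<in> carrier Q \<and> R \<in> carrier Q" | "\<not> (P \<in> carrier Q \<and> R \<in> carrier Q)" by blast
    then show "alg_dist Q P R = alg_dist Q R P"
    proof cases
      case 1
      then obtain x y where xy: "x \<in> D" "y \<in> D" "P = cos x" "R = cos y" by (auto simp: Q)
      have "qn (x - y) = qn (y - x)" using qn_minus [of "x - y"] Dd [OF xy(1,2)] D(1) by auto
      then show ?thesis using dist xy by simp
    qed (auto simp: alg_dist_def)
  next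
    fix P R assume PR: "P \<in> carrier Q" "R \<in> carrier Q"
    then obtain x y where xy: "x \<in> D" "y \<in> D" "P = cos x" "R = cos y" by (auto simp: Q)
    have C0: "0 \<in> C" using I_0 I_sub by blast
    then have z: "qn 0 = 0" using qn_le [OF C0 I_0] qn_nonneg [OF C0] by (simp add: N_0)
    show "alg_dist Q P R = 0 \<longleftrightarrow> P = R"
      using dist [OF xy(1,2)] xy definite [OF Dd [OF xy(1,2)]] qn_cong [of "x - y" 0] z by (auto simp: cos_eq_iff)
  next
    fix P R S assume "P \<in> carrier Q" "R \<in> carrier Q" "S \<in> carrier Q"
    then obtain x y z where xyz: "x \<in> D" "y \<in> D" "z \<in> D" "P = cos x" "R = cos y" "S = cos z" by (auto simp: Q)
    have "qn ((x - y) + (y - z)) \<le> qn (x - y) + qn (y - z)"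
      using Dd xyz D(1) by (intro qn_add) auto
    then show "alg_dist Q P S \<le> alg_dist Q P R + alg_dist Q R S"
      using xyz by (simp add: dist)
  qed
qed

end

lemma a_inv_concrete:
  fixes A :: "('a::ab_group_add, 'm) ring_scheme"
  assumes "add A = (+)" "\<zero>\<^bsub>A\<^esub> = 0" "- x \<in> carrier A"
  shows "\<ominus>\<^bsub>A\<^esub> x = - x"
  unfolding a_inv_def m_inv_def
  by (rule the_equality) (use assms in \<open>auto simp: add_eq_0_iff add.commute\<close>)

lemma alg_dist_concrete:
  fixes A :: "('a::ab_group_add, 'm) star_alg_scheme"
  assumes A: "add A = (+)" "\<zero>\<^bsub>A\<^esub> = 0" and "\<And>x. x \<in> carrier A \<Longrightarrow> - x \<in> carrier A"
    and "x \<in> carrier A" "y \<in> carrier A"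
  shows "alg_dist A x y = anorm A (x - y)"
  using assms a_inv_concrete [OF A, of y] by (simp add: alg_dist_def a_minus_def)

lemma metric_space_concrete:
  fixes A :: "('a::ab_group_add, 'm) star_alg_scheme"
  assumes A: "add A = (+)" "\<zero>\<^bsub>A\<^esub> = 0"
    and minus: "\<And>x. x \<in> carrier A \<Longrightarrow> - x \<in> carrier A"
    and add: "\<And>x y. x \<in> carrier A \<Longrightarrow> y \<in> carrier A \<Longrightarrow> x + y \<in> carrier A"
    and N: "\<And>x. x \<in> carrier A \<Longrightarrow> anorm A x \<ge> 0" "\<And>x. x \<in> carrier A \<Longrightarrow> anorm A x = 0 \<longleftrightarrow> x = 0"
      "\<And>x. x \<in> carrier A \<Longrightarrow> anorm A (- x) = anorm A x"
      "\<And>x y. x \<in> carrier A \<Longrightarrow> y \<in> carrier A \<Longrightarrow> anorm A (x + y) \<le> anorm A x + anorm A y"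
  shows "Metric_space (carrier A) (alg_dist A)"
proof -
  have dist: "alg_dist A x y = anorm A (x - y)" if "x \<in> carrier A" "y \<in> carrier A" for x y
    by (rule alg_dist_concrete) (use A minus that in auto)
  have d: "x - y \<in> carrier A" if "x \<in> carrier A" "y \<in> carrier A" for x y
    using add [OF that(1) minus [OF that(2)]] by simp
  show ?thesis
  proof
    fix x y
    show "0 \<le> alg_dist A x y"
    proof (cases "x \<in> carrier A \<and> y \<in> carrier A")
      case True
      then show ?thesis using dist N(1) d by simp
    qed (auto simp: alg_dist_def)
    show "alg_dist A x y = alg_dist A y x"
    proof (cases "x \<in> carrier A \<and> y \<in> carrier A")
      case True
      then show ?thesis using dist N(3) [of "x - y"] d by simp
    qed (auto simp: alg_dist_def)
  next
    fix x y assume xy: "x \<in> carrier A" "y \<in> carrier A"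
    show "alg_dist A x y = 0 \<longleftrightarrow> x = y" unfolding dist [OF xy] N(2) [OF d [OF xy]] by simp
  next
    fix x y z assume xyz: "x \<in> carrier A" "y \<in> carrier A" "z \<in> carrier A"
    show "alg_dist A x z \<le> alg_dist A x y + alg_dist A y z"
      using N(4) [OF d [OF xyz(1,2)] d [OF xyz(2,3)]] xyz by (simp add: dist)
  qed
qed

section \<open>The quotient \<open>\<E>/\<K>\<close>\<close>

lemma B_alg_simps [simp]:
  "carrier B_alg = bounded_ops" "mult B_alg = (o\<^sub>L)" "one B_alg = id_blinfun" "zero B_alg = 0" "add B_alg = (+)"
  "cscale B_alg = scaleO" "anorm B_alg = norm" "star B_alg = adj_op"
  by (simp_all add: B_alg_def scaleO_def fun_eq_iff)

lemma quot_alg_simps: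
  "carrier (quot_alg A I) = carrier (A Quot I)" "mult (quot_alg A I) = mult (A Quot I)"
  "zero (quot_alg A I) = zero (A Quot I)" "add (quot_alg A I) = add (A Quot I)"
  "cscale (quot_alg A I) = (\<lambda>c P. \<Union>x\<in>P. I +>\<^bsub>A\<^esub> cscale A c x)" "anorm (quot_alg A I) = (\<lambda>P. Inf (anorm A ` P))"
  "star (quot_alg A I) = (\<lambda>P. \<Union>x\<in>P. I +>\<^bsub>A\<^esub> star A x)"
  by (simp_all add: quot_alg_def ring.defs star_alg.defs)

context quotient_norm
begin

lemma a_r_coset_cos: "add A = (+) \<Longrightarrow> I +>\<^bsub>A\<^esub> x = cos x"
  by (auto simp: a_r_coset_def' cos_def)

text \<open>The operations of \<open>quot_alg\<close> are unions over all representatives;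
  independence of the representative collapses such a union to a single coset.\<close>

lemma UN_cos:
  assumes "\<And>a. a \<in> cos x \<Longrightarrow> f a - f x \<in> I"
  shows "(\<Union>a\<in>cos x. cos (f a)) = cos (f x)"
proof -
  have "cos (f a) = cos (f x)" if "a \<in> cos x" for a
    using assms [OF that] cos_eq_iff by blast
  then show ?thesis using cos_ne [of x] by auto
qed

lemma quot_alg_carrier: "add A = (+) \<Longrightarrow> carrier (quot_alg A I) = cos ` carrier A"
  by (auto simp: quot_alg_simps FactRing_def A_RCOSETS_def' a_r_coset_cos)

lemma quot_alg_zero: "zero (quot_alg A I) = cos 0"
  by (simp add: quot_alg_simps FactRing_def cos_0)

lemma quot_alg_add: "add A = (+) \<Longrightarrow> cos x \<oplus>\<^bsub>quot_alg A I\<^esub> cos y = cos (x + y)"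
  by (simp add: quot_alg_simps FactRing_def set_add_def' cos_plus)

lemma quot_alg_mult:
  assumes "add A = (+)" "\<And>a b. a \<in> cos x \<Longrightarrow> b \<in> cos y \<Longrightarrow> a \<otimes>\<^bsub>A\<^esub> b - x \<otimes>\<^bsub>A\<^esub> y \<in> I"
  shows "cos x \<otimes>\<^bsub>quot_alg A I\<^esub> cos y = cos (x \<otimes>\<^bsub>A\<^esub> y)"
proof -
  have "cos (a \<otimes>\<^bsub>A\<^esub> b) = cos (x \<otimes>\<^bsub>A\<^esub> y)" if "a \<in> cos x" "b \<in> cos y" for a b
    using assms(2) [OF that] cos_eq_iff by blast
  then show ?thesis using cos_ne [of x] cos_ne [of y]
    by (auto simp: quot_alg_simps FactRing_def rcoset_mult_def a_r_coset_cos [OF assms(1)])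
qed

lemma quot_alg_cscale:
  assumes "add A = (+)" "\<And>a. a \<in> cos x \<Longrightarrow> cscale A c a - cscale A c x \<in> I"
  shows "cscale (quot_alg A I) c (cos x) = cos (cscale A c x)"
  using UN_cos [of x "cscale A c"] assms by (simp add: quot_alg_simps a_r_coset_cos)

lemma quot_alg_star:
  assumes "add A = (+)" "\<And>a. a \<in> cos x \<Longrightarrow> star A a - star A x \<in> I"
  shows "star (quot_alg A I) (cos x) = cos (star A x)"
  using UN_cos [of x "star A"] assms by (simp add: quot_alg_simps a_r_coset_cos)

end

context hermitian_tuple
begin

definition KE :: "('h \<Rightarrow>\<^sub>L 'h) set" where "KE = E \<inter> compact_ops"

lemma E_alg_simps [simp]:
  "carrier (E_alg n T) = E" "mult (E_alg n T) = (o\<^sub>L)" "one (E_alg n T) = id_blinfun" "zero (E_alg n T) = 0"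
  "add (E_alg n T) = (+)" "cscale (E_alg n T) = scaleO" "anorm (E_alg n T) = Enorm" "star (E_alg n T) = adj_op"
  by (simp_all add: E_alg_def E_def J_def Enorm_def fun_eq_iff)

lemma K_alg_simps [simp]:
  "carrier (K_alg n T) = KE" "mult (K_alg n T) = (o\<^sub>L)" "one (K_alg n T) = id_blinfun" "zero (K_alg n T) = 0"
  "add (K_alg n T) = (+)" "cscale (K_alg n T) = scaleO" "anorm (K_alg n T) = Enorm" "star (K_alg n T) = adj_op"
  by (simp_all add: K_alg_def KE_def)

lemma KE_E: "X \<in> KE \<Longrightarrow> X \<in> E" and KE_compact: "X \<in> KE \<Longrightarrow> X \<in> compact_ops"
  by (simp_all add: KE_def)

lemma KE_add: "X \<in> KE \<Longrightarrow> Y \<in> KE \<Longrightarrow> X + Y \<in> KE"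
  and KE_minus: "X \<in> KE \<Longrightarrow> - X \<in> KE"
  and KE_diff: "X \<in> KE \<Longrightarrow> Y \<in> KE \<Longrightarrow> X - Y \<in> KE"
  and KE_scaleO: "X \<in> KE \<Longrightarrow> scaleO c X \<in> KE"
  and KE_adj: "X \<in> KE \<Longrightarrow> adj_op X \<in> KE"
  and KE_compose_left: "X \<in> KE \<Longrightarrow> Y \<in> E \<Longrightarrow> X o\<^sub>L Y \<in> KE"
  and KE_compose_right: "X \<in> KE \<Longrightarrow> Y \<in> E \<Longrightarrow> Y o\<^sub>L X \<in> KE"
  and KE_0: "0 \<in> KE"
  by (simp_all add: KE_def E_add E_minus E_diff E_scaleO E_adj E_compose compact_ops_add compact_ops_minus
      compact_ops_diff compact_ops_scaleO compact_ops_adj compact_ops_compose_left compact_ops_compose_right E_bounded)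

lemma finite_rank_KE: "X \<in> finite_rank_ops \<Longrightarrow> X \<in> KE"
  by (simp add: KE_def finite_rank_E)

lemma Enorm_nonneg: "X \<in> E \<Longrightarrow> Enorm X \<ge> 0"
  using norm_le_Enorm norm_ge_zero order_trans by blast

lemma Enorm_0: "Enorm 0 = 0"
proof -
  have "Enorm 0 \<le> norm (0 :: 'h \<Rightarrow>\<^sub>L 'h) + 0"
    by (rule Enorm_le) (simp_all add: ecomm_def commutator_op_def mac_bdd_0)
  then show ?thesis using Enorm_nonneg [of 0] by simp
qed

lemma Enorm_eq_0: "X \<in> E \<Longrightarrow> Enorm X = 0 \<longleftrightarrow> X = 0"
  using norm_le_Enorm [of X] Enorm_0 by auto

lemma K_metric: "Metric_space KE (alg_dist (K_alg n T))"
  using metric_space_concrete [of "K_alg n T"]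
  by (simp add: KE_minus KE_add Enorm_nonneg Enorm_eq_0 Enorm_minus Enorm_add KE_E)

lemma K_dist: "X \<in> KE \<Longrightarrow> Y \<in> KE \<Longrightarrow> alg_dist (K_alg n T) X Y = Enorm (X - Y)"
  using alg_dist_concrete [of "K_alg n T" X Y] by (simp add: KE_minus)

text \<open>Compactness of X permits \<open>Y = 0\<close> in \<open>E_approx_modulo_compact\<close>,
  whose bounds then become arbitrarily small in both parts of the norm.\<close>

theorem finite_rank_dense: "alg_topology (K_alg n T) closure_of finite_rank_ops = carrier (K_alg n T)"
proof -
  interpret K: Metric_space KE "alg_dist (K_alg n T)" by (rule K_metric)
  have "\<exists>Y\<in>finite_rank_ops. Y \<in> K.mball X r" if X: "X \<in> KE" and r: "r > 0" for X r
  proof -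
    obtain G where G: "G \<in> finite_rank_ops" "norm (X - G) \<le> 2 * norm (0 :: 'h \<Rightarrow>\<^sub>L 'h) + r/3"
      "ecomm (X - G) (C0 * norm (0 :: 'h \<Rightarrow>\<^sub>L 'h) + r/3)"
      using E_approx_modulo_compact [OF KE_E [OF X], of 0 "r/3"] KE_compact [OF X] r by auto
    have "Enorm (X - G) \<le> norm (X - G) + r/3"
      using G by (intro Enorm_le E_diff KE_E X finite_rank_E) simp_all
    then have "Enorm (X - G) < r" using G(2) r by simp
    then show ?thesis using G(1) X finite_rank_KE K_dist by (intro bexI [of _ G]) auto
  qed
  then show ?thesis
    unfolding alg_topology_def K_alg_simps K.metric_closure_of by auto
qed

sublocale cal: quotient_norm "bounded_ops :: ('h \<Rightarrow>\<^sub>L 'h) set" compact_ops norm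
  by unfold_locales
    (auto intro: bounded_ops_add bounded_ops_minus compact_ops_add compact_ops_minus norm_triangle_ineq)

sublocale ek: quotient_norm E KE Enorm
  by unfold_locales
    (auto intro: E_add E_minus KE_add KE_minus KE_E KE_0 Enorm_nonneg Enorm_minus Enorm_add Enorm_0)

section \<open>Equivalence of the quotient norm and the Calkin norm\<close>

lemma calkin_proj_cos: "calkin_proj X = cal.cos X"
  by (simp add: calkin_proj_def cal.a_r_coset_cos)

lemma calkin_norm_definite:
  fixes X :: "'h \<Rightarrow>\<^sub>L 'h"
  assumes "X \<in> bounded_ops" "cal.qn X = 0" shows "X \<in> compact_ops"
proof (rule compact_op_limit [OF assms(1)])
  fix e :: real assume "e > 0"
  then obtain K where "K \<in> compact_ops" "norm (K + X) < 0 + e"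
    using cal.qn_approx [OF assms(1)] assms(2) by metis
  then show "\<exists>F\<in>compact_ops. norm (X - F) \<le> e"
    by (intro bexI [of _ "- K"]) (auto simp: compact_ops_minus add.commute)
qed

lemma qn_le_ek: "X \<in> E \<Longrightarrow> cal.qn X \<le> ek.qn X"
proof (rule ek.qn_greatest)
  fix K assume X: "X \<in> E" and K: "K \<in> KE"
  have "cal.qn X \<le> norm (K + X)" using X K by (intro cal.qn_le) (auto simp: E_bounded KE_compact)
  also have "\<dots> \<le> Enorm (K + X)" using X K by (simp add: norm_le_Enorm E_add KE_E)
  finally show "cal.qn X \<le> Enorm (K + X)" .
qed

text \<open>Choose a compact K with \<open>norm (K + X)\<close> nearly minimal and apply the
  approximation modulo compact operators with \<open>Y = K + X\<close>: a finite rank G, which lies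
  in \<open>KE\<close>, already brings \<open>Enorm (X - G)\<close> down to about
  \<open>2 + C0\<close> times that minimum.\<close>

lemma ek_le_qn:
  assumes X: "X \<in> E" shows "ek.qn X \<le> (2 + C0) * cal.qn X"
proof (rule field_le_epsilon)
  fix e :: real assume e: "e > 0"
  \<comment> \<open>The slack: \<open>(2 + C0) * d\<close> from the choice of K and
    \<open>2 * d\<close> from the approximation add up to e.\<close>
  define d where "d = e / (4 + C0)"
  have p: "4 + C0 > 0" using C0_nonneg by simp
  have d: "d > 0" "(4 + C0) * d = e" using e p by (simp_all add: d_def)
  obtain K where K: "K \<in> compact_ops" "norm (K + X) < cal.qn X + d"
    using cal.qn_approx [OF E_bounded [OF X] d(1)] by blast
  have "X - (K + X) = - K" by simp
  then have "X - (K + X) \<in> compact_ops" using compact_ops_minus [OF K(1)] by simp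
  then obtain G where G: "G \<in> finite_rank_ops" "norm (X - G) \<le> 2 * norm (K + X) + d"
    "ecomm (X - G) (C0 * norm (K + X) + d)"
    using E_approx_modulo_compact [OF X bounded_ops_add [OF compact_ops_bounded [OF K(1)] E_bounded [OF X]] _ d(1)]
    by blast
  have "ek.qn X \<le> Enorm (- G + X)"
    by (rule ek.qn_le [OF X KE_minus [OF finite_rank_KE [OF G(1)]]])
  also have "- G + X = X - G" by simp
  also have "Enorm (X - G) \<le> norm (X - G) + (C0 * norm (K + X) + d)"
    by (rule Enorm_le [OF E_diff [OF X finite_rank_E [OF G(1)]] G(3)])
  also have "\<dots> \<le> (2 + C0) * norm (K + X) + 2 * d" using G(2) by (simp add: algebra_simps)
  also have "\<dots> \<le> (2 + C0) * (cal.qn X + d) + 2 * d"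
    using K(2) C0_nonneg by (intro add_right_mono mult_left_mono) auto
  also have "\<dots> = (2 + C0) * cal.qn X + e" using d(2) by (simp add: algebra_simps)
  finally show "ek.qn X \<le> (2 + C0) * cal.qn X + e" .
qed

section \<open>The two quotient algebras in terms of representatives\<close>

abbreviation "pE \<equiv> calkin_alg\<lparr>carrier := calkin_proj ` carrier (E_alg n T)\<rparr>"

lemma calkin_carrier: "carrier (calkin_alg :: ('h \<Rightarrow>\<^sub>L 'h) set star_alg) = cal.cos ` bounded_ops"
  by (simp add: calkin_alg_def cal.quot_alg_carrier)

lemma calkin_add: "cal.cos X \<oplus>\<^bsub>calkin_alg\<^esub> cal.cos Y = cal.cos (X + Y)"
  by (simp add: calkin_alg_def cal.quot_alg_add)

lemma calkin_zero: "\<zero>\<^bsub>calkin_alg\<^esub> = cal.cos 0"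
  by (simp add: calkin_alg_def cal.quot_alg_zero)

lemma calkin_anorm: "anorm calkin_alg (cal.cos X) = cal.qn X"
  by (simp add: calkin_alg_def quot_alg_simps cal.qn_def)

lemma calkin_mult:
  assumes "X \<in> bounded_ops" "Y \<in> bounded_ops"
  shows "cal.cos X \<otimes>\<^bsub>calkin_alg\<^esub> cal.cos Y = cal.cos (X o\<^sub>L Y)"
proof -
  have "cal.cos X \<otimes>\<^bsub>quot_alg B_alg compact_ops\<^esub> cal.cos Y = cal.cos (X \<otimes>\<^bsub>B_alg\<^esub> Y)"
  proof (rule cal.quot_alg_mult)
    fix a b assume "a \<in> cal.cos X" "b \<in> cal.cos Y"
    then have ab: "a - X \<in> compact_ops" "b - Y \<in> compact_ops" by (simp_all add: cal.mem_cos_iff)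
    have bb: "(b - Y) + Y \<in> bounded_ops" using ab assms by (intro bounded_ops_add) auto
    have "(a o\<^sub>L b) - (X o\<^sub>L Y) = ((a - X) o\<^sub>L b) + (X o\<^sub>L (b - Y))" by (simp add: compose_algebra)
    then show "a \<otimes>\<^bsub>B_alg\<^esub> b - X \<otimes>\<^bsub>B_alg\<^esub> Y \<in> compact_ops"
      using ab assms bb by (simp add: compact_ops_add compact_ops_compose_left compact_ops_compose_right)
  qed simp
  then show ?thesis by (simp add: calkin_alg_def)
qed

lemma calkin_cscale: "cscale calkin_alg c (cal.cos X) = cal.cos (scaleO c X)"
  unfolding calkin_alg_def
  by (subst cal.quot_alg_cscale) (auto simp: cal.mem_cos_iff compact_ops_scaleO simp flip: scaleO_diff_right)

lemma calkin_star:
  assumes "X \<in> bounded_ops"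
  shows "star calkin_alg (cal.cos X) = cal.cos (adj_op X)"
proof -
  have "star (quot_alg B_alg compact_ops) (cal.cos X) = cal.cos (star B_alg X)"
  proof (rule cal.quot_alg_star)
    fix a assume "a \<in> cal.cos X"
    then have a: "a - X \<in> compact_ops" by (simp add: cal.mem_cos_iff)
    then have "(a - X) + X \<in> bounded_ops" using assms by (intro bounded_ops_add) auto
    then show "star B_alg a - star B_alg X \<in> compact_ops"
      using a assms compact_ops_adj [OF a] by (simp add: adj_op_diff)
  qed simp
  then show ?thesis by (simp add: calkin_alg_def)
qed

lemma EK_carrier: "carrier (EK_alg n T) = ek.cos ` E"
  by (simp add: EK_alg_def ek.quot_alg_carrier)

lemma EK_add: "ek.cos X \<oplus>\<^bsub>EK_alg n T\<^esub> ek.cos Y = ek.cos (X + Y)"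
  by (simp add: EK_alg_def ek.quot_alg_add)

lemma EK_zero: "\<zero>\<^bsub>EK_alg n T\<^esub> = ek.cos 0"
  using ek.quot_alg_zero [of "E_alg n T"] by (simp add: EK_alg_def)

lemma EK_anorm: "anorm (EK_alg n T) (ek.cos X) = ek.qn X"
  by (simp add: EK_alg_def quot_alg_simps ek.qn_def)

lemma EK_mult:
  assumes "X \<in> E" "Y \<in> E"
  shows "ek.cos X \<otimes>\<^bsub>EK_alg n T\<^esub> ek.cos Y = ek.cos (X o\<^sub>L Y)"
proof -
  have "ek.cos X \<otimes>\<^bsub>quot_alg (E_alg n T) KE\<^esub> ek.cos Y = ek.cos (X \<otimes>\<^bsub>E_alg n T\<^esub> Y)"
  proof (rule ek.quot_alg_mult)
    fix a b assume "a \<in> ek.cos X" "b \<in> ek.cos Y"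
    then have ab: "a - X \<in> KE" "b - Y \<in> KE" by (simp_all add: ek.mem_cos_iff)
    have bb: "(b - Y) + Y \<in> E" by (rule E_add [OF KE_E [OF ab(2)] assms(2)])
    have "(a o\<^sub>L b) - (X o\<^sub>L Y) = ((a - X) o\<^sub>L b) + (X o\<^sub>L (b - Y))" by (simp add: compose_algebra)
    then show "a \<otimes>\<^bsub>E_alg n T\<^esub> b - X \<otimes>\<^bsub>E_alg n T\<^esub> Y \<in> KE"
      using ab assms bb by (simp add: KE_add KE_compose_left KE_compose_right)
  qed simp
  then show ?thesis by (simp add: EK_alg_def)
qed

lemma EK_cscale: "cscale (EK_alg n T) c (ek.cos X) = ek.cos (scaleO c X)"
proof -
  have "cscale (quot_alg (E_alg n T) KE) c (ek.cos X) = ek.cos (cscale (E_alg n T) c X)"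
    by (rule ek.quot_alg_cscale) (auto simp: ek.mem_cos_iff KE_scaleO simp flip: scaleO_diff_right)
  then show ?thesis by (simp add: EK_alg_def)
qed

lemma EK_star:
  assumes "X \<in> E"
  shows "star (EK_alg n T) (ek.cos X) = ek.cos (adj_op X)"
proof -
  have "star (quot_alg (E_alg n T) KE) (ek.cos X) = ek.cos (star (E_alg n T) X)"
  proof (rule ek.quot_alg_star)
    fix a assume "a \<in> ek.cos X"
    then have a: "a - X \<in> KE" by (simp add: ek.mem_cos_iff)
    then have "(a - X) + X \<in> E" using E_add [OF KE_E assms] by blast
    then show "star (E_alg n T) a - star (E_alg n T) X \<in> KE"
      using a assms KE_adj [OF a] by (simp add: adj_op_diff E_bounded)
  qed simp
  then show ?thesis by (simp add: EK_alg_def)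
qed

lemma calkin_metric: "Metric_space (carrier calkin_alg) (alg_dist (calkin_alg :: ('h \<Rightarrow>\<^sub>L 'h) set star_alg))"
  by (rule cal.quotient_metric [of bounded_ops])
    (auto simp: calkin_carrier calkin_add calkin_zero calkin_anorm intro: bounded_ops_minus bounded_ops_add calkin_norm_definite)

lemma calkin_dist:
  assumes "X \<in> bounded_ops" "Y \<in> bounded_ops"
  shows "alg_dist calkin_alg (cal.cos X) (cal.cos Y) = cal.qn (X - Y)"
  by (rule cal.quotient_dist [of bounded_ops])
    (auto simp: calkin_carrier calkin_add calkin_zero calkin_anorm assms intro: bounded_ops_minus bounded_ops_add)

lemma pE_carrier: "carrier pE = cal.cos ` E"
  by (auto simp: calkin_proj_cos)

lemma pE_metric: "Metric_space (carrier pE) (alg_dist pE)"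
proof (rule cal.quotient_metric [of E])
  show "carrier pE = cal.cos ` E" by (rule pE_carrier)
qed (auto simp: calkin_add calkin_zero calkin_anorm intro: E_minus E_add calkin_norm_definite E_bounded)

lemma pE_dist:
  assumes "X \<in> E" "Y \<in> E"
  shows "alg_dist pE (cal.cos X) (cal.cos Y) = cal.qn (X - Y)"
proof (rule cal.quotient_dist [of E])
  show "carrier pE = cal.cos ` E" by (rule pE_carrier)
qed (auto simp: calkin_add calkin_zero calkin_anorm assms intro: E_minus E_add E_bounded)

lemma ek_norm_definite: "X \<in> E \<Longrightarrow> ek.qn X = 0 \<Longrightarrow> X \<in> KE"
  using qn_le_ek [of X] cal.qn_nonneg [OF E_bounded, of X] calkin_norm_definite [OF E_bounded, of X] by (auto simp: KE_def)

lemma EK_metric: "Metric_space (carrier (EK_alg n T)) (alg_dist (EK_alg n T))"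
  by (rule ek.quotient_metric [of E])
    (auto simp: EK_carrier EK_add EK_zero EK_anorm intro: E_minus E_add ek_norm_definite)

lemma EK_dist:
  assumes "X \<in> E" "Y \<in> E"
  shows "alg_dist (EK_alg n T) (ek.cos X) (ek.cos Y) = ek.qn (X - Y)"
  by (rule ek.quotient_dist [of E])
    (auto simp: EK_carrier EK_add EK_zero EK_anorm assms intro: E_minus E_add)

text \<open>Elements \<open>X k\<close> of \<open>E\<close> approximate Y modulo compacts at a
  geometric rate, but only in the Calkin norm. Finite rank corrections \<open>G k\<close> make their
  differences summable in both parts of the norm of \<open>E\<close>; being invisible in the
  quotient, they do no harm, and the series sums to the representative sought.\<close>

lemma E_closed_modulo_compact:
  assumes Y: "Y \<in> bounded_ops" and approx: "\<And>r. r > 0 \<Longrightarrow> \<exists>X\<in>E. cal.qn (Y - X) < r"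
  shows "\<exists>X\<in>E. Y - X \<in> compact_ops"
proof -
  have "\<forall>k. \<exists>X\<in>E. cal.qn (Y - X) < (1/2) ^ k" using approx by simp
  then obtain X where X: "\<And>k. X k \<in> E" "\<And>k. cal.qn (Y - X k) < (1/2) ^ k" by metis
  have Xb: "X k \<in> bounded_ops" for k by (rule E_bounded [OF X(1)])
  \<comment> \<open>With d the k-th power of 1/2, consecutive differences have Calkin norm below 2
    d, hence a compact perturbation of norm below 3 d. The approximation turns 3 into
    \<open>2 * 3 + 1 = 7\<close> for the norm and \<open>3 * C0 + 1\<close> for the
    commutators.\<close>
  have "\<exists>G\<in>finite_rank_ops. norm (X (Suc k) - X k - G) \<le> 7 * (1/2) ^ k \<and> ecomm (X (Suc k) - X k - G) ((3 * C0 + 1) * (1/2) ^ k)" for k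
  proof -
    let ?d = "(1/2 :: real) ^ k"
    let ?Z = "X (Suc k) - X k"
    have Zb: "?Z \<in> bounded_ops" using Xb by (simp add: bounded_ops_diff)
    have "cal.qn ?Z = cal.qn ((Y - X k) + - (Y - X (Suc k)))" by simp
    also have "\<dots> \<le> cal.qn (Y - X k) + cal.qn (- (Y - X (Suc k)))"
      using Y Xb by (intro cal.qn_add bounded_ops_minus bounded_ops_diff)
    also have "cal.qn (- (Y - X (Suc k))) = cal.qn (Y - X (Suc k))"
      using Y Xb by (intro cal.qn_minus bounded_ops_diff)
    also have "cal.qn (Y - X k) + cal.qn (Y - X (Suc k)) < ?d + ?d"
    proof -
      have "(1/2 :: real) ^ Suc k < ?d" by simp
      then show ?thesis using X(2) [of k] X(2) [of "Suc k"] by linarith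
    qed
    finally have q: "cal.qn ?Z + ?d < 3 * ?d" by simp
    obtain K where K: "K \<in> compact_ops" "norm (K + ?Z) < cal.qn ?Z + ?d"
      using cal.qn_approx [OF Zb, of ?d] by auto
    have n3: "norm (K + ?Z) \<le> 3 * ?d" using K(2) q by simp
    have "?Z - (K + ?Z) \<in> compact_ops" using compact_ops_minus [OF K(1)] by simp
    moreover have "K + ?Z \<in> bounded_ops" using K(1) Zb by (intro bounded_ops_add) auto
    ultimately obtain G where G: "G \<in> finite_rank_ops" "norm (?Z - G) \<le> 2 * norm (K + ?Z) + ?d"
      "ecomm (?Z - G) (C0 * norm (K + ?Z) + ?d)"
      using E_approx_modulo_compact [OF E_diff [OF X(1) X(1)], of "K + ?Z" "Suc k" k ?d] by auto
    have "norm (?Z - G) \<le> 7 * ?d" using G(2) n3 by simp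
    moreover have "C0 * norm (K + ?Z) + ?d \<le> (3 * C0 + 1) * ?d"
      using mult_left_mono [OF n3 C0_nonneg] by (simp add: algebra_simps)
    ultimately show ?thesis using G ecomm_mono by blast
  qed
  then obtain G where G: "\<And>k. G k \<in> finite_rank_ops" "\<And>k. norm (X (Suc k) - X k - G k) \<le> 7 * (1/2) ^ k"
    "\<And>k. ecomm (X (Suc k) - X k - G k) ((3 * C0 + 1) * (1/2) ^ k)" by metis
  define D where "D = (\<lambda>k. X (Suc k) - X k - G k)"
  define c where "c = (\<lambda>k. (7 + 3 * C0 + 1) * (1/2 :: real) ^ k)"
  have sc: "summable c" unfolding c_def by (intro summable_mult summable_geometric) simp
  have le: "7 * (1/2) ^ k \<le> c k" "(3 * C0 + 1) * (1/2) ^ k \<le> c k" for k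
    unfolding c_def using C0_nonneg by (intro mult_right_mono; simp)+
  have "D k \<in> E" for k unfolding D_def using X(1) G(1) finite_rank_E by (intro E_diff) auto
  moreover have "norm (D k) \<le> c k" "ecomm (D k) (c k)" for k
    using G(2,3) [of k] le [of k] ecomm_mono unfolding D_def by (auto intro: order_trans)
  ultimately have S: "summable D" "(\<Sum>k. D k) \<in> E" using E_series [OF _ _ _ sc] by blast+
  have part: "(\<Sum>k<m. D k) = X m - X 0 - (\<Sum>k<m. G k)" for m
    by (induction m) (simp_all add: D_def)
  have XE: "X 0 + (\<Sum>k. D k) \<in> E" by (intro E_add X S)
  have "Y - (X 0 + (\<Sum>k. D k)) \<in> compact_ops"
  proof (rule compact_op_limit)
    show "Y - (X 0 + (\<Sum>k. D k)) \<in> bounded_ops" by (intro bounded_ops_diff Y E_bounded XE)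
    fix e :: real assume e: "e > 0"
    obtain M where M: "norm ((\<Sum>k<M. D k) - (\<Sum>k. D k)) < e/3" "(1/2) ^ M < e/3"
    proof -
      obtain M1 where "\<And>m. m \<ge> M1 \<Longrightarrow> norm ((\<Sum>k<m. D k) - (\<Sum>k. D k)) < e/3"
        using LIMSEQ_D [OF summable_LIMSEQ [OF S(1)], of "e/3"] e by auto
      moreover obtain M2 where "(1/2 :: real) ^ M2 < e/3"
        using real_arch_pow_inv [of "e/3" "1/2"] e by auto
      moreover have "(1/2 :: real) ^ max M1 M2 \<le> (1/2) ^ M2" by (rule power_decreasing) auto
      ultimately show ?thesis by (intro that [of "max M1 M2"]) (simp, linarith)
    qed
    have YXb: "Y - X M \<in> bounded_ops" by (intro bounded_ops_diff Y Xb)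
    obtain K where K: "K \<in> compact_ops" "norm (K + (Y - X M)) < cal.qn (Y - X M) + e/3"
      using cal.qn_approx [OF YXb, of "e/3"] e by auto
    \<comment> \<open>Telescoping trades \<open>X M\<close> for \<open>X 0\<close> plus the series
      up to the finite rank sum of the \<open>G k\<close>, so the closeness of Y to
      \<open>X M\<close> modulo compacts carries over.\<close>
    have "Y - (X 0 + (\<Sum>k. D k)) - ((\<Sum>k<M. G k) - K) = (K + (Y - X M)) + ((\<Sum>k<M. D k) - (\<Sum>k. D k))"
      unfolding part by simp
    then have "norm (Y - (X 0 + (\<Sum>k. D k)) - ((\<Sum>k<M. G k) - K)) \<le> norm (K + (Y - X M)) + norm ((\<Sum>k<M. D k) - (\<Sum>k. D k))"
      by (metis norm_triangle_ineq)
    also have "\<dots> \<le> e" using K(2) M X(2) [of M] by simp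
    finally have "norm (Y - (X 0 + (\<Sum>k. D k)) - ((\<Sum>k<M. G k) - K)) \<le> e" .
    moreover have "(\<Sum>k<M. G k) - K \<in> compact_ops"
      using G(1) K(1) by (simp add: compact_ops_diff compact_ops_sum)
    ultimately show "\<exists>F\<in>compact_ops. norm (Y - (X 0 + (\<Sum>k. D k)) - F) \<le> e" by blast
  qed
  then show ?thesis using XE by blast
qed

theorem pE_cstar_subalgebra: "cstar_subalgebra (calkin_proj ` carrier (E_alg n T)) calkin_alg"
  unfolding cstar_subalgebra_def
proof (intro conjI ballI allI)
  interpret M: Metric_space "carrier calkin_alg" "alg_dist (calkin_alg :: ('h \<Rightarrow>\<^sub>L 'h) set star_alg)"
    by (rule calkin_metric)
  have S: "calkin_proj ` carrier (E_alg n T) = cal.cos ` E" by (simp add: calkin_proj_cos)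
  show sub: "calkin_proj ` carrier (E_alg n T) \<subseteq> carrier calkin_alg"
    unfolding S calkin_carrier using E_bounded by auto
  show "\<zero>\<^bsub>calkin_alg\<^esub> \<in> calkin_proj ` carrier (E_alg n T)" unfolding S calkin_zero by simp
  show "x \<oplus>\<^bsub>calkin_alg\<^esub> y \<in> calkin_proj ` carrier (E_alg n T)" "x \<otimes>\<^bsub>calkin_alg\<^esub> y \<in> calkin_proj ` carrier (E_alg n T)"
    if "x \<in> calkin_proj ` carrier (E_alg n T)" "y \<in> calkin_proj ` carrier (E_alg n T)" for x y
    using that unfolding S by (auto simp: calkin_add calkin_mult E_bounded E_add E_compose)
  show "cscale calkin_alg c x \<in> calkin_proj ` carrier (E_alg n T)" if "x \<in> calkin_proj ` carrier (E_alg n T)" for c x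
    using that unfolding S by (auto simp: calkin_cscale E_scaleO)
  show "star calkin_alg x \<in> calkin_proj ` carrier (E_alg n T)" if "x \<in> calkin_proj ` carrier (E_alg n T)" for x
    using that unfolding S by (auto simp: calkin_star E_bounded E_adj)
  have "M.mtopology closure_of (cal.cos ` E) \<subseteq> cal.cos ` E"
  proof
    fix P assume P: "P \<in> M.mtopology closure_of (cal.cos ` E)"
    then have Pc: "P \<in> carrier calkin_alg" and Pr: "\<And>r. r > 0 \<Longrightarrow> \<exists>R\<in>cal.cos ` E. R \<in> M.mball P r"
      unfolding M.metric_closure_of by auto
    obtain Y where Y: "Y \<in> bounded_ops" "P = cal.cos Y" using Pc by (auto simp: calkin_carrier)
    have "\<exists>X\<in>E. cal.qn (Y - X) < r" if r: "r > 0" for r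
    proof -
      obtain X where "X \<in> E" "cal.cos X \<in> M.mball P r" using Pr [OF r] by blast
      then show ?thesis using calkin_dist [OF Y(1) E_bounded] Y(2) by (intro bexI [of _ X]) auto
    qed
    then obtain X where "X \<in> E" "Y - X \<in> compact_ops" using E_closed_modulo_compact [OF Y(1)] by blast
    then have "P = cal.cos X" using Y by (simp add: cal.cos_eq_iff)
    then show "P \<in> cal.cos ` E" using \<open>X \<in> E\<close> by simp
  qed
  then show "closedin (alg_topology calkin_alg) (calkin_proj ` carrier (E_alg n T))"
    unfolding alg_topology_def S using sub unfolding S
    by (metis M.topspace_mtopology closure_of_subset_eq)
qed

text \<open>A Calkin coset of an element of \<open>E\<close> meets \<open>E\<close> in exactly one
  coset of \<open>KE\<close>, so intersecting with \<open>E\<close> inverts the canonical map. The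
  inequalities \<open>qn_le_ek\<close> and \<open>ek_le_qn\<close> make both directions
  Lipschitz.\<close>

theorem pE_iso_EK: "banach_star_iso pE (EK_alg n T) (\<lambda>P. P \<inter> E)"
proof -
  have phi: "cal.cos X \<inter> E = ek.cos X" if X: "X \<in> E" for X
  proof -
    have "Y \<in> E \<and> Y - X \<in> compact_ops \<longleftrightarrow> Y - X \<in> KE" for Y
      using E_diff [OF _ X, of Y] E_add [OF _ X, of "Y - X"] by (auto simp: KE_def)
    then show ?thesis unfolding set_eq_iff Int_iff cal.mem_cos_iff ek.mem_cos_iff by blast
  qed
  interpret A: Metric_space "carrier pE" "alg_dist pE" by (rule pE_metric)
  interpret B: Metric_space "carrier (EK_alg n T)" "alg_dist (EK_alg n T)" by (rule EK_metric)
  have inj: "cal.cos X = cal.cos Y \<longleftrightarrow> ek.cos X = ek.cos Y" if "X \<in> E" "Y \<in> E" for X Y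
    using E_diff [OF that] unfolding cal.cos_eq_iff ek.cos_eq_iff by (simp add: KE_def)
  have bij: "bij_betw (\<lambda>P. P \<inter> E) (carrier pE) (carrier (EK_alg n T))"
    unfolding pE_carrier EK_carrier
    by (rule bij_betw_imageI) (auto simp: inj_on_def phi inj image_iff intro!: bexI)
  define psi where "psi = inv_into (carrier pE) (\<lambda>P. P \<inter> E)"
  have psi: "psi (ek.cos X) = cal.cos X" if "X \<in> E" for X
    unfolding psi_def using bij_betw_inv_into_left [OF bij, of "cal.cos X"] that by (simp only: phi pE_carrier imageI)
  have c1: "continuous_map A.mtopology B.mtopology (\<lambda>P. P \<inter> E)"
  proof (rule lipschitz_continuous_map [where L = "2 + C0"])
    show "(\<lambda>P. P \<inter> E) ` carrier pE \<subseteq> carrier (EK_alg n T)" using bij by (simp add: bij_betw_def)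
    fix x y assume "x \<in> carrier pE" "y \<in> carrier pE"
    then obtain X Y where "X \<in> E" "Y \<in> E" "x = cal.cos X" "y = cal.cos Y" unfolding pE_carrier by blast
    then show "alg_dist (EK_alg n T) (x \<inter> E) (y \<inter> E) \<le> (2 + C0) * alg_dist pE x y"
      using ek_le_qn [OF E_diff] by (simp only: phi pE_dist EK_dist)
  qed (rule A.Metric_space_axioms B.Metric_space_axioms)+
  have c2: "continuous_map B.mtopology A.mtopology psi"
  proof (rule lipschitz_continuous_map [where L = 1])
    show "psi ` carrier (EK_alg n T) \<subseteq> carrier pE" unfolding pE_carrier EK_carrier using psi by auto
    fix x y assume "x \<in> carrier (EK_alg n T)" "y \<in> carrier (EK_alg n T)"
    then obtain X Y where "X \<in> E" "Y \<in> E" "x = ek.cos X" "y = ek.cos Y" unfolding EK_carrier by blast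
    then show "alg_dist pE (psi x) (psi y) \<le> 1 * alg_dist (EK_alg n T) x y"
      using qn_le_ek [OF E_diff] by (simp only: psi pE_dist EK_dist mult_1)
  qed (rule A.Metric_space_axioms B.Metric_space_axioms)+
  have "homeomorphic_maps A.mtopology B.mtopology (\<lambda>P. P \<inter> E) psi"
    unfolding homeomorphic_maps_def A.topspace_mtopology B.topspace_mtopology
    using c1 c2 bij bij_betw_inv_into_left [OF bij] bij_betw_inv_into_right [OF bij] unfolding psi_def by blast
  then have homeo: "homeomorphic_map (alg_topology pE) (alg_topology (EK_alg n T)) (\<lambda>P. P \<inter> E)"
    unfolding alg_topology_def homeomorphic_map_maps by blast
  show ?thesis
    unfolding banach_star_iso_def
  proof (intro conjI ballI allI)
    fix x y assume "x \<in> carrier pE" "y \<in> carrier pE"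
    then obtain X Y where XY: "X \<in> E" "Y \<in> E" "x = cal.cos X" "y = cal.cos Y" unfolding pE_carrier by blast
    show "(x \<oplus>\<^bsub>pE\<^esub> y) \<inter> E = (x \<inter> E) \<oplus>\<^bsub>EK_alg n T\<^esub> (y \<inter> E)"
      using XY by (simp add: calkin_add phi EK_add E_add)
    show "(x \<otimes>\<^bsub>pE\<^esub> y) \<inter> E = (x \<inter> E) \<otimes>\<^bsub>EK_alg n T\<^esub> (y \<inter> E)"
      using XY by (simp add: calkin_mult phi EK_mult E_compose E_bounded)
  next
    fix c x assume "x \<in> carrier pE"
    then obtain X where X: "X \<in> E" "x = cal.cos X" unfolding pE_carrier by blast
    show "cscale pE c x \<inter> E = cscale (EK_alg n T) c (x \<inter> E)"
      using X by (simp add: calkin_cscale phi EK_cscale E_scaleO)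
  next
    fix x assume "x \<in> carrier pE"
    then obtain X where X: "X \<in> E" "x = cal.cos X" unfolding pE_carrier by blast
    show "star pE x \<inter> E = star (EK_alg n T) (x \<inter> E)"
      using X by (simp add: calkin_star phi EK_star E_adj E_bounded)
  qed (fact bij homeo)+
qed

end

section \<open>Grothendieck groups\<close>

context comm_monoid
begin

lemma groth_rel_iff:
  "((a, b), (c, d)) \<in> groth_rel G \<longleftrightarrow> a \<in> carrier G \<and> b \<in> carrier G \<and> c \<in> carrier G \<and> d \<in> carrier G \<and>
     (\<exists>g\<in>carrier G. a \<otimes> d \<otimes> g = c \<otimes> b \<otimes> g)"
  by (simp add: groth_rel_def)

lemma groth_relI:
  "a \<in> carrier G \<Longrightarrow> b \<in> carrier G \<Longrightarrow> c \<in> carrier G \<Longrightarrow> d \<in> carrier G \<Longrightarrow> g \<in> carrier G \<Longrightarrow>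
    a \<otimes> d \<otimes> g = c \<otimes> b \<otimes> g \<Longrightarrow> ((a, b), (c, d)) \<in> groth_rel G"
  by (auto simp: groth_rel_iff)

lemma equiv_groth_rel: "equiv (carrier G \<times> carrier G) (groth_rel G)"
proof (rule equivI)
  show "groth_rel G \<subseteq> (carrier G \<times> carrier G) \<times> (carrier G \<times> carrier G)" by (auto simp: groth_rel_def)
  show "refl_on (carrier G \<times> carrier G) (groth_rel G)"
    by (auto simp: refl_on_def groth_rel_def)
  show "sym (groth_rel G)"
  proof (rule symI)
    fix x y assume "(x, y) \<in> groth_rel G"
    then show "(y, x) \<in> groth_rel G" by (cases x; cases y) (metis groth_rel_iff)
  qed
  show "trans (groth_rel G)"
  proof (rule transI)
    fix x y z assume xy: "(x, y) \<in> groth_rel G" and yz: "(y, z) \<in> groth_rel G"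
    obtain a b c d e f where abc: "x = (a, b)" "y = (c, d)" "z = (e, f)" by (metis surj_pair)
    obtain g where g: "a \<in> carrier G" "b \<in> carrier G" "c \<in> carrier G" "d \<in> carrier G" "g \<in> carrier G" "a \<otimes> d \<otimes> g = c \<otimes> b \<otimes> g"
      using xy unfolding abc groth_rel_iff by blast
    obtain k where k: "e \<in> carrier G" "f \<in> carrier G" "k \<in> carrier G" "c \<otimes> f \<otimes> k = e \<otimes> d \<otimes> k"
      using yz unfolding abc groth_rel_iff by blast
    have "a \<otimes> f \<otimes> (c \<otimes> d \<otimes> g \<otimes> k) = (a \<otimes> d \<otimes> g) \<otimes> (c \<otimes> f \<otimes> k)" using g(1-5) k(1-3) by (simp add: m_ac)
    also have "\<dots> = (c \<otimes> b \<otimes> g) \<otimes> (e \<otimes> d \<otimes> k)" by (simp only: g(6) k(4))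
    also have "\<dots> = e \<otimes> b \<otimes> (c \<otimes> d \<otimes> g \<otimes> k)" using g(1-5) k(1-3) by (simp add: m_ac)
    finally show "(x, z) \<in> groth_rel G"
      unfolding abc using g k by (intro groth_relI [where g = "c \<otimes> d \<otimes> g \<otimes> k"]) auto
  qed
qed

definition gcls :: "'a \<Rightarrow> 'a \<Rightarrow> ('a \<times> 'a) set" where "gcls a b = groth_rel G `` {(a, b)}"

lemma gcls_eq_iff:
  "a \<in> carrier G \<Longrightarrow> b \<in> carrier G \<Longrightarrow> c \<in> carrier G \<Longrightarrow> d \<in> carrier G \<Longrightarrow>
    gcls a b = gcls c d \<longleftrightarrow> (\<exists>g\<in>carrier G. a \<otimes> d \<otimes> g = c \<otimes> b \<otimes> g)"
  unfolding gcls_def using eq_equiv_class_iff [OF equiv_groth_rel, of "(a, b)" "(c, d)"] by (auto simp: groth_rel_iff)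

lemma groth_carrier: "carrier (groth_group G) = {gcls a b | a b. a \<in> carrier G \<and> b \<in> carrier G}"
  by (auto simp: groth_group_def quotient_def gcls_def)

lemma groth_one: "\<one>\<^bsub>groth_group G\<^esub> = gcls \<one> \<one>"
  by (simp add: groth_group_def gcls_def)

lemma mem_gcls: "(c, d) \<in> gcls a b \<longleftrightarrow> ((a, b), (c, d)) \<in> groth_rel G"
  by (simp add: gcls_def)

lemma gcls_self: "a \<in> carrier G \<Longrightarrow> b \<in> carrier G \<Longrightarrow> (a, b) \<in> gcls a b"
  by (auto simp: mem_gcls groth_rel_iff)

lemma groth_mult:
  assumes abcd: "a \<in> carrier G" "b \<in> carrier G" "c \<in> carrier G" "d \<in> carrier G"
  shows "gcls a b \<otimes>\<^bsub>groth_group G\<^esub> gcls c d = gcls (a \<otimes> c) (b \<otimes> d)"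
proof -
  have *: "groth_rel G `` {(a' \<otimes> c', b' \<otimes> d')} = gcls (a \<otimes> c) (b \<otimes> d)"
    if ab': "(a', b') \<in> gcls a b" and cd': "(c', d') \<in> gcls c d" for a' b' c' d'
  proof -
    obtain g where g: "a' \<in> carrier G" "b' \<in> carrier G" "g \<in> carrier G" "a \<otimes> b' \<otimes> g = a' \<otimes> b \<otimes> g"
      using ab' unfolding mem_gcls groth_rel_iff by blast
    obtain k where k: "c' \<in> carrier G" "d' \<in> carrier G" "k \<in> carrier G" "c \<otimes> d' \<otimes> k = c' \<otimes> d \<otimes> k"
      using cd' unfolding mem_gcls groth_rel_iff by blast
    have "(a' \<otimes> c') \<otimes> (b \<otimes> d) \<otimes> (g \<otimes> k) = (a' \<otimes> b \<otimes> g) \<otimes> (c' \<otimes> d \<otimes> k)"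
      using abcd g(1-3) k(1-3) by (simp add: m_ac)
    also have "\<dots> = (a \<otimes> b' \<otimes> g) \<otimes> (c \<otimes> d' \<otimes> k)" by (simp only: g(4) k(4))
    also have "\<dots> = (a \<otimes> c) \<otimes> (b' \<otimes> d') \<otimes> (g \<otimes> k)" using abcd g(1-3) k(1-3) by (simp add: m_ac)
    finally have eq: "(a' \<otimes> c') \<otimes> (b \<otimes> d) \<otimes> (g \<otimes> k) = (a \<otimes> c) \<otimes> (b' \<otimes> d') \<otimes> (g \<otimes> k)" .
    have "gcls (a' \<otimes> c') (b' \<otimes> d') = gcls (a \<otimes> c) (b \<otimes> d)"
    proof (rule iffD2 [OF gcls_eq_iff])
      show "\<exists>g\<in>carrier G. (a' \<otimes> c') \<otimes> (b \<otimes> d) \<otimes> g = (a \<otimes> c) \<otimes> (b' \<otimes> d') \<otimes> g"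
        by (rule bexI [where x = "g \<otimes> k"]) (rule eq, simp add: g(1-3) k(1-3))
    qed (simp_all add: abcd g k)
    then show ?thesis by (simp add: gcls_def)
  qed
  have "gcls a b \<otimes>\<^bsub>groth_group G\<^esub> gcls c d
      = (\<Union>(a', b')\<in>gcls a b. \<Union>(c', d')\<in>gcls c d. groth_rel G `` {(a' \<otimes> c', b' \<otimes> d')})"
    by (simp add: groth_group_def)
  also have "\<dots> = (\<Union>(a', b')\<in>gcls a b. \<Union>(c', d')\<in>gcls c d. gcls (a \<otimes> c) (b \<otimes> d))"
    using * by (auto split: prod.splits) blast+
  also have "\<dots> = gcls (a \<otimes> c) (b \<otimes> d)"
    using gcls_self [OF abcd(1,2)] gcls_self [OF abcd(3,4)] by (auto split: prod.splits)
  finally show ?thesis .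
qed

end

lemma groth_map_gcls:
  assumes M: "comm_monoid M" and N: "comm_monoid N"
    and h: "\<And>x. x \<in> carrier M \<Longrightarrow> h x \<in> carrier N"
      "\<And>x y. x \<in> carrier M \<Longrightarrow> y \<in> carrier M \<Longrightarrow> h (x \<otimes>\<^bsub>M\<^esub> y) = h x \<otimes>\<^bsub>N\<^esub> h y"
    and ab: "a \<in> carrier M" "b \<in> carrier M"
  shows "groth_map N h (comm_monoid.gcls M a b) = comm_monoid.gcls N (h a) (h b)"
proof -
  interpret M: comm_monoid M by (rule M)
  interpret N: comm_monoid N by (rule N)
  have *: "groth_rel N `` {(h a', h b')} = N.gcls (h a) (h b)" if "(a', b') \<in> M.gcls a b" for a' b'
  proof -
    obtain g where g: "a' \<in> carrier M" "b' \<in> carrier M" "g \<in> carrier M" "a \<otimes>\<^bsub>M\<^esub> b' \<otimes>\<^bsub>M\<^esub> g = a' \<otimes>\<^bsub>M\<^esub> b \<otimes>\<^bsub>M\<^esub> g"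
      using \<open>(a', b') \<in> M.gcls a b\<close> unfolding M.mem_gcls M.groth_rel_iff by blast
    have "h a' \<otimes>\<^bsub>N\<^esub> h b \<otimes>\<^bsub>N\<^esub> h g = h (a' \<otimes>\<^bsub>M\<^esub> b \<otimes>\<^bsub>M\<^esub> g)" using ab g(1-3) by (simp add: h)
    also have "\<dots> = h (a \<otimes>\<^bsub>M\<^esub> b' \<otimes>\<^bsub>M\<^esub> g)" by (simp only: g(4))
    also have "\<dots> = h a \<otimes>\<^bsub>N\<^esub> h b' \<otimes>\<^bsub>N\<^esub> h g" using ab g(1-3) by (simp add: h)
    finally have eq: "h a' \<otimes>\<^bsub>N\<^esub> h b \<otimes>\<^bsub>N\<^esub> h g = h a \<otimes>\<^bsub>N\<^esub> h b' \<otimes>\<^bsub>N\<^esub> h g" .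
    have "N.gcls (h a') (h b') = N.gcls (h a) (h b)"
    proof (rule iffD2 [OF N.gcls_eq_iff])
      show "\<exists>g\<in>carrier N. h a' \<otimes>\<^bsub>N\<^esub> h b \<otimes>\<^bsub>N\<^esub> g = h a \<otimes>\<^bsub>N\<^esub> h b' \<otimes>\<^bsub>N\<^esub> g"
        by (rule bexI [where x = "h g"]) (rule eq, simp add: h(1) g(1-3))
    qed (simp_all add: h(1) ab g)
    then show ?thesis by (simp add: N.gcls_def)
  qed
  have "groth_map N h (M.gcls a b) = (\<Union>(a', b')\<in>M.gcls a b. N.gcls (h a) (h b))"
    unfolding groth_map_def using * by (auto split: prod.splits)
  also have "\<dots> = N.gcls (h a) (h b)" using M.gcls_self [OF ab] by (auto split: prod.splits)
  finally show ?thesis .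
qed

text \<open>If every element of \<open>M\<close> is stably of the form \<open>u\<^sup>r q\<^sup>b\<close> with unique exponents and \<open>h\<close> forgets \<open>q\<close> but not \<open>u\<close>,
  then the kernel of \<open>h\<close> on Grothendieck groups is generated freely by \<open>q\<close>.\<close>

lemma groth_kernel_iso_integers:
  fixes t :: "'b \<Rightarrow> complex"
  assumes M: "comm_monoid M" and N: "comm_monoid N"
    and h: "\<And>x. x \<in> carrier M \<Longrightarrow> h x \<in> carrier N"
      "\<And>x y. x \<in> carrier M \<Longrightarrow> y \<in> carrier M \<Longrightarrow> h (x \<otimes>\<^bsub>M\<^esub> y) = h x \<otimes>\<^bsub>N\<^esub> h y" "h \<one>\<^bsub>M\<^esub> = \<one>\<^bsub>N\<^esub>"
    and t: "\<And>x y. x \<in> carrier N \<Longrightarrow> y \<in> carrier N \<Longrightarrow> t (x \<otimes>\<^bsub>N\<^esub> y) = t x + t y"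
    and u: "u \<in> carrier M" "t (h u) = 1" and q: "q \<in> carrier M" "h q = \<one>\<^bsub>N\<^esub>"
    and ex: "\<And>v. v \<in> carrier M \<Longrightarrow> \<exists>r a b. v \<otimes>\<^bsub>M\<^esub> q [^]\<^bsub>M\<^esub> (a::nat) = u [^]\<^bsub>M\<^esub> (r::nat) \<otimes>\<^bsub>M\<^esub> q [^]\<^bsub>M\<^esub> (b::nat)"
    and uniq: "\<And>r b b'. u [^]\<^bsub>M\<^esub> (r::nat) \<otimes>\<^bsub>M\<^esub> q [^]\<^bsub>M\<^esub> (b::nat) = u [^]\<^bsub>M\<^esub> r \<otimes>\<^bsub>M\<^esub> q [^]\<^bsub>M\<^esub> (b'::nat) \<Longrightarrow> b = b'"
  shows "(groth_group M)\<lparr>carrier := kernel (groth_group M) (groth_group N) (groth_map N h)\<rparr> \<cong> integer_group"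
proof -
  interpret M: comm_monoid M by (rule M)
  interpret N: comm_monoid N by (rule N)
  let ?G = "(groth_group M)\<lparr>carrier := kernel (groth_group M) (groth_group N) (groth_map N h)\<rparr>"
  \<comment> \<open>\<open>rp v r k\<close> says that v is stably the r-th power of u times the k-th
    power of q; the stabilizing exponent a is absorbed in the integer k.\<close>
  define rp where "rp = (\<lambda>v (r::nat) (k::int). \<exists>a b. v \<otimes>\<^bsub>M\<^esub> q [^]\<^bsub>M\<^esub> (a::nat) = u [^]\<^bsub>M\<^esub> r \<otimes>\<^bsub>M\<^esub> q [^]\<^bsub>M\<^esub> (b::nat) \<and> k = int b - int a)"
  have t1: "t \<one>\<^bsub>N\<^esub> = 0" using t [of "\<one>\<^bsub>N\<^esub>" "\<one>\<^bsub>N\<^esub>"] by simp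
  have hq: "h (q [^]\<^bsub>M\<^esub> (a::nat)) = \<one>\<^bsub>N\<^esub>" for a by (induction a) (simp_all add: h q)
  have thu: "t (h (u [^]\<^bsub>M\<^esub> (r::nat))) = of_nat r" for r
    by (induction r) (simp_all add: h t t1 u)
  have th_rp: "t (h v) = of_nat r" if v: "v \<in> carrier M" and "rp v r k" for v r k
  proof -
    obtain a b :: nat where "v \<otimes>\<^bsub>M\<^esub> q [^]\<^bsub>M\<^esub> a = u [^]\<^bsub>M\<^esub> r \<otimes>\<^bsub>M\<^esub> q [^]\<^bsub>M\<^esub> b" using \<open>rp v r k\<close> by (auto simp: rp_def)
    then have "h (v \<otimes>\<^bsub>M\<^esub> q [^]\<^bsub>M\<^esub> a) = h (u [^]\<^bsub>M\<^esub> r \<otimes>\<^bsub>M\<^esub> q [^]\<^bsub>M\<^esub> b)" by simp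
    then have "h v = h (u [^]\<^bsub>M\<^esub> r)" using v u q h by (simp add: hq)
    then show ?thesis by (simp add: thu)
  qed
  have total: "\<exists>r k. rp v r k" if "v \<in> carrier M" for v using ex [OF that] by (auto simp: rp_def)
  have add: "rp (v \<otimes>\<^bsub>M\<^esub> w) (r + s) (k + l)" if v: "v \<in> carrier M" "rp v r k" and w: "w \<in> carrier M" "rp w s l" for v w r s k l
  proof -
    obtain a b :: nat where ab: "v \<otimes>\<^bsub>M\<^esub> q [^]\<^bsub>M\<^esub> a = u [^]\<^bsub>M\<^esub> r \<otimes>\<^bsub>M\<^esub> q [^]\<^bsub>M\<^esub> b" "k = int b - int a" using v by (auto simp: rp_def)
    obtain c d :: nat where cd: "w \<otimes>\<^bsub>M\<^esub> q [^]\<^bsub>M\<^esub> c = u [^]\<^bsub>M\<^esub> s \<otimes>\<^bsub>M\<^esub> q [^]\<^bsub>M\<^esub> d" "l = int d - int c" using w by (auto simp: rp_def)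
    have "(v \<otimes>\<^bsub>M\<^esub> w) \<otimes>\<^bsub>M\<^esub> q [^]\<^bsub>M\<^esub> (a + c) = (v \<otimes>\<^bsub>M\<^esub> q [^]\<^bsub>M\<^esub> a) \<otimes>\<^bsub>M\<^esub> (w \<otimes>\<^bsub>M\<^esub> q [^]\<^bsub>M\<^esub> c)"
      using v w q by (simp add: M.m_ac flip: M.nat_pow_mult)
    also have "\<dots> = (u [^]\<^bsub>M\<^esub> r \<otimes>\<^bsub>M\<^esub> q [^]\<^bsub>M\<^esub> b) \<otimes>\<^bsub>M\<^esub> (u [^]\<^bsub>M\<^esub> s \<otimes>\<^bsub>M\<^esub> q [^]\<^bsub>M\<^esub> d)" using ab cd by simp
    also have "\<dots> = u [^]\<^bsub>M\<^esub> (r + s) \<otimes>\<^bsub>M\<^esub> q [^]\<^bsub>M\<^esub> (b + d)"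
      using u q by (simp add: M.m_ac flip: M.nat_pow_mult)
    finally show ?thesis using ab cd unfolding rp_def by (intro exI [of _ "a + c"] exI [of _ "b + d"]) simp
  qed
  have unique: "k = k'" if v: "v \<in> carrier M" and 1: "rp v r k" and 2: "rp v r k'" for v r k k'
  proof -
    obtain a b :: nat where ab: "v \<otimes>\<^bsub>M\<^esub> q [^]\<^bsub>M\<^esub> a = u [^]\<^bsub>M\<^esub> r \<otimes>\<^bsub>M\<^esub> q [^]\<^bsub>M\<^esub> b" "k = int b - int a" using 1 by (auto simp: rp_def)
    obtain c d :: nat where cd: "v \<otimes>\<^bsub>M\<^esub> q [^]\<^bsub>M\<^esub> c = u [^]\<^bsub>M\<^esub> r \<otimes>\<^bsub>M\<^esub> q [^]\<^bsub>M\<^esub> d" "k' = int d - int c" using 2 by (auto simp: rp_def)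
    have "u [^]\<^bsub>M\<^esub> r \<otimes>\<^bsub>M\<^esub> q [^]\<^bsub>M\<^esub> (b + c) = (v \<otimes>\<^bsub>M\<^esub> q [^]\<^bsub>M\<^esub> a) \<otimes>\<^bsub>M\<^esub> q [^]\<^bsub>M\<^esub> c"
      using u q by (simp add: ab(1) M.m_assoc flip: M.nat_pow_mult)
    also have "\<dots> = (v \<otimes>\<^bsub>M\<^esub> q [^]\<^bsub>M\<^esub> c) \<otimes>\<^bsub>M\<^esub> q [^]\<^bsub>M\<^esub> a" using v q by (simp add: M.m_ac)
    also have "\<dots> = u [^]\<^bsub>M\<^esub> r \<otimes>\<^bsub>M\<^esub> q [^]\<^bsub>M\<^esub> (d + a)"
      using u q by (simp add: cd(1) M.m_assoc flip: M.nat_pow_mult)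
    finally have "b + c = d + a" by (rule uniq)
    then show ?thesis using ab cd by simp
  qed
  have stable: "\<exists>c\<in>carrier M. v \<otimes>\<^bsub>M\<^esub> c = w \<otimes>\<^bsub>M\<^esub> c" if v: "v \<in> carrier M" "rp v r k" and w: "w \<in> carrier M" "rp w r k" for v w r k
  proof -
    obtain a b :: nat where ab: "v \<otimes>\<^bsub>M\<^esub> q [^]\<^bsub>M\<^esub> a = u [^]\<^bsub>M\<^esub> r \<otimes>\<^bsub>M\<^esub> q [^]\<^bsub>M\<^esub> b" "k = int b - int a" using v by (auto simp: rp_def)
    obtain c d :: nat where cd: "w \<otimes>\<^bsub>M\<^esub> q [^]\<^bsub>M\<^esub> c = u [^]\<^bsub>M\<^esub> r \<otimes>\<^bsub>M\<^esub> q [^]\<^bsub>M\<^esub> d" "k = int d - int c" using w by (auto simp: rp_def)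
    have bc: "b + c = d + a" using ab cd by simp
    have "v \<otimes>\<^bsub>M\<^esub> q [^]\<^bsub>M\<^esub> (a + c) = (v \<otimes>\<^bsub>M\<^esub> q [^]\<^bsub>M\<^esub> a) \<otimes>\<^bsub>M\<^esub> q [^]\<^bsub>M\<^esub> c"
      using v q by (simp add: M.m_assoc flip: M.nat_pow_mult)
    also have "\<dots> = u [^]\<^bsub>M\<^esub> r \<otimes>\<^bsub>M\<^esub> q [^]\<^bsub>M\<^esub> (b + c)" using u q by (simp add: ab(1) M.m_assoc flip: M.nat_pow_mult)
    also have "\<dots> = (w \<otimes>\<^bsub>M\<^esub> q [^]\<^bsub>M\<^esub> c) \<otimes>\<^bsub>M\<^esub> q [^]\<^bsub>M\<^esub> a" unfolding bc using u q by (simp add: cd(1) M.m_assoc flip: M.nat_pow_mult)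
    also have "\<dots> = w \<otimes>\<^bsub>M\<^esub> q [^]\<^bsub>M\<^esub> (a + c)" using w q by (simp add: M.m_ac flip: M.nat_pow_mult)
    finally show ?thesis using q by blast
  qed
  have rq: "rp (q [^]\<^bsub>M\<^esub> (i::nat)) 0 (int i)" for i
    unfolding rp_def using q by (intro exI [of _ 0] exI [of _ i]) simp
  \<comment> \<open>The integer k goes to the k-th power of the class of q, a negative power being
    written as a formal difference.\<close>
  define psi where "psi = (\<lambda>k. M.gcls (q [^]\<^bsub>M\<^esub> nat k) (q [^]\<^bsub>M\<^esub> nat (- k)))"
  have ker: "M.gcls a b \<in> kernel (groth_group M) (groth_group N) (groth_map N h) \<longleftrightarrow> (\<exists>g\<in>carrier N. h a \<otimes>\<^bsub>N\<^esub> g = h b \<otimes>\<^bsub>N\<^esub> g)"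
    if "a \<in> carrier M" "b \<in> carrier M" for a b
  proof -
    have "M.gcls a b \<in> carrier (groth_group M)" using that by (auto simp: M.groth_carrier)
    moreover have "groth_map N h (M.gcls a b) = \<one>\<^bsub>groth_group N\<^esub> \<longleftrightarrow> (\<exists>g\<in>carrier N. h a \<otimes>\<^bsub>N\<^esub> g = h b \<otimes>\<^bsub>N\<^esub> g)"
      using that h by (simp add: groth_map_gcls [OF M N h(1,2)] N.groth_one N.gcls_eq_iff)
    ultimately show ?thesis by (simp add: kernel_def)
  qed
  have "psi \<in> iso integer_group ?G"
    unfolding iso_def
  proof (intro CollectI conjI)
    show "psi \<in> hom integer_group ?G"
    proof (rule homI)
      fix k :: int
      show "psi k \<in> carrier ?G"
        unfolding psi_def using ker q by (simp add: hq) (use N.one_closed in blast)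
      fix l :: int
      have "nat (k + l) + (nat (- k) + nat (- l)) = nat k + nat l + nat (- (k + l))" by linarith
      then have "q [^]\<^bsub>M\<^esub> nat (k + l) \<otimes>\<^bsub>M\<^esub> (q [^]\<^bsub>M\<^esub> nat (- k) \<otimes>\<^bsub>M\<^esub> q [^]\<^bsub>M\<^esub> nat (- l))
          = (q [^]\<^bsub>M\<^esub> nat k \<otimes>\<^bsub>M\<^esub> q [^]\<^bsub>M\<^esub> nat l) \<otimes>\<^bsub>M\<^esub> q [^]\<^bsub>M\<^esub> nat (- (k + l))"
        using q(1) by (simp only: M.nat_pow_mult)
      then have "psi (k + l) = M.gcls (q [^]\<^bsub>M\<^esub> nat k \<otimes>\<^bsub>M\<^esub> q [^]\<^bsub>M\<^esub> nat l) (q [^]\<^bsub>M\<^esub> nat (- k) \<otimes>\<^bsub>M\<^esub> q [^]\<^bsub>M\<^esub> nat (- l))"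
        unfolding psi_def using q(1) by (subst M.gcls_eq_iff) (auto intro!: bexI [of _ "\<one>\<^bsub>M\<^esub>"])
      then show "psi (k \<otimes>\<^bsub>integer_group\<^esub> l) = psi k \<otimes>\<^bsub>?G\<^esub> psi l"
        using q(1) by (simp add: psi_def M.groth_mult)
    qed
    show "bij_betw psi (carrier integer_group) (carrier ?G)"
    proof (rule bij_betw_imageI)
      show "inj_on psi (carrier integer_group)"
      proof (rule inj_onI)
        fix k l assume "psi k = psi l"
        then obtain g where g: "g \<in> carrier M" and eq: "q [^]\<^bsub>M\<^esub> nat k \<otimes>\<^bsub>M\<^esub> q [^]\<^bsub>M\<^esub> nat (- l) \<otimes>\<^bsub>M\<^esub> g = q [^]\<^bsub>M\<^esub> nat l \<otimes>\<^bsub>M\<^esub> q [^]\<^bsub>M\<^esub> nat (- k) \<otimes>\<^bsub>M\<^esub> g"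
          unfolding psi_def using q(1) by (subst (asm) M.gcls_eq_iff) auto
        obtain r m where rm: "rp g r m" using total [OF g] by blast
        have "rp (q [^]\<^bsub>M\<^esub> nat k \<otimes>\<^bsub>M\<^esub> q [^]\<^bsub>M\<^esub> nat (- l) \<otimes>\<^bsub>M\<^esub> g) (0 + 0 + r) (int (nat k) + int (nat (- l)) + m)"
          using q(1) g by (intro add rq rm) auto
        moreover have "rp (q [^]\<^bsub>M\<^esub> nat l \<otimes>\<^bsub>M\<^esub> q [^]\<^bsub>M\<^esub> nat (- k) \<otimes>\<^bsub>M\<^esub> g) (0 + 0 + r) (int (nat l) + int (nat (- k)) + m)"
          using q(1) g by (intro add rq rm) auto
        ultimately have "int (nat k) + int (nat (- l)) + m = int (nat l) + int (nat (- k)) + m"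
          using q(1) g unfolding eq by (intro unique) auto
        then show "k = l" by linarith
      qed
      show "psi ` carrier integer_group = carrier ?G"
      proof (rule subset_antisym; rule subsetI)
        fix P assume "P \<in> psi ` carrier integer_group"
        then show "P \<in> carrier ?G"
          unfolding psi_def using ker q by (auto simp: hq) (use N.one_closed in blast)
      next
        fix P assume P: "P \<in> carrier ?G"
        then have "P \<in> carrier (groth_group M)" by (simp add: kernel_def)
        then obtain v w where vw: "v \<in> carrier M" "w \<in> carrier M" "P = M.gcls v w" by (auto simp: M.groth_carrier)
        obtain g where g: "g \<in> carrier N" "h v \<otimes>\<^bsub>N\<^esub> g = h w \<otimes>\<^bsub>N\<^esub> g" using P ker [OF vw(1,2)] vw(3) by auto
        \<comment> \<open>The stabilizing g cancels because t takes values in a group; equal values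
          of t then force equal exponents of u.\<close>
        have "t (h v) + t g = t (h w) + t g" using arg_cong [OF g(2), of t] g(1) vw h by (simp add: t)
        then have tt: "t (h v) = t (h w)" by simp
        obtain r k where rk: "rp v r k" using total [OF vw(1)] by blast
        obtain s l where sl: "rp w s l" using total [OF vw(2)] by blast
        have rs: "r = s" using th_rp [OF vw(1) rk] th_rp [OF vw(2) sl] tt by simp
        have 1: "rp (v \<otimes>\<^bsub>M\<^esub> q [^]\<^bsub>M\<^esub> nat (- (k - l))) (r + 0) (k + int (nat (- (k - l))))"
          using q(1) vw by (intro add rq rk) auto
        have 2: "rp (w \<otimes>\<^bsub>M\<^esub> q [^]\<^bsub>M\<^esub> nat (k - l)) (s + 0) (l + int (nat (k - l)))"
          using q(1) vw by (intro add rq sl) auto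
        have kl: "k + int (nat (- (k - l))) = l + int (nat (k - l))" by linarith
        obtain c where c: "c \<in> carrier M" "v \<otimes>\<^bsub>M\<^esub> q [^]\<^bsub>M\<^esub> nat (- (k - l)) \<otimes>\<^bsub>M\<^esub> c = w \<otimes>\<^bsub>M\<^esub> q [^]\<^bsub>M\<^esub> nat (k - l) \<otimes>\<^bsub>M\<^esub> c"
          using stable [OF _ 1 _ 2 [folded rs kl]] vw q(1) by auto
        have "P = psi (k - l)"
          unfolding vw(3) psi_def
        proof (subst M.gcls_eq_iff)
          show "\<exists>g\<in>carrier M. v \<otimes>\<^bsub>M\<^esub> q [^]\<^bsub>M\<^esub> nat (- (k - l)) \<otimes>\<^bsub>M\<^esub> g = q [^]\<^bsub>M\<^esub> nat (k - l) \<otimes>\<^bsub>M\<^esub> w \<otimes>\<^bsub>M\<^esub> g"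
            using c vw q(1) by (intro bexI [of _ c]) (simp_all add: M.m_comm)
        qed (use vw q(1) in auto)
        then show "P \<in> psi ` carrier integer_group" by simp
      qed
    qed
  qed
  then have "integer_group \<cong> ?G" by (auto simp: is_iso_def)
  then show ?thesis by (rule group.iso_sym [OF group_integer_group])
qed

section \<open>Row-finite matrices over a ring\<close>

text \<open>Finite rows turn every entry of a product into a finite sum and make the product
  associative. Besides finite matrices the type contains the unit, the one-sided shifts and constant
  diagonals, all of which occur as factors.\<close>

typedef (overloaded) 'r rfmat = "{x :: nat \<Rightarrow> nat \<Rightarrow> 'r::zero. \<forall>i. finite {k. x i k \<noteq> 0}}"
  morphisms ent Rf
  by (rule exI [of _ "\<lambda>i j. 0"]) simp

setup_lifting type_definition_rfmat

lemma ent_finite: "finite {k. ent x i k \<noteq> 0}"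
  using ent [of x] by blast

lemma rfmat_eqI: "(\<And>i j. ent x i j = ent y i j) \<Longrightarrow> x = y"
  by (simp add: ent_inject [symmetric] fun_eq_iff)

instantiation rfmat :: ("{ring, monoid_mult}") "{ring, monoid_mult}"
begin

lift_definition zero_rfmat :: "'a rfmat" is "\<lambda>i j. 0" by simp

lift_definition one_rfmat :: "'a rfmat" is "\<lambda>i j. if i = j then 1 else 0"
proof -
  fix i :: nat
  have "{k. (if i = k then 1 else 0 :: 'a) \<noteq> 0} \<subseteq> {i}" by auto
  then show "finite {k. (if i = k then 1 else 0 :: 'a) \<noteq> 0}" by (rule finite_subset) simp
qed

lift_definition plus_rfmat :: "'a rfmat \<Rightarrow> 'a rfmat \<Rightarrow> 'a rfmat" is "\<lambda>x y i j. x i j + y i j"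
proof -
  fix x y :: "nat \<Rightarrow> nat \<Rightarrow> 'a" and i
  assume "\<And>i. finite {k. x i k \<noteq> 0}" "\<And>i. finite {k. y i k \<noteq> 0}"
  then have "finite ({k. x i k \<noteq> 0} \<union> {k. y i k \<noteq> 0})" by blast
  then show "finite {k. x i k + y i k \<noteq> 0}" by (rule rev_finite_subset) auto
qed

lift_definition uminus_rfmat :: "'a rfmat \<Rightarrow> 'a rfmat" is "\<lambda>x i j. - x i j" by simp

definition minus_rfmat :: "'a rfmat \<Rightarrow> 'a rfmat \<Rightarrow> 'a rfmat" where "minus_rfmat x y = x + - y"

lift_definition times_rfmat :: "'a rfmat \<Rightarrow> 'a rfmat \<Rightarrow> 'a rfmat" is
  "\<lambda>x y i j. \<Sum>k\<in>{k. x i k \<noteq> 0}. x i k * y k j"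
proof -
  fix x y :: "nat \<Rightarrow> nat \<Rightarrow> 'a" and i
  assume xy: "\<And>i. finite {k. x i k \<noteq> 0}" "\<And>i. finite {k. y i k \<noteq> 0}"
  have "{j. (\<Sum>k\<in>{k. x i k \<noteq> 0}. x i k * y k j) \<noteq> 0} \<subseteq> (\<Union>k\<in>{k. x i k \<noteq> 0}. {j. y k j \<noteq> 0})"
  proof
    fix j assume "j \<in> {j. (\<Sum>k\<in>{k. x i k \<noteq> 0}. x i k * y k j) \<noteq> 0}"
    then obtain k where "k \<in> {k. x i k \<noteq> 0}" "x i k * y k j \<noteq> 0"
      using sum.neutral [of "{k. x i k \<noteq> 0}" "\<lambda>k. x i k * y k j"] by blast
    then show "j \<in> (\<Union>k\<in>{k. x i k \<noteq> 0}. {j. y k j \<noteq> 0})" by auto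
  qed
  then show "finite {j. (\<Sum>k\<in>{k. x i k \<noteq> 0}. x i k * y k j) \<noteq> 0}"
    using xy by (rule_tac finite_subset) auto
qed

lemma ent_mult:
  fixes x y :: "'a rfmat"
  assumes "finite A" "\<And>k. k \<notin> A \<Longrightarrow> ent x i k = 0"
  shows "ent (x * y) i j = (\<Sum>k\<in>A. ent x i k * ent y k j)"
  unfolding times_rfmat.rep_eq
  by (rule sum.mono_neutral_left [OF assms(1)]) (use assms(2) in auto)

instance
proof
  fix a b c :: "'a rfmat"
  show "a + b + c = a + (b + c)" by transfer (simp add: add.assoc)
  show "a + b = b + a" by transfer (simp add: add.commute)
  show "0 + a = a" by transfer simp
  show "- a + a = 0" by transfer simp
  show "a - b = a + - b" by (rule minus_rfmat_def)
  show "a * b * c = a * (b * c)"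
  proof (rule rfmat_eqI)
    fix i j
    let ?A = "{k. ent a i k \<noteq> 0}"
    let ?S = "\<Union>k\<in>?A. {l. ent b k l \<noteq> 0}"
    have finS: "finite ?S" by (intro finite_UN_I ent_finite)
    have ab: "ent (a * b) i l = (\<Sum>k\<in>?A. ent a i k * ent b k l)" for l
      by (rule ent_mult [OF ent_finite]) simp
    have "ent (a * b * c) i j = (\<Sum>l\<in>?S. ent (a * b) i l * ent c l j)"
      by (rule ent_mult [OF finS]) (auto simp: ab intro!: sum.neutral)
    also have "\<dots> = (\<Sum>l\<in>?S. \<Sum>k\<in>?A. ent a i k * (ent b k l * ent c l j))"
      by (simp add: ab sum_distrib_right mult.assoc)
    also have "\<dots> = (\<Sum>k\<in>?A. \<Sum>l\<in>?S. ent a i k * (ent b k l * ent c l j))" by (rule sum.swap)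
    also have "\<dots> = (\<Sum>k\<in>?A. ent a i k * ent (b * c) k j)"
    proof (rule sum.cong [OF refl])
      fix k assume "k \<in> ?A"
      then have "ent (b * c) k j = (\<Sum>l\<in>?S. ent b k l * ent c l j)" by (intro ent_mult finS) auto
      then show "(\<Sum>l\<in>?S. ent a i k * (ent b k l * ent c l j)) = ent a i k * ent (b * c) k j"
        by (simp add: sum_distrib_left)
    qed
    also have "\<dots> = ent (a * (b * c)) i j" by (rule ent_mult [OF ent_finite, symmetric]) simp
    finally show "ent (a * b * c) i j = ent (a * (b * c)) i j" .
  qed
  show "(a + b) * c = a * c + b * c"
  proof (rule rfmat_eqI)
    fix i j
    let ?S = "{k. ent a i k \<noteq> 0} \<union> {k. ent b i k \<noteq> 0}"
    have fin: "finite ?S" using ent_finite by blast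
    have "ent ((a + b) * c) i j = (\<Sum>k\<in>?S. ent (a + b) i k * ent c k j)"
      "ent (a * c) i j = (\<Sum>k\<in>?S. ent a i k * ent c k j)" "ent (b * c) i j = (\<Sum>k\<in>?S. ent b i k * ent c k j)"
      by (rule ent_mult [OF fin]; simp add: plus_rfmat.rep_eq)+
    then show "ent ((a + b) * c) i j = ent (a * c + b * c) i j"
      by (simp add: plus_rfmat.rep_eq distrib_right sum.distrib)
  qed
  show "a * (b + c) = a * b + a * c"
  proof (rule rfmat_eqI)
    fix i j
    show "ent (a * (b + c)) i j = ent (a * b + a * c) i j"
      by (simp add: times_rfmat.rep_eq plus_rfmat.rep_eq distrib_left sum.distrib)
  qed
  show "1 * a = a"
  proof (rule rfmat_eqI)
    fix i j
    have "ent (1 * a) i j = (\<Sum>k\<in>{i}. ent 1 i k * ent a k j)" by (rule ent_mult) (auto simp: one_rfmat.rep_eq)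
    then show "ent (1 * a) i j = ent a i j" by (simp add: one_rfmat.rep_eq)
  qed
  show "a * 1 = a"
  proof (rule rfmat_eqI)
    fix i j
    have "ent (a * 1) i j = (\<Sum>k\<in>insert j {k. ent a i k \<noteq> 0}. ent a i k * ent 1 k j)"
      by (rule ent_mult) (auto simp: ent_finite)
    also have "\<dots> = (\<Sum>k\<in>insert j {k. ent a i k \<noteq> 0}. if k = j then ent a i k else 0)"
      by (intro sum.cong) (auto simp: one_rfmat.rep_eq)
    also have "\<dots> = ent a i j" by (subst sum.delta) (simp_all add: ent_finite)
    finally show "ent (a * 1) i j = ent a i j" .
  qed
qed

end

lemmas ent_simps = zero_rfmat.rep_eq one_rfmat.rep_eq plus_rfmat.rep_eq uminus_rfmat.rep_eq

lemma ent_minus [simp]: "ent (x - y) i j = ent x i j - ent y i j"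
  unfolding minus_rfmat_def by (simp only: ent_simps) simp

lemma ent_add [simp]: "ent (x + y) i j = ent x i j + ent y i j"
  and ent_uminus [simp]: "ent (- x) i j = - ent x i j"
  and ent_zero [simp]: "ent 0 i j = 0"
  and ent_one: "ent 1 i j = (if i = j then 1 else 0)"
  by (simp_all add: ent_simps)

section \<open>Finite blocks in row-finite matrices\<close>

definition corner :: "nat \<Rightarrow> 'r::zero rfmat \<Rightarrow> bool" where
  "corner n x \<longleftrightarrow> (\<forall>i j. n \<le> i \<or> n \<le> j \<longrightarrow> ent x i j = 0)"

lemma cornerD: "corner n x \<Longrightarrow> n \<le> i \<or> n \<le> j \<Longrightarrow> ent x i j = 0"
  unfolding corner_def by blast

lemma corner_mono: "corner n x \<Longrightarrow> n \<le> m \<Longrightarrow> corner m x"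
  by (auto simp: corner_def)

lemma corner_0 [simp]: "corner n (0 :: 'r::{ring, monoid_mult} rfmat)" by (simp add: corner_def)

lemma corner_add: "corner n x \<Longrightarrow> corner n y \<Longrightarrow> corner n (x + (y :: 'r::{ring, monoid_mult} rfmat))"
  and corner_diff: "corner n x \<Longrightarrow> corner n y \<Longrightarrow> corner n (x - (y :: 'r::{ring, monoid_mult} rfmat))"
  by (auto simp: corner_def)

lemma ent_mult_corner:
  fixes x y :: "'r::{ring, monoid_mult} rfmat"
  shows "corner n x \<Longrightarrow> ent (x * y) i j = (\<Sum>k<n. ent x i k * ent y k j)"
  by (rule ent_mult) (auto simp: corner_def)

lemma ent_mult_corner_right:
  fixes x y :: "'r::{ring, monoid_mult} rfmat"
  assumes "corner n y" shows "ent (x * y) i j = (\<Sum>k<n. ent x i k * ent y k j)"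
proof -
  have "ent (x * y) i j = (\<Sum>k\<in>{k. ent x i k \<noteq> 0} \<union> {..<n}. ent x i k * ent y k j)"
    by (rule ent_mult) (auto simp: ent_finite)
  also have "\<dots> = (\<Sum>k<n. ent x i k * ent y k j)"
    by (rule sum.mono_neutral_right) (auto simp: ent_finite cornerD [OF assms])
  finally show ?thesis .
qed

lemma corner_mult:
  fixes x y :: "'r::{ring, monoid_mult} rfmat"
  assumes x: "corner n x" and y: "corner n y" shows "corner n (x * y)"
  unfolding corner_def ent_mult_corner [OF x] using cornerD [OF x] cornerD [OF y] by auto

lemma ent_Rf:
  assumes "\<And>i. finite {k. f i k \<noteq> 0}" shows "ent (Rf f) = f"
  by (rule Rf_inverse) (use assms in simp)

lemma ent_Rf_corner:
  assumes "\<And>i j. n \<le> i \<or> n \<le> j \<Longrightarrow> f i j = 0" shows "ent (Rf f) = f"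
proof (rule ent_Rf)
  fix i
  have "{k. f i k \<noteq> 0} \<subseteq> {..<n}" using assms not_less by auto
  then show "finite {k. f i k \<noteq> 0}" by (rule finite_subset) simp
qed

section \<open>The monoid \<open>V(R)\<close> and the group \<open>GL\<^sub>\<infinity>(R)\<close>\<close>

text \<open>The ring \<open>R\<close> is represented inside a type \<open>'r\<close> of class ring, so that matrices over \<open>R\<close> become elements of
  a type of class ring as well.\<close>

definition shiftl :: "nat \<Rightarrow> 'r::{ring, monoid_mult} rfmat" where
  "shiftl k = Rf (\<lambda>i j. if i = j + k then 1 else 0)"

definition shiftr :: "nat \<Rightarrow> 'r::{ring, monoid_mult} rfmat" where
  "shiftr k = Rf (\<lambda>i j. if j = i + k then 1 else 0)"

lemma ent_shiftl: "ent (shiftl k) i j = (if i = j + k then 1 else (0 :: 'r::{ring, monoid_mult}))"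
proof -
  have "finite {j. (if i = j + k then 1 else (0 :: 'r)) \<noteq> 0}" for i
    by (rule finite_subset [of _ "{i - k}"]) auto
  then show ?thesis unfolding shiftl_def by (subst ent_Rf) auto
qed

lemma ent_shiftr: "ent (shiftr k) i j = (if j = i + k then 1 else (0 :: 'r::{ring, monoid_mult}))"
proof -
  have "finite {j. (if j = i + k then 1 else (0 :: 'r)) \<noteq> 0}" for i
    by (rule finite_subset [of _ "{i + k}"]) auto
  then show ?thesis unfolding shiftr_def by (subst ent_Rf) auto
qed

lemma ent_shiftl_mult: "ent (shiftl k * m) i j = (if k \<le> i then ent m (i - k) j else (0 :: 'r::{ring, monoid_mult}))"
proof -
  have "ent (shiftl k * m) i j = (\<Sum>l\<in>{i - k}. ent (shiftl k) i l * ent m l j)"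
    by (rule ent_mult) (auto simp: ent_shiftl)
  then show ?thesis by (auto simp: ent_shiftl)
qed

lemma ent_mult_shiftr: "ent (m * shiftr k) i j = (if k \<le> j then ent m i (j - k) else (0 :: 'r::{ring, monoid_mult}))"
proof -
  have "ent (m * shiftr k) i j = (\<Sum>l\<in>insert (j - k) {l. ent m i l \<noteq> 0}. ent m i l * ent (shiftr k) l j)"
    by (rule ent_mult) (auto simp: ent_finite)
  also have "\<dots> = (\<Sum>l\<in>insert (j - k) {l. ent m i l \<noteq> 0}. if l = j - k then (if k \<le> j then ent m i l else 0) else 0)"
    by (intro sum.cong) (auto simp: ent_shiftr)
  also have "\<dots> = (if k \<le> j then ent m i (j - k) else 0)" by (subst sum.delta) (simp_all add: ent_finite)
  finally show ?thesis .
qed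

lemma shiftr_shiftl: "shiftr k * shiftl k = (1 :: 'r::{ring, monoid_mult} rfmat)"
proof (rule rfmat_eqI)
  fix i j
  have "ent (shiftr k * shiftl k) i j = (\<Sum>l\<in>{i + k}. ent (shiftr k) i l * ent (shiftl k :: 'r rfmat) l j)"
    by (rule ent_mult) (auto simp: ent_shiftr)
  then show "ent (shiftr k * shiftl k) i j = ent (1 :: 'r rfmat) i j" by (auto simp: ent_shiftr ent_shiftl ent_one)
qed

text \<open>The block diagonal matrix of a zero block of size k followed by m. Writing it with the
  one-sided shifts makes multiplicativity a consequence of \<open>shiftr_shiftl\<close>.\<close>

definition shifted :: "nat \<Rightarrow> 'r::{ring, monoid_mult} rfmat \<Rightarrow> 'r rfmat" where
  "shifted k m = shiftl k * m * shiftr k"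

lemma ent_shifted: "ent (shifted k m) i j = (if k \<le> i \<and> k \<le> j then ent m (i - k) (j - k) else 0)"
  by (simp add: shifted_def ent_mult_shiftr ent_shiftl_mult)

lemma corner_shifted: "corner n m \<Longrightarrow> corner (n + k) (shifted k m)"
  by (auto simp: corner_def ent_shifted)

lemma shifted_mult: "shifted k a * shifted k b = shifted k (a * b)"
proof -
  have "shifted k a * shifted k b = shiftl k * a * (shiftr k * shiftl k) * b * shiftr k"
    by (simp add: shifted_def mult.assoc)
  then show ?thesis by (simp add: shiftr_shiftl shifted_def mult.assoc)
qed

lemma corner_shifted_orthogonal:
  assumes "corner k e" shows "e * shifted k f = 0" "shifted k f * e = 0"
  by (rule rfmat_eqI, simp add: ent_mult_corner [OF assms] ent_shifted)
    (rule rfmat_eqI, simp add: ent_mult_corner_right [OF assms] ent_shifted)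

lemma corner_mult_1:
  assumes a: "corner n (a - 1)" and b: "corner n (b - 1)" shows "corner n (a * b - (1 :: 'r::{ring, monoid_mult} rfmat))"
proof -
  have "a * b - 1 = (a - 1) * (b - 1) + (a - 1) + (b - 1)" by (simp add: algebra_simps)
  then show ?thesis using corner_add corner_mult a b by metis
qed

locale matrix_rep =
  fixes R :: "('a, 'm) ring_scheme" and iota :: "'a \<Rightarrow> 'r::{ring, monoid_mult}"
  assumes inj: "inj_on iota (carrier R)"
    and zero: "\<zero>\<^bsub>R\<^esub> \<in> carrier R" "iota \<zero>\<^bsub>R\<^esub> = 0"
    and one: "\<one>\<^bsub>R\<^esub> \<in> carrier R" "iota \<one>\<^bsub>R\<^esub> = 1"
    and add: "\<And>x y. x \<in> carrier R \<Longrightarrow> y \<in> carrier R \<Longrightarrow> x \<oplus>\<^bsub>R\<^esub> y \<in> carrier R"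
      "\<And>x y. x \<in> carrier R \<Longrightarrow> y \<in> carrier R \<Longrightarrow> iota (x \<oplus>\<^bsub>R\<^esub> y) = iota x + iota y"
    and mult: "\<And>x y. x \<in> carrier R \<Longrightarrow> y \<in> carrier R \<Longrightarrow> x \<otimes>\<^bsub>R\<^esub> y \<in> carrier R"
      "\<And>x y. x \<in> carrier R \<Longrightarrow> y \<in> carrier R \<Longrightarrow> iota (x \<otimes>\<^bsub>R\<^esub> y) = iota x * iota y"
    and minus: "\<And>x. x \<in> carrier R \<Longrightarrow> \<exists>y\<in>carrier R. iota y = - iota x"
begin

lemma iota_eq_iff: "x \<in> carrier R \<Longrightarrow> y \<in> carrier R \<Longrightarrow> iota x = iota y \<longleftrightarrow> x = y"
  using inj by (auto simp: inj_on_def)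

lemma iota_eq_0: "x \<in> carrier R \<Longrightarrow> iota x = 0 \<longleftrightarrow> x = \<zero>\<^bsub>R\<^esub>"
  using iota_eq_iff [of x "\<zero>\<^bsub>R\<^esub>"] zero by simp

lemma abelian_monoid_R: "abelian_monoid R"
proof (rule abelian_monoidI)
  fix x y z assume xyz: "x \<in> carrier R" "y \<in> carrier R" "z \<in> carrier R"
  have "iota (x \<oplus>\<^bsub>R\<^esub> y \<oplus>\<^bsub>R\<^esub> z) = iota (x \<oplus>\<^bsub>R\<^esub> (y \<oplus>\<^bsub>R\<^esub> z))" using xyz by (simp add: add add.assoc)
  then show "x \<oplus>\<^bsub>R\<^esub> y \<oplus>\<^bsub>R\<^esub> z = x \<oplus>\<^bsub>R\<^esub> (y \<oplus>\<^bsub>R\<^esub> z)" by (rule inj_onD [OF inj]) (simp_all add: add xyz)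
next
  fix x assume x: "x \<in> carrier R"
  have "iota (\<zero>\<^bsub>R\<^esub> \<oplus>\<^bsub>R\<^esub> x) = iota x" using x zero by (simp add: add)
  then show "\<zero>\<^bsub>R\<^esub> \<oplus>\<^bsub>R\<^esub> x = x" by (rule inj_onD [OF inj]) (simp_all add: add x zero(1))
next
  fix x y assume xy: "x \<in> carrier R" "y \<in> carrier R"
  have "iota (x \<oplus>\<^bsub>R\<^esub> y) = iota (y \<oplus>\<^bsub>R\<^esub> x)" using xy by (simp add: add add.commute)
  then show "x \<oplus>\<^bsub>R\<^esub> y = y \<oplus>\<^bsub>R\<^esub> x" by (rule inj_onD [OF inj]) (simp_all add: add xy)
qed (use zero add in auto)

lemma finsum_iota:
  assumes "f \<in> A \<rightarrow> carrier R"
  shows "finsum R f A \<in> carrier R" "iota (finsum R f A) = (\<Sum>a\<in>A. iota (f a))"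
proof -
  interpret abelian_monoid R by (rule abelian_monoid_R)
  show "finsum R f A \<in> carrier R" using assms by (rule finsum_closed)
  show "iota (finsum R f A) = (\<Sum>a\<in>A. iota (f a))"
    using assms
  proof (induction A rule: infinite_finite_induct)
    case (insert a A)
    have fA: "f \<in> A \<rightarrow> carrier R" "f a \<in> carrier R" using insert.prems by auto
    then show ?case using insert finsum_closed [OF fA(1)] by (simp add: add)
  qed (simp_all add: zero)
qed

definition S :: "'r set" where "S = iota ` carrier R"

text \<open>The matrices over \<open>R\<close> inside \<open>'r rfmat\<close>. \<open>MF\<close> is
  then the image of \<open>M_inf R\<close>, and \<open>rmat\<close> and \<open>unr\<close> pass
  between the two pictures.\<close>

definition SE :: "'r rfmat \<Rightarrow> bool" where "SE m \<longleftrightarrow> (\<forall>i j. ent m i j \<in> S)"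

definition MF :: "'r rfmat set" where "MF = {m. SE m \<and> (\<exists>n. corner n m)}"

definition rowfin :: "(nat \<Rightarrow> nat \<Rightarrow> 'a) \<Rightarrow> bool" where
  "rowfin x \<longleftrightarrow> (\<forall>i j. x i j \<in> carrier R) \<and> (\<forall>i. finite {k. x i k \<noteq> \<zero>\<^bsub>R\<^esub>})"

definition rmat :: "(nat \<Rightarrow> nat \<Rightarrow> 'a) \<Rightarrow> 'r rfmat" where "rmat x = Rf (\<lambda>i j. iota (x i j))"

definition unr :: "'r rfmat \<Rightarrow> nat \<Rightarrow> nat \<Rightarrow> 'a" where "unr m = (\<lambda>i j. inv_into (carrier R) iota (ent m i j))"

lemma S_0: "0 \<in> S" and S_1: "1 \<in> S"
  unfolding S_def using zero one by (metis imageI)+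

lemma S_add: "a \<in> S \<Longrightarrow> b \<in> S \<Longrightarrow> a + b \<in> S"
  unfolding S_def using add by (auto simp: image_iff) metis

lemma S_mult: "a \<in> S \<Longrightarrow> b \<in> S \<Longrightarrow> a * b \<in> S"
  unfolding S_def using mult by (auto simp: image_iff) metis

lemma S_minus: "a \<in> S \<Longrightarrow> - a \<in> S"
  unfolding S_def using minus by (auto simp: image_iff) metis

lemma S_sum: "(\<And>i. i \<in> A \<Longrightarrow> f i \<in> S) \<Longrightarrow> (\<Sum>i\<in>A. f i) \<in> S"
  by (induction A rule: infinite_finite_induct) (auto simp: S_0 S_add)

lemma SE_add: "SE a \<Longrightarrow> SE b \<Longrightarrow> SE (a + b)" and SE_minus: "SE a \<Longrightarrow> SE (- a)"
  and SE_0: "SE 0" and SE_1: "SE 1"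
  by (auto simp: SE_def S_add S_minus S_0 S_1 ent_one)

lemma SE_diff: "SE a \<Longrightarrow> SE b \<Longrightarrow> SE (a - b)"
  using SE_add [of a "- b"] SE_minus [of b] by simp

lemma SE_mult: "SE a \<Longrightarrow> SE b \<Longrightarrow> SE (a * b)"
  unfolding SE_def times_rfmat.rep_eq by (intro allI S_sum S_mult) auto

lemma SE_shifted: "SE a \<Longrightarrow> SE (shifted k a)" and SE_shiftl: "SE (shiftl k)" and SE_shiftr: "SE (shiftr k)"
  by (auto simp: SE_def ent_shifted ent_shiftl ent_shiftr S_0 S_1)

lemma MF_SE: "m \<in> MF \<Longrightarrow> SE m" by (simp add: MF_def)

lemma MF_I: "SE m \<Longrightarrow> corner n m \<Longrightarrow> m \<in> MF" by (auto simp: MF_def)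

lemma MF_corner2:
  assumes "a \<in> MF" "b \<in> MF" obtains n where "corner n a" "corner n b"
proof -
  obtain k l where "corner k a" "corner l b" using assms by (auto simp: MF_def)
  then show ?thesis using that [of "max k l"] corner_mono by (metis max.cobounded1 max.cobounded2)
qed

lemma MF_add:
  assumes "a \<in> MF" "b \<in> MF" shows "a + b \<in> MF"
proof -
  obtain n where "corner n a" "corner n b" by (rule MF_corner2 [OF assms])
  then show ?thesis by (rule MF_I [OF SE_add [OF MF_SE [OF assms(1)] MF_SE [OF assms(2)]] corner_add])
qed

lemma MF_mult:
  assumes "a \<in> MF" "b \<in> MF" shows "a * b \<in> MF"
proof -
  obtain n where "corner n a" "corner n b" by (rule MF_corner2 [OF assms])
  then show ?thesis by (rule MF_I [OF SE_mult [OF MF_SE [OF assms(1)] MF_SE [OF assms(2)]] corner_mult])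
qed

lemma MF_diff:
  assumes "a \<in> MF" "b \<in> MF" shows "a - b \<in> MF"
proof -
  obtain n where "corner n a" "corner n b" by (rule MF_corner2 [OF assms])
  then show ?thesis by (rule MF_I [OF SE_diff [OF MF_SE [OF assms(1)] MF_SE [OF assms(2)]] corner_diff])
qed

lemma MF_0: "0 \<in> MF" by (rule MF_I [OF SE_0, of 0]) simp

lemma MF_shifted: "a \<in> MF \<Longrightarrow> shifted k a \<in> MF"
  unfolding MF_def using SE_shifted corner_shifted by blast

lemma ent_rmat:
  assumes "rowfin x" shows "ent (rmat x) i j = iota (x i j)"
proof -
  have "{k. iota (x i k) \<noteq> 0} = {k. x i k \<noteq> \<zero>\<^bsub>R\<^esub>}" for i
    using assms iota_eq_0 by (auto simp: rowfin_def)
  then show ?thesis unfolding rmat_def using assms by (subst ent_Rf) (auto simp: rowfin_def)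
qed

lemma rmat_inj: "rowfin x \<Longrightarrow> rowfin y \<Longrightarrow> rmat x = rmat y \<Longrightarrow> x = y"
proof (intro ext)
  fix i j assume x: "rowfin x" and y: "rowfin y" and eq: "rmat x = rmat y"
  have "iota (x i j) = iota (y i j)" using ent_rmat [OF x] ent_rmat [OF y] eq by metis
  then show "x i j = y i j" using x y iota_eq_iff by (auto simp: rowfin_def)
qed

lemma SE_rmat: "rowfin x \<Longrightarrow> SE (rmat x)"
  unfolding SE_def S_def by (simp add: ent_rmat) (auto simp: rowfin_def)

lemma ent_unr:
  assumes "SE m" shows "unr m i j \<in> carrier R" "iota (unr m i j) = ent m i j"
proof -
  have "ent m i j \<in> iota ` carrier R" using assms by (simp add: SE_def S_def)
  then show "unr m i j \<in> carrier R" "iota (unr m i j) = ent m i j"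
    unfolding unr_def by (rule inv_into_into, rule f_inv_into_f)
qed

lemma rowfin_unr: assumes "SE m" shows "rowfin (unr m)"
proof -
  have "unr m i k \<noteq> \<zero>\<^bsub>R\<^esub> \<longleftrightarrow> ent m i k \<noteq> 0" for i k
    using ent_unr [OF assms, of i k] iota_eq_0 by metis
  then show ?thesis using ent_unr(1) [OF assms] by (simp add: rowfin_def ent_finite)
qed

lemma rmat_unr: "SE m \<Longrightarrow> rmat (unr m) = m"
  by (rule rfmat_eqI) (simp add: ent_rmat rowfin_unr ent_unr)

lemma rmat_mult:
  assumes x: "rowfin x" and y: "rowfin y"
  shows "rowfin (inf_mat_mult R x y)" "rmat (inf_mat_mult R x y) = rmat x * rmat y"
proof -
  have f: "(\<lambda>k. x i k \<otimes>\<^bsub>R\<^esub> y k j) \<in> {k. x i k \<noteq> \<zero>\<^bsub>R\<^esub>} \<rightarrow> carrier R" for i j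
    using x y by (auto simp: rowfin_def mult)
  have c: "inf_mat_mult R x y i j \<in> carrier R" for i j
    unfolding inf_mat_mult_def by (rule finsum_iota [OF f])
  have e: "iota (inf_mat_mult R x y i j) = ent (rmat x * rmat y) i j" for i j
  proof -
    have "iota (inf_mat_mult R x y i j) = (\<Sum>k\<in>{k. x i k \<noteq> \<zero>\<^bsub>R\<^esub>}. iota (x i k \<otimes>\<^bsub>R\<^esub> y k j))"
      unfolding inf_mat_mult_def by (rule finsum_iota [OF f])
    also have "\<dots> = (\<Sum>k\<in>{k. x i k \<noteq> \<zero>\<^bsub>R\<^esub>}. ent (rmat x) i k * ent (rmat y) k j)"
      using x y by (intro sum.cong refl) (simp add: ent_rmat mult rowfin_def)
    also have "\<dots> = ent (rmat x * rmat y) i j"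
      using x by (intro ent_mult [symmetric]) (auto simp: ent_rmat zero rowfin_def)
    finally show ?thesis .
  qed
  have "inf_mat_mult R x y i k \<noteq> \<zero>\<^bsub>R\<^esub> \<longleftrightarrow> ent (rmat x * rmat y) i k \<noteq> 0" for i k
    using e [of i k] iota_eq_0 [OF c [of i k]] by simp
  then show r: "rowfin (inf_mat_mult R x y)" using c by (simp add: rowfin_def ent_finite)
  show "rmat (inf_mat_mult R x y) = rmat x * rmat y"
    by (rule rfmat_eqI) (simp add: ent_rmat [OF r] e)
qed

lemma corner_rmat: "rowfin x \<Longrightarrow> corner n (rmat x) \<longleftrightarrow> (\<forall>i j. n \<le> i \<or> n \<le> j \<longrightarrow> x i j = \<zero>\<^bsub>R\<^esub>)"
  using iota_eq_0 by (auto simp: corner_def ent_rmat rowfin_def)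

lemma M_inf_iff: "x \<in> M_inf R \<longleftrightarrow> rowfin x \<and> rmat x \<in> MF"
proof
  assume x: "x \<in> M_inf R"
  then obtain n where n: "\<And>i j. n \<le> i \<or> n \<le> j \<Longrightarrow> x i j = \<zero>\<^bsub>R\<^esub>" unfolding M_inf_def by blast
  have "finite {k. x i k \<noteq> \<zero>\<^bsub>R\<^esub>}" for i
    by (rule finite_subset [of _ "{..<n}"]) (use n not_less in auto)
  then have r: "rowfin x" using x by (simp add: rowfin_def M_inf_def)
  then show "rowfin x \<and> rmat x \<in> MF" using n SE_rmat corner_rmat by (auto simp: MF_def)
next
  assume "rowfin x \<and> rmat x \<in> MF"
  then obtain n where r: "rowfin x" and "corner n (rmat x)" by (auto simp: MF_def)
  then have "\<forall>i j. n \<le> i \<or> n \<le> j \<longrightarrow> x i j = \<zero>\<^bsub>R\<^esub>" by (simp only: corner_rmat [OF r])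
  then show "x \<in> M_inf R" using r unfolding M_inf_def rowfin_def by blast
qed

subsection \<open>Equivalence of idempotents\<close>

definition IDEM :: "'r rfmat set" where "IDEM = {e \<in> MF. e * e = e}"

definition sim :: "'r rfmat \<Rightarrow> 'r rfmat \<Rightarrow> bool" where
  "sim e f \<longleftrightarrow> (\<exists>x\<in>MF. \<exists>y\<in>MF. x * y = e \<and> y * x = f)"

lemma IDEM_MF: "e \<in> IDEM \<Longrightarrow> e \<in> MF" and IDEM_idem: "e \<in> IDEM \<Longrightarrow> e * e = e"
  by (simp_all add: IDEM_def)

lemma IDEM_I: "e \<in> MF \<Longrightarrow> e * e = e \<Longrightarrow> e \<in> IDEM" by (simp add: IDEM_def)

lemma IDEM_0: "0 \<in> IDEM" by (simp add: IDEM_I MF_0)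

lemma simI: "x \<in> MF \<Longrightarrow> y \<in> MF \<Longrightarrow> x * y = e \<Longrightarrow> y * x = f \<Longrightarrow> sim e f"
  by (auto simp: sim_def)

lemma sim_refl: "e \<in> IDEM \<Longrightarrow> sim e e"
  by (rule simI [of e e]) (simp_all add: IDEM_MF IDEM_idem)

lemma sim_sym: "sim e f \<Longrightarrow> sim f e"
  by (auto simp: sim_def)

text \<open>Replacing x and y by \<open>e * x * f\<close> and \<open>f * y * e\<close> leaves both
  products unchanged and lets e and f act as units on them. Composing equivalences and adding
  orthogonal ones relies on this form.\<close>

lemma sim_normal:
  assumes "sim e f" "e \<in> IDEM" "f \<in> IDEM"
  obtains x y where "x \<in> MF" "y \<in> MF" "x * y = e" "y * x = f" "e * x = x" "x * f = x" "f * y = y" "y * e = y"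
proof -
  obtain x y where xy: "x \<in> MF" "y \<in> MF" "x * y = e" "y * x = f" using assms(1) by (auto simp: sim_def)
  have e: "e * e = e" and f: "f * f = f" using assms IDEM_idem by auto
  have ex: "e * x = x * f" and fy: "f * y = y * e" unfolding xy(3,4) [symmetric] by (simp_all add: mult.assoc)
  show ?thesis
  proof (rule that)
    show "e * x * f \<in> MF" "f * y * e \<in> MF" using assms xy IDEM_MF by (simp_all add: MF_mult)
    have "e * x * f * (f * y * e) = e * x * (f * f) * y * e" by (simp add: mult.assoc)
    also have "\<dots> = e * (x * f) * y * e" by (simp add: f mult.assoc)
    also have "\<dots> = e * e * (x * y) * e" by (simp add: ex [symmetric] mult.assoc)
    finally show "e * x * f * (f * y * e) = e" by (simp add: xy(3) e)
    have "f * y * e * (e * x * f) = f * y * (e * e) * x * f" by (simp add: mult.assoc)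
    also have "\<dots> = f * (y * e) * x * f" by (simp add: e mult.assoc)
    also have "\<dots> = f * f * (y * x) * f" by (simp add: fy [symmetric] mult.assoc)
    finally show "f * y * e * (e * x * f) = f" by (simp add: xy(4) f)
    show "e * (e * x * f) = e * x * f" "f * (f * y * e) = f * y * e" by (simp_all add: e f flip: mult.assoc)
    show "e * x * f * f = e * x * f" "f * y * e * e = f * y * e" by (simp_all add: e f mult.assoc)
  qed
qed

lemma sim_trans:
  assumes "sim e f" "sim f g" "e \<in> IDEM" "f \<in> IDEM" "g \<in> IDEM"
  shows "sim e g"
proof -
  obtain x y where x: "x \<in> MF" "y \<in> MF" "x * y = e" "y * x = f" "x * f = x" "f * y = y"
    by (rule sim_normal [OF assms(1,3,4)]) blast
  obtain z w where z: "z \<in> MF" "w \<in> MF" "z * w = f" "w * z = g" "f * z = z" "w * f = w"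
    by (rule sim_normal [OF assms(2,4,5)]) blast
  show ?thesis
  proof (rule simI [of "x * z" "w * y"])
    have "x * z * (w * y) = x * (z * w) * y" by (simp add: mult.assoc)
    then show "x * z * (w * y) = e" by (simp add: z x)
    have "w * y * (x * z) = w * (y * x) * z" by (simp add: mult.assoc)
    then show "w * y * (x * z) = g" by (simp add: z x)
  qed (simp_all add: x z MF_mult)
qed

lemma IDEM_add:
  assumes "e \<in> IDEM" "f \<in> IDEM" "e * f = 0" "f * e = 0" shows "e + f \<in> IDEM"
  using assms by (auto simp: IDEM_def MF_add distrib_left distrib_right)

lemma sim_add:
  assumes s: "sim e e'" "sim f f'" and I: "e \<in> IDEM" "e' \<in> IDEM" "f \<in> IDEM" "f' \<in> IDEM"
    and o: "e * f = 0" "f * e = 0" "e' * f' = 0" "f' * e' = 0"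
  shows "sim (e + f) (e' + f')"
proof -
  obtain x y where x: "x \<in> MF" "y \<in> MF" "x * y = e" "y * x = e'" "e * x = x" "x * e' = x" "e' * y = y" "y * e = y"
    by (rule sim_normal [OF s(1) I(1,2)]) blast
  obtain z w where z: "z \<in> MF" "w \<in> MF" "z * w = f" "w * z = f'" "f * z = z" "z * f' = z" "f' * w = w" "w * f = w"
    by (rule sim_normal [OF s(2) I(3,4)]) blast
  have "x * w = x * (e' * f') * w" using x z by (metis mult.assoc)
  then have 1: "x * w = 0" by (simp add: o)
  have "z * y = z * (f' * e') * y" using x z by (metis mult.assoc)
  then have 2: "z * y = 0" by (simp add: o)
  have "y * z = y * (e * f) * z" using x z by (metis mult.assoc)
  then have 3: "y * z = 0" by (simp add: o)
  have "w * x = w * (f * e) * x" using x z by (metis mult.assoc)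
  then have 4: "w * x = 0" by (simp add: o)
  show ?thesis
    by (rule simI [of "x + z" "y + w"]) (simp_all add: MF_add x z distrib_left distrib_right 1 2 3 4)
qed

lemma IDEM_shifted: "f \<in> IDEM \<Longrightarrow> shifted k f \<in> IDEM"
  by (simp add: IDEM_def MF_shifted shifted_mult)

text \<open>The shifts have infinitely many nonzero entries, but multiplied by the finite matrix f
  they become finite and implement the equivalence.\<close>

lemma sim_shifted:
  assumes f: "f \<in> IDEM" shows "sim f (shifted k f)"
proof (rule sim_sym, rule simI [of "shiftl k * f" "f * shiftr k"])
  obtain n where n: "corner n f" using IDEM_MF [OF f] by (auto simp: MF_def)
  have ff: "f * f = f" by (rule IDEM_idem [OF f])
  have SEf: "SE f" by (rule MF_SE [OF IDEM_MF [OF f]])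
  show "shiftl k * f \<in> MF"
    by (rule MF_I [OF SE_mult [OF SE_shiftl SEf], of "n + k"]) (use n in \<open>auto simp: corner_def ent_shiftl_mult\<close>)
  show "f * shiftr k \<in> MF"
    by (rule MF_I [OF SE_mult [OF SEf SE_shiftr], of "n + k"]) (use n in \<open>auto simp: corner_def ent_mult_shiftr\<close>)
  have "shiftl k * f * (f * shiftr k) = shiftl k * (f * f) * shiftr k" by (simp add: mult.assoc)
  then show "shiftl k * f * (f * shiftr k) = shifted k f" by (simp add: ff shifted_def)
  have "f * shiftr k * (shiftl k * f) = f * (shiftr k * shiftl k) * f" by (simp add: mult.assoc)
  then show "f * shiftr k * (shiftl k * f) = f" by (simp add: shiftr_shiftl ff)
qed

lemma idempotents_iff: "x \<in> idempotents R \<longleftrightarrow> rowfin x \<and> rmat x \<in> IDEM"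
proof (cases "rowfin x")
  case True
  have "inf_mat_mult R x x = x \<longleftrightarrow> rmat x * rmat x = rmat x"
    using rmat_inj [OF rmat_mult(1) [OF True True] True] rmat_mult(2) [OF True True] by auto
  then show ?thesis using True by (simp add: idempotents_def M_inf_iff IDEM_def)
qed (simp add: idempotents_def M_inf_iff)

lemma idem_equiv_iff:
  "(x, y) \<in> idem_equiv R \<longleftrightarrow> x \<in> idempotents R \<and> y \<in> idempotents R \<and> sim (rmat x) (rmat y)"
proof (cases "x \<in> idempotents R \<and> y \<in> idempotents R")
  case True
  then have xy: "rowfin x" "rowfin y" by (auto simp: idempotents_iff)
  have "(\<exists>a\<in>M_inf R. \<exists>b\<in>M_inf R. inf_mat_mult R a b = x \<and> inf_mat_mult R b a = y) \<longleftrightarrow> sim (rmat x) (rmat y)"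
  proof
    assume "\<exists>a\<in>M_inf R. \<exists>b\<in>M_inf R. inf_mat_mult R a b = x \<and> inf_mat_mult R b a = y"
    then obtain a b where ab: "rowfin a" "rmat a \<in> MF" "rowfin b" "rmat b \<in> MF" "inf_mat_mult R a b = x" "inf_mat_mult R b a = y"
      by (auto simp: M_inf_iff)
    show "sim (rmat x) (rmat y)"
      by (rule simI [OF ab(2,4)]) (use rmat_mult(2) ab in auto)
  next
    assume "sim (rmat x) (rmat y)"
    then obtain a b where ab: "a \<in> MF" "b \<in> MF" "a * b = rmat x" "b * a = rmat y" by (auto simp: sim_def)
    have r: "rowfin (unr a)" "rowfin (unr b)" "rmat (unr a) = a" "rmat (unr b) = b"
      using ab MF_SE rowfin_unr rmat_unr by auto
    have "inf_mat_mult R (unr a) (unr b) = x" "inf_mat_mult R (unr b) (unr a) = y"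
      using r ab xy by (auto intro!: rmat_inj rmat_mult simp: rmat_mult)
    moreover have "unr a \<in> M_inf R" "unr b \<in> M_inf R" using r ab by (simp_all add: M_inf_iff)
    ultimately show "\<exists>a\<in>M_inf R. \<exists>b\<in>M_inf R. inf_mat_mult R a b = x \<and> inf_mat_mult R b a = y" by blast
  qed
  then show ?thesis using True by (simp add: idem_equiv_def)
qed (auto simp: idem_equiv_def)

definition cls :: "'r rfmat \<Rightarrow> (nat \<Rightarrow> nat \<Rightarrow> 'a) set" where
  "cls m = {x. rowfin x \<and> rmat x \<in> IDEM \<and> sim m (rmat x)}"

lemma idem_equiv_image: "x \<in> idempotents R \<Longrightarrow> idem_equiv R `` {x} = cls (rmat x)"
  by (auto simp: cls_def idem_equiv_iff idempotents_iff)

lemma unr_cls: "m \<in> IDEM \<Longrightarrow> m' \<in> IDEM \<Longrightarrow> sim m m' \<Longrightarrow> unr m' \<in> cls m"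
  using IDEM_MF MF_SE by (simp add: cls_def rowfin_unr rmat_unr)

lemma cls_eq_iff:
  assumes "m \<in> IDEM" "m' \<in> IDEM" shows "cls m = cls m' \<longleftrightarrow> sim m m'"
proof
  assume eq: "cls m = cls m'"
  have "unr m' \<in> cls m" unfolding eq by (rule unr_cls [OF assms(2,2) sim_refl [OF assms(2)]])
  then show "sim m m'" using assms IDEM_MF MF_SE by (simp add: cls_def rmat_unr)
next
  assume s: "sim m m'"
  show "cls m = cls m'"
    unfolding cls_def using sim_trans [OF s] sim_trans [OF sim_sym [OF s]] assms by blast
qed

lemma V_carrier: "carrier (V_monoid R) = cls ` IDEM"
proof -
  have "carrier (V_monoid R) = (\<Union>x\<in>idempotents R. {idem_equiv R `` {x}})"
    by (simp add: V_monoid_def quotient_def)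
  also have "\<dots> = cls ` IDEM"
  proof (rule subset_antisym; rule subsetI)
    fix P assume "P \<in> (\<Union>x\<in>idempotents R. {idem_equiv R `` {x}})"
    then show "P \<in> cls ` IDEM" using idem_equiv_image idempotents_iff by auto
  next
    fix P assume "P \<in> cls ` IDEM"
    then obtain m where m: "m \<in> IDEM" "P = cls m" by blast
    have "unr m \<in> idempotents R" "rmat (unr m) = m"
      using m IDEM_MF MF_SE by (simp_all add: idempotents_iff rowfin_unr rmat_unr)
    then show "P \<in> (\<Union>x\<in>idempotents R. {idem_equiv R `` {x}})" using idem_equiv_image m(2) by force
  qed
  finally show ?thesis .
qed

lemma cls_in_V: "m \<in> IDEM \<Longrightarrow> cls m \<in> carrier (V_monoid R)"
  by (simp add: V_carrier)

lemma rowfin_zero: "rowfin (\<lambda>i j. \<zero>\<^bsub>R\<^esub>)" and rmat_zero: "rmat (\<lambda>i j. \<zero>\<^bsub>R\<^esub>) = 0"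
proof -
  show r: "rowfin (\<lambda>i j. \<zero>\<^bsub>R\<^esub>)" by (simp add: rowfin_def zero)
  show "rmat (\<lambda>i j. \<zero>\<^bsub>R\<^esub>) = 0" by (rule rfmat_eqI) (simp add: ent_rmat [OF r] zero)
qed

lemma V_one: "\<one>\<^bsub>V_monoid R\<^esub> = cls 0"
proof -
  have "(\<lambda>i j. \<zero>\<^bsub>R\<^esub>) \<in> idempotents R" by (simp add: idempotents_iff rowfin_zero rmat_zero IDEM_0)
  then show ?thesis using idem_equiv_image rmat_zero by (simp add: V_monoid_def)
qed

text \<open>Where the second block starts depends on the representative, through the smallest size
  of x. Only some k bounding x is recorded, since the class does not depend on the position.\<close>

lemma rmat_diag_sum:
  assumes x: "x \<in> idempotents R" and y: "y \<in> idempotents R"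
  shows "rowfin (diag_sum R x y)" "\<exists>k. corner k (rmat x) \<and> rmat (diag_sum R x y) = rmat x + shifted k (rmat y)"
proof -
  have r: "rowfin x" "rowfin y" "rmat x \<in> MF" using x y by (auto simp: idempotents_iff IDEM_MF)
  define k where "k = mat_size R x"
  have "\<exists>n. corner n (rmat x)" using r(3) by (auto simp: MF_def)
  then have "\<exists>n. \<forall>i j. n \<le> i \<or> n \<le> j \<longrightarrow> x i j = \<zero>\<^bsub>R\<^esub>" by (simp add: corner_rmat [OF r(1)])
  then have "\<forall>i j. k \<le> i \<or> k \<le> j \<longrightarrow> x i j = \<zero>\<^bsub>R\<^esub>"
    unfolding k_def mat_size_def by (rule LeastI_ex)
  then have k: "corner k (rmat x)" by (simp add: corner_rmat [OF r(1)])
  have d: "diag_sum R x y i j = (if i < k \<and> j < k then x i j else if k \<le> i \<and> k \<le> j then y (i - k) (j - k) else \<zero>\<^bsub>R\<^esub>)" for i j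
    by (simp add: diag_sum_def Let_def k_def)
  have c: "diag_sum R x y i j \<in> carrier R" for i j using r zero by (simp add: d rowfin_def)
  have e: "iota (diag_sum R x y i j) = ent (rmat x + shifted k (rmat y)) i j" for i j
    using cornerD [OF k, of i j] by (auto simp: d ent_shifted ent_rmat r zero)
  have "diag_sum R x y i j \<noteq> \<zero>\<^bsub>R\<^esub> \<longleftrightarrow> ent (rmat x + shifted k (rmat y)) i j \<noteq> 0" for i j
    using e [of i j] iota_eq_0 [OF c [of i j]] by simp
  then show rd: "rowfin (diag_sum R x y)" using c ent_finite [of "rmat x + shifted k (rmat y)"] by (simp add: rowfin_def)
  have "rmat (diag_sum R x y) = rmat x + shifted k (rmat y)"
    by (rule rfmat_eqI) (simp only: ent_rmat [OF rd] e)
  then show "\<exists>k. corner k (rmat x) \<and> rmat (diag_sum R x y) = rmat x + shifted k (rmat y)" using k by blast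
qed

text \<open>Any orthogonal representatives compute the product of classes: moving f down the
  diagonal does not change its class, and equivalences between orthogonal idempotents add.\<close>

lemma V_mult:
  assumes ef: "e \<in> IDEM" "f \<in> IDEM" "e * f = 0" "f * e = 0"
  shows "cls e \<otimes>\<^bsub>V_monoid R\<^esub> cls f = cls (e + f)"
proof -
  have *: "idem_equiv R `` {diag_sum R x y} = cls (e + f)" if x: "x \<in> cls e" and y: "y \<in> cls f" for x y
  proof -
    have xi: "x \<in> idempotents R" "sim e (rmat x)" and yi: "y \<in> idempotents R" "sim f (rmat y)"
      using x y by (auto simp: cls_def idempotents_iff)
    then have xI: "rmat x \<in> IDEM" and yI: "rmat y \<in> IDEM" by (auto simp: idempotents_iff)
    obtain k where k: "corner k (rmat x)" "rmat (diag_sum R x y) = rmat x + shifted k (rmat y)"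
      using rmat_diag_sum [OF xi(1) yi(1)] by blast
    note o = corner_shifted_orthogonal [OF k(1), of "rmat y"]
    have I: "rmat x + shifted k (rmat y) \<in> IDEM" by (rule IDEM_add [OF xI IDEM_shifted [OF yI] o])
    have "sim f (shifted k (rmat y))"
      by (rule sim_trans [OF yi(2) sim_shifted [OF yI] ef(2) yI IDEM_shifted [OF yI]])
    then have "sim (e + f) (rmat x + shifted k (rmat y))"
      by (intro sim_add xi(2) ef xI IDEM_shifted yI o)
    then have "cls (e + f) = cls (rmat x + shifted k (rmat y))"
      using cls_eq_iff [OF IDEM_add [OF ef] I] by blast
    moreover have "diag_sum R x y \<in> idempotents R"
      using rmat_diag_sum(1) [OF xi(1) yi(1)] I k(2) by (simp add: idempotents_iff)
    ultimately show ?thesis using idem_equiv_image k(2) by simp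
  qed
  have ne: "cls e \<noteq> {}" "cls f \<noteq> {}"
    using unr_cls [OF ef(1,1) sim_refl [OF ef(1)]] unr_cls [OF ef(2,2) sim_refl [OF ef(2)]] by auto
  have "cls e \<otimes>\<^bsub>V_monoid R\<^esub> cls f = (\<Union>x\<in>cls e. \<Union>y\<in>cls f. idem_equiv R `` {diag_sum R x y})"
    by (simp add: V_monoid_def)
  also have "\<dots> = (\<Union>x\<in>cls e. \<Union>y\<in>cls f. cls (e + f))" using * by simp
  also have "\<dots> = cls (e + f)" using ne by simp
  finally show ?thesis .
qed

lemma V_mult':
  assumes "e \<in> IDEM" "f \<in> IDEM" "corner k e"
  shows "cls e \<otimes>\<^bsub>V_monoid R\<^esub> cls f = cls (e + shifted k f)" "e + shifted k f \<in> IDEM"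
proof -
  note o = corner_shifted_orthogonal [OF assms(3), of f]
  have "cls f = cls (shifted k f)"
    using cls_eq_iff sim_shifted assms(2) IDEM_shifted by blast
  then show "cls e \<otimes>\<^bsub>V_monoid R\<^esub> cls f = cls (e + shifted k f)"
    using V_mult [OF assms(1) IDEM_shifted [OF assms(2)] o] by simp
  show "e + shifted k f \<in> IDEM" by (rule IDEM_add [OF assms(1) IDEM_shifted [OF assms(2)] o])
qed

lemma IDEM_corner: "e \<in> IDEM \<Longrightarrow> \<exists>k. corner k e"
  using IDEM_MF by (auto simp: MF_def)

lemma comm_monoid_V: "comm_monoid (V_monoid R)"
proof (rule comm_monoidI)
  fix x y z assume "x \<in> carrier (V_monoid R)" "y \<in> carrier (V_monoid R)" "z \<in> carrier (V_monoid R)"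
  then obtain e f g where efg: "e \<in> IDEM" "f \<in> IDEM" "g \<in> IDEM" "x = cls e" "y = cls f" "z = cls g"
    by (auto simp: V_carrier)
  obtain k where k: "corner k e" using IDEM_corner efg by blast
  show "x \<otimes>\<^bsub>V_monoid R\<^esub> y \<in> carrier (V_monoid R)"
    using V_mult' [OF efg(1,2) k] efg by (simp add: cls_in_V)
  let ?f = "shifted k f"
  have fI: "?f \<in> IDEM" and fc: "cls ?f = cls f"
    using IDEM_shifted sim_shifted cls_eq_iff efg by blast+
  note o1 = corner_shifted_orthogonal [OF k, of f]
  have ef: "e + ?f \<in> IDEM" by (rule IDEM_add [OF efg(1) fI o1])
  obtain l where l: "corner l e" "corner l ?f" by (rule MF_corner2 [OF IDEM_MF [OF efg(1)] IDEM_MF [OF fI]])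
  let ?g = "shifted l g"
  have gI: "?g \<in> IDEM" and gc: "cls ?g = cls g"
    using IDEM_shifted sim_shifted cls_eq_iff efg by blast+
  note o2 = corner_shifted_orthogonal [OF l(1), of g] and o3 = corner_shifted_orthogonal [OF l(2), of g]
  have fg: "?f + ?g \<in> IDEM" by (rule IDEM_add [OF fI gI o3])
  have "x \<otimes>\<^bsub>V_monoid R\<^esub> y = cls (e + ?f)" unfolding efg fc [symmetric] by (rule V_mult [OF efg(1) fI o1])
  moreover have "cls (e + ?f) \<otimes>\<^bsub>V_monoid R\<^esub> z = cls (e + ?f + ?g)" unfolding efg gc [symmetric]
    by (rule V_mult [OF ef gI]) (simp_all add: distrib_left distrib_right o2 o3)
  moreover have "y \<otimes>\<^bsub>V_monoid R\<^esub> z = cls (?f + ?g)"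
    unfolding efg fc [symmetric] gc [symmetric] by (rule V_mult [OF fI gI o3])
  moreover have "x \<otimes>\<^bsub>V_monoid R\<^esub> cls (?f + ?g) = cls (e + (?f + ?g))" unfolding efg
    by (rule V_mult [OF efg(1) fg]) (simp_all add: distrib_left distrib_right o1 o2)
  ultimately show "x \<otimes>\<^bsub>V_monoid R\<^esub> y \<otimes>\<^bsub>V_monoid R\<^esub> z = x \<otimes>\<^bsub>V_monoid R\<^esub> (y \<otimes>\<^bsub>V_monoid R\<^esub> z)"
    by (simp add: add.assoc)
  have "cls ?f \<otimes>\<^bsub>V_monoid R\<^esub> cls e = cls (?f + e)" by (rule V_mult [OF fI efg(1) o1(2,1)])
  then show "x \<otimes>\<^bsub>V_monoid R\<^esub> y = y \<otimes>\<^bsub>V_monoid R\<^esub> x"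
    using V_mult [OF efg(1) fI o1] by (simp add: efg fc add.commute)
next
  show "\<one>\<^bsub>V_monoid R\<^esub> \<in> carrier (V_monoid R)" by (simp add: V_one cls_in_V IDEM_0)
  fix x assume "x \<in> carrier (V_monoid R)"
  then obtain e where e: "e \<in> IDEM" "x = cls e" by (auto simp: V_carrier)
  show "\<one>\<^bsub>V_monoid R\<^esub> \<otimes>\<^bsub>V_monoid R\<^esub> x = x"
    using V_mult [OF IDEM_0 e(1)] by (simp add: V_one e(2))
qed

subsection \<open>Invertible matrices\<close>

definition invm :: "nat \<Rightarrow> 'r rfmat \<Rightarrow> bool" where
  "invm n m \<longleftrightarrow> SE m \<and> corner n (m - 1) \<and> (\<exists>h. SE h \<and> corner n (h - 1) \<and> m * h = 1 \<and> h * m = 1)"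

lemma rowfin_one: "rowfin (inf_mat_one R)" and rmat_one: "rmat (inf_mat_one R) = 1"
proof -
  have "{k. inf_mat_one R i k \<noteq> \<zero>\<^bsub>R\<^esub>} \<subseteq> {i}" for i by (auto simp: inf_mat_one_def)
  then have "finite {k. inf_mat_one R i k \<noteq> \<zero>\<^bsub>R\<^esub>}" for i by (rule finite_subset) simp
  then show r: "rowfin (inf_mat_one R)" using zero one by (auto simp: rowfin_def inf_mat_one_def)
  show "rmat (inf_mat_one R) = 1"
    by (rule rfmat_eqI) (simp only: ent_rmat [OF r] ent_one, simp add: inf_mat_one_def zero one)
qed

lemma stable_mats_iff: "g \<in> stable_mats R n \<longleftrightarrow> rowfin g \<and> corner n (rmat g - 1)"
proof
  assume g: "g \<in> stable_mats R n"
  have "{k. g i k \<noteq> \<zero>\<^bsub>R\<^esub>} \<subseteq> {..<n} \<union> {i}" for i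
  proof
    fix k assume k: "k \<in> {k. g i k \<noteq> \<zero>\<^bsub>R\<^esub>}"
    show "k \<in> {..<n} \<union> {i}"
    proof (rule ccontr)
      assume "k \<notin> {..<n} \<union> {i}"
      then have "g i k = \<zero>\<^bsub>R\<^esub>" using g by (auto simp: stable_mats_def inf_mat_one_def)
      then show False using k by simp
    qed
  qed
  then have "finite {k. g i k \<noteq> \<zero>\<^bsub>R\<^esub>}" for i by (rule finite_subset) simp
  then have r: "rowfin g" using g by (simp add: rowfin_def stable_mats_def)
  then show "rowfin g \<and> corner n (rmat g - 1)"
    using g by (auto simp: corner_def ent_rmat ent_one stable_mats_def inf_mat_one_def zero one)
next
  assume g: "rowfin g \<and> corner n (rmat g - 1)"
  show "g \<in> stable_mats R n"
    unfolding stable_mats_def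
  proof (intro CollectI conjI allI impI)
    show "g i j \<in> carrier R" for i j using g by (simp add: rowfin_def)
    fix i j assume "n \<le> i \<or> n \<le> j"
    then have "ent (rmat g - 1) i j = 0" using g cornerD by blast
    then have "iota (g i j) = iota (inf_mat_one R i j)"
      using g by (simp add: ent_rmat ent_one inf_mat_one_def zero one split: if_splits)
    then show "g i j = inf_mat_one R i j"
      using g rowfin_one iota_eq_iff by (auto simp: rowfin_def)
  qed
qed

lemma GL_n_iff: "g \<in> GL_n R n \<longleftrightarrow> rowfin g \<and> invm n (rmat g)"
proof
  assume "g \<in> GL_n R n"
  then obtain h where h: "g \<in> stable_mats R n" "h \<in> stable_mats R n"
    "inf_mat_mult R g h = inf_mat_one R" "inf_mat_mult R h g = inf_mat_one R" by (auto simp: GL_n_def)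
  then have r: "rowfin g" "rowfin h" by (simp_all add: stable_mats_iff)
  have "rmat g * rmat h = 1" "rmat h * rmat g = 1"
    using rmat_mult(2) [OF r] rmat_mult(2) [OF r(2,1)] h rmat_one by simp_all
  then show "rowfin g \<and> invm n (rmat g)"
    unfolding invm_def using h r SE_rmat by (auto simp: stable_mats_iff)
next
  assume g: "rowfin g \<and> invm n (rmat g)"
  then obtain h where h: "SE h" "corner n (h - 1)" "rmat g * h = 1" "h * rmat g = 1" by (auto simp: invm_def)
  have r: "rowfin g" "rowfin (unr h)" using g h by (simp_all add: rowfin_unr)
  have "inf_mat_mult R g (unr h) = inf_mat_one R" "inf_mat_mult R (unr h) g = inf_mat_one R"
    using rmat_mult [OF r] rmat_mult [OF r(2,1)] h by (auto intro!: rmat_inj rowfin_one simp: rmat_one rmat_unr)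
  then show "g \<in> GL_n R n"
    unfolding GL_n_def using g h r by (auto simp: stable_mats_iff rmat_unr invm_def intro!: bexI [of _ "unr h"])
qed

lemma invm_1: "invm n 1"
  by (auto simp: invm_def SE_1 intro!: exI [of _ 1])

lemma invm_mult:
  assumes "invm n a" "invm n b" shows "invm n (a * b)"
proof -
  obtain c where c: "SE c" "corner n (c - 1)" "a * c = 1" "c * a = 1" using assms by (auto simp: invm_def)
  obtain d where d: "SE d" "corner n (d - 1)" "b * d = 1" "d * b = 1" using assms by (auto simp: invm_def)
  have "a * b * (d * c) = a * (b * d) * c" "d * c * (a * b) = d * (c * a) * b" by (simp_all add: mult.assoc)
  then have "a * b * (d * c) = 1" "d * c * (a * b) = 1" by (simp_all add: c d)
  then show ?thesis
    using assms c d by (auto simp: invm_def intro!: SE_mult corner_mult_1 exI [of _ "d * c"])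
qed

lemma invm_mono: "invm n a \<Longrightarrow> n \<le> m \<Longrightarrow> invm m a"
  unfolding invm_def using corner_mono by blast

lemma invm_inverse:
  assumes "invm n a" obtains c where "invm n c" "a * c = 1" "c * a = 1"
  using assms by (auto simp: invm_def)

lemma GL_carrier: "g \<in> carrier (GL_inf R) \<longleftrightarrow> rowfin g \<and> (\<exists>n. invm n (rmat g))"
  by (auto simp: GL_inf_def GL_n_iff)

lemma group_GL_inf: "group (GL_inf R)"
proof (rule groupI)
  have m: "mult (GL_inf R) = inf_mat_mult R" and o: "one (GL_inf R) = inf_mat_one R" by (simp_all add: GL_inf_def)
  show "\<one>\<^bsub>GL_inf R\<^esub> \<in> carrier (GL_inf R)" unfolding o GL_carrier rmat_one using rowfin_one invm_1 by blast
  fix x y assume xy: "x \<in> carrier (GL_inf R)" "y \<in> carrier (GL_inf R)"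
  then obtain k l where kl: "rowfin x" "invm k (rmat x)" "rowfin y" "invm l (rmat y)" by (auto simp: GL_carrier)
  show "x \<otimes>\<^bsub>GL_inf R\<^esub> y \<in> carrier (GL_inf R)"
    unfolding m GL_carrier rmat_mult(2) [OF kl(1,3)]
    using rmat_mult(1) [OF kl(1,3)] invm_mult invm_mono kl(2,4) by (meson max.cobounded1 max.cobounded2)
  show "\<one>\<^bsub>GL_inf R\<^esub> \<otimes>\<^bsub>GL_inf R\<^esub> x = x"
    unfolding m o by (rule rmat_inj) (simp_all add: rmat_mult rowfin_one rmat_one kl)
  obtain c where c: "invm k c" "c * rmat x = 1" by (rule invm_inverse [OF kl(2)])
  have s: "SE c" using c by (simp add: invm_def)
  have "inf_mat_mult R (unr c) x = inf_mat_one R"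
    using c s by (intro rmat_inj) (simp_all add: rmat_mult rowfin_one rmat_one kl rowfin_unr rmat_unr)
  then show "\<exists>y\<in>carrier (GL_inf R). y \<otimes>\<^bsub>GL_inf R\<^esub> x = \<one>\<^bsub>GL_inf R\<^esub>"
    unfolding m o using c s by (intro bexI [of _ "unr c"]) (auto simp: GL_carrier rowfin_unr rmat_unr)
  fix z assume "z \<in> carrier (GL_inf R)"
  then have z: "rowfin z" by (simp add: GL_carrier)
  show "x \<otimes>\<^bsub>GL_inf R\<^esub> y \<otimes>\<^bsub>GL_inf R\<^esub> z = x \<otimes>\<^bsub>GL_inf R\<^esub> (y \<otimes>\<^bsub>GL_inf R\<^esub> z)"
    unfolding m by (rule rmat_inj) (simp_all add: rmat_mult z kl mult.assoc)
qed

lemma trivial_quotient_GL: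
  assumes "N = carrier (GL_inf R)" shows "trivial_group (GL_inf R Mod N)"
proof -
  interpret G: group "GL_inf R" by (rule group_GL_inf)
  have n: "N \<lhd> GL_inf R" unfolding assms by (rule G.normal_self)
  have "N #>\<^bsub>GL_inf R\<^esub> x = N" if "x \<in> carrier (GL_inf R)" for x
    unfolding assms using G.coset_join2 [OF that G.subgroup_self that] .
  then have "carrier (GL_inf R Mod N) = {N}"
    using G.one_closed by (auto simp: FactGroup_def RCOSETS_def)
  then show ?thesis
    using normal.factorgroup_is_group [OF n] by (simp add: trivial_group_def FactGroup_def)
qed

end

section \<open>Complex matrices\<close>

definition dg :: "'r::{ring, monoid_mult} \<Rightarrow> 'r rfmat" where
  "dg X = Rf (\<lambda>i j. if i = j then X else 0)"

lemma ent_dg: "ent (dg X) i j = (if i = j then X else (0 :: 'r::{ring, monoid_mult}))"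
proof -
  have "finite {j. (if i = j then X else 0) \<noteq> 0}" for i
    by (rule finite_subset [of _ "{i}"]) auto
  then show ?thesis unfolding dg_def by (subst ent_Rf) auto
qed

lemma ent_dg_mult: "ent (dg X * m) i j = X * ent m i (j :: nat)"
proof -
  have "ent (dg X * m) i j = (\<Sum>k\<in>{i}. ent (dg X) i k * ent m k j)" by (rule ent_mult) (auto simp: ent_dg)
  then show ?thesis by (simp add: ent_dg)
qed

lemma ent_mult_dg: "ent (m * dg X) i j = ent m i j * X"
proof -
  have "ent (m * dg X) i j = (\<Sum>k\<in>insert j {k. ent m i k \<noteq> 0}. ent m i k * ent (dg X) k j)"
    by (rule ent_mult) (auto simp: ent_finite)
  also have "\<dots> = (\<Sum>k\<in>insert j {k. ent m i k \<noteq> 0}. if k = j then ent m i k * X else 0)"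
    by (intro sum.cong) (auto simp: ent_dg)
  also have "\<dots> = ent m i j * X" by (subst sum.delta) (simp_all add: ent_finite)
  finally show ?thesis .
qed

lemma dg_add: "dg (X + Y) = dg X + dg Y" and dg_mult: "dg (X * Y) = dg X * dg Y" and dg_1: "dg 1 = 1"
  by (rule rfmat_eqI; simp add: ent_dg ent_dg_mult ent_one)+

lemma corner_dg_mult: "corner n m \<Longrightarrow> corner n (dg X * m)"
  by (simp add: corner_def ent_dg_mult)

definition idm :: "nat \<Rightarrow> 'r::{ring, monoid_mult} rfmat" where
  "idm n = Rf (\<lambda>i j. if i = j \<and> i < n then 1 else 0)"

lemma ent_idm: "ent (idm n) i j = (if i = j \<and> i < n then 1 else (0 :: 'r::{ring, monoid_mult}))"
  unfolding idm_def by (subst ent_Rf_corner [of n]) auto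

lemma corner_idm: "corner n (idm n)"
  by (auto simp: corner_def ent_idm)

lemma idm_mult_ent: "ent (idm n * m) i j = (if i < n then ent m i j else (0 :: 'r::{ring, monoid_mult}))"
proof -
  have "ent (idm n * m) i j = (\<Sum>k\<in>{i}. ent (idm n) i k * ent m k j)" by (rule ent_mult) (auto simp: ent_idm)
  then show ?thesis by (simp add: ent_idm)
qed

lemma idm_mult: "corner n m \<Longrightarrow> idm n * m = m"
  by (rule rfmat_eqI) (auto simp: idm_mult_ent corner_def)

lemma mult_idm: "corner n m \<Longrightarrow> m * idm n = (m :: 'r::{ring, monoid_mult} rfmat)"
proof (rule rfmat_eqI)
  fix i j assume n: "corner n m"
  have "ent (m * idm n) i j = (\<Sum>k<n. ent m i k * ent (idm n) k j)" by (rule ent_mult_corner [OF n])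
  also have "\<dots> = (\<Sum>k<n. if k = j then ent m i k else 0)" by (intro sum.cong) (auto simp: ent_idm)
  also have "\<dots> = ent m i j" using cornerD [OF n, of i j] by (cases "j < n") auto
  finally show "ent (m * idm n) i j = ent m i j" .
qed

lemma idm_idm: "idm n * idm n = idm n" by (rule idm_mult [OF corner_idm])

lemma idm_0: "idm 0 = 0" by (rule rfmat_eqI) (simp add: ent_idm)

lemma idm_shifted: "idm (r + k) = idm r + shifted r (idm k)"
  by (rule rfmat_eqI) (auto simp: ent_idm ent_shifted)

text \<open>The bridge to finite matrices and determinants. It is applied to matrices that agree
  with 1 outside the first d rows and columns, where cutting out the block is multiplicative and
  injective.\<close>

definition tom :: "nat \<Rightarrow> complex rfmat \<Rightarrow> complex mat" where
  "tom d m = mat d d (\<lambda>(i, j). ent m i j)"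

lemma tom_carrier [simp]: "tom d m \<in> carrier_mat d d" by (simp add: tom_def)

lemma ent_outside_1:
  assumes "corner d (a - (1 :: 'r::{ring, monoid_mult} rfmat))" "d \<le> i \<or> d \<le> j"
  shows "ent a i j = (if i = j then 1 else 0)"
  using cornerD [OF assms] by (simp add: ent_one)

lemma tom_mult:
  assumes a: "corner d (a - 1)" shows "tom d (a * b) = tom d a * tom d b"
proof (rule eq_matI)
  fix i j assume "i < dim_row (tom d a * tom d b)" "j < dim_col (tom d a * tom d b)"
  then have ij: "i < d" "j < d" by (simp_all add: tom_def)
  have "ent (a * b) i j = (\<Sum>k\<in>{0..<d}. ent a i k * ent b k j)"
    by (rule ent_mult) (use ent_outside_1 [OF a] ij in auto)
  then show "tom d (a * b) $$ (i, j) = (tom d a * tom d b) $$ (i, j)"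
    using ij by (simp add: tom_def scalar_prod_def)
qed (simp_all add: tom_def)

lemma tom_1: "tom d 1 = 1\<^sub>m d"
  by (rule eq_matI) (auto simp: tom_def ent_one)

lemma tom_inj:
  assumes "corner d (a - 1)" "corner d (b - 1)" "tom d a = tom d b" shows "a = b"
proof (rule rfmat_eqI)
  fix i j
  show "ent a i j = ent b i j"
  proof (cases "i < d \<and> j < d")
    case True
    then have "tom d a $$ (i, j) = ent a i j" "tom d b $$ (i, j) = ent b i j" by (simp_all add: tom_def)
    then show ?thesis using assms(3) by simp
  next
    case False
    then show ?thesis using ent_outside_1 [OF assms(1), of i j] ent_outside_1 [OF assms(2), of i j] by auto
  qed
qed

lemma tom_surj:
  assumes "B \<in> carrier_mat d d" shows "\<exists>h. corner d (h - 1) \<and> tom d h = B"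
proof -
  define f where "f = (\<lambda>i j. if i < d \<and> j < d then B $$ (i, j) else if i = j then 1 else 0)"
  have "finite {k. f i k \<noteq> 0}" for i
    by (rule finite_subset [of _ "{..<d} \<union> {i}"]) (auto simp: f_def split: if_splits)
  then have e: "ent (Rf f) = f" by (rule ent_Rf)
  have "tom d (Rf f) = B" using assms by (intro eq_matI; simp add: tom_def e; simp add: f_def)
  moreover have "corner d (Rf f - 1)" unfolding corner_def ent_minus ent_one e by (auto simp: f_def)
  ultimately show ?thesis by blast
qed

lemma complex_left_inverse:
  fixes a b :: "complex rfmat"
  assumes "corner d (a - 1)" "corner d (b - 1)" "a * b = 1" shows "b * a = 1"
proof -
  have "tom d a * tom d b = 1\<^sub>m d" using tom_mult [OF assms(1), of b] by (simp add: assms(3) tom_1)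
  then have "tom d b * tom d a = 1\<^sub>m d" by (rule mat_mult_left_right_inverse [OF tom_carrier tom_carrier])
  then have "tom d (b * a) = tom d 1" by (simp add: tom_mult [OF assms(2)] tom_1)
  then show ?thesis by (intro tom_inj [of d] corner_mult_1 assms) simp_all
qed

lemma complex_inverse:
  fixes a :: "complex rfmat"
  assumes a: "corner d (a - 1)" and det: "det (tom d a) \<noteq> 0"
  shows "\<exists>h. corner d (h - 1) \<and> a * h = 1 \<and> h * a = 1"
proof -
  obtain B where B: "B \<in> carrier_mat d d" "tom d a * B = 1\<^sub>m d"
    using det_non_zero_imp_unit [OF tom_carrier det, of "()"] by (auto simp: Units_def ring_mat_simps)
  obtain h where h: "corner d (h - 1)" "tom d h = B" using tom_surj [OF B(1)] by blast
  have "tom d (a * h) = tom d 1" using B(2) h(2) by (simp add: tom_mult [OF a] tom_1)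
  then have "a * h = 1" by (intro tom_inj [of d] corner_mult_1 a h) simp_all
  then show ?thesis using complex_left_inverse [OF a h(1)] h(1) by blast
qed

text \<open>A nonzero vector killed by the block of 1 + z c is an eigenvector of c for - 1/z, hence
  z comes from a root of the characteristic polynomial.\<close>

lemma finite_singular_values:
  fixes c :: "complex rfmat"
  assumes c: "corner d c"
  shows "finite {z. \<not> (\<exists>h. corner d (h - 1) \<and> (1 + dg z * c) * h = 1 \<and> h * (1 + dg z * c) = 1)}"
proof (rule finite_subset)
  let ?A = "tom d c"
  have mono: "degree (char_poly ?A) = d \<and> coeff (char_poly ?A) d = 1"
    by (rule degree_monic_char_poly [OF tom_carrier])
  then have "char_poly ?A \<noteq> 0" by auto
  then show "finite ((\<lambda>e. - inverse e) ` {e. poly (char_poly ?A) e = 0})"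
    by (intro finite_imageI poly_roots_finite)
  show "{z. \<not> (\<exists>h. corner d (h - 1) \<and> (1 + dg z * c) * h = 1 \<and> h * (1 + dg z * c) = 1)}
      \<subseteq> (\<lambda>e. - inverse e) ` {e. poly (char_poly ?A) e = 0}"
  proof
    fix z assume "z \<in> {z. \<not> (\<exists>h. corner d (h - 1) \<and> (1 + dg z * c) * h = 1 \<and> h * (1 + dg z * c) = 1)}"
    then have n: "\<not> (\<exists>h. corner d (h - 1) \<and> (1 + dg z * c) * h = 1 \<and> h * (1 + dg z * c) = 1)" by simp
    let ?B = "tom d (1 + dg z * c)"
    have co: "corner d (1 + dg z * c - 1)" using corner_dg_mult [OF c] by simp
    have "det ?B = 0" using complex_inverse [OF co] n by blast
    then obtain v where v: "v \<in> carrier_vec d" "v \<noteq> 0\<^sub>v d" "?B *\<^sub>v v = 0\<^sub>v d"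
      using det_0_iff_vec_prod_zero_field [OF tom_carrier] by blast
    have Bv: "v $ i + z * (\<Sum>j\<in>{0..<d}. ent c i j * v $ j) = 0" if i: "i < d" for i
    proof -
      have "0 = (?B *\<^sub>v v) $ i" using v(3) i by simp
      also have "\<dots> = (\<Sum>j\<in>{0..<d}. ent (1 + dg z * c) i j * v $ j)"
        using i v(1) by (simp add: tom_def scalar_prod_def)
      also have "\<dots> = (\<Sum>j\<in>{0..<d}. (if j = i then v $ j else 0) + z * (ent c i j * v $ j))"
        by (intro sum.cong) (auto simp: ent_one ent_dg_mult distrib_right)
      also have "\<dots> = v $ i + z * (\<Sum>j\<in>{0..<d}. ent c i j * v $ j)"
        using i by (simp add: sum.distrib sum_distrib_left)
      finally show ?thesis by simp
    qed
    have z: "z \<noteq> 0"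
    proof
      assume "z = 0"
      then have "v $ i = 0" if "i < d" for i using Bv [OF that] by simp
      then have "v = 0\<^sub>v d" using v(1) by (intro eq_vecI) auto
      then show False using v(2) by simp
    qed
    have "?A *\<^sub>v v = (- inverse z) \<cdot>\<^sub>v v"
    proof (rule eq_vecI)
      fix i assume "i < dim_vec (- inverse z \<cdot>\<^sub>v v)"
      then have i: "i < d" using v(1) by simp
      have "(?A *\<^sub>v v) $ i = (\<Sum>j\<in>{0..<d}. ent c i j * v $ j)"
        using i v(1) by (simp add: tom_def scalar_prod_def)
      also have "\<dots> = - inverse z * v $ i" using Bv [OF i] z by (simp add: field_simps add_eq_0_iff)
      finally show "(?A *\<^sub>v v) $ i = (- inverse z \<cdot>\<^sub>v v) $ i" using i v(1) by simp
    qed (use v(1) in \<open>simp add: tom_def\<close>)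
    then have "eigenvalue ?A (- inverse z)"
      unfolding eigenvalue_def eigenvector_def using v(1,2) by (intro exI [of _ v]) (simp add: tom_def)
    then have "poly (char_poly ?A) (- inverse z) = 0" by (simp add: eigenvalue_root_char_poly [OF tom_carrier])
    then show "z \<in> (\<lambda>e. - inverse e) ` {e. poly (char_poly ?A) e = 0}"
      by (intro image_eqI [of _ _ "- inverse z"]) auto
  qed
qed

global_interpretation cx: matrix_rep complex_alg "\<lambda>x. x"
  by unfold_locales (auto simp: complex_alg_def intro: exI [of _ "- _"])

lemma cx_SE [simp]: "cx.SE m"
  unfolding cx.SE_def cx.S_def by (simp add: complex_alg_def)

lemma cx_MF: "m \<in> cx.MF \<longleftrightarrow> (\<exists>n. corner n m)"
  by (simp add: cx.MF_def)

text \<open>Column vectors are represented by matrices concentrated in the column \<open>0\<close>.\<close>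

global_interpretation cfun: vector_space "\<lambda>c (v :: complex rfmat). dg c * v"
  by unfold_locales (simp_all add: dg_add dg_mult dg_1 distrib_left distrib_right mult.assoc)

lemma ent_sum: "ent (\<Sum>a\<in>A. f a) i j = (\<Sum>a\<in>A. ent (f a :: 'r::{ring, monoid_mult} rfmat) i j)"
  by (induction A rule: infinite_finite_induct) auto

text \<open>Rank factorization \<open>e = y x\<close> with \<open>x y = 1\<close>: the columns of \<open>y\<close> are a basis of the range.\<close>

lemma complex_idempotent_sim_idm:
  assumes e: "e \<in> cx.IDEM" shows "\<exists>k. cx.sim e (idm k)"
proof -
  obtain n where n: "corner n e" using cx.IDEM_corner [OF e] by blast
  have ee: "e * e = e" by (rule cx.IDEM_idem [OF e])
  define col where "col = (\<lambda>j. Rf (\<lambda>i l. if l = 0 then ent e i j else 0))"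
  have ecol: "ent (col j) i l = (if l = 0 then ent e i j else 0)" for j i l
  proof -
    have "finite {l. (if l = (0::nat) then ent e i j else 0) \<noteq> 0}" for i
      by (rule finite_subset [of _ "{0}"]) auto
    then show ?thesis unfolding col_def by (subst ent_Rf) auto
  qed
  obtain B where B: "B \<subseteq> col ` {..<n}" "cfun.independent B" "col ` {..<n} \<subseteq> cfun.span B"
    using cfun.maximal_independent_subset by blast
  have finB: "finite B" using B(1) finite_subset by blast
  obtain b where b: "bij_betw b {..<card B} B"
    using ex_bij_betw_nat_finite [OF finB] by (auto simp: atLeast0LessThan)
  define k where "k = card B"
  have bB: "b a \<in> B" if "a < k" for a using b that by (auto simp: bij_betw_def k_def)
  define N where "N = max n k"
  define y where "y = Rf (\<lambda>i a. if i < n \<and> a < k then ent (b a) i 0 else 0)"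
  define x where "x = Rf (\<lambda>a j. if a < k \<and> j < n then cfun.representation B (col j) (b a) else 0)"
  have ey: "ent y i a = (if i < n \<and> a < k then ent (b a) i 0 else 0)" for i a
    unfolding y_def by (subst ent_Rf_corner [of N]) (auto simp: N_def)
  have ex: "ent x a j = (if a < k \<and> j < n then cfun.representation B (col j) (b a) else 0)" for a j
    unfolding x_def by (subst ent_Rf_corner [of N]) (auto simp: N_def)
  have cy: "corner N y" and cx: "corner N x" by (auto simp: corner_def ey ex N_def)
  have bcol: "\<exists>j<n. b a = col j" if "a < k" for a
    using bB [OF that] B(1) by auto
  have b0: "ent (b a) i 0 = 0" if "a < k" "n \<le> i" for a i
    using bcol [OF that(1)] cornerD [OF n] that(2) by (auto simp: ecol)
  have bl: "ent (b a) i l = 0" if "a < k" "l \<noteq> 0" for a i l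
    using bcol [OF that(1)] that(2) by (auto simp: ecol)
  have yx: "y * x = e"
  proof (rule rfmat_eqI)
    fix i j
    have s: "ent (y * x) i j = (\<Sum>a<k. ent y i a * ent x a j)"
      by (rule ent_mult) (auto simp: ey)
    show "ent (y * x) i j = ent e i j"
    proof (cases "i < n \<and> j < n")
      case True
      have "col j = (\<Sum>v\<in>B. dg (cfun.representation B (col j) v) * v)"
        by (rule cfun.sum_representation_eq [OF B(2) _ finB order_refl, symmetric]) (use B(3) True in auto)
      also have "\<dots> = (\<Sum>a<k. dg (cfun.representation B (col j) (b a)) * b a)"
        unfolding k_def by (rule sum.reindex_bij_betw [OF b, symmetric])
      finally have "ent (col j) i 0 = ent (\<Sum>a<k. dg (cfun.representation B (col j) (b a)) * b a) i 0" by simp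
      then have "ent e i j = (\<Sum>a<k. cfun.representation B (col j) (b a) * ent (b a) i 0)"
        by (simp add: ecol ent_sum ent_dg_mult)
      then show ?thesis unfolding s using True by (simp add: ey ex mult.commute)
    next
      case False
      then show ?thesis unfolding s using cornerD [OF n, of i j] by (auto simp: ey ex)
    qed
  qed
  have eyy: "e * y = y"
  proof (rule rfmat_eqI)
    fix i a
    have s: "ent (e * y) i a = (\<Sum>l<n. ent e i l * ent y l a)" by (rule ent_mult_corner [OF n])
    show "ent (e * y) i a = ent y i a"
    proof (cases "a < k")
      case True
      obtain j where j: "j < n" "b a = col j" using bcol [OF True] by blast
      have "ent (e * y) i a = (\<Sum>l<n. ent e i l * ent e l j)"
        unfolding s using True j by (intro sum.cong) (auto simp: ey ecol)
      also have "\<dots> = ent (e * e) i j" by (rule ent_mult_corner [OF n, symmetric])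
      also have "\<dots> = ent y i a" using True j b0 [OF True, of i] by (auto simp: ee ey ecol)
      finally show ?thesis .
    qed (simp add: s ey)
  qed
  have "x * y = idm k"
  proof -
    \<comment> \<open>Since \<open>y * x * y = y\<close>, the defect satisfies
      \<open>y * D = 0\<close>: its columns are linear relations among the basis columns that make
      up y, and therefore vanish.\<close>
    define D where "D = x * y - idm k"
    have cD: "ent D a c = 0" if "k \<le> a" for a c
    proof -
      have "ent (x * y) a c = (\<Sum>l\<in>{}. ent x a l * ent y l c)" by (rule ent_mult) (use that in \<open>auto simp: ex\<close>)
      then show ?thesis using that by (simp add: D_def ent_idm)
    qed
    have yk: "y * idm k = y"
    proof (rule rfmat_eqI)
      fix i a
      have "ent (y * idm k) i a = (\<Sum>l<k. ent y i l * ent (idm k) l a)" by (rule ent_mult) (auto simp: ey)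
      also have "\<dots> = (\<Sum>l<k. if l = a then ent y i l else 0)" by (intro sum.cong) (auto simp: ent_idm)
      also have "\<dots> = ent y i a" by (cases "a < k") (auto simp: ey)
      finally show "ent (y * idm k) i a = ent y i a" .
    qed
    have "y * D = (y * x) * y - y * idm k" by (simp add: D_def algebra_simps)
    then have yD: "y * D = 0" by (simp add: yx eyy yk)
    have "ent D a c = 0" for a c
    proof (cases "a < k")
      case True
      have "(\<Sum>a<k. dg (ent D a c) * b a) = 0"
      proof (rule rfmat_eqI)
        fix i l
        have "ent (\<Sum>a<k. dg (ent D a c) * b a) i l = (if l = 0 then (\<Sum>a<k. ent D a c * ent (b a) i 0) else 0)"
          by (auto simp: ent_sum ent_dg_mult bl)
        also have "(\<Sum>a<k. ent D a c * ent (b a) i 0) = ent (y * D) i c"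
        proof (cases "i < n")
          case True
          have "ent (y * D) i c = (\<Sum>l<k. ent y i l * ent D l c)" by (rule ent_mult) (auto simp: ey)
          then show ?thesis using True by (simp add: ey mult.commute)
        next
          case False
          have "ent (y * D) i c = (\<Sum>l\<in>{}. ent y i l * ent D l c)" by (rule ent_mult) (use False in \<open>auto simp: ey\<close>)
          then show ?thesis using False b0 by simp
        qed
        finally show "ent (\<Sum>a<k. dg (ent D a c) * b a) i l = ent 0 i l" by (simp add: yD)
      qed
      moreover have "(\<Sum>a<k. dg (ent D a c) * b a) = (\<Sum>v\<in>B. dg (ent D (inv_into {..<k} b v) c) * v)"
        using sum.reindex_bij_betw [OF b, of "\<lambda>v. dg (ent D (inv_into {..<k} b v) c) * v"] b
        by (simp add: k_def bij_betw_def)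
      ultimately have "(\<Sum>v\<in>B. dg (ent D (inv_into {..<k} b v) c) * v) = 0" by simp
      then have "ent D (inv_into {..<k} b (b a)) c = 0"
        by (rule cfun.independentD [OF B(2) finB order_refl, where u = "\<lambda>v. ent D (inv_into {..<k} b v) c"]) (rule bB [OF True])
      then show ?thesis using b True by (simp add: bij_betw_def k_def)
    qed (simp add: cD)
    then have "D = 0" by (intro rfmat_eqI) simp
    then show ?thesis by (simp add: D_def)
  qed
  then show ?thesis
    using cy cx yx by (intro exI [of _ k] cx.simI [of y x]) (auto simp: cx_MF)
qed

section \<open>The trace as an additive invariant of complex idempotents\<close>

definition tr :: "complex rfmat \<Rightarrow> complex" where
  "tr m = (\<Sum>i\<in>{i. ent m i i \<noteq> 0}. ent m i i)"

lemma tr_corner: "corner n m \<Longrightarrow> tr m = (\<Sum>i<n. ent m i i)"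
  unfolding tr_def by (rule sum.mono_neutral_left) (auto simp: corner_def not_less [symmetric])

lemma tr_commute:
  assumes "x \<in> cx.MF" "y \<in> cx.MF" shows "tr (x * y) = tr (y * x)"
proof -
  obtain n where n: "corner n x" "corner n y" by (rule cx.MF_corner2 [OF assms])
  have "tr (x * y) = (\<Sum>i<n. \<Sum>k<n. ent x i k * ent y k i)"
    by (simp add: tr_corner [OF corner_mult [OF n]] ent_mult_corner [OF n(1)])
  also have "\<dots> = (\<Sum>k<n. \<Sum>i<n. ent x i k * ent y k i)" by (rule sum.swap)
  also have "\<dots> = tr (y * x)"
    by (simp add: tr_corner [OF corner_mult [OF n(2,1)]] ent_mult_corner [OF n(2)] mult.commute)
  finally show ?thesis .
qed

lemma tr_add:
  assumes "x \<in> cx.MF" "y \<in> cx.MF" shows "tr (x + y) = tr x + tr y"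
proof -
  obtain n where n: "corner n x" "corner n y" by (rule cx.MF_corner2 [OF assms])
  show ?thesis by (simp add: tr_corner [OF corner_add [OF n]] tr_corner [OF n(1)] tr_corner [OF n(2)] sum.distrib)
qed

lemma tr_sim: "cx.sim e f \<Longrightarrow> tr e = tr f"
  using tr_commute by (auto simp: cx.sim_def)

text \<open>The choice of e is immaterial, because equivalent idempotents have equal trace. This
  supplies the additive function \<open>t\<close> of
  \<open>groth_kernel_iso_integers\<close>.\<close>

definition V_tr :: "(nat \<Rightarrow> nat \<Rightarrow> complex) set \<Rightarrow> complex" where
  "V_tr P = tr (SOME e. e \<in> cx.IDEM \<and> P = cx.cls e)"

lemma V_tr_cls: assumes e: "e \<in> cx.IDEM" shows "V_tr (cx.cls e) = tr e"
proof -
  let ?f = "SOME f. f \<in> cx.IDEM \<and> cx.cls e = cx.cls f"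
  have f: "?f \<in> cx.IDEM \<and> cx.cls e = cx.cls ?f" by (rule someI_ex) (use e in blast)
  then have "cx.sim e ?f" using cx.cls_eq_iff [OF e] by blast
  then show ?thesis unfolding V_tr_def using tr_sim by simp
qed

lemma V_tr_mult:
  assumes "P \<in> carrier (V_monoid complex_alg)" "Q \<in> carrier (V_monoid complex_alg)"
  shows "V_tr (P \<otimes>\<^bsub>V_monoid complex_alg\<^esub> Q) = V_tr P + V_tr Q"
proof -
  obtain e f where ef: "e \<in> cx.IDEM" "f \<in> cx.IDEM" "P = cx.cls e" "Q = cx.cls f" using assms by (auto simp: cx.V_carrier)
  obtain k where k: "corner k e" using cx.IDEM_corner [OF ef(1)] by blast
  have s: "shifted k f \<in> cx.IDEM" by (rule cx.IDEM_shifted [OF ef(2)])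
  have "tr (shifted k f) = tr f" using tr_sim [OF cx.sim_shifted [OF ef(2)]] by simp
  then show ?thesis
    using cx.V_mult' [OF ef(1,2) k] ef s by (simp add: V_tr_cls tr_add cx.IDEM_MF)
qed

section \<open>Operator matrices\<close>

text \<open>Bounded complex-linear operators as a type of their own, with composition as product, so
  that operator matrices fall under \<open>rfmat\<close>.\<close>

typedef (overloaded) 'h cop = "bounded_ops :: ('h::complex_hilbert \<Rightarrow>\<^sub>L 'h) set"
  morphisms opr Cop
  using bounded_ops_0 by blast

setup_lifting type_definition_cop

instantiation cop :: (complex_hilbert) "{ring, monoid_mult}"
begin

lift_definition zero_cop :: "'a cop" is 0 by simp
lift_definition one_cop :: "'a cop" is id_blinfun by simp
lift_definition plus_cop :: "'a cop \<Rightarrow> 'a cop \<Rightarrow> 'a cop" is "(+)" by (rule bounded_ops_add)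
lift_definition minus_cop :: "'a cop \<Rightarrow> 'a cop \<Rightarrow> 'a cop" is "(-)" by (rule bounded_ops_diff)
lift_definition uminus_cop :: "'a cop \<Rightarrow> 'a cop" is uminus by (rule bounded_ops_minus)
lift_definition times_cop :: "'a cop \<Rightarrow> 'a cop \<Rightarrow> 'a cop" is "(o\<^sub>L)" by (rule bounded_ops_compose)

instance
proof
  fix a b c :: "'a cop"
  show "a + b + c = a + (b + c)" "a + b = b + a" "0 + a = a" "- a + a = 0" "a - b = a + - b"
    "a * b * c = a * (b * c)" "1 * a = a" "a * 1 = a"
    "(a + b) * c = a * c + b * c" "a * (b + c) = a * b + a * c"
    by (transfer; simp add: compose_assoc compose_algebra)+
qed

end

lemma opr_simps [simp]:
  "opr 0 = 0" "opr 1 = id_blinfun" "opr (X + Y) = opr X + opr Y" "opr (X - Y) = opr X - opr Y"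
  "opr (- X) = - opr X" "opr (X * Y) = opr X o\<^sub>L opr Y"
  by (simp_all add: zero_cop.rep_eq one_cop.rep_eq plus_cop.rep_eq minus_cop.rep_eq uminus_cop.rep_eq times_cop.rep_eq)

lemma opr_bounded [simp]: "opr X \<in> bounded_ops" using opr by blast

lemma opr_Cop: "X \<in> bounded_ops \<Longrightarrow> opr (Cop X) = X" by (rule Cop_inverse)

lemma cop_eqI: "opr X = opr Y \<Longrightarrow> X = Y" by (simp add: opr_inject)

lemma opr_sum: "opr (\<Sum>i\<in>A. f i) = (\<Sum>i\<in>A. opr (f i))"
  by (induction A rule: infinite_finite_induct) auto

definition scal :: "complex \<Rightarrow> 'h::complex_hilbert cop" where "scal c = Cop (scaleO c id_blinfun)"

lemma opr_scal [simp]: "opr (scal c) = scaleO c id_blinfun"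
  unfolding scal_def by (rule opr_Cop) (simp add: bounded_ops_scaleO)

lemma scal_add: "scal (a + b) = scal a + scal b" and scal_mult: "scal (a * b) = scal a * scal b"
  and scal_0: "scal 0 = 0" and scal_1: "scal 1 = 1" and scal_minus: "scal (- a) = - scal a"
proof -
  show "scal (- a) = - scal a"
    by (rule cop_eqI) (use scaleO_diff_left [of 0 a] in \<open>simp add: scaleO_zero_left\<close>)
qed (rule cop_eqI; simp add: scaleO_add_left scaleO_compose_left scaleO_scaleO scaleO_zero_left scaleO_one)+

lemma scal_commute: "scal c * X = X * scal c"
  by (rule cop_eqI) (simp add: scaleO_compose_left scaleO_compose_right)

lemma scal_sum: "scal (\<Sum>i\<in>A. f i) = (\<Sum>i\<in>A. scal (f i))"
  by (induction A rule: infinite_finite_induct) (auto simp: scal_0 scal_add)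

definition emb :: "complex rfmat \<Rightarrow> 'h::complex_hilbert cop rfmat" where
  "emb s = Rf (\<lambda>i j. scal (ent s i j))"

lemma ent_emb: "ent (emb s) i j = scal (ent s i j)"
proof -
  have "finite {j. scal (ent s i j) \<noteq> (0 :: 'h::complex_hilbert cop)}" for i
    by (rule finite_subset [OF _ ent_finite [of s i]]) (auto simp: scal_0)
  then show ?thesis unfolding emb_def by (subst ent_Rf) auto
qed

lemma emb_add: "emb (s + t) = emb s + emb t" and emb_minus: "emb (- s) = - emb s"
  and emb_0: "emb 0 = 0" and emb_1: "emb 1 = 1" and emb_idm: "emb (idm n) = idm n"
  by (rule rfmat_eqI; simp add: ent_emb scal_add scal_minus scal_0 scal_1 ent_one ent_idm)+

lemma emb_diff: "emb (s - t) = emb s - emb t"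
  using emb_add [of s "- t"] by (simp add: emb_minus)

lemma emb_mult: "(emb (s * t) :: 'h::complex_hilbert cop rfmat) = emb s * emb t"
proof (rule rfmat_eqI)
  fix i j
  have st: "ent (s * t) i j = (\<Sum>k\<in>{k. ent s i k \<noteq> 0}. ent s i k * ent t k j)"
    by (rule ent_mult) (auto simp: ent_finite)
  have "ent (emb s * emb t :: 'h cop rfmat) i j = (\<Sum>k\<in>{k. ent s i k \<noteq> 0}. ent (emb s) i k * ent (emb t) k j)"
    by (rule ent_mult) (auto simp: ent_finite ent_emb scal_0)
  then show "ent (emb (s * t) :: 'h cop rfmat) i j = ent (emb s * emb t) i j"
    by (simp add: ent_emb st scal_sum scal_mult)
qed

lemma corner_emb: "corner n s \<Longrightarrow> corner n (emb s)"
  by (simp add: corner_def ent_emb scal_0)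

text \<open>Think of H tensored with sequences: \<open>dg X\<close> acts on H and
  \<open>emb s\<close> on the sequences. This commutation lets a projection of H cut down scalar
  matrices.\<close>

lemma dg_emb_commute: "dg X * emb s = emb s * dg X"
  by (rule rfmat_eqI) (simp add: ent_dg_mult ent_mult_dg ent_emb scal_commute)

definition EM :: "('h::complex_hilbert \<Rightarrow>\<^sub>L 'h) set \<Rightarrow> 'h cop rfmat \<Rightarrow> bool" where
  "EM I m \<longleftrightarrow> (\<forall>i j. opr (ent m i j) \<in> I)"

lemma EM_D: "EM I m \<Longrightarrow> opr (ent m i j) \<in> I" by (simp add: EM_def)

text \<open>Three sets in one statement, to cover products and one-sided multiplications for finite
  rank operators, \<open>KE\<close>, \<open>E\<close> and the Macaev ideal alike.\<close>

lemma EM_mult: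
  assumes "0 \<in> I" "\<And>X Y. X \<in> I \<Longrightarrow> Y \<in> I \<Longrightarrow> X + Y \<in> I"
    "\<And>X Y. X \<in> A \<Longrightarrow> Y \<in> B \<Longrightarrow> X o\<^sub>L Y \<in> I" "EM A a" "EM B b"
  shows "EM I (a * b)"
proof -
  have "(\<Sum>k\<in>K. opr (ent a i k) o\<^sub>L opr (ent b k j)) \<in> I" for i j K
  proof (induction K rule: infinite_finite_induct)
    case (insert k K)
    then show ?case using assms(2) [OF assms(3) [OF EM_D [OF assms(4)] EM_D [OF assms(5)]]] by simp
  qed (simp_all add: assms(1))
  then show ?thesis by (simp add: EM_def times_rfmat.rep_eq opr_sum)
qed

lemma EM_bounded: "EM bounded_ops m" by (simp add: EM_def)

lemma EM_fr_mult_left: "EM finite_rank_ops a \<Longrightarrow> EM finite_rank_ops (a * b)"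
  by (rule EM_mult [OF _ _ _ _ EM_bounded]) (auto intro: finite_rank_add finite_rank_compose_left)

lemma EM_fr_mult_right: "EM finite_rank_ops b \<Longrightarrow> EM finite_rank_ops (a * b)"
  by (rule EM_mult [OF _ _ _ EM_bounded]) (auto intro: finite_rank_add finite_rank_compose_right)

lemma EM_fr_diff: "EM finite_rank_ops a \<Longrightarrow> EM finite_rank_ops b \<Longrightarrow> EM finite_rank_ops (a - b)"
  by (simp add: EM_def finite_rank_diff)

lemma corner_mult3:
  fixes a b x :: "'r::{ring, monoid_mult} rfmat"
  assumes a: "corner n a" and b: "corner n b" shows "corner n (a * x * b)"
  unfolding corner_def
proof (intro allI impI)
  fix i j assume "n \<le> i \<or> n \<le> j"
  then show "ent (a * x * b) i j = 0"
  proof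
    assume "n \<le> i"
    then show ?thesis unfolding mult.assoc [of a] by (simp add: ent_mult_corner [OF a] cornerD [OF a])
  next
    assume "n \<le> j"
    then show ?thesis by (simp add: ent_mult_corner_right [OF b] cornerD [OF b])
  qed
qed

context infinite_dim
begin

lemma macaev_add:
  fixes X :: "'h \<Rightarrow>\<^sub>L 'h"
  shows "X \<in> macaev_ideal \<Longrightarrow> Y \<in> macaev_ideal \<Longrightarrow> X + Y \<in> macaev_ideal"
  unfolding macaev_ideal_iff using compact_ops_add mac_bdd_add by blast

lemma macaev_minus:
  fixes X :: "'h \<Rightarrow>\<^sub>L 'h"
  shows "X \<in> macaev_ideal \<Longrightarrow> - X \<in> macaev_ideal"
  unfolding macaev_ideal_iff using compact_ops_minus mac_bdd_minus by blast

lemma macaev_compose_left: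
  fixes X :: "'h \<Rightarrow>\<^sub>L 'h"
  shows "X \<in> macaev_ideal \<Longrightarrow> A \<in> bounded_ops \<Longrightarrow> A o\<^sub>L X \<in> macaev_ideal"
  unfolding macaev_ideal_iff using compact_ops_compose_right mac_bdd_compose_left by blast

lemma macaev_compose_right:
  fixes X :: "'h \<Rightarrow>\<^sub>L 'h"
  shows "X \<in> macaev_ideal \<Longrightarrow> A \<in> bounded_ops \<Longrightarrow> X o\<^sub>L A \<in> macaev_ideal"
  unfolding macaev_ideal_iff using compact_ops_compose_left mac_bdd_compose_right by blast

lemma macaev_0: "(0 :: 'h \<Rightarrow>\<^sub>L 'h) \<in> macaev_ideal"
  by (simp add: finite_rank_macaev)

text \<open>A unit vector orthogonal to the range of a finite rank operator shows that 1 keeps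
  distance from it. Scalar parts in the unitization are unique for this reason.\<close>

lemma id_not_compact: "(id_blinfun :: 'h \<Rightarrow>\<^sub>L 'h) \<notin> compact_ops"
proof
  assume "(id_blinfun :: 'h \<Rightarrow>\<^sub>L 'h) \<in> compact_ops"
  then obtain F :: "'h \<Rightarrow>\<^sub>L 'h" where F: "F \<in> finite_rank_ops" "norm (id_blinfun - F) \<le> 1/2"
    using compact_op_approx [of id_blinfun "1/2"] by auto
  obtain k u where u: "orthn k u" "oproj k u o\<^sub>L F = F" using F(1) finite_rank_iff_oproj by blast
  obtain v :: 'h where v: "norm v = 1" "\<forall>i<k. cinner v (u i) = 0" using orthogonal_unit_vector [OF u(1)] by blast
  have "blinfun_apply F v = ocomp k u (blinfun_apply F v)"
    by (metis u(2) blinfun_apply_blinfun_compose oproj_apply)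
  moreover have "cinner v (ocomp k u w) = 0" for w
    using v(2) by (simp add: ocomp_def cinner_sum_right cinner_scaleC_right)
  ultimately have "cinner v (blinfun_apply F v) = 0" by metis
  then have "cinner v (blinfun_apply (id_blinfun - F) v) = 1"
    using v(1) by (simp add: blinfun.diff_left cinner_diff_right cinner_self)
  then have "1 \<le> norm v * norm (blinfun_apply (id_blinfun - F) v)"
    using cinner_bound [of v "blinfun_apply (id_blinfun - F) v"] by simp
  also have "\<dots> \<le> 1/2" using norm_blinfun [of "id_blinfun - F" v] v(1) F(2) by simp
  finally show False by simp
qed

end

section \<open>The unitization as an algebra of operators: scalar and compact parts\<close>

context hermitian_tuple
begin

definition iota :: "complex \<times> ('h \<Rightarrow>\<^sub>L 'h) \<Rightarrow> 'h cop" where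
  "iota = (\<lambda>(c, X). scal c + Cop X)"

abbreviation "Kp \<equiv> unitization (K_alg n T)"

lemma Kp_simps [simp]:
  "carrier Kp = UNIV \<times> KE" "one Kp = (1, 0)" "zero Kp = (0, 0)"
  "(a, X) \<oplus>\<^bsub>Kp\<^esub> (b, Y) = (a + b, X + Y)"
  "(a, X) \<otimes>\<^bsub>Kp\<^esub> (b, Y) = (a * b, scaleO a Y + scaleO b X + (X o\<^sub>L Y))"
  "anorm Kp (a, X) = cmod a + Enorm X"
  by (simp_all add: unitization_def)

lemma opr_iota: "X \<in> KE \<Longrightarrow> opr (iota (c, X)) = scaleO c id_blinfun + X"
  by (simp add: iota_def opr_Cop KE_compact)

lemma scalar_part_unique:
  assumes "X \<in> compact_ops" "Y \<in> compact_ops" "scaleO c id_blinfun + X = scaleO d id_blinfun + (Y :: 'h \<Rightarrow>\<^sub>L 'h)"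
  shows "c = d"
proof (rule ccontr)
  assume ne: "c \<noteq> d"
  have "scaleO c id_blinfun - scaleO d id_blinfun = Y - X"
    using assms(3) by (metis add_diff_cancel_left add_diff_cancel_right' diff_add_cancel add_diff_eq diff_diff_eq2)
  then have "scaleO (c - d) id_blinfun = Y - X" by (simp add: scaleO_diff_left)
  then have "scaleO (c - d) (id_blinfun :: 'h \<Rightarrow>\<^sub>L 'h) \<in> compact_ops" using compact_ops_diff assms by metis
  then have "scaleO (inverse (c - d)) (scaleO (c - d) (id_blinfun :: 'h \<Rightarrow>\<^sub>L 'h)) \<in> compact_ops"
    by (rule compact_ops_scaleO)
  then show False using ne id_not_compact by (simp add: scaleO_scaleO scaleO_one)
qed

text \<open>Uniqueness of scalar parts makes \<open>iota\<close> injective, so the abstract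
  unitization is the algebra of operators c 1 + X with X in \<open>KE\<close>, and its product
  becomes composition.\<close>

sublocale U: matrix_rep "unitization (K_alg n T)" iota
proof
  show "inj_on iota (carrier Kp)"
  proof (rule inj_onI)
    fix p q assume pq: "p \<in> carrier Kp" "q \<in> carrier Kp" "iota p = iota q"
    obtain c X d Y where cd: "p = (c, X)" "q = (d, Y)" by (metis surj_pair)
    have KE: "X \<in> KE" "Y \<in> KE" using pq cd by auto
    have eq: "scaleO c id_blinfun + X = scaleO d id_blinfun + Y"
      using pq(3) opr_iota KE cd by metis
    then have "c = d" using scalar_part_unique KE KE_compact by blast
    then show "p = q" using eq cd by simp
  qed
  show "\<zero>\<^bsub>Kp\<^esub> \<in> carrier Kp" "\<one>\<^bsub>Kp\<^esub> \<in> carrier Kp" by (simp_all add: KE_0)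
  show "iota \<zero>\<^bsub>Kp\<^esub> = 0" "iota \<one>\<^bsub>Kp\<^esub> = 1"
    by (rule cop_eqI; simp add: opr_iota KE_0 scaleO_zero_left scaleO_one)+
  fix p assume p: "p \<in> carrier Kp"
  obtain c X where c: "p = (c, X)" by (metis surj_pair)
  have X: "X \<in> KE" using p c by auto
  have "iota (- c, - X) = - iota p"
    by (rule cop_eqI) (use X scaleO_diff_left [of 0 c] in \<open>simp add: c opr_iota KE_minus scaleO_zero_left\<close>)
  then show "\<exists>q\<in>carrier Kp. iota q = - iota p" using KE_minus [OF X] by (intro bexI [of _ "(- c, - X)"]) auto
  fix q assume q: "q \<in> carrier Kp"
  obtain d Y where d: "q = (d, Y)" by (metis surj_pair)
  have Y: "Y \<in> KE" using q d by auto
  show "p \<oplus>\<^bsub>Kp\<^esub> q \<in> carrier Kp" using X Y by (simp add: c d KE_add)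
  show "iota (p \<oplus>\<^bsub>Kp\<^esub> q) = iota p + iota q"
    by (rule cop_eqI) (simp add: c d opr_iota X Y KE_add scaleO_add_left)
  have XY: "scaleO c Y + scaleO d X + (X o\<^sub>L Y) \<in> KE"
    using X Y by (simp add: KE_add KE_scaleO KE_compose_left KE_E)
  then show "p \<otimes>\<^bsub>Kp\<^esub> q \<in> carrier Kp" by (simp add: c d)
  show "iota (p \<otimes>\<^bsub>Kp\<^esub> q) = iota p * iota q"
  proof (rule cop_eqI)
    have "opr (iota p * iota q) = (scaleO c id_blinfun + X) o\<^sub>L (scaleO d id_blinfun + Y)"
      by (simp add: c d opr_iota X Y)
    also have "\<dots> = scaleO (c * d) id_blinfun + (scaleO c Y + scaleO d X + (X o\<^sub>L Y))"
      using KE_compact [OF X] by (simp add: compose_algebra scaleO_compose_left scaleO_compose_right scaleO_scaleO)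
    finally show "opr (iota (p \<otimes>\<^bsub>Kp\<^esub> q)) = opr (iota p * iota q)" by (simp add: c d opr_iota XY)
  qed
qed

lemma S_iff: "a \<in> U.S \<longleftrightarrow> (\<exists>c. opr a - scaleO c id_blinfun \<in> KE)"
proof
  assume "a \<in> U.S"
  then obtain c X where "X \<in> KE" "a = iota (c, X)" by (auto simp: U.S_def)
  then show "\<exists>c. opr a - scaleO c id_blinfun \<in> KE" by (intro exI [of _ c]) (simp add: opr_iota)
next
  assume "\<exists>c. opr a - scaleO c id_blinfun \<in> KE"
  then obtain c where c: "opr a - scaleO c id_blinfun \<in> KE" by blast
  then have "a = iota (c, opr a - scaleO c id_blinfun)" by (intro cop_eqI) (simp add: opr_iota)
  then show "a \<in> U.S" unfolding U.S_def using c by (intro image_eqI) auto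
qed

text \<open>The character of the unitization, read off from the operator alone.\<close>

definition scp :: "'h cop \<Rightarrow> complex" where
  "scp a = (THE c. opr a - scaleO c id_blinfun \<in> KE)"

lemma scp_eq: assumes "opr a - scaleO c id_blinfun \<in> KE" shows "scp a = c"
  unfolding scp_def
proof (rule the_equality)
  show "opr a - scaleO c id_blinfun \<in> KE" by (rule assms)
  fix d assume d: "opr a - scaleO d id_blinfun \<in> KE"
  show "d = c"
    by (rule scalar_part_unique [OF KE_compact [OF d] KE_compact [OF assms]]) simp
qed

lemma scp_S: "a \<in> U.S \<Longrightarrow> opr a - scaleO (scp a) id_blinfun \<in> KE"
  using S_iff scp_eq by metis

lemma scp_iota: "X \<in> KE \<Longrightarrow> scp (iota (c, X)) = c"
  by (rule scp_eq) (simp add: opr_iota)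

lemma scp_add: assumes "a \<in> U.S" "b \<in> U.S" shows "scp (a + b) = scp a + scp b"
proof (rule scp_eq)
  have "opr (a + b) - scaleO (scp a + scp b) id_blinfun = (opr a - scaleO (scp a) id_blinfun) + (opr b - scaleO (scp b) id_blinfun)"
    by (simp add: scaleO_add_left)
  then show "opr (a + b) - scaleO (scp a + scp b) id_blinfun \<in> KE" using KE_add scp_S assms by metis
qed

lemma scp_mult: assumes "a \<in> U.S" "b \<in> U.S" shows "scp (a * b) = scp a * scp b"
proof (rule scp_eq)
  define X Y where "X = opr a - scaleO (scp a) id_blinfun" and "Y = opr b - scaleO (scp b) id_blinfun"
  have XY: "X \<in> KE" "Y \<in> KE" using scp_S assms by (simp_all add: X_def Y_def)
  have Xb: "X \<in> bounded_ops" using XY KE_compact by simp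
  have "opr (a * b) = (scaleO (scp a) id_blinfun + X) o\<^sub>L (scaleO (scp b) id_blinfun + Y)" by (simp add: X_def Y_def)
  then have "opr (a * b) - scaleO (scp a * scp b) id_blinfun = scaleO (scp a) Y + scaleO (scp b) X + (X o\<^sub>L Y)"
    using Xb by (simp add: compose_algebra scaleO_compose_left scaleO_compose_right scaleO_scaleO)
  moreover have "scaleO (scp a) Y + scaleO (scp b) X + (X o\<^sub>L Y) \<in> KE"
    using XY by (simp add: KE_add KE_scaleO KE_compose_left KE_E)
  ultimately show "opr (a * b) - scaleO (scp a * scp b) id_blinfun \<in> KE" by simp
qed

lemma scp_scal: "scp (scal c) = c" by (rule scp_eq) (simp add: KE_0)

lemma scal_S: "scal c \<in> U.S" unfolding S_iff by (rule exI [of _ c]) (simp add: KE_0)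

lemma KE_S: "opr a \<in> KE \<Longrightarrow> a \<in> U.S" unfolding S_iff by (rule exI [of _ 0]) (simp add: scaleO_zero_left)

lemma scp_KE: "opr a \<in> KE \<Longrightarrow> scp a = 0" by (rule scp_eq) (simp add: scaleO_zero_left)

lemma scp_0: "scp 0 = 0" by (rule scp_KE) (simp add: KE_0)

lemma scp_sum: "(\<And>i. i \<in> A \<Longrightarrow> f i \<in> U.S) \<Longrightarrow> scp (\<Sum>i\<in>A. f i) = (\<Sum>i\<in>A. scp (f i))"
  by (induction A rule: infinite_finite_induct) (auto simp: scp_0 scp_add U.S_sum)

definition sc :: "'h cop rfmat \<Rightarrow> complex rfmat" where
  "sc m = Rf (\<lambda>i j. scp (ent m i j))"

lemma ent_sc: "ent (sc m) i j = scp (ent m i j)"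
proof -
  have "finite {j. scp (ent m i j) \<noteq> 0}" for i
    by (rule finite_subset [OF _ ent_finite [of m i]]) (auto simp: scp_0)
  then show ?thesis unfolding sc_def by (subst ent_Rf) auto
qed

lemma SE_D: "U.SE m \<Longrightarrow> ent m i j \<in> U.S" by (simp add: U.SE_def)

lemma sc_add: "U.SE a \<Longrightarrow> U.SE b \<Longrightarrow> sc (a + b) = sc a + sc b"
  by (rule rfmat_eqI) (simp add: ent_sc scp_add SE_D)

lemma sc_mult: assumes "U.SE a" "U.SE b" shows "sc (a * b) = sc a * sc b"
proof (rule rfmat_eqI)
  fix i j
  have "ent (sc a * sc b) i j = (\<Sum>k\<in>{k. ent a i k \<noteq> 0}. ent (sc a) i k * ent (sc b) k j)"
    by (rule ent_mult) (auto simp: ent_finite ent_sc scp_0)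
  moreover have "scp (\<Sum>k\<in>{k. ent a i k \<noteq> 0}. ent a i k * ent b k j) = (\<Sum>k\<in>{k. ent a i k \<noteq> 0}. scp (ent a i k * ent b k j))"
    by (rule scp_sum) (simp add: U.S_mult SE_D assms)
  ultimately show "ent (sc (a * b)) i j = ent (sc a * sc b) i j"
    by (simp add: ent_sc times_rfmat.rep_eq scp_mult SE_D assms)
qed

lemma SE_emb: "U.SE (emb s)" by (simp add: U.SE_def ent_emb scal_S)

lemma sc_emb: "sc (emb s) = s" by (rule rfmat_eqI) (simp add: ent_sc ent_emb scp_scal)

lemma SE_KE: "EM KE m \<Longrightarrow> U.SE m" by (simp add: U.SE_def EM_def KE_S)

lemma sc_KE: "EM KE m \<Longrightarrow> sc m = 0" by (rule rfmat_eqI) (simp add: ent_sc EM_def scp_KE)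

lemma SE_decomp: "U.SE m \<Longrightarrow> EM KE (m - emb (sc m))"
  by (simp add: EM_def ent_emb ent_sc scp_S SE_D)

lemma SE_sc_0: "U.SE m \<Longrightarrow> sc m = 0 \<Longrightarrow> EM KE m"
  using SE_decomp [of m] by (simp add: emb_0)

lemma corner_sc: "corner k m \<Longrightarrow> corner k (sc m)"
  by (simp add: corner_def ent_sc scp_0)

lemma SE_E: "U.SE m \<Longrightarrow> EM E m"
  unfolding EM_def
proof (intro allI)
  fix i j assume "U.SE m"
  then have "opr (ent m i j) - scaleO (scp (ent m i j)) id_blinfun \<in> KE" using scp_S SE_D by blast
  then have "(opr (ent m i j) - scaleO (scp (ent m i j)) id_blinfun) + scaleO (scp (ent m i j)) id_blinfun \<in> E"
    by (intro E_add KE_E E_scaleO E_id)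
  then show "opr (ent m i j) \<in> E" by simp
qed

lemma EM_KE_mult_left: "EM KE a \<Longrightarrow> EM E b \<Longrightarrow> EM KE (a * b)"
  by (rule EM_mult [where A = KE and B = E]) (auto intro: KE_0 KE_add KE_compose_left)

lemma EM_KE_mult_right: "EM E a \<Longrightarrow> EM KE b \<Longrightarrow> EM KE (a * b)"
  by (rule EM_mult [where A = E and B = KE]) (auto intro: KE_0 KE_add KE_compose_right)

lemma EM_KE_add: "EM KE a \<Longrightarrow> EM KE b \<Longrightarrow> EM KE (a + b)" and EM_KE_minus: "EM KE a \<Longrightarrow> EM KE (- a)"
  and EM_KE_diff: "EM KE a \<Longrightarrow> EM KE b \<Longrightarrow> EM KE (a - b)"
  by (simp_all add: EM_def KE_add KE_minus KE_diff)

lemma EM_fr_KE: "EM finite_rank_ops m \<Longrightarrow> EM KE m"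
  by (simp add: EM_def finite_rank_KE)

lemma EM_E_mult: "EM E a \<Longrightarrow> EM E b \<Longrightarrow> EM E (a * b)"
  by (rule EM_mult [where A = E and B = E]) (auto intro: E_add E_compose)

lemma EM_E_dg_scal: "EM E (dg (scal c))"
  by (simp add: EM_def ent_dg E_scaleO E_id)

text \<open>Inverse closedness: the commutators of \<open>(1 + k)\<^sup>-\<^sup>1\<close> are \<open>- (1 + k)\<^sup>-\<^sup>1 [k, T] (1 + k)\<^sup>-\<^sup>1\<close>.\<close>

lemma inverse_entries_E:
  assumes k: "corner m k" "EM KE k" and w: "(1 + k) * w = 1" "w * (1 + k) = 1"
  shows "EM E w"
  unfolding EM_def
proof (intro allI)
  fix i l
  show "opr (ent w i l) \<in> E"
    unfolding E_def
  proof (intro CollectI conjI ballI opr_bounded)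
    fix j assume j: "j \<in> J"
    define t where "t = dg (Cop (T j))"
    have "w * (t * k - k * t) * w = w * t * ((1 + k) * w) - w * (1 + k) * t * w"
      by (simp add: algebra_simps)
    also have "\<dots> = w * t - t * w" by (simp add: w)
    finally have eq: "w * t - t * w = w * (t * k - k * t) * w" by simp
    have oT: "opr (Cop (T j)) = T j" by (rule opr_Cop [OF T_bounded [OF j]])
    have mac: "EM macaev_ideal (t * k - k * t)"
      unfolding EM_def
    proof (intro allI)
      fix a b
      have "opr (ent (t * k - k * t) a b) = - commutator_op (opr (ent k a b)) (T j)"
        by (simp add: t_def ent_dg_mult ent_mult_dg oT commutator_op_def)
      then show "opr (ent (t * k - k * t) a b) \<in> macaev_ideal"
        using macaev_minus [OF E_comm [OF KE_E [OF EM_D [OF k(2)]] j]] by simp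
    qed
    have 1: "EM macaev_ideal (w * (t * k - k * t))"
      by (rule EM_mult [OF _ _ _ EM_bounded mac]) (auto intro: macaev_0 macaev_add macaev_compose_left)
    have "EM macaev_ideal (w * (t * k - k * t) * w)"
      by (rule EM_mult [OF _ _ _ 1 EM_bounded]) (auto intro: macaev_0 macaev_add macaev_compose_right)
    then have "opr (ent (w * t - t * w) i l) \<in> macaev_ideal" unfolding eq by (rule EM_D)
    then show "commutator_op (opr (ent w i l)) (T j) \<in> macaev_ideal"
      by (simp add: t_def ent_dg_mult ent_mult_dg oT commutator_op_def)
  qed
qed

text \<open>The inverse satisfies \<open>w = 1 - k + k * w * k\<close>. As \<open>KE\<close> is an
  ideal in \<open>E\<close> and k sits in a finite block, \<open>w - 1\<close> has entries in
  \<open>KE\<close> and sits in the same block.\<close>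

lemma invmI:
  assumes k: "corner m k" "EM KE k" and w: "(1 + k) * w = 1" "w * (1 + k) = 1"
  shows "U.invm m (1 + k)"
proof -
  have wE: "EM E w" by (rule inverse_entries_E [OF k w])
  have 1: "k * w = 1 - w" using w(1) by (simp add: algebra_simps)
  have 2: "w * k = 1 - w" using w(2) by (simp add: algebra_simps)
  have "k * w * k = k - w * k" by (simp add: 1 left_diff_distrib)
  then have weq: "w = 1 + (- k + k * w * k)" by (simp add: 2)
  have "EM E k" using k(2) KE_E by (simp add: EM_def)
  then have KE: "EM KE (- k + k * w * k)"
    by (intro EM_KE_add EM_KE_minus EM_KE_mult_right EM_E_mult wE k)
  have "corner m (0 - k + k * w * k)" by (intro corner_add corner_diff corner_mult3 corner_0 k)
  then have "corner m (w - 1)" by (subst weq) simp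
  moreover have "U.SE w" by (subst weq) (rule U.SE_add [OF U.SE_1 SE_KE [OF KE]])
  ultimately show ?thesis
    unfolding U.invm_def using k w U.SE_add [OF U.SE_1 SE_KE [OF k(2)]] by auto
qed

text \<open>The bound on the entries compensates for the m terms in each entry of a product, so the
  entries of the p-th power have norm at most \<open>(1/2) ^ p\<close> and the series converges in
  operator norm. That its sum lies over the unitization is left to \<open>invmI\<close>.\<close>

lemma neumann_series:
  assumes k: "corner m k" "EM KE k" and small: "\<And>i j. norm (opr (ent k i j)) \<le> 1 / (2 * (real m + 1))"
  shows "U.invm m (1 + k)"
proof -
  define c where "c = (\<lambda>p i j. opr (ent ((- k) ^ p) i j))"
  have cS: "c (Suc p) i j = - (\<Sum>l<m. opr (ent k i l) o\<^sub>L c p l j)" for p i j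
    by (simp add: c_def ent_mult_corner [OF k(1)] opr_sum)
  have cS': "c (Suc p) i j = - (\<Sum>l<m. c p i l o\<^sub>L opr (ent k l j))" for p i j
    unfolding c_def power_Suc2 by (simp add: ent_mult_corner_right [OF k(1)] opr_sum)
  have c0: "c 0 i j = (if i = j then id_blinfun else 0)" for i j
    by (simp add: c_def ent_one)
  have cn: "norm (c p i j) \<le> (1/2) ^ p" for p i j
  proof (induction p arbitrary: i j)
    case 0 then show ?case using norm_blinfun_id_le [where ?'a = 'h] by (simp add: c0)
  next
    case (Suc p)
    have "norm (c (Suc p) i j) \<le> (\<Sum>l<m. 1 / (2 * (real m + 1)) * (1/2) ^ p)"
      unfolding cS norm_minus_cancel by (intro sum_norm_le norm_compose_le small Suc)
    also have "\<dots> = real m / (real m + 1) * (1/2) ^ Suc p" by simp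
    also have "\<dots> \<le> 1 * (1/2) ^ Suc p" by (intro mult_right_mono) auto
    finally show ?case by simp
  qed
  have sm: "summable (\<lambda>p. c p i j)" for i j
    by (rule summable_comparison_test' [of "\<lambda>p. (1/2) ^ p" 0]) (use cn in \<open>auto intro: summable_geometric\<close>)
  have summable_Suc: "summable (\<lambda>p. c (Suc p) i j)" for i j
    using sm [of i j] summable_Suc_iff [of "\<lambda>p. c p i j"] by simp
  define W where "W = (\<lambda>i j. \<Sum>p. c p i j)"
  have Wb: "W i j \<in> bounded_ops" for i j
  proof (rule closed_sequentially [OF closed_bounded_ops])
    show "(\<lambda>n. \<Sum>p<n. c p i j) \<longlonglongrightarrow> W i j" unfolding W_def by (rule summable_LIMSEQ [OF sm])
    show "(\<Sum>p<n. c p i j) \<in> bounded_ops" for n by (intro bounded_ops_sum) (simp add: c_def)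
  qed
  have Wsplit: "W i j = c 0 i j + (\<Sum>p. c (Suc p) i j)" for i j
    unfolding W_def using suminf_split_head [OF sm] by (simp add: algebra_simps)
  \<comment> \<open>Outside the block all positive powers vanish, so the sum agrees with the
    identity there; in particular its rows are finite.\<close>
  have Wout: "W i j = (if i = j then id_blinfun else 0)" if "m \<le> i \<or> m \<le> j" for i j
  proof -
    have "c (Suc p) i j = 0" for p
    proof (cases "m \<le> i")
      case True
      then show ?thesis unfolding cS by (simp add: cornerD [OF k(1)] compose_zero_left)
    next
      case False
      then show ?thesis using that unfolding cS' by (simp add: cornerD [OF k(1)] compose_zero_right)
    qed
    then show ?thesis unfolding Wsplit by (simp add: c0)
  qed
  define w where "w = Rf (\<lambda>i j. Cop (W i j))"
  have w_ent: "ent w i j = Cop (W i j)" for i j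
  proof -
    have z: "Cop (0 :: 'h \<Rightarrow>\<^sub>L 'h) = 0" by (simp add: zero_cop_def)
    have "finite {j. Cop (W i j) \<noteq> 0}" for i
    proof (rule finite_subset [of _ "{..<m} \<union> {i}"])
      show "{j. Cop (W i j) \<noteq> 0} \<subseteq> {..<m} \<union> {i}"
      proof
        fix j assume "j \<in> {j. Cop (W i j) \<noteq> 0}"
        then show "j \<in> {..<m} \<union> {i}" using Wout [of i j] z by (cases "j < m"; cases "j = i") auto
      qed
    qed simp
    then show ?thesis unfolding w_def by (subst ent_Rf) auto
  qed
  have w_opr: "opr (ent w i j) = W i j" for i j by (simp add: w_ent opr_Cop Wb)
  have k1: "(1 + k) * w = 1"
  proof (rule rfmat_eqI, rule cop_eqI)
    fix i j
    have "(\<Sum>l<m. opr (ent k i l) o\<^sub>L W l j) = (\<Sum>l<m. \<Sum>p. opr (ent k i l) o\<^sub>L c p l j)"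
      unfolding W_def
      by (intro sum.cong refl bounded_linear.suminf [OF bounded_bilinear.bounded_linear_right [OF bounded_bilinear_blinfun_compose]] sm)
    also have "\<dots> = (\<Sum>p. \<Sum>l<m. opr (ent k i l) o\<^sub>L c p l j)"
      by (intro suminf_sum [symmetric] bounded_linear.summable [OF bounded_bilinear.bounded_linear_right [OF bounded_bilinear_blinfun_compose]] sm)
    also have "\<dots> = (\<Sum>p. - c (Suc p) i j)" by (simp add: cS)
    also have "\<dots> = - (\<Sum>p. c (Suc p) i j)"
      by (rule suminf_minus [OF summable_Suc])
    finally show "opr (ent ((1 + k) * w) i j) = opr (ent 1 i j)"
      unfolding distrib_right ent_add ent_mult_corner [OF k(1)] mult_1_left opr_simps opr_sum w_opr ent_one
      by (simp add: Wsplit [of i j] c0)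
  qed
  have k2: "w * (1 + k) = 1"
  proof (rule rfmat_eqI, rule cop_eqI)
    fix i j
    have "(\<Sum>l<m. W i l o\<^sub>L opr (ent k l j)) = (\<Sum>l<m. \<Sum>p. c p i l o\<^sub>L opr (ent k l j))"
      unfolding W_def
      by (intro sum.cong refl bounded_linear.suminf [OF bounded_bilinear.bounded_linear_left [OF bounded_bilinear_blinfun_compose]] sm)
    also have "\<dots> = (\<Sum>p. \<Sum>l<m. c p i l o\<^sub>L opr (ent k l j))"
      by (intro suminf_sum [symmetric] bounded_linear.summable [OF bounded_bilinear.bounded_linear_left [OF bounded_bilinear_blinfun_compose]] sm)
    also have "\<dots> = (\<Sum>p. - c (Suc p) i j)" by (simp add: cS')
    also have "\<dots> = - (\<Sum>p. c (Suc p) i j)"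
      by (rule suminf_minus [OF summable_Suc])
    finally show "opr (ent (w * (1 + k)) i j) = opr (ent 1 i j)"
      unfolding distrib_left ent_add ent_mult_corner_right [OF k(1)] mult_1_right opr_simps opr_sum w_opr ent_one
      by (simp add: Wsplit [of i j] c0)
  qed
  show ?thesis by (rule invmI [OF k k1 k2])
qed

text \<open>Entrywise approximation of compact operators. The finite rank part lies in
  \<open>KE\<close>, hence so does the remainder, which is small in operator norm as
  \<open>neumann_series\<close> asks.\<close>

lemma small_plus_finite_rank:
  assumes k: "corner m k" "EM KE k" and d: "d > 0"
  obtains a h where "k = a + h" "corner m a" "corner m h" "EM KE a" "EM finite_rank_ops h"
    "\<And>i j. norm (opr (ent a i j)) \<le> d"
proof -
  have "\<forall>i j. \<exists>F\<in>finite_rank_ops. norm (opr (ent k i j) - F) \<le> d"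
    using compact_op_approx [OF KE_compact [OF EM_D [OF k(2)]] d] by blast
  then obtain F where F: "\<And>i j. F i j \<in> finite_rank_ops" "\<And>i j. norm (opr (ent k i j) - F i j) \<le> d" by metis
  define h where "h = Rf (\<lambda>i j. if i < m \<and> j < m then Cop (F i j) else 0)"
  have h: "ent h i j = (if i < m \<and> j < m then Cop (F i j) else 0)" for i j
    unfolding h_def by (subst ent_Rf_corner [of m]) auto
  have ho: "opr (ent h i j) = (if i < m \<and> j < m then F i j else 0)" for i j
    by (simp add: h opr_Cop F(1))
  show ?thesis
  proof (rule that [of "k - h" h])
    show ch: "corner m h" by (auto simp: corner_def h)
    then show "corner m (k - h)" by (rule corner_diff [OF k(1)])
    show fh: "EM finite_rank_ops h" by (simp add: EM_def ho F(1))
    show "EM KE (k - h)" by (rule EM_KE_diff [OF k(2) EM_fr_KE [OF fh]])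
    show "norm (opr (ent (k - h) i j)) \<le> d" for i j
      using F(2) [of i j] d cornerD [OF k(1), of i j] by (auto simp: ho)
  qed simp
qed

end

section \<open>The group \<open>K\<^sub>0\<close>\<close>

lemma mult_eq_left: "a * b = c \<Longrightarrow> a * (b * z) = c * (z :: 'r::semigroup_mult)"
  by (simp add: mult.assoc [symmetric])

lemma EM_dg: "0 \<in> I \<Longrightarrow> opr X \<in> I \<Longrightarrow> EM I (dg X)"
  by (simp add: EM_def ent_dg)

lemma shifted_dg: "shifted r (dg X * m) = dg X * shifted r m"
  by (rule rfmat_eqI) (simp add: ent_shifted ent_dg_mult)

context hermitian_tuple
begin

section \<open>Complex matrices realized by finite rank operators\<close>

definition xi :: 'h where "xi = (SOME v. norm v = 1)"

lemma norm_xi: "norm xi = 1"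
proof -
  have "\<exists>v :: 'h. norm v = 1" using orthogonal_unit_vector [OF orthn_0] by blast
  then show ?thesis unfolding xi_def by (rule someI_ex)
qed

text \<open>On H tensored with sequences, Q projects H onto the line of \<open>xi\<close> and is the
  identity on sequences. Thus \<open>Q * emb a\<close> is a faithful copy of the complex matrix a
  whose entries have finite rank.\<close>

definition Q :: "'h cop rfmat" where "Q = dg (Cop (rank1 xi xi))"

lemma Q_emb: "Q * emb a = emb a * Q"
  by (simp add: Q_def dg_emb_commute)

lemma Q_Q: "Q * Q = Q"
proof -
  have "Cop (rank1 xi xi) * Cop (rank1 xi xi) = Cop (rank1 xi xi)"
    by (rule cop_eqI, rule blinfun_eqI) (simp add: opr_Cop cinner_scaleC_left cinner_self norm_xi)
  then show ?thesis by (simp add: Q_def flip: dg_mult)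
qed

lemma Q_fr: "EM finite_rank_ops (Q * m)"
  unfolding Q_def by (intro EM_fr_mult_left EM_dg) (simp_all add: opr_Cop)

lemma Q_emb_mult: "Q * emb a * (Q * emb b) = Q * emb (a * b)"
  by (metis Q_Q Q_emb emb_mult mult.assoc)

lemma Q_emb_inj: assumes "Q * emb a = Q * emb b" shows "a = b"
proof (rule rfmat_eqI)
  fix i j
  have "blinfun_apply (opr (ent (Q * emb a) i j)) xi = blinfun_apply (opr (ent (Q * emb b) i j)) xi" by (simp add: assms)
  then have "ent a i j *\<^sub>C xi = ent b i j *\<^sub>C xi"
    by (simp add: Q_def ent_dg_mult ent_emb opr_Cop cinner_scaleC_left cinner_self norm_xi)
  then show "ent a i j = ent b i j"
    using norm_xi complex_vs.scale_right_imp_eq [of xi] by force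
qed

lemma corner_Q: "corner k m \<Longrightarrow> corner k (Q * m)"
  by (simp add: Q_def corner_dg_mult)

text \<open>With p the projection onto the line of \<open>xi\<close>, every operator p Y p is a
  scalar multiple of p; the scalars form the complex matrix \<open>l\<close>.\<close>

lemma Q_compress:
  assumes X: "corner d X" "Q * X = X" "X * Q = X"
  obtains l where "corner d l" "X = Q * emb l"
proof -
  define l where "l = Rf (\<lambda>i j. cinner (blinfun_apply (opr (ent X i j)) xi) xi)"
  have l: "ent l i j = cinner (blinfun_apply (opr (ent X i j)) xi) xi" for i j
    unfolding l_def by (subst ent_Rf_corner [of d]) (auto simp: cornerD [OF X(1)])
  have "X = Q * X * Q" by (simp add: X)
  also have "\<dots> = Q * emb l"
  proof (rule rfmat_eqI, rule cop_eqI, rule blinfun_eqI)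
    fix i j v
    show "blinfun_apply (opr (ent (Q * X * Q) i j)) v = blinfun_apply (opr (ent (Q * emb l) i j)) v"
      using opr_bounded [of "ent X i j"]
      by (simp add: Q_def ent_dg_mult ent_mult_dg ent_emb opr_Cop l bounded_ops_def cinner_scaleC_left
          scaleC_scaleC mult.commute)
  qed
  finally have "X = Q * emb l" .
  moreover have "corner d l" by (simp add: corner_def l cornerD [OF X(1)])
  ultimately show ?thesis using that by blast
qed

text \<open>Expanding the rows of \<open>F\<close> in an orthonormal basis \<open>u\<close> of a space containing all ranges, the
  middle index \<open>a * k + s\<close> of the factorization stands for the pair of the row \<open>a\<close> and the vector \<open>u s\<close>.\<close>

lemma finite_rank_factor:
  assumes F: "corner m F" "EM finite_rank_ops F"
  obtains d a b where "F = b * a" "corner d a" "corner d b" "Q * a = a" "b * Q = b"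
    "EM finite_rank_ops a" "EM finite_rank_ops b"
proof -
  define X where "X = (\<lambda>i j. opr (ent F i j))"
  have "finite ((\<lambda>(i, j). X i j) ` ({..<m} \<times> {..<m}))" "(\<lambda>(i, j). X i j) ` ({..<m} \<times> {..<m}) \<subseteq> finite_rank_ops"
    using F(2) by (auto simp: EM_def X_def)
  then obtain k u where u: "\<And>Y. Y \<in> (\<lambda>(i, j). X i j) ` ({..<m} \<times> {..<m}) \<Longrightarrow> oproj k u o\<^sub>L Y = Y"
    by (rule finite_rank_corner) blast
  have Xb: "X i j \<in> bounded_ops" for i j by (simp add: X_def)
  have uX: "ocomp k u (blinfun_apply (X i j) v) = blinfun_apply (X i j) v" if "i < m" "j < m" for i j v
  proof -
    have "oproj k u o\<^sub>L X i j = X i j" by (rule u) (use that in auto)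
    then show ?thesis by (metis blinfun_apply_blinfun_compose oproj_apply)
  qed
  \<comment> \<open>A common square size for both factors: the middle index stays below
    \<open>m * k\<close>, the outer ones below m.\<close>
  define d where "d = m * k + m"
  define b where "b = Rf (\<lambda>i t. if i < m \<and> t < m * k \<and> t div k = i then Cop (rank1 (u (t mod k)) xi) else 0)"
  define a where "a = Rf (\<lambda>t j. if t < m * k \<and> j < m then Cop (rank1 xi (blinfun_apply (adj_op (X (t div k) j)) (u (t mod k)))) else 0)"
  have eb: "ent b i t = (if i < m \<and> t < m * k \<and> t div k = i then Cop (rank1 (u (t mod k)) xi) else 0)" for i t
    unfolding b_def by (subst ent_Rf_corner [of d]) (auto simp: d_def)
  have ea: "ent a t j = (if t < m * k \<and> j < m then Cop (rank1 xi (blinfun_apply (adj_op (X (t div k) j)) (u (t mod k)))) else 0)" for t j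
    unfolding a_def by (subst ent_Rf_corner [of d]) (auto simp: d_def)
  have ca: "corner d a" and cb: "corner d b" by (auto simp: corner_def ea eb d_def)
  have "F = b * a"
  proof (rule rfmat_eqI, rule cop_eqI, rule blinfun_eqI)
    fix i j v
    define g where "g = (\<lambda>t. blinfun_apply (opr (ent b i t)) (blinfun_apply (opr (ent a t j)) v))"
    have "ent (b * a) i j = (\<Sum>t<m * k. ent b i t * ent a t j)"
      by (rule ent_mult) (auto simp: eb)
    then have *: "blinfun_apply (opr (ent (b * a) i j)) v = (\<Sum>t<m * k. g t)"
      by (simp add: opr_sum blinfun.sum_left g_def)
    show "blinfun_apply (opr (ent F i j)) v = blinfun_apply (opr (ent (b * a) i j)) v"
    proof (cases "i < m \<and> j < m")
      case True
      have gr: "(\<Sum>t\<in>{c * k..<c * k + k}. g t) = (if c = i then blinfun_apply (X i j) v else 0)" if c: "c < m" for c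
      proof -
        have "c * k + s < m * k" if "s < k" for s
        proof -
          have "c * k + s < Suc c * k" using that by simp
          also have "\<dots> \<le> m * k" using c by (intro mult_right_mono) auto
          finally show ?thesis .
        qed
        then have gs: "g (s + c * k) = (if c = i then cinner (blinfun_apply (X i j) v) (u s) *\<^sub>C u s else 0)" if "s < k" for s
          using that True
          by (simp add: g_def ea eb opr_Cop add.commute [of s] cinner_scaleC_left cinner_self norm_xi cinner_adj' [symmetric]
              cinner_commute [of v])
            (metis Xb adj_op_adj_op adj_op_in cinner_adj' cinner_commute)
        have "(\<Sum>t\<in>{c * k..<c * k + k}. g t) = (\<Sum>s\<in>{0..<k}. g (s + c * k))"
          using sum.shift_bounds_nat_ivl [of g 0 "c * k" k] by (simp add: add.commute)
        also have "\<dots> = (if c = i then ocomp k u (blinfun_apply (X i j) v) else 0)"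
          using gs by (simp add: ocomp_def atLeast0LessThan)
        finally show ?thesis using uX True by simp
      qed
      have "(\<Sum>t<m * k. g t) = (\<Sum>c<m. \<Sum>t\<in>{c * k..<c * k + k}. g t)"
        by (rule sum.nat_group [symmetric])
      also have "\<dots> = (\<Sum>c<m. if c = i then blinfun_apply (X i j) v else 0)"
        by (intro sum.cong) (simp_all add: gr)
      also have "\<dots> = blinfun_apply (X i j) v" using True by simp
      finally show ?thesis by (simp add: * X_def)
    next
      case False
      then have "g t = 0" for t by (auto simp: g_def ea eb)
      then show ?thesis using False cornerD [OF F(1), of i j] by (auto simp: *)
    qed
  qed
  moreover have "Q * a = a"
    by (rule rfmat_eqI, rule cop_eqI, rule blinfun_eqI)
      (simp add: Q_def ent_dg_mult ea opr_Cop cinner_scaleC_left cinner_self norm_xi)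
  moreover have "b * Q = b"
    by (rule rfmat_eqI, rule cop_eqI, rule blinfun_eqI)
      (simp add: Q_def ent_mult_dg eb opr_Cop cinner_scaleC_left cinner_self norm_xi)
  moreover have "EM finite_rank_ops a" "EM finite_rank_ops b"
    by (simp_all add: EM_def ea eb opr_Cop)
  ultimately show ?thesis using that ca cb by blast
qed

lemma fr_MF: "corner m f \<Longrightarrow> EM finite_rank_ops f \<Longrightarrow> f \<in> U.MF"
  using U.MF_I SE_KE EM_fr_KE by blast

lemma emb_MF: "corner m s \<Longrightarrow> emb s \<in> U.MF"
  using U.MF_I SE_emb corner_emb by blast

lemma idm_IDEM: "idm r \<in> U.IDEM"
  using emb_MF [OF corner_idm] by (intro U.IDEM_I) (simp_all add: emb_idm idm_idm)

lemma Q_idm_IDEM: "Q * idm b \<in> U.IDEM"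
  using Q_emb_mult [of "idm b" "idm b"] fr_MF [OF corner_Q [OF corner_idm] Q_fr]
  by (intro U.IDEM_I) (simp_all add: emb_idm idm_idm)

lemma sim_emb: assumes "cx.sim a b" shows "U.sim (emb a) (emb b)" "U.sim (Q * emb a) (Q * emb b)"
proof -
  obtain x y m m' where xy: "corner m x" "corner m' y" "x * y = a" "y * x = b"
    using assms by (auto simp: cx.sim_def cx_MF)
  show "U.sim (emb a) (emb b)"
    by (rule U.simI [OF emb_MF [OF xy(1)] emb_MF [OF xy(2)]]) (simp_all add: xy flip: emb_mult)
  have "Q * emb z \<in> U.MF" if "corner k z" for k z by (rule fr_MF [OF corner_Q [OF corner_emb [OF that]] Q_fr])
  then show "U.sim (Q * emb a) (Q * emb b)"
    using xy by (intro U.simI [of "Q * emb x" "Q * emb y"]) (simp_all add: Q_emb_mult)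
qed

text \<open>Factor \<open>f = y * x\<close> with \<open>x * y = Q * emb c\<close>. From
  \<open>f * f = f\<close> it follows only that the third and second powers of \<open>x * y\<close>
  agree; so the idempotent on the complex side is \<open>c * c\<close>, and the equivalence is
  arranged to end there.\<close>

lemma finite_rank_idempotent:
  assumes f: "f \<in> U.IDEM" "EM finite_rank_ops f"
  obtains b where "U.cls f = U.cls (Q * idm b)"
proof -
  obtain m where m: "corner m f" using U.IDEM_corner [OF f(1)] by blast
  obtain d x y where xy: "f = y * x" "corner d x" "corner d y" "Q * x = x" "y * Q = y"
    "EM finite_rank_ops x" "EM finite_rank_ops y"
    by (rule finite_rank_factor [OF m f(2)]) blast
  have ff: "y * x * (y * x) = y * x" using U.IDEM_idem [OF f(1)] by (simp add: xy(1))
  obtain c where c: "corner d c" "x * y = Q * emb c"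
    by (rule Q_compress [of d "x * y"]) (use xy in \<open>simp_all add: corner_mult mult.assoc mult_eq_left [OF xy(4)]\<close>)
  have sq: "x * (y * x * y) = Q * emb (c * c)"
    using Q_emb_mult [of c c] by (simp add: c(2) [symmetric] mult.assoc)
  have "U.sim f (Q * emb (c * c))"
  proof (rule U.simI [of "y * x * y" x])
    show "y * x * y * x = f" "x * (y * x * y) = Q * emb (c * c)" using ff sq xy(1) by (simp_all add: mult.assoc)
    show "y * x * y \<in> U.MF" "x \<in> U.MF" using xy by (auto intro!: fr_MF [of d] corner_mult EM_fr_mult_left)
  qed
  have "Q * emb (c * c * (c * c)) = Q * emb (c * c)"
  proof -
    have "y * (x * (y * (x * z))) = y * (x * z)" for z using mult_eq_left [OF ff, of z] by (simp add: mult.assoc)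
    then have "x * (y * x * y) * (x * (y * x * y)) = x * (y * x * y)" by (simp add: mult.assoc)
    then show ?thesis by (simp only: sq Q_emb_mult)
  qed
  then have "c * c * (c * c) = c * c" by (rule Q_emb_inj)
  then have "c * c \<in> cx.IDEM" using corner_mult [OF c(1) c(1)] by (intro cx.IDEM_I) (auto simp: cx_MF)
  then obtain b where "cx.sim (c * c) (idm b)" using complex_idempotent_sim_idm by blast
  then have s2: "U.sim (Q * emb (c * c)) (Q * idm b)" using sim_emb(2) emb_idm by metis
  have "Q * emb (c * c) \<in> U.IDEM"
    by (intro U.IDEM_I fr_MF [OF corner_Q [OF corner_emb [OF corner_mult [OF c(1) c(1)]]]] Q_fr)
      (simp add: Q_emb_mult \<open>c * c * (c * c) = c * c\<close>)
  then have "U.sim f (Q * idm b)"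
    by (rule U.sim_trans [OF \<open>U.sim f (Q * emb (c * c))\<close> s2 f(1) _ Q_idm_IDEM])
  then show ?thesis using that U.cls_eq_iff f(1) Q_idm_IDEM by blast
qed

abbreviation "V \<equiv> V_monoid (unitization (K_alg n T))"

lemma cls_idm_power: "U.cls (idm 1) [^]\<^bsub>V\<^esub> r = U.cls (idm r)"
proof (induction r)
  case (Suc r)
  interpret V: comm_monoid V by (rule U.comm_monoid_V)
  have "idm (Suc r) = idm r + shifted r (idm 1 :: 'h cop rfmat)" using idm_shifted [of r 1] unfolding Suc_eq_plus1 .
  then show ?case
    using U.V_mult'(1) [OF idm_IDEM idm_IDEM corner_idm, of r 1] by (simp add: Suc del: One_nat_def)
qed (simp add: nat_pow_def U.V_one idm_0)

lemma cls_Q_idm_power: "U.cls (Q * idm 1) [^]\<^bsub>V\<^esub> b = U.cls (Q * idm b)"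
proof (induction b)
  case (Suc b)
  interpret V: comm_monoid V by (rule U.comm_monoid_V)
  have "idm (Suc b) = idm b + shifted b (idm 1 :: 'h cop rfmat)" using idm_shifted [of b 1] unfolding Suc_eq_plus1 .
  then have "Q * idm b + shifted b (Q * idm 1) = Q * idm (Suc b)"
    by (simp add: Q_def shifted_dg distrib_left)
  then show ?case
    using U.V_mult'(1) [OF Q_idm_IDEM Q_idm_IDEM corner_Q [OF corner_idm], of b 1] by (simp add: Suc del: One_nat_def)
qed (simp add: nat_pow_def U.V_one idm_0)

lemma sc_IDEM: "e \<in> U.IDEM \<Longrightarrow> sc e \<in> cx.IDEM"
  using U.IDEM_corner [of e] corner_sc U.MF_SE [OF U.IDEM_MF] U.IDEM_idem sc_mult
  by (intro cx.IDEM_I) (auto simp: cx_MF, metis)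

text \<open>Since \<open>e\<close> and its scalar part \<open>s\<close> differ by compact operators, so do \<open>e s + (1 - e) (1 - s)\<close>, which
  intertwines them, and \<open>1\<close>. Dropping a finite rank part makes it invertible, so that \<open>e\<close> is similar to a
  finite rank perturbation of \<open>s\<close>.\<close>

lemma idempotent_finite_rank_perturbation:
  assumes e: "e \<in> U.IDEM"
  obtains m F where "corner m F" "EM finite_rank_ops F" "corner m (emb (sc e) :: 'h cop rfmat)"
    "emb (sc e) + F \<in> U.IDEM" "U.sim e (emb (sc e) + F)"
proof -
  define s :: "'h cop rfmat" where "s = emb (sc e)"
  obtain m where m: "corner m e" using U.IDEM_corner [OF e] by blast
  have SEe: "U.SE e" by (rule U.MF_SE [OF U.IDEM_MF [OF e]])
  have ee: "e * e = e" by (rule U.IDEM_idem [OF e])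
  have ss: "s * s = s" using cx.IDEM_idem [OF sc_IDEM [OF e]] by (simp add: s_def flip: emb_mult)
  have cs: "corner m s" unfolding s_def by (intro corner_emb corner_sc m)
  define k where "k = e - s"
  have k: "EM KE k" "corner m k" unfolding k_def using SE_decomp [OF SEe] corner_diff [OF m cs] by (simp_all add: s_def)
  \<comment> \<open>As \<open>k = e - s\<close> and s is idempotent, \<open>1 + kap\<close> equals
    \<open>e * s + (1 - e) * (1 - s)\<close>.\<close>
  define kap where "kap = k * s + k * s - k"
  have Es: "EM E s" unfolding s_def by (intro SE_E SE_emb)
  have kap: "EM KE kap" "corner m kap"
    unfolding kap_def by (intro EM_KE_diff EM_KE_add EM_KE_mult_left k Es) (intro corner_diff corner_add corner_mult k cs)
  obtain a h where ah: "kap = a + h" "corner m a" "corner m h" "EM KE a" "EM finite_rank_ops h"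
    "\<And>i j. norm (opr (ent a i j)) \<le> 1 / (2 * (real m + 1))"
    by (rule small_plus_finite_rank [OF kap(2,1), of "1 / (2 * (real m + 1))"]) auto
  have "U.invm m (1 + a)" by (rule neumann_series [OF ah(2,4,6)])
  then obtain w where w: "U.SE w" "corner m (w - 1)" "(1 + a) * w = 1" "w * (1 + a) = 1" "U.SE (1 + a)"
    by (auto simp: U.invm_def)
  have e1: "e * (1 + kap) = e * s" and s1: "(1 + kap) * s = e * s"
    by (simp_all add: kap_def k_def algebra_simps ee ss mult_eq_left [OF ee] mult_eq_left [OF ss])
  have "e * (1 + a) = e * (1 + kap) - e * h" "(1 + a) * s = (1 + kap) * s - h * s"
    by (simp_all add: ah(1) algebra_simps)
  \<comment> \<open>Without the finite rank part h of \<open>kap\<close> the intertwining holds up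
    to a finite rank defect; multiplied by the inverse w, it becomes F.\<close>
  then have ea: "e * (1 + a) = (1 + a) * s + (h * s - e * h)" by (simp add: e1 s1)
  define F where "F = w * (h * s - e * h)"
  have "w * e * (1 + a) = w * ((1 + a) * s + (h * s - e * h))" by (simp only: mult.assoc ea)
  also have "\<dots> = w * (1 + a) * s + F" by (simp only: F_def distrib_left [of w "(1 + a) * s"] mult.assoc)
  finally have e2: "w * e * (1 + a) = s + F" by (simp add: w(4))
  have fr: "EM finite_rank_ops F" unfolding F_def
    by (intro EM_fr_mult_right EM_fr_diff EM_fr_mult_left [OF ah(5)] EM_fr_mult_right [OF ah(5)])
  have ch: "corner m (h * s - e * h)" by (intro corner_diff corner_mult ah cs m)
  have "F = (h * s - e * h) + (w - 1) * (h * s - e * h)" by (simp add: F_def algebra_simps)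
  then have cF: "corner m F" using corner_add [OF ch corner_mult [OF w(2) ch]] by simp
  have ev: "e * (1 + a) * (w * e) = e"
    by (simp add: mult.assoc mult_eq_left [OF w(3)] ee)
  have "e * (1 + a) = e + e * a" "w * e = e + (w - 1) * e" by (simp_all add: algebra_simps)
  then have c: "corner m (e * (1 + a))" "corner m (w * e)"
    using corner_add [OF m corner_mult [OF m ah(2)]] corner_add [OF m corner_mult [OF w(2) m]] by simp_all
  show ?thesis
  proof (rule that [of m F])
    show "U.sim e (emb (sc e) + F)"
      by (rule U.simI [of "e * (1 + a)" "w * e"])
        (use U.MF_I [OF U.SE_mult c(1)] U.MF_I [OF U.SE_mult c(2)] SEe w ev e2 ee in
          \<open>simp_all add: s_def [symmetric] mult.assoc mult_eq_left [OF ee]\<close>)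
    have "w * e * (1 + a) * (w * e * (1 + a)) = w * e * (1 + a)"
      by (simp add: mult.assoc mult_eq_left [OF w(3)] mult_eq_left [OF ee])
    then show "emb (sc e) + F \<in> U.IDEM"
      using U.MF_add [OF emb_MF [OF corner_sc [OF m]] fr_MF [OF cF fr]]
      by (intro U.IDEM_I) (simp_all add: e2 s_def)
  qed (use cF fr cs in \<open>simp_all add: s_def\<close>)
qed

text \<open>Replace e by s + F with s scalar and F of finite rank, and let P be a finite rank
  projection absorbing F. Then s and s + F share the summand s - P s and differ in the finite rank
  idempotents P s and P s + F. Adding the class of P s to that of e therefore gives the class of s
  plus that of P s + F, which explains the stabilizing power on the left.\<close>

lemma V_decomposition:
  assumes v: "v \<in> carrier V"
  shows "\<exists>r a b. v \<otimes>\<^bsub>V\<^esub> U.cls (Q * idm 1) [^]\<^bsub>V\<^esub> (a::nat) = U.cls (idm 1) [^]\<^bsub>V\<^esub> (r::nat) \<otimes>\<^bsub>V\<^esub> U.cls (Q * idm 1) [^]\<^bsub>V\<^esub> (b::nat)"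
proof -
  interpret V: comm_monoid V by (rule U.comm_monoid_V)
  obtain e where e: "e \<in> U.IDEM" "v = U.cls e" using v by (auto simp: U.V_carrier)
  obtain m F where F: "corner m F" "EM finite_rank_ops F" "corner m (emb (sc e) :: 'h cop rfmat)"
    "emb (sc e) + F \<in> U.IDEM" "U.sim e (emb (sc e) + F)"
    by (rule idempotent_finite_rank_perturbation [OF e(1)])
  define s :: "'h cop rfmat" where "s = emb (sc e)"
  have ss: "s * s = s" using cx.IDEM_idem [OF sc_IDEM [OF e(1)]] by (simp add: s_def flip: emb_mult)
  obtain r where "cx.sim (sc e) (idm r)" using complex_idempotent_sim_idm sc_IDEM e by blast
  then have "U.sim s (idm r)" using sim_emb(1) emb_idm s_def by metis
  moreover have "s \<in> U.IDEM" using emb_MF [OF corner_sc] U.IDEM_corner [OF e(1)] ss by (auto intro!: U.IDEM_I simp: s_def)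
  ultimately have cls_s: "U.cls s = U.cls (idm r)" using U.cls_eq_iff idm_IDEM by blast
  have "finite ((\<lambda>(i, j). opr (ent F i j)) ` ({..<m} \<times> {..<m}))"
    "(\<lambda>(i, j). opr (ent F i j)) ` ({..<m} \<times> {..<m}) \<subseteq> finite_rank_ops"
    using F(2) by (auto simp: EM_def)
  then obtain k u where u: "orthn k u"
    "\<And>Y. Y \<in> (\<lambda>(i, j). opr (ent F i j)) ` ({..<m} \<times> {..<m}) \<Longrightarrow> oproj k u o\<^sub>L Y = Y"
    "\<And>Y. Y \<in> (\<lambda>(i, j). opr (ent F i j)) ` ({..<m} \<times> {..<m}) \<Longrightarrow> Y o\<^sub>L oproj k u = Y"
    by (rule finite_rank_corner) blast
  have uF: "oproj k u o\<^sub>L opr (ent F i j) = opr (ent F i j) \<and> opr (ent F i j) o\<^sub>L oproj k u = opr (ent F i j)" for i j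
  proof (cases "i < m \<and> j < m")
    case True
    then show ?thesis using u(2,3) [of "opr (ent F i j)"] by force
  next
    case False
    then show ?thesis using cornerD [OF F(1), of i j] by (auto simp: compose_zero_left compose_zero_right)
  qed
  \<comment> \<open>Acting diagonally, P commutes with the scalar matrix s as well as being absorbed
    by F from both sides; this makes the three summands below idempotent and orthogonal where
    required.\<close>
  define P where "P = dg (Cop (oproj k u))"
  have PF: "P * F = F" "F * P = F"
    by (rule rfmat_eqI, rule cop_eqI; simp add: P_def ent_dg_mult ent_mult_dg opr_Cop uF)+
  have "Cop (oproj k u) * Cop (oproj k u) = Cop (oproj k u)"
    by (rule cop_eqI, rule blinfun_eqI) (simp add: opr_Cop ocomp_span [OF u(1) ocomp_in_span])
  then have PP: "P * P = P" by (simp add: P_def flip: dg_mult)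
  have Ps: "s * P = P * s" by (simp add: P_def s_def dg_emb_commute)
  have frP: "EM finite_rank_ops (P * x)" for x
    unfolding P_def by (intro EM_fr_mult_left EM_dg) (simp_all add: opr_Cop)
  note rw = PF PP Ps ss mult_eq_left [OF PF(1)] mult_eq_left [OF PF(2)] mult_eq_left [OF PP] mult_eq_left [OF Ps] mult_eq_left [OF ss]
  define a1 a2 a3 where "a1 = s - P * s" and "a2 = P * s" and "a3 = P * s + F"
  have cs: "corner m s" using F(3) by (simp add: s_def)
  have c2: "corner m a2" unfolding a2_def P_def by (intro corner_dg_mult cs)
  have MFs: "s \<in> U.MF" "F \<in> U.MF" "a2 \<in> U.MF"
    using \<open>s \<in> U.IDEM\<close> U.IDEM_MF fr_MF [OF F(1,2)] fr_MF [OF c2] frP by (auto simp: a2_def)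
  have sFs: "s * s + s * F + F * s + F * F = s + F"
    using U.IDEM_idem [OF F(4)] by (simp add: s_def [symmetric] algebra_simps)
  have sF: "P * (s * F) = s * F" using Ps PF by (metis mult.assoc)
  have Fs: "F * (s * P) = F * s" by (simp add: Ps mult_eq_left [OF PF(2)])
  have o: "a1 * a2 = 0" "a2 * a1 = 0" "a1 * a3 = 0" "a3 * a1 = 0"
    by (simp_all add: a1_def a2_def a3_def algebra_simps rw sF)
  have I: "a1 \<in> U.IDEM" "a2 \<in> U.IDEM" "a3 \<in> U.IDEM"
  proof -
    show "a1 \<in> U.IDEM" "a2 \<in> U.IDEM"
      using MFs by (auto intro!: U.IDEM_I U.MF_diff simp: a1_def a2_def algebra_simps rw)
    have "a3 * a3 = a3" using sFs by (simp add: a3_def algebra_simps rw sF)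
    then show "a3 \<in> U.IDEM" using U.MF_add MFs by (intro U.IDEM_I) (simp_all add: a2_def a3_def)
  qed
  obtain a where a: "U.cls a2 = U.cls (Q * idm a)"
    by (rule finite_rank_idempotent [OF I(2)]) (simp_all add: a2_def frP)
  have fr3: "EM finite_rank_ops a3" using frP [of s] F(2) by (auto simp: a3_def EM_def intro!: finite_rank_add)
  obtain b where b: "U.cls a3 = U.cls (Q * idm b)" by (rule finite_rank_idempotent [OF I(3) fr3])
  have "U.cls s = U.cls a1 \<otimes>\<^bsub>V\<^esub> U.cls a2" using U.V_mult [OF I(1,2) o(1,2)] by (simp add: a1_def a2_def)
  moreover have "U.cls e = U.cls a1 \<otimes>\<^bsub>V\<^esub> U.cls a3"
    using U.V_mult [OF I(1,3) o(3,4)] F(4,5) U.cls_eq_iff [OF e(1) F(4)] by (simp add: a1_def a3_def s_def)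
  ultimately have "U.cls e \<otimes>\<^bsub>V\<^esub> U.cls a2 = U.cls s \<otimes>\<^bsub>V\<^esub> U.cls a3"
    using U.cls_in_V [OF I(1)] U.cls_in_V [OF I(2)] U.cls_in_V [OF I(3)] by (simp add: V.m_ac)
  then have "v \<otimes>\<^bsub>V\<^esub> U.cls (Q * idm 1) [^]\<^bsub>V\<^esub> a = U.cls (idm 1) [^]\<^bsub>V\<^esub> r \<otimes>\<^bsub>V\<^esub> U.cls (Q * idm 1) [^]\<^bsub>V\<^esub> b"
    unfolding cls_Q_idm_power cls_idm_power using a b cls_s e(2) by simp
  then show ?thesis by blast
qed

end

section \<open>Compact perturbations of the identity and uniqueness of the rank\<close>

lemma dg_scal_commute: "x * dg (scal z) = dg (scal z) * x"
  by (rule rfmat_eqI) (simp add: ent_mult_dg ent_dg_mult scal_commute)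

lemma dg_scal_0: "dg (scal 0) = 0" and dg_scal_1: "dg (scal 1) = 1"
  by (rule rfmat_eqI, simp add: ent_dg scal_0) (simp add: scal_1 dg_1)

context hermitian_tuple
begin

text \<open>The identity (1 + b a)^(-1) = 1 - b (1 + a b)^(-1) a. The middle inverse is represented
  by \<open>emb h\<close>, which inverts 1 + a b only on the range of Q; \<open>Q * a = a\<close>
  and \<open>b * Q = b\<close> confine everything to that range.\<close>

lemma finite_rank_resolvent:
  assumes ab: "a * b = Q * emb c" "Q * a = a" "b * Q = b" and h: "(1 + c) * h = 1" "h * (1 + c) = 1"
  shows "(1 + b * a) * (1 - b * emb h * a) = 1" "(1 - b * emb h * a) * (1 + b * a) = 1"
proof -
  have 1: "emb c * emb h = (1 - emb h :: 'h cop rfmat)"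
    using arg_cong [OF h(1), of "emb :: _ \<Rightarrow> 'h cop rfmat"] by (simp add: emb_mult emb_add emb_1 distrib_right eq_diff_eq add.commute)
  have 2: "emb h * emb c = (1 - emb h :: 'h cop rfmat)"
    using arg_cong [OF h(2), of "emb :: _ \<Rightarrow> 'h cop rfmat"] by (simp add: emb_mult emb_add emb_1 distrib_left eq_diff_eq add.commute)
  have "b * a * (b * emb h * a) = b * Q * (emb c * emb h) * a"
    by (simp add: mult.assoc mult_eq_left [OF ab(1)])
  also have "\<dots> = b * a - b * emb h * a" by (simp add: 1 ab algebra_simps)
  finally show "(1 + b * a) * (1 - b * emb h * a) = 1" by (simp add: algebra_simps)
  have "b * emb h * a * (b * a) = b * (emb h * emb c) * (Q * a)"
    by (simp add: mult.assoc mult_eq_left [OF ab(1)] mult_eq_left [OF Q_emb])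
  also have "\<dots> = b * a - b * emb h * a" by (simp add: 2 ab algebra_simps)
  finally show "(1 - b * emb h * a) * (1 + b * a) = 1" by (simp add: algebra_simps)
qed

text \<open>By the resolvent identity \<open>1 + b a\<close> is invertible as soon as \<open>1 + a b\<close> is, and the latter is a complex
  matrix.\<close>

lemma left_inverse_right_inverse:
  assumes k: "corner m k" "EM KE k" and Z: "Z * (1 + k) = 1"
  shows "(1 + k) * Z = 1"
proof -
  obtain a0 h0 where ah: "k = a0 + h0" "corner m a0" "corner m h0" "EM KE a0" "EM finite_rank_ops h0"
    "\<And>i j. norm (opr (ent a0 i j)) \<le> 1 / (2 * (real m + 1))"
    by (rule small_plus_finite_rank [OF k, of "1 / (2 * (real m + 1))"]) auto
  have "U.invm m (1 + a0)" by (rule neumann_series [OF ah(2,4,6)])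
  then obtain w where w: "corner m (w - 1)" "(1 + a0) * w = 1" "w * (1 + a0) = 1"
    by (auto simp: U.invm_def)
  define F where "F = w * h0"
  have "F = h0 + (w - 1) * h0" by (simp add: F_def algebra_simps)
  then have cF: "corner m F" using corner_add [OF ah(3) corner_mult [OF w(1) ah(3)]] by simp
  have fF: "EM finite_rank_ops F" unfolding F_def by (rule EM_fr_mult_right [OF ah(5)])
  have kF: "1 + k = (1 + a0) * (1 + F)"
    by (simp add: F_def distrib_left [of "1 + a0"] mult_eq_left [OF w(2)] ah(1))
  define L where "L = Z * (1 + a0)"
  have LF: "L * (1 + F) = 1" using Z by (simp add: L_def kF mult.assoc)
  obtain d a b where ab: "F = b * a" "corner d a" "corner d b" "Q * a = a" "b * Q = b"
    by (rule finite_rank_factor [OF cF fF])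
  obtain c where c: "corner d c" "a * b = Q * emb c"
    by (rule Q_compress [of d "a * b"]) (use ab in \<open>simp_all add: corner_mult mult.assoc mult_eq_left [OF ab(4)]\<close>)
  obtain l where l: "corner d l" "a * L * b = Q * emb l"
    by (rule Q_compress [of d "a * L * b"]) (rule corner_mult3 [OF ab(2,3)], simp_all add: mult.assoc mult_eq_left [OF ab(4)] ab(5))
  \<comment> \<open>Compressing the left inverse L of \<open>1 + b * a\<close> by a and b yields a
    left inverse \<open>1 - l\<close> of the finite complex matrix \<open>1 + c\<close>, where left
    inverses are inverses.\<close>
  have "L = 1 - L * (b * a)" using LF by (simp add: ab(1) distrib_left eq_diff_eq)
  then have "a * L * b = a * (1 - L * (b * a)) * b" by simp
  also have "\<dots> = a * b - a * L * b * (a * b)" by (simp add: algebra_simps)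
  finally have "Q * emb l = Q * emb (c - l * c)"
    by (simp add: l(2) c(2) Q_emb_mult emb_diff right_diff_distrib)
  then have "l = c - l * c" by (rule Q_emb_inj)
  then have "(1 - l) * (1 + c) = 1" by (simp add: algebra_simps)
  moreover from this have "(1 + c) * (1 - l) = 1"
    using l(1) c(1) corner_diff [OF corner_0 l(1)] by (intro complex_left_inverse [of d "1 - l" "1 + c"]) simp_all
  ultimately obtain v where v: "(1 + F) * v = 1"
    using finite_rank_resolvent(1) [OF c(2) ab(4,5)] ab(1) by blast
  have kv: "(1 + k) * (v * w) = 1"
    by (simp add: kF mult.assoc mult_eq_left [OF v] w(2))
  have "Z = Z * ((1 + k) * (v * w))" by (simp add: kv)
  also have "\<dots> = v * w" by (simp add: mult_eq_left [OF Z])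
  finally show ?thesis using kv by simp
qed

lemma sc_idm: "sc (idm r) = idm r"
  using sc_emb [of "idm r"] by (simp only: emb_idm)

lemma idm_mult_idm: "r \<le> k \<Longrightarrow> idm r * idm k = idm r" "r \<le> k \<Longrightarrow> idm k * idm r = idm r"
  by (auto intro!: mult_idm idm_mult intro: corner_mono [OF corner_idm])

text \<open>A similarity of \<open>e\<close> and \<open>f\<close> can be corrected to one whose scalar part is \<open>idm r\<close>. With \<open>e \<le> f\<close> it
  extends by \<open>1 - f\<close> to a compact perturbation of the identity with left inverse, whose range projection
  is \<open>1 - (f - e)\<close>.\<close>

lemma sim_imp_eq:
  assumes sim: "U.sim (idm r + shifted r (Q * idm b)) (idm r + shifted r (Q * idm b'))" and le: "b \<le> b'"
  shows "b = b'"
proof -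
  \<comment> \<open>Written with nested identities, the two idempotents satisfy
    \<open>e * f = e = f * e\<close>; this is where \<open>b \<le> b'\<close> enters.\<close>
  define A B C :: "'h cop rfmat" where "A = idm r" and "B = idm (r + b)" and "C = idm (r + b')"
  define e f where "e = A + Q * (B - A)" and "f = A + Q * (C - A)"
  have sh: "idm r + shifted r (Q * idm k) = idm r + Q * (idm (r + k) - idm r)" for k
    unfolding Q_def shifted_dg idm_shifted [of r k] by simp
  have "idm r + Q * (idm (r + k) - idm r) \<in> U.IDEM" for k
    by (subst sh [symmetric]) (rule U.V_mult'(2) [OF idm_IDEM Q_idm_IDEM corner_idm])
  then have ef: "e \<in> U.IDEM" "f \<in> U.IDEM" "U.sim e f"
    using sim by (simp_all add: e_def f_def A_def B_def C_def sh)
  have AQ: "A * Q = Q * A" "B * Q = Q * B" "C * Q = Q * C"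
    using Q_emb [symmetric] by (simp_all add: A_def B_def C_def flip: emb_idm)
  have AB: "A * A = A" "A * B = A" "B * A = A" "A * C = A" "C * A = A" "B * C = B" "C * B = B" "B * B = B" "C * C = C"
    using le by (simp_all add: A_def B_def C_def idm_mult_idm)
  note rw = Q_Q AQ AB mult_eq_left [OF Q_Q] mult_eq_left [OF AQ(1)] mult_eq_left [OF AQ(2)] mult_eq_left [OF AQ(3)]
    mult_eq_left [OF AB(1)] mult_eq_left [OF AB(2)] mult_eq_left [OF AB(3)] mult_eq_left [OF AB(4)] mult_eq_left [OF AB(5)]
    mult_eq_left [OF AB(6)] mult_eq_left [OF AB(7)]
  have prods: "e * f = e" "f * e = e" "f * f = f" by (simp_all add: e_def f_def algebra_simps rw)
  obtain x y where xy: "x \<in> U.MF" "y \<in> U.MF" "x * y = e" "y * x = f" "e * x = x" "x * f = x" "f * y = y" "y * e = y"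
    by (rule U.sim_normal [OF ef(3,1,2)])
  have SE: "U.SE x" "U.SE y" "U.SE e" "U.SE f" using xy ef U.IDEM_MF U.MF_SE by blast+
  define X Y where "X = sc x" and "Y = sc y"
  have scA: "sc A = idm r" by (simp add: A_def sc_idm)
  have scQ: "sc (A + Q * z) = idm r" for z
    using sc_add [of A "Q * z"] SE_emb [of "idm r"] SE_KE [OF EM_fr_KE [OF Q_fr]] sc_KE [OF EM_fr_KE [OF Q_fr]]
    by (simp add: sc_idm emb_idm A_def)
  have XY: "X * Y = idm r" "Y * X = idm r" "idm r * X = X" "X * idm r = X" "idm r * Y = Y" "Y * idm r = Y"
    using sc_mult [OF SE(1,2)] sc_mult [OF SE(2,1)] sc_mult [OF SE(3,1)] sc_mult [OF SE(1,4)] sc_mult [OF SE(4,2)] sc_mult [OF SE(2,3)]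
    by (simp_all add: xy X_def Y_def) (simp_all add: e_def f_def scQ)
  \<comment> \<open>On the scalar block M is the inverse Y of the scalar part of x, on the rest of f
    it is the identity. So \<open>x * M\<close> still implements the equivalence of e and f, now
    with scalar part \<open>idm r\<close>.\<close>
  define M N where "M = emb Y + Q * (C - A)" and "N = emb X + Q * (C - A)"
  have eXY: "emb X * emb Y = A" "emb Y * emb X = A" "A * emb X = emb X" "emb X * A = emb X" "A * emb Y = emb Y" "emb Y * A = emb Y"
    by (simp_all add: A_def XY flip: emb_mult emb_idm)
  have CX: "C * emb X = emb X" "emb X * C = emb X" "C * emb Y = emb Y" "emb Y * C = emb Y"
    using eXY AB by (metis mult.assoc)+
  note rw2 = rw eXY CX Q_emb [symmetric] mult_eq_left [OF Q_emb [symmetric]] mult_eq_left [OF eXY(1)] mult_eq_left [OF eXY(2)]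
  have MN: "M * N = f" "N * M = f" "f * M = M" "M * f = M" "f * N = N" "N * f = N"
    by (simp_all add: M_def N_def f_def algebra_simps rw2)
  define x' y' where "x' = x * M" and "y' = N * y"
  have xy': "x' * y' = e" "y' * x' = f" "e * x' = x'" "x' * f = x'" "f * y' = y'" "y' * e = y'"
  proof -
    show "x' * y' = e" by (simp add: x'_def y'_def mult.assoc mult_eq_left [OF MN(1)] xy)
    show "y' * x' = f" by (simp add: x'_def y'_def mult.assoc mult_eq_left [OF xy(4)] MN)
    show "e * x' = x'" by (simp add: x'_def mult_eq_left [OF xy(5)])
    show "x' * f = x'" by (simp add: x'_def mult.assoc MN)
    show "f * y' = y'" by (simp add: y'_def mult_eq_left [OF MN(5)])
    show "y' * e = y'" by (simp add: y'_def mult.assoc xy)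
  qed
  have fx: "f * x' = x'" using xy'(3) prods(2) by (metis mult.assoc)
  have yf: "y' * f = y'" using xy'(6) prods(1) by (metis mult.assoc)
  define k where "k = x' - f"
  have ZW: "(y' + (1 - f)) * (1 + k) = 1" by (simp add: k_def algebra_simps xy' fx yf prods)
  obtain m where m: "corner m y" "corner m x" using U.MF_corner2 [OF xy(2,1)] by blast
  have "corner m Y" using m by (simp add: Y_def corner_sc)
  then have "emb Y \<in> U.MF" by (rule emb_MF)
  moreover have "Q * (C - A) \<in> U.MF"
    by (rule fr_MF [OF corner_Q Q_fr, of "r + b'"])
      (auto simp: C_def A_def intro!: corner_diff corner_idm intro: corner_mono [OF corner_idm])
  ultimately have MMF: "M \<in> U.MF" unfolding M_def by (rule U.MF_add)
  then have kMF: "k \<in> U.MF" unfolding k_def x'_def by (intro U.MF_diff U.MF_mult [OF xy(1)] U.IDEM_MF [OF ef(2)])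
  then obtain m' where m': "corner m' k" by (auto simp: U.MF_def)
  have "sc M = Y"
    unfolding M_def using sc_add [OF SE_emb SE_KE [OF EM_fr_KE [OF Q_fr]]] by (simp add: sc_emb sc_KE [OF EM_fr_KE [OF Q_fr]])
  then have "sc x' = idm r" unfolding x'_def using sc_mult [OF SE(1) U.MF_SE [OF MMF]] XY by (simp add: X_def)
  moreover have "sc f = idm r" by (simp add: f_def scQ)
  moreover have "sc x' = sc (k + f)" by (simp add: k_def)
  ultimately have "sc k = 0" using sc_add [OF U.MF_SE [OF kMF] SE(4)] by simp
  then have kKE: "EM KE k" by (rule SE_sc_0 [OF U.MF_SE [OF kMF]])
  have "(1 + k) * (y' + (1 - f)) = 1" by (rule left_inverse_right_inverse [OF m' kKE ZW])
  then have "e + 1 - f = 1" by (simp add: k_def algebra_simps xy' fx yf prods)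
  then have "e = f" by (simp add: algebra_simps)
  then have "Q * emb (idm (r + b)) = Q * emb (idm (r + b'))"
    by (simp add: e_def f_def B_def C_def emb_idm right_diff_distrib)
  then have eq: "idm (r + b) = (idm (r + b') :: complex rfmat)" by (rule Q_emb_inj)
  show "b = b'"
    using arg_cong [OF eq, of "\<lambda>m. ent m (r + b) (r + b)"] le by (auto simp: ent_idm split: if_splits)
qed

section \<open>The character on classes of idempotents and the kernel\<close>

lemma sc_sim: "U.sim e f \<Longrightarrow> cx.sim (sc e) (sc f)"
proof -
  assume "U.sim e f"
  then obtain x y where xy: "x \<in> U.MF" "y \<in> U.MF" "x * y = e" "y * x = f" by (auto simp: U.sim_def)
  then have "sc x \<in> cx.MF" "sc y \<in> cx.MF" by (auto simp: U.MF_def cx_MF dest: corner_sc)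
  then show ?thesis
    using xy sc_mult U.MF_SE by (intro cx.simI [of "sc x" "sc y"]) auto
qed

lemma V_map_cls: assumes e: "e \<in> U.IDEM" shows "V_map complex_alg fst (U.cls e) = cx.cls (sc e)"
proof -
  have "idem_equiv complex_alg `` {\<lambda>i j. fst (x i j)} = cx.cls (sc e)" if x: "x \<in> U.cls e" for x
  proof -
    let ?y = "\<lambda>i j. fst (x i j)"
    have x': "U.rowfin x" "U.rmat x \<in> U.IDEM" "U.sim e (U.rmat x)" using x by (auto simp: U.cls_def)
    have "{k. ?y i k \<noteq> 0} \<subseteq> {k. x i k \<noteq> \<zero>\<^bsub>Kp\<^esub>}" for i by auto
    then have "finite {k. ?y i k \<noteq> 0}" for i
      using x'(1) unfolding U.rowfin_def by (metis (no_types, lifting) finite_subset)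
    then have y: "cx.rowfin ?y" by (simp add: cx.rowfin_def) (simp add: complex_alg_def)
    have "cx.rmat ?y = sc (U.rmat x)"
    proof (rule rfmat_eqI)
      fix i j
      have "x i j \<in> carrier Kp" using x'(1) by (simp add: U.rowfin_def)
      then have "scp (iota (x i j)) = fst (x i j)" using scp_iota [of "snd (x i j)" "fst (x i j)"] by (simp add: mem_Times_iff)
      then show "ent (cx.rmat ?y) i j = ent (sc (U.rmat x)) i j"
        by (simp add: cx.ent_rmat [OF y] ent_sc U.ent_rmat [OF x'(1)])
    qed
    moreover have "cx.cls (sc (U.rmat x)) = cx.cls (sc e)"
      using cx.cls_eq_iff sc_IDEM sc_sim x' e cx.sim_sym by metis
    ultimately show ?thesis
      using cx.idem_equiv_image [of ?y] y sc_IDEM [OF x'(2)] by (simp add: cx.idempotents_iff)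
  qed
  moreover have "U.unr e \<in> U.cls e" by (rule U.unr_cls [OF e e U.sim_refl [OF e]])
  ultimately show ?thesis unfolding V_map_def by auto
qed

text \<open>Here u is the class of the unit of the unitization, detected by the trace of the scalar
  part, and q is the class of a rank one projection on H, which the character sends to zero. The
  generator of the kernel is q.\<close>

theorem K0_integers: "K0 (K_alg n T) \<cong> integer_group"
  unfolding K0_def K0_unital_def
proof (rule groth_kernel_iso_integers [where t = V_tr and u = "U.cls (idm 1)" and q = "U.cls (Q * idm 1)"])
  show "comm_monoid V" "comm_monoid (V_monoid complex_alg)" by (rule U.comm_monoid_V, rule cx.comm_monoid_V)
  show "V_map complex_alg fst x \<in> carrier (V_monoid complex_alg)" if x: "x \<in> carrier V" for x
    using that by (auto simp: U.V_carrier V_map_cls cx.V_carrier sc_IDEM)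
  show "V_map complex_alg fst (x \<otimes>\<^bsub>V\<^esub> y) = V_map complex_alg fst x \<otimes>\<^bsub>V_monoid complex_alg\<^esub> V_map complex_alg fst y"
    if xy: "x \<in> carrier V" "y \<in> carrier V" for x y
  proof -
    obtain e f where ef: "e \<in> U.IDEM" "f \<in> U.IDEM" "x = U.cls e" "y = U.cls f" using xy by (auto simp: U.V_carrier)
    obtain k where k: "corner k e" using U.IDEM_corner [OF ef(1)] by blast
    have "sc (shifted k f) = shifted k (sc f)" by (rule rfmat_eqI) (simp add: ent_sc ent_shifted scp_0)
    then have "sc (e + shifted k f) = sc e + shifted k (sc f)"
      using sc_add [of e "shifted k f"] U.SE_shifted U.MF_SE U.IDEM_MF ef by simp
    then show ?thesis
      using U.V_mult' [OF ef(1,2) k] cx.V_mult' [OF sc_IDEM sc_IDEM corner_sc, OF ef(1,2) k] ef by (simp add: V_map_cls)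
  qed
  have sc0: "sc (0 :: 'h cop rfmat) = 0" by (rule rfmat_eqI) (simp add: ent_sc scp_0)
  show "V_map complex_alg fst \<one>\<^bsub>V\<^esub> = \<one>\<^bsub>V_monoid complex_alg\<^esub>"
    by (simp add: U.V_one cx.V_one V_map_cls U.IDEM_0 sc0)
  show "V_tr (x \<otimes>\<^bsub>V_monoid complex_alg\<^esub> y) = V_tr x + V_tr y"
    if "x \<in> carrier (V_monoid complex_alg)" "y \<in> carrier (V_monoid complex_alg)" for x y
    by (rule V_tr_mult [OF that])
  show "U.cls (idm 1) \<in> carrier V" "U.cls (Q * idm 1) \<in> carrier V"
    using U.cls_in_V idm_IDEM Q_idm_IDEM by blast+
  have "(idm 1 :: complex rfmat) \<in> cx.IDEM" using corner_idm by (intro cx.IDEM_I) (auto simp: cx_MF idm_idm)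
  moreover have "tr (idm 1) = 1" using tr_corner [OF corner_idm, of 1] by (simp add: ent_idm)
  ultimately show "V_tr (V_map complex_alg fst (U.cls (idm 1))) = 1"
    using V_map_cls [OF idm_IDEM, of 1] by (simp only: V_tr_cls sc_idm)
  show "V_map complex_alg fst (U.cls (Q * idm 1)) = \<one>\<^bsub>V_monoid complex_alg\<^esub>"
    by (simp only: V_map_cls [OF Q_idm_IDEM] cx.V_one sc_KE [OF EM_fr_KE [OF Q_fr]])
  show "\<exists>r a b. v \<otimes>\<^bsub>V\<^esub> U.cls (Q * idm 1) [^]\<^bsub>V\<^esub> (a::nat) = U.cls (idm 1) [^]\<^bsub>V\<^esub> (r::nat) \<otimes>\<^bsub>V\<^esub> U.cls (Q * idm 1) [^]\<^bsub>V\<^esub> (b::nat)"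
    if "v \<in> carrier V" for v by (rule V_decomposition [OF that])
  fix r b b' :: nat
  assume eq: "U.cls (idm 1) [^]\<^bsub>V\<^esub> r \<otimes>\<^bsub>V\<^esub> U.cls (Q * idm 1) [^]\<^bsub>V\<^esub> b = U.cls (idm 1) [^]\<^bsub>V\<^esub> r \<otimes>\<^bsub>V\<^esub> U.cls (Q * idm 1) [^]\<^bsub>V\<^esub> b'"
  have D: "idm r + shifted r (Q * idm k) \<in> U.IDEM" for k by (rule U.V_mult'(2) [OF idm_IDEM Q_idm_IDEM corner_idm])
  have "U.cls (idm r + shifted r (Q * idm b)) = U.cls (idm r + shifted r (Q * idm b'))"
    using eq U.V_mult'(1) [OF idm_IDEM Q_idm_IDEM corner_idm] by (simp only: cls_idm_power cls_Q_idm_power)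
  then have s: "U.sim (idm r + shifted r (Q * idm b)) (idm r + shifted r (Q * idm b'))"
    using U.cls_eq_iff [OF D D] by blast
  show "b = b'"
    \<comment> \<open>\<open>sim_imp_eq\<close> compares the two exponents under an ordering
      assumption; the symmetric equivalence covers the other order.\<close>
    using sim_imp_eq [OF s] sim_imp_eq [OF U.sim_sym [OF s]] by linarith
qed

section \<open>The group \<open>K\<^sub>1\<close>\<close>

lemma Kp_metric: "Metric_space (carrier Kp) (alg_dist Kp)"
  and Kp_dist: "p \<in> carrier Kp \<Longrightarrow> q \<in> carrier Kp \<Longrightarrow> alg_dist Kp p q = cmod (fst p - fst q) + Enorm (snd p - snd q)"
proof -
  have add: "add Kp = (+)" by (intro ext) (auto simp: unitization_def)
  have zero: "\<zero>\<^bsub>Kp\<^esub> = 0" by (simp add: zero_prod_def)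
  have norm: "anorm Kp x = cmod (fst x) + Enorm (snd x)" for x by (cases x) simp
  have tri: "cmod (a + b) + Enorm (X + Y) \<le> (cmod a + Enorm X) + (cmod b + Enorm Y)" if "X \<in> KE" "Y \<in> KE" for a b X Y
    using norm_triangle_ineq [of a b] Enorm_add [OF KE_E KE_E, OF that] by linarith
  show "Metric_space (carrier Kp) (alg_dist Kp)"
    by (rule metric_space_concrete [OF add zero])
      (auto simp: norm KE_minus KE_add Enorm_nonneg KE_E Enorm_eq_0 Enorm_minus tri add_nonneg_eq_0_iff zero_prod_def)
  show "p \<in> carrier Kp \<Longrightarrow> q \<in> carrier Kp \<Longrightarrow> alg_dist Kp p q = cmod (fst p - fst q) + Enorm (snd p - snd q)"
    by (subst alg_dist_concrete [OF add zero]) (auto simp: KE_minus norm)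
qed

definition GL_dist :: "nat \<Rightarrow> (nat \<Rightarrow> nat \<Rightarrow> complex \<times> ('h \<Rightarrow>\<^sub>L 'h)) \<Rightarrow> (nat \<Rightarrow> nat \<Rightarrow> complex \<times> ('h \<Rightarrow>\<^sub>L 'h)) \<Rightarrow> real" where
  "GL_dist k g h = (\<Sum>i<k. \<Sum>j<k. alg_dist Kp (g i j) (h i j))"

lemma GL_metric: "Metric_space (GL_n Kp k) (GL_dist k)"
proof -
  interpret K: Metric_space "carrier Kp" "alg_dist Kp" by (rule Kp_metric)
  have G: "g i j \<in> carrier Kp" if "g \<in> GL_n Kp k" for g i j using that by (simp add: GL_n_def stable_mats_def)
  show ?thesis
  proof
    show "0 \<le> GL_dist k g h" for g h unfolding GL_dist_def by (intro sum_nonneg K.nonneg)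
    show "GL_dist k g h = GL_dist k h g" for g h unfolding GL_dist_def using K.commute by (intro sum.cong refl) auto
    show "GL_dist k f h \<le> GL_dist k f g + GL_dist k g h" if "f \<in> GL_n Kp k" "g \<in> GL_n Kp k" "h \<in> GL_n Kp k" for f g h
      unfolding GL_dist_def sum.distrib [symmetric] by (intro sum_mono K.triangle G that)
    show "GL_dist k g h = 0 \<longleftrightarrow> g = h" if gh: "g \<in> GL_n Kp k" "h \<in> GL_n Kp k" for g h
    proof
      assume "GL_dist k g h = 0"
      then have "\<forall>i<k. \<forall>j<k. alg_dist Kp (g i j) (h i j) = 0"
        unfolding GL_dist_def by (simp add: sum_nonneg_eq_0_iff sum_nonneg)
      then have "g i j = h i j" if "i < k" "j < k" for i j
        using K.zero [OF G [OF gh(1)] G [OF gh(2)]] that by blast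
      moreover have "f i j = inf_mat_one Kp i j" if "f \<in> GL_n Kp k" "k \<le> i \<or> k \<le> j" for f i j
        using that unfolding GL_n_def stable_mats_def by blast
      then have "g i j = h i j" if "k \<le> i \<or> k \<le> j" for i j using gh that by metis
      ultimately show "g = h" by (intro ext) (meson not_le)
    next
      assume "g = h"
      then show "GL_dist k g h = 0" unfolding GL_dist_def using K.mdist_zero [OF G [OF gh(1)]] by simp
    qed
  qed
qed

text \<open>By uniqueness of scalar parts, an operator identity between entries splits into one for
  scalars and one for compact parts, each homogeneous in z. Affine families are thereby Lipschitz in
  their parameter.\<close>

lemma Kp_dist_unr:
  assumes m: "U.SE a" "U.SE b" "U.SE c" and eq: "a - b = dg (scal z) * c"
  shows "alg_dist Kp (U.unr a i j) (U.unr b i j) \<le> cmod z * (cmod (fst (U.unr c i j)) + Enorm (snd (U.unr c i j)))"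
proof -
  obtain p X where p: "U.unr a i j = (p, X)" by (metis surj_pair)
  obtain q Y where q: "U.unr b i j = (q, Y)" by (metis surj_pair)
  obtain r W where r: "U.unr c i j = (r, W)" by (metis surj_pair)
  have KE: "X \<in> KE" "Y \<in> KE" "W \<in> KE"
    using U.ent_unr(1) [OF m(1), of i j] U.ent_unr(1) [OF m(2), of i j] U.ent_unr(1) [OF m(3), of i j] by (simp_all add: p q r)
  have "opr (iota (p, X)) - opr (iota (q, Y)) = opr (scal z * iota (r, W))"
    using U.ent_unr(2) [OF m(1), of i j] U.ent_unr(2) [OF m(2), of i j] U.ent_unr(2) [OF m(3), of i j]
      arg_cong [OF eq, of "\<lambda>m. opr (ent m i j)"] by (simp add: p q r ent_dg_mult)
  then have "scaleO (p - q) id_blinfun + (X - Y) = scaleO (z * r) id_blinfun + scaleO z W"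
    using KE_compact [OF KE(3)]
    by (simp add: opr_iota KE scaleO_diff_left scaleO_compose_left compose_algebra scaleO_scaleO id_compose)
      (simp add: algebra_simps scaleO_add_right scaleO_scaleO)
  moreover from this have "p - q = z * r"
    using scalar_part_unique compact_ops_diff compact_ops_scaleO KE_compact KE by metis
  ultimately have "p - q = z * r" "X - Y = scaleO z W" by simp_all
  then show ?thesis
    using U.ent_unr(1) [OF m(1), of i j] U.ent_unr(1) [OF m(2), of i j] Enorm_scaleO_le [OF KE_E [OF KE(3)], of z]
    by (simp add: Kp_dist p q r norm_mult distrib_left)
qed

text \<open>\<open>GL_topology\<close> measures entries, and an affine family is Lipschitz in the
  parameter with the constant \<open>D\<close> read off from B. So a continuous choice of parameters
  with invertible values is a path of matrices.\<close>

lemma GL_path: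
  assumes g: "path \<gamma>" "\<And>t. t \<in> {0..1} \<Longrightarrow> U.invm k (A + dg (scal (\<gamma> t)) * B)" and B: "U.SE B"
  shows "path_component_of (GL_topology Kp k) (U.unr (A + dg (scal (pathstart \<gamma>)) * B)) (U.unr (A + dg (scal (pathfinish \<gamma>)) * B))"
proof -
  interpret G: Metric_space "GL_n Kp k" "GL_dist k" by (rule GL_metric)
  have top: "GL_topology Kp k = G.mtopology" unfolding GL_topology_def GL_dist_def [abs_def] ..
  define m where "m = (\<lambda>t. A + dg (scal (\<gamma> t)) * B)"
  have SEm: "U.SE (m t)" if "t \<in> {0..1}" for t using g(2) [OF that] by (simp add: U.invm_def m_def)
  have GLm: "U.unr (m t) \<in> GL_n Kp k" if "t \<in> {0..1}" for t
    using g(2) [OF that] SEm [OF that] U.rowfin_unr U.rmat_unr by (simp add: U.GL_n_iff m_def)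
  define D where "D = (\<Sum>i<k. \<Sum>j<k. cmod (fst (U.unr B i j)) + Enorm (snd (U.unr B i j)))"
  have dist: "GL_dist k (U.unr (m s)) (U.unr (m t)) \<le> cmod (\<gamma> s - \<gamma> t) * D" if "s \<in> {0..1}" "t \<in> {0..1}" for s t
  proof -
    have "dg (scal (\<gamma> s)) - dg (scal (\<gamma> t)) = (dg (scal (\<gamma> s - \<gamma> t)) :: 'h cop rfmat)"
      by (rule rfmat_eqI, rule cop_eqI) (simp add: ent_dg scaleO_diff_left)
    then have "m s - m t = dg (scal (\<gamma> s - \<gamma> t)) * B"
      by (simp add: m_def flip: left_diff_distrib)
    then show ?thesis
      unfolding GL_dist_def D_def sum_distrib_left by (intro sum_mono Kp_dist_unr SEm that B)
  qed
  have "pathin G.mtopology (\<lambda>t. U.unr (m t))"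
    unfolding pathin_def G.continuous_map_to_metric
  proof (intro ballI allI impI)
    fix t and \<epsilon> :: real assume t: "t \<in> topspace (top_of_set {0..1::real})" and \<epsilon>: "\<epsilon> > 0"
    define d where "d = \<epsilon> / (\<bar>D\<bar> + 1)"
    have d: "d > 0" using \<epsilon> by (simp add: d_def)
    show "\<exists>U'. openin (top_of_set {0..1}) U' \<and> t \<in> U' \<and> (\<forall>s\<in>U'. U.unr (m s) \<in> G.mball (U.unr (m t)) \<epsilon>)"
    proof (intro exI conjI ballI)
      show "openin (top_of_set {0..1}) ({0..1} \<inter> \<gamma> -` ball (\<gamma> t) d)"
        using g(1) by (intro continuous_openin_preimage_gen) (simp_all add: path_def)
      show "t \<in> {0..1} \<inter> \<gamma> -` ball (\<gamma> t) d" using t d by simp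
      fix s assume s: "s \<in> {0..1} \<inter> \<gamma> -` ball (\<gamma> t) d"
      have "GL_dist k (U.unr (m t)) (U.unr (m s)) \<le> cmod (\<gamma> t - \<gamma> s) * D" using t s by (intro dist) auto
      also have "\<dots> \<le> cmod (\<gamma> t - \<gamma> s) * (\<bar>D\<bar> + 1)" by (intro mult_left_mono) auto
      also have "\<dots> < d * (\<bar>D\<bar> + 1)" using s by (intro mult_strict_right_mono) (auto simp: dist_norm)
      also have "\<dots> = \<epsilon>" by (simp add: d_def)
      finally show "U.unr (m s) \<in> G.mball (U.unr (m t)) \<epsilon>" using t s GLm by (simp add: G.in_mball)
    qed
  qed
  then show ?thesis
    unfolding path_component_of_def top by (intro exI [of _ "\<lambda>t. U.unr (m t)"]) (simp add: m_def pathstart_def pathfinish_def)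
qed

text \<open>The invertible values of an affine family with finitely many singular parameters are connected,
  since the complement of a finite set in the plane is.\<close>

lemma GL_path_finite:
  assumes fin: "finite {z. \<not> U.invm k (A + dg (scal z) * B)}" and B: "U.SE B"
    and ends: "U.invm k A" "U.invm k (A + B)"
  shows "path_component_of (GL_topology Kp k) (U.unr A) (U.unr (A + B))"
proof -

  have "path_connected (- {z. \<not> U.invm k (A + dg (scal z) * B)})"
    using fin by (intro path_connected_complement_countable) (simp_all add: countable_finite)
  moreover have "0 \<in> - {z. \<not> U.invm k (A + dg (scal z) * B)}" "1 \<in> - {z. \<not> U.invm k (A + dg (scal z) * B)}"
    using ends by (simp_all add: dg_scal_0 dg_scal_1)
  ultimately obtain \<gamma> where \<gamma>: "path \<gamma>" "path_image \<gamma> \<subseteq> - {z. \<not> U.invm k (A + dg (scal z) * B)}"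
    "pathstart \<gamma> = 0" "pathfinish \<gamma> = 1"
    unfolding path_connected_def by blast
  have "U.invm k (A + dg (scal (\<gamma> t)) * B)" if "t \<in> {0..1}" for t
    using \<gamma>(2) that unfolding path_image_def by blast
  then show ?thesis using GL_path [OF \<gamma>(1) _ B] \<gamma>(3,4) by (simp add: dg_scal_0 dg_scal_1)
qed

text \<open>Scaling F may be done in the factor a alone, and then \<open>a' * b\<close> is the copy
  of z c. Hence 1 + z F is invertible whenever the complex matrix 1 + z c is.\<close>

lemma finite_rank_singular_values:
  assumes F: "corner k F" "EM finite_rank_ops F"
  shows "finite {z. \<not> U.invm k (1 + dg (scal z) * F)}"
proof -
  obtain d a b where ab: "F = b * a" "corner d a" "corner d b" "Q * a = a" "b * Q = b"
    by (rule finite_rank_factor [OF F])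
  obtain c where c: "corner d c" "a * b = Q * emb c"
    by (rule Q_compress [of d "a * b"]) (use ab in \<open>simp_all add: corner_mult mult.assoc mult_eq_left [OF ab(4)]\<close>)
  have dg_emb: "dg (scal z) = (emb (dg z) :: 'h cop rfmat)" for z
    by (rule rfmat_eqI) (simp add: ent_emb ent_dg scal_0)
  show ?thesis
  proof (rule finite_subset [OF _ finite_singular_values [OF c(1)]], rule subsetI, rule ccontr)
    fix z assume z: "z \<in> {z. \<not> U.invm k (1 + dg (scal z) * F)}"
      and "z \<notin> {z. \<not> (\<exists>h. corner d (h - 1) \<and> (1 + dg z * c) * h = 1 \<and> h * (1 + dg z * c) = 1)}"
    then obtain h where h: "(1 + dg z * c) * h = 1" "h * (1 + dg z * c) = 1" by blast
    define a' where "a' = dg (scal z) * a"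
    have "a' * b = Q * emb (dg z * c)" "Q * a' = a'" "b * a' = dg (scal z) * F"
      using c(2) ab(1,4) by (simp_all add: a'_def mult.assoc emb_mult mult_eq_left [OF dg_scal_commute] flip: dg_emb)
    then have "U.invm k (1 + dg (scal z) * F)"
      using finite_rank_resolvent [OF _ _ ab(5) h, of a'] F
      by (intro invmI) (auto intro!: corner_dg_mult EM_fr_KE EM_fr_mult_right)
    then show False using z by simp
  qed
qed

text \<open>Taking scalar parts is multiplicative and so preserves invertibility. The path runs
  through complex matrices 1 + z (s - 1), with s the scalar part, which are singular for finitely
  many z.\<close>

lemma invm_scalar_part:
  assumes W: "U.invm k W"
  shows "U.invm k (emb (sc W))" "path_component_of (GL_topology Kp k) (U.unr 1) (U.unr (emb (sc W)))"
proof -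
  obtain V where V: "U.SE W" "corner k (W - 1)" "U.SE V" "corner k (V - 1)" "W * V = 1" "V * W = 1"
    using W by (auto simp: U.invm_def)
  have sc1: "sc (1 :: 'h cop rfmat) = 1" using sc_emb [of 1] by (simp add: emb_1)
  have scd: "corner k (sc M - 1)" if "corner k (M - 1)" "U.SE M" for M
  proof -
    have "sc M = sc (M - 1) + 1"
      using sc_add [OF U.SE_diff [OF that(2) U.SE_1] U.SE_1] by (simp add: sc1)
    then show ?thesis using corner_sc [OF that(1)] by simp
  qed
  have invm: "U.invm k (emb s)" if s: "corner k (s - 1)" "corner k (h - 1)" "s * h = 1" "h * s = 1" for s h
    unfolding U.invm_def using s corner_emb [OF s(1)] corner_emb [OF s(2)] SE_emb
    by (intro conjI exI [of _ "emb h"]) (simp_all add: emb_diff emb_1 flip: emb_mult)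
  have WV: "sc W * sc V = 1" "sc V * sc W = 1"
    using sc_mult [OF V(1,3)] sc_mult [OF V(3,1)] by (simp_all add: V sc1)
  show inv: "U.invm k (emb (sc W))" by (rule invm [OF scd scd WV]) (use V in auto)
  define c where "c = sc W - 1"
  have c: "corner k c" unfolding c_def by (rule scd [OF V(2,1)])
  have fam: "1 + dg (scal z) * emb c = (emb (1 + dg z * c) :: 'h cop rfmat)" for z
    by (rule rfmat_eqI) (simp add: ent_emb ent_one ent_dg_mult scal_add scal_mult scal_1 scal_0)
  have "finite {z. \<not> U.invm k (1 + dg (scal z) * emb c)}"
  proof (rule finite_subset [OF _ finite_singular_values [OF c]], rule subsetI, rule ccontr)
    fix z assume z: "z \<in> {z. \<not> U.invm k (1 + dg (scal z) * emb c)}"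
      and "z \<notin> {z. \<not> (\<exists>h. corner k (h - 1) \<and> (1 + dg z * c) * h = 1 \<and> h * (1 + dg z * c) = 1)}"
    then obtain h where h: "corner k (h - 1)" "(1 + dg z * c) * h = 1" "h * (1 + dg z * c) = 1" by blast
    have "U.invm k (emb (1 + dg z * c))" using corner_dg_mult [OF c, of z] by (intro invm [OF _ h]) simp
    then show False using z by (simp add: fam)
  qed
  moreover have "1 + emb c = (emb (sc W) :: 'h cop rfmat)" by (simp add: c_def emb_diff emb_1)
  ultimately show "path_component_of (GL_topology Kp k) (U.unr 1) (U.unr (emb (sc W)))"
    using GL_path_finite [of k 1 "emb c"] SE_emb U.invm_1 inv by simp
qed

text \<open>With s the scalar part of W, write W = s V and V = 1 + a + h, where a is small compared
  with the inverse of V and h has finite rank. The segment V - t a stays invertible and ends at 1 +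
  h, which the family 1 + z h joins to 1. Multiplication by s gives a path from W to s, and s is
  joined to 1 by scalar matrices.\<close>

lemma GL_connected:
  assumes W: "U.invm k W" shows "path_component_of (GL_topology Kp k) (U.unr 1) (U.unr W)"
proof -
  define s :: "'h cop rfmat" where "s = emb (sc W)"
  have s: "U.invm k s" unfolding s_def by (rule invm_scalar_part(1) [OF W])
  obtain s' where s': "U.invm k s'" "s * s' = 1" "s' * s = 1" by (rule U.invm_inverse [OF s])
  define V where "V = s' * W"
  have V: "U.invm k V" unfolding V_def by (rule U.invm_mult [OF s'(1) W])
  obtain v where v: "U.invm k v" "V * v = 1" "v * V = 1" by (rule U.invm_inverse [OF V])
  have sV: "s * V = W" by (simp add: V_def mult_eq_left [OF s'(2)])
  have SE: "U.SE s" "U.SE W" "U.SE V" "U.SE s'" using s W V s' by (simp_all add: U.invm_def)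
  define \<kappa> where "\<kappa> = V - 1"
  have "\<kappa> = s' * (W - s)" by (simp add: \<kappa>_def V_def right_diff_distrib s')
  then have \<kappa>: "EM KE \<kappa>" "corner k \<kappa>"
    using EM_KE_mult_right [OF SE_E [OF SE(4)] SE_decomp [OF SE(2)]] V by (simp_all add: s_def \<kappa>_def U.invm_def)
  define Cv where "Cv = (\<Sum>i<k. \<Sum>l<k. norm (opr (ent v i l)))"
  have Cv: "Cv \<ge> 0" unfolding Cv_def by (intro sum_nonneg) auto
  \<comment> \<open>The Neumann bound is wanted for the entries of \<open>v * a\<close>, so the size
    of the inverse v is divided out; the summand 1 keeps the denominator positive.\<close>
  define \<epsilon> where "\<epsilon> = 1 / (2 * (real k + 1)) / (Cv + 1)"
  have \<epsilon>: "\<epsilon> > 0" using Cv by (simp add: \<epsilon>_def)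
  obtain a h where ah: "\<kappa> = a + h" "corner k a" "corner k h" "EM KE a" "EM finite_rank_ops h" "\<And>i j. norm (opr (ent a i j)) \<le> \<epsilon>"
    by (rule small_plus_finite_rank [OF \<kappa>(2,1) \<epsilon>]) blast
  have "v * a = a + (v - 1) * a" by (simp add: left_diff_distrib)
  moreover have "corner k (v - 1)" using v(1) by (simp add: U.invm_def)
  ultimately have cva: "corner k (v * a)" using corner_add [OF ah(2) corner_mult [OF _ ah(2)]] by metis
  have small: "norm (opr (ent (v * a) i j)) \<le> 1 / (2 * (real k + 1))" for i j
  proof (cases "i < k")
    case True
    have "norm (opr (ent (v * a) i j)) \<le> (\<Sum>l<k. norm (opr (ent v i l)) * \<epsilon>)"
      unfolding ent_mult_corner_right [OF ah(2)] opr_sum opr_simps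
      by (intro sum_norm_le order_trans [OF norm_blinfun_compose] mult_left_mono ah(6)) auto
    also have "\<dots> \<le> Cv * \<epsilon>"
      unfolding Cv_def sum_distrib_right [symmetric]
      by (intro mult_right_mono member_le_sum [of i _ "\<lambda>i. \<Sum>l<k. norm (opr (ent v i l))"])
        (use True \<epsilon> in \<open>auto intro: sum_nonneg\<close>)
    also have "\<dots> \<le> (Cv + 1) * \<epsilon>" using \<epsilon> by (intro mult_right_mono) auto
    also have "\<dots> = 1 / (2 * (real k + 1))" using Cv by (simp add: \<epsilon>_def)
    finally show ?thesis .
  qed (use cornerD [OF cva, of i j] in simp)
  have EMva: "EM KE (v * a)"
    using EM_KE_mult_right [OF SE_E ah(4)] v(1) by (simp add: U.invm_def)
  have seg: "U.invm k (V + dg (scal (of_real t)) * (- a))" if t: "t \<in> {0..1}" for t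
  proof -
    have e: "ent (dg (scal (of_real t)) * (- (v * a))) i j = - (scal (of_real t) * ent (v * a) i j)" for i j
      by (simp add: ent_dg_mult)
    have "U.invm k (1 + dg (scal (of_real t)) * (- (v * a)))"
    proof (rule neumann_series)
      show "corner k (dg (scal (of_real t)) * (- (v * a)))"        by (rule corner_dg_mult) (use cva in \<open>simp add: corner_def\<close>)
      show "EM KE (dg (scal (of_real t)) * (- (v * a)))" by (rule EM_KE_mult_right [OF EM_E_dg_scal EM_KE_minus [OF EMva]])
      show "norm (opr (ent (dg (scal (of_real t)) * (- (v * a))) i j)) \<le> 1 / (2 * (real k + 1))" for i j
      proof -
        have "norm (opr (ent (dg (scal (of_real t)) * (- (v * a))) i j)) = t * norm (opr (ent (v * a) i j))"
          using t unfolding e by (simp add: scaleO_compose_left norm_scaleO)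
        also have "\<dots> \<le> 1 * norm (opr (ent (v * a) i j))" using t by (intro mult_right_mono) auto
        finally show ?thesis using small [of i j] by linarith
      qed
    qed
    moreover have "V * (1 + dg (scal (of_real t)) * (- (v * a))) = V + dg (scal (of_real t)) * (- a)"
      by (simp add: right_diff_distrib mult_eq_left [OF dg_scal_commute] mult.assoc mult_eq_left [OF v(2)])
    ultimately show ?thesis using U.invm_mult [OF V] by metis
  qed
  have Vh: "V - a = 1 + h" using ah(1) by (simp add: \<kappa>_def algebra_simps)
  then have inv1: "U.invm k (1 + h)" using seg [of 1] by (simp add: dg_scal_1)
  have 1: "path_component_of (GL_topology Kp k) (U.unr s) (U.unr (s + s * h))"
  proof (rule GL_path_finite)
    have eq: "s + dg (scal z) * (s * h) = s * (1 + dg (scal z) * h)" for z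
      by (simp add: distrib_left mult_eq_left [OF dg_scal_commute] mult.assoc)
    show "finite {z. \<not> U.invm k (s + dg (scal z) * (s * h))}"
      by (rule finite_subset [OF _ finite_rank_singular_values [OF ah(3,5)]]) (use U.invm_mult [OF s] in \<open>auto simp: eq\<close>)
    show "U.SE (s * h)" by (rule U.SE_mult [OF SE(1) SE_KE [OF EM_fr_KE [OF ah(5)]]])
    show "U.invm k (s + s * h)" using U.invm_mult [OF s inv1] by (simp add: distrib_left)
  qed (rule s)
  have 2: "path_component_of (GL_topology Kp k) (U.unr W) (U.unr (s + s * h))"
  proof -
    have eq: "W + dg (scal z) * (- (s * a)) = s * (V + dg (scal z) * (- a))" for z
      by (simp add: right_diff_distrib mult_eq_left [OF dg_scal_commute] mult.assoc sV)
    have "path (\<lambda>t. complex_of_real t)" unfolding path_def by (intro continuous_intros)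
    moreover have "U.SE (- (s * a))" by (rule U.SE_minus [OF U.SE_mult [OF SE(1) SE_KE [OF ah(4)]]])
    moreover have "U.invm k (W + dg (scal (complex_of_real t)) * (- (s * a)))" if "t \<in> {0..1}" for t
      unfolding eq by (rule U.invm_mult [OF s seg [OF that]])
    ultimately have "path_component_of (GL_topology Kp k) (U.unr (W + dg (scal 0) * (- (s * a)))) (U.unr (W + dg (scal 1) * (- (s * a))))"
      using GL_path [of "\<lambda>t. complex_of_real t" k W "- (s * a)"] by (simp add: pathstart_def pathfinish_def)
    moreover have "s * (V + - a) = s + s * h" using Vh by (simp add: distrib_left flip: sV)
    ultimately show ?thesis unfolding eq by (simp add: dg_scal_0 dg_scal_1 sV)
  qed
  show ?thesis
    by (rule path_component_of_trans [OF path_component_of_trans [OF invm_scalar_part(2) [OF W, folded s_def] 1]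
          path_component_of_sym [OF 2]])
qed

text \<open>Every invertible matrix is joined to 1 within its own size, so the identity component
  exhausts the group and the quotient has one element.\<close>

theorem K1_trivial: "trivial_group (K1 (K_alg n T))"
  unfolding K1_def K1_unital_def
proof (rule U.trivial_quotient_GL, rule subset_antisym; rule subsetI)
  have unr: "U.unr (U.rmat g) = g" if "U.rowfin g" for g
    using that by (intro U.rmat_inj U.rowfin_unr U.SE_rmat) (simp_all add: U.rmat_unr U.SE_rmat)
  fix g
  {
    assume "g \<in> GL_inf_0 Kp"
    then obtain k where "path_component_of (GL_topology Kp k) (inf_mat_one Kp) g" by (auto simp: GL_inf_0_def)
    then have "g \<in> topspace (GL_topology Kp k)" using path_component_in_topspace by metis
    then have "g \<in> GL_n Kp k"
      using Metric_space.topspace_mtopology [OF GL_metric [of k]] by (simp add: GL_topology_def GL_dist_def [abs_def])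
    then show "g \<in> carrier (GL_inf Kp)" by (auto simp: GL_inf_def)
  next
    assume "g \<in> carrier (GL_inf Kp)"
    then obtain k where k: "U.rowfin g" "U.invm k (U.rmat g)" by (auto simp: U.GL_carrier)
    have "U.unr 1 = inf_mat_one Kp" using unr [OF U.rowfin_one] by (simp add: U.rmat_one)
    then have "path_component_of (GL_topology Kp k) (inf_mat_one Kp) g"
      using GL_connected [OF k(2)] unr [OF k(1)] by simp
    then show "g \<in> GL_inf_0 Kp" by (auto simp: GL_inf_0_def)
  }
qed

end

theorem corollary5p4:
  fixes T :: "nat \<Rightarrow> 'h::complex_hilbert \<Rightarrow>\<^sub>L 'h" and n :: nat
  assumes separable: "\<exists>D :: 'h set. countable D \<and> closure D = UNIV"
    and infinite_dim: "\<nexists>S :: 'h set. finite S \<and> cspan S = UNIV"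
    and n: "n \<ge> 1"
    and hermitian: "\<And>j. 1 \<le> j \<Longrightarrow> j \<le> n \<Longrightarrow> hermitian_op (T j)"
  shows "finite_rank_ops \<subseteq> carrier (K_alg n T)
       \<and> alg_topology (K_alg n T) closure_of finite_rank_ops = carrier (K_alg n T)
       \<and> K0 (K_alg n T) \<cong> integer_group
       \<and> trivial_group (K1 (K_alg n T))
       \<and> cstar_subalgebra (calkin_proj ` carrier (E_alg n T)) calkin_alg
       \<and> (\<exists>\<phi>. banach_star_iso (calkin_alg\<lparr>carrier := calkin_proj ` carrier (E_alg n T)\<rparr>)
               (EK_alg n T) \<phi>)"
proof -
  interpret hermitian_tuple "TYPE('h)" T n
  proof
    show "\<nexists>S :: 'h set. finite S \<and> cspan S = UNIV" by (rule infinite_dim)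
  qed (use n hermitian in auto)
  show ?thesis
    using finite_rank_KE finite_rank_dense K0_integers K1_trivial pE_cstar_subalgebra pE_iso_EK by auto
qed

end
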